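(* Let $k$ be a nonzero integer and let $b:\mathbb R\to\mathbb R$ satisfy: (i) there is $0<c_m<1$ with $c_m\le b'(y)\le c_m^{-1}$ for all $y\in\mathbb R$; (ii) $b''\in H^4(\mathbb R)$; (iii) the Rayleigh operator $\mathcal R_{b,k}$ has a single embedded eigenvalue and has no other eigenvalues. Then for any $M>0$ there exist $\omega_{\rm in}$, $T$ and $\nu_0>0$ such that $$\|\omega_{\rm in}\|_{L^2(\mathbb R)}=1,$$ and for every $0\le\nu\le\nu_0$ the solution $\omega(t,y)$ of $$\partial_t\omega(t,y)+\mathcal O_{b,k,\nu}\omega(t,y)=0,\qquad \omega(0,y)=\omega_{\rm in}(y),$$ satisfies $$\|\omega(T,\cdot)\|_{L^2(\mathbb R)}\ge M.$$
   Context: The Rayleigh operator is $\mathcal R_{b,k}\omega=b\,\omega-b''\,(\partial_y^2-k^2)^{-1}\omega$, acting on complex-valued functions on $\mathbb R$ (in $L^2(\mathbb R)$, where $(\partial_y^2-k^2)^{-1}\omega$ denotes the solution $\psi\in H^2(\mathbb R)$ of $\psi''-k^2\psi=\omega$). Its continuous spectrum is $\mathrm{Ran}\,b=\mathbb R$. A number $c\in\mathbb C$ is an eigenvalue if $\mathcal R_{b,k}\omega=c\,\omega$ for some nonzero $\omega\in L^2(\mathbb R)$, equivalently if $(b-c)(\psi''-k^2\psi)-b''\psi=0$ for some nonzero $\psi\in H^2(\mathbb R)$; an eigenvalue $c\in\mathbb R$ is called an embedded eigenvalue. The Orr--Sommerfeld operator with viscosity $\nu\ge0$ is $\mathcal O_{b,k,\nu}\omega=ik\,\mathcal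 R_{b,k}\omega-\nu(\partial_y^2-k^2)\omega$. *)

theory Defs
  imports "HOL-Analysis.Analysis"
begin

text \<open>
  The elements of \<open>L\<^sup>2(\<real>)\<close> and of the Sobolev spaces are represented by Borel measurable
  functions; two functions that agree almost everywhere represent the same element.
\<close>

definition square_integrable :: "(real \<Rightarrow> complex) \<Rightarrow> bool" where
  "square_integrable f \<longleftrightarrow>
     f \<in> borel_measurable lborel \<and> integrable lborel (\<lambda>y. (cmod (f y))\<^sup>2)"

definition L2_norm :: "(real \<Rightarrow> complex) \<Rightarrow> real" where
  "L2_norm f = sqrt (\<integral>y. (cmod (f y))\<^sup>2 \<partial>lborel)"

definition test_function :: "(real \<Rightarrow> real) \<Rightarrow> bool" where
  "test_function \<phi> \<longleftrightarrow>
     (\<forall>n. (deriv ^^ n) \<phi> differentiable_on UNIV) \<and> (\<exists>r. \<forall>y. r < \<bar>y\<bar> \<longrightarrow> \<phi> y = 0)"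

definition locally_integrable :: "(real \<Rightarrow> complex) \<Rightarrow> bool" where
  "locally_integrable f \<longleftrightarrow> (\<forall>a b. set_integrable lborel {a..b} f)"

definition weak_derivative :: "nat \<Rightarrow> (real \<Rightarrow> complex) \<Rightarrow> (real \<Rightarrow> complex) \<Rightarrow> bool" where
  "weak_derivative n f g \<longleftrightarrow>
     locally_integrable f \<and> locally_integrable g \<and>
     (\<forall>\<phi>. test_function \<phi> \<longrightarrow>
        (\<integral>y. f y * of_real ((deriv ^^ n) \<phi> y) \<partial>lborel)
          = (-1) ^ n * (\<integral>y. g y * of_real (\<phi> y) \<partial>lborel))"

text \<open>The Sobolev space \<open>H\<^sup>m(\<real>)\<close>.\<close>

definition sobolev :: "nat \<Rightarrow> (real \<Rightarrow> complex) \<Rightarrow> bool" where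
  "sobolev m f \<longleftrightarrow>
     square_integrable f \<and>
     (\<forall>j\<in>{1..m}. \<exists>g. square_integrable g \<and> weak_derivative j f g)"

text \<open>\<open>\<psi> \<in> H\<^sup>2(\<real>)\<close> solves \<open>\<psi>'' - k\<^sup>2 \<psi> = \<omega>\<close>.\<close>

definition helmholtz_solution :: "int \<Rightarrow> (real \<Rightarrow> complex) \<Rightarrow> (real \<Rightarrow> complex) \<Rightarrow> bool" where
  "helmholtz_solution k \<omega> \<psi> \<longleftrightarrow>
     sobolev 2 \<psi> \<and> weak_derivative 2 \<psi> (\<lambda>y. \<omega> y + (of_int k)\<^sup>2 * \<psi> y)"

text \<open>
  For \<open>k \<noteq> 0\<close> and square integrable \<open>\<omega>\<close> the solution exists and is unique up to a null set;
  the choice operator picks a representative, and the definitions below do not depend on which.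
\<close>

definition helmholtz_inverse :: "int \<Rightarrow> (real \<Rightarrow> complex) \<Rightarrow> real \<Rightarrow> complex" where
  "helmholtz_inverse k \<omega> = (SOME \<psi>. helmholtz_solution k \<omega> \<psi>)"

definition rayleigh :: "(real \<Rightarrow> real) \<Rightarrow> int \<Rightarrow> (real \<Rightarrow> complex) \<Rightarrow> real \<Rightarrow> complex" where
  "rayleigh b k \<omega> y =
     of_real (b y) * \<omega> y - of_real (deriv (deriv b) y) * helmholtz_inverse k \<omega> y"

definition rayleigh_eigenvalue :: "(real \<Rightarrow> real) \<Rightarrow> int \<Rightarrow> complex \<Rightarrow> bool" where
  "rayleigh_eigenvalue b k c \<longleftrightarrow>
     (\<exists>\<omega>. square_integrable \<omega> \<and> \<not> (AE y in lborel. \<omega> y = 0) \<and>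
        (AE y in lborel. rayleigh b k \<omega> y = c * \<omega> y))"

definition embedded_eigenvalue :: "(real \<Rightarrow> real) \<Rightarrow> int \<Rightarrow> complex \<Rightarrow> bool" where
  "embedded_eigenvalue b k c \<longleftrightarrow> rayleigh_eigenvalue b k c \<and> c \<in> \<real>"

text \<open>
  The distribution \<open>i k R \<omega> - \<nu> (\<partial>\<^sub>y\<^sup>2 - k\<^sup>2) \<omega>\<close> (\<open>R\<close> the Rayleigh operator) applied to a
  test function; the derivatives in the viscous term are moved to the test function.
\<close>

definition orr_sommerfeld ::
  "(real \<Rightarrow> real) \<Rightarrow> int \<Rightarrow> real \<Rightarrow> (real \<Rightarrow> complex) \<Rightarrow> (real \<Rightarrow> real) \<Rightarrow> complex" where
  "orr_sommerfeld b k \<nu> \<omega> \<phi> =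
     \<i> * of_int k * (\<integral>y. rayleigh b k \<omega> y * of_real (\<phi> y) \<partial>lborel)
     - of_real \<nu> * (\<integral>y. \<omega> y *
         of_real (deriv (deriv \<phi>) y - (of_int k)\<^sup>2 * \<phi> y) \<partial>lborel)"

text \<open>
  The Orr--Sommerfeld operator is unbounded on \<open>L\<^sup>2(\<real>)\<close> (also for \<open>\<nu> = 0\<close>, because \<open>b\<close> is
  unbounded), so for general initial data in \<open>L\<^sup>2(\<real>)\<close> the solution of the evolution equation is
  the one given by the generated semigroup. It is characterised as the unique
  \<open>\<omega> \<in> C([0,\<infinity>); L\<^sup>2(\<real>))\<close> that solves the equation in the sense of distributions in \<open>y\<close>.
\<close>

definition orr_sommerfeld_solution ::
  "(real \<Rightarrow> real) \<Rightarrow> int \<Rightarrow> real \<Rightarrow> (real \<Rightarrow> complex) \<Rightarrow> (real \<Rightarrow> real \<Rightarrow> complex) \<Rightarrow> bool" where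
  "orr_sommerfeld_solution b k \<nu> \<omega>\<^sub>i\<^sub>n \<omega> \<longleftrightarrow>
     (\<forall>t\<ge>0. square_integrable (\<omega> t)) \<and>
     (\<forall>t\<ge>0. ((\<lambda>s. L2_norm (\<lambda>y. \<omega> s y - \<omega> t y)) \<longlongrightarrow> 0) (at t within {0..})) \<and>
     (AE y in lborel. \<omega> 0 y = \<omega>\<^sub>i\<^sub>n y) \<and>
     (\<forall>\<phi>. test_function \<phi> \<longrightarrow> (\<forall>t\<ge>0.
        ((\<lambda>s. \<integral>y. \<omega> s y * of_real (\<phi> y) \<partial>lborel) has_vector_derivative
           - orr_sommerfeld b k \<nu> (\<omega> t) \<phi>) (at t within {0..})))"

end

theory Submission
  imports Defs
begin

text \<open>
  Suppose that no initial datum in a dense class of smooth compactly supported functions grows by the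
  factor \<open>M\<close> in the asserted way. For every fixed time one then finds viscosities tending to \<open>0\<close> for
  which the solution is bounded by \<open>M\<close> at that time; a weak limit, together with uniqueness for
  \<open>\<nu> = 0\<close>, shows that all inviscid solutions \<open>u\<close> with such data satisfy \<open>\<parallel>u(t)\<parallel> \<le> M \<parallel>u(0)\<parallel>\<close>. Let
  \<open>c\<close> be the embedded eigenvalue with eigenvector \<open>w\<close>, and \<open>A = i k (R - c)\<close> with \<open>R\<close> the Rayleigh
  operator. A Laplace transform in time gives \<open>\<parallel>\<lambda> (\<lambda> + A)\<^sup>-\<^sup>1\<parallel> \<le> M\<close> for all \<open>\<lambda> > 0\<close>; here
  \<open>\<lambda> + A\<close> is injective because there are no nonreal eigenvalues.

  The adjoint of \<open>R\<close>, however, has no real eigenvalue \<open>c\<close>: for an eigenfunction \<open>\<eta>\<close> the function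
  \<open>\<Psi> = (\<partial>\<^sub>y\<^sup>2 - k\<^sup>2)\<^sup>-\<^sup>1 (b'' \<eta>)\<close> equals \<open>(b - c) \<eta>\<close>, so it vanishes at the critical point of \<open>b - c\<close>
  since \<open>\<eta>\<close> is square integrable, and
  \<open>\<integral> \<Psi>'\<^sup>2 + b'' \<Psi>\<^sup>2 / (b - c) = \<integral> (\<Psi>' - b' \<Psi> / (b - c))\<^sup>2 \<ge> 0\<close>, while the equation for \<open>\<Psi>\<close> says that
  the left-hand side is \<open>- k\<^sup>2 \<integral> \<Psi>\<^sup>2\<close>. Hence the range of \<open>A\<close> is dense, and \<open>w\<close> can be approximated
  by elements \<open>A g\<close>. As \<open>\<lambda>\<close> tends to \<open>0\<close>, \<open>\<lambda> (\<lambda> + A)\<^sup>-\<^sup>1 A g\<close> tends to \<open>0\<close> because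
  \<open>\<parallel>\<lambda> (\<lambda> + A)\<^sup>-\<^sup>1\<parallel> \<le> M\<close>, but \<open>\<lambda> (\<lambda> + A)\<^sup>-\<^sup>1 w = w\<close>. So \<open>w = 0\<close>, a contradiction.
\<close>

section \<open>Real Hilbert spaces\<close>

text \<open>The obstacle is that \<open>b\<close> is unbounded, so the generators are unbounded and
  their domains are not under control. Equations are therefore tested against test functions and the
  operators moved to the test side, which makes them stable under weak limits. Uniqueness of such
  weak solutions is then proved by mollifying: as \<open>b\<close> is Lipschitz, the commutator of
  multiplication by \<open>b\<close> with a mollifier of radius \<open>\<epsilon>\<close> is of
  order \<open>\<epsilon>\<close>.

  The negated claim supplies, for each time, only some small viscosity and some solution that is
  bounded at that time. Uniqueness for that viscosity identifies it with a solution constructed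
  beforehand, whose Lipschitz bound in time is independent of the viscosity. This bound is the
  reason to start from test vectors, and it survives in the limit.

  No Jordan chain is looked for. The contradiction is that of the mean ergodic theorem: bounded
  \<open>\<lambda> (\<lambda> + A)^-1\<close> would force the kernel and the closure of the range of
  \<open>A\<close> to meet only in 0. The Laplace transform is available for test vectors only;
  injectivity of \<open>\<lambda> + A\<close> carries the bound over to all data.\<close>

lemma parallelogram_id:
  fixes x y :: "'a::real_inner"
  shows "(norm (x - y))\<^sup>2 + (norm (x + y))\<^sup>2 = 2 * (norm x)\<^sup>2 + 2 * (norm y)\<^sup>2"
  by (simp add: power2_norm_eq_inner inner_simps inner_commute)

lemma norm_diff_scaleR_square:
  fixes w y :: "'a::real_inner"
  shows "(norm (w - t *\<^sub>R y))\<^sup>2 = (norm w)\<^sup>2 - 2 * t * (w \<bullet> y) + t * t * (y \<bullet> y)"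
  by (simp add: power2_norm_eq_inner inner_diff_left inner_diff_right inner_commute algebra_simps)

text \<open>A minimising sequence is Cauchy: the midpoint of two members lies in the convex set,
  hence is no closer than the infimum, and the parallelogram law turns this into a bound on their
  difference.\<close>

lemma hilbert_closest_point:
  fixes S :: "'a::{real_inner,banach} set"
  assumes "closed S" "convex S" "S \<noteq> {}"
  obtains s where "s \<in> S" "\<And>y. y \<in> S \<Longrightarrow> norm (x - s) \<le> norm (x - y)"
proof -
  define d where "d = infdist x S"
  have dle: "d \<le> norm (x - y)" if "y \<in> S" for y
    using infdist_le[OF that, of x] by (simp add: d_def dist_norm)
  have d0: "0 \<le> d" by (simp add: d_def infdist_nonneg)
  have "\<exists>y\<in>S. norm (x - y) < d + 1 / real (Suc n)" for n
  proof (rule ccontr)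
    assume "\<not> ?thesis"
    then have "d + 1 / real (Suc n) \<le> infdist x S"
      using assms(3) unfolding infdist_notempty[OF assms(3)]
      by (intro cINF_greatest) (auto simp: dist_norm not_less)
    then show False by (simp add: d_def)
  qed
  then obtain y where yS: "\<And>n. y n \<in> S" and yd: "\<And>n. norm (x - y n) < d + 1 / real (Suc n)"
    by metis
  have key: "(norm (y n - y m))\<^sup>2 \<le> 8 * (d + 1) / real (Suc N)" if "N \<le> n" "N \<le> m" for n m N
  proof -
    define e where "e = 1 / real (Suc N)"
    have e: "0 < e" "e \<le> 1" by (auto simp: e_def)
    have le: "1 / real (Suc n) \<le> e" "1 / real (Suc m) \<le> e"
      using that by (auto simp: e_def frac_le)
    have 1: "(norm (x - y n))\<^sup>2 \<le> (d + e)\<^sup>2" "(norm (x - y m))\<^sup>2 \<le> (d + e)\<^sup>2"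
      using yd[of n] yd[of m] le by (auto intro!: power_mono)
    have "(1/2) *\<^sub>R y n + (1/2) *\<^sub>R y m \<in> S"
      using assms(2) yS by (intro convexD) auto
    then have "d \<le> norm (x - ((1/2) *\<^sub>R y n + (1/2) *\<^sub>R y m))" by (rule dle)
    then have "2 * d \<le> norm (2 *\<^sub>R (x - ((1/2) *\<^sub>R y n + (1/2) *\<^sub>R y m)))" by simp
    also have "2 *\<^sub>R (x - ((1/2) *\<^sub>R y n + (1/2) *\<^sub>R y m)) = (x - y n) + (x - y m)"
      by (simp add: algebra_simps scaleR_2)
    finally have 2: "(2 * d)\<^sup>2 \<le> (norm ((x - y n) + (x - y m)))\<^sup>2"
      using d0 by (intro power_mono) auto
    have 3: "norm ((x - y n) - (x - y m)) = norm (y n - y m)"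
      by (simp add: norm_minus_commute)
    from 1 2 3 have "(norm (y n - y m))\<^sup>2 \<le> 4 * (d + e)\<^sup>2 - 4 * d\<^sup>2"
      using parallelogram_id[of "x - y n" "x - y m"] by (simp add: power_mult_distrib)
    also have "\<dots> = e * (8 * d + 4 * e)" by (simp add: power2_eq_square algebra_simps)
    also have "\<dots> \<le> e * (8 * (d + 1))" using e by (intro mult_left_mono) auto
    finally show ?thesis by (simp add: e_def)
  qed
  have "Cauchy y"
  proof (rule metric_CauchyI)
    fix e :: real assume e: "0 < e"
    obtain N where N: "8 * (d + 1) / e\<^sup>2 < real N" using reals_Archimedean2 by blast
    have "8 * (d + 1) / real (Suc N) < e\<^sup>2"
    proof -
      have "8 * (d + 1) < real N * e\<^sup>2" using N e by (simp add: divide_less_eq)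
      also have "\<dots> \<le> e\<^sup>2 * real (Suc N)" by (simp add: algebra_simps)
      finally show ?thesis by (simp add: divide_less_eq)
    qed
    then have "dist (y m) (y n) < e" if "m \<ge> N" "n \<ge> N" for m n
      using power_less_imp_less_base[of "norm (y m - y n)" 2 e] key[of N m n] that e
      by (simp add: dist_norm)
    then show "\<exists>M. \<forall>m\<ge>M. \<forall>n\<ge>M. dist (y m) (y n) < e" by blast
  qed
  then obtain s where s: "y \<longlonglongrightarrow> s" using Cauchy_convergent_iff convergent_def by blast
  have sS: "s \<in> S" using closed_sequentially[OF assms(1)] yS s by blast
  have "(\<lambda>n. norm (x - y n)) \<longlonglongrightarrow> norm (x - s)" by (intro tendsto_intros s)
  moreover have "(\<lambda>n. d + 1 / real (Suc n)) \<longlonglongrightarrow> d + 0"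
    by (intro tendsto_intros LIMSEQ_Suc[OF lim_inverse_n', unfolded inverse_eq_divide])
  ultimately have "norm (x - s) \<le> d + 0"
    using yd by (intro LIMSEQ_le[of _ _ "\<lambda>n. d + 1 / real (Suc n)"]) (auto intro: less_imp_le)
  with dle sS show ?thesis by (intro that[of s]) force+
qed

text \<open>The closest point works: if \<open>x - s\<close> were not orthogonal to
  \<open>y\<close>, moving from \<open>s\<close> along \<open>y\<close> by the minimiser
  \<open>t\<close> of the quadratic distance would bring it strictly closer.\<close>

lemma hilbert_orthogonal_decomposition:
  fixes S :: "'a::{real_inner,banach} set"
  assumes "closed S" "subspace S"
  obtains s where "s \<in> S" "\<And>y. y \<in> S \<Longrightarrow> (x - s) \<bullet> y = 0"
proof -
  obtain s where s: "s \<in> S" "\<And>y. y \<in> S \<Longrightarrow> norm (x - s) \<le> norm (x - y)"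
    using hilbert_closest_point[of S x] assms subspace_imp_convex subspace_0 by blast
  have "(x - s) \<bullet> y = 0" if y: "y \<in> S" for y
  proof (cases "y = 0")
    case False
    define t where "t = ((x - s) \<bullet> y) / (y \<bullet> y)"
    have "s + t *\<^sub>R y \<in> S" using assms(2) s y by (simp add: subspace_add subspace_scale)
    then have "(norm (x - s))\<^sup>2 \<le> (norm (x - (s + t *\<^sub>R y)))\<^sup>2"
      using s(2) by (intro power_mono) auto
    also have "\<dots> = (norm ((x - s) - t *\<^sub>R y))\<^sup>2" by (simp add: algebra_simps)
    also have "\<dots> = (norm (x - s))\<^sup>2 - 2 * t * ((x - s) \<bullet> y) + t * t * (y \<bullet> y)"
      by (rule norm_diff_scaleR_square)
    also have "\<dots> = (norm (x - s))\<^sup>2 - ((x - s) \<bullet> y)\<^sup>2 / (y \<bullet> y)"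
      using False by (simp add: t_def power2_eq_square)
    finally have "((x - s) \<bullet> y)\<^sup>2 / (y \<bullet> y) \<le> 0" by simp
    moreover have "0 < y \<bullet> y" using False by simp
    ultimately show ?thesis by (simp add: divide_le_0_iff)
  qed simp
  then show ?thesis using that s(1) by blast
qed

lemma subspace_closure:
  fixes D :: "'a::real_normed_vector set"
  assumes "subspace D"
  shows "subspace (closure D)"
proof (rule subspaceI)
  show "0 \<in> closure D" using assms subspace_0 closure_subset by blast
next
  fix x y assume "x \<in> closure D" "y \<in> closure D"
  then obtain f g where "\<forall>n. f n \<in> D" "f \<longlonglongrightarrow> x" "\<forall>n. g n \<in> D" "g \<longlonglongrightarrow> y"
    unfolding closure_sequential by blast
  then show "x + y \<in> closure D" unfolding closure_sequential
    using assms by (intro exI[of _ "\<lambda>n. f n + g n"]) (auto intro: subspace_add tendsto_add)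
next
  fix x and c :: real assume "x \<in> closure D"
  then obtain f where "\<forall>n. f n \<in> D" "f \<longlonglongrightarrow> x"
    unfolding closure_sequential by blast
  then show "c *\<^sub>R x \<in> closure D" unfolding closure_sequential
    using assms by (intro exI[of _ "\<lambda>n. c *\<^sub>R f n"]) (auto intro: subspace_scale tendsto_scaleR)
qed

text \<open>All density statements below have this form: continuous functions, test vectors, and the
  range of the shifted Rayleigh operator.\<close>

lemma dense_subspace_if_orthogonal_trivial:
  fixes D :: "'a::{real_inner,banach} set"
  assumes "subspace D" and "\<And>x. (\<And>d. d \<in> D \<Longrightarrow> x \<bullet> d = 0) \<Longrightarrow> x = 0"
  shows "closure D = UNIV"
proof -
  have "x \<in> closure D" for x
  proof -
    obtain s where s: "s \<in> closure D" "\<And>y. y \<in> closure D \<Longrightarrow> (x - s) \<bullet> y = 0"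
      using hilbert_orthogonal_decomposition[of "closure D" x] assms(1) subspace_closure by auto
    then have "x - s = 0" using assms(2) closure_subset by blast
    then show ?thesis using s by simp
  qed
  then show ?thesis by blast
qed

text \<open>The part \<open>w\<close> of a vector that is orthogonal to the kernel spans the rest of
  the space, because \<open>y - (f y / f w) w\<close> lies in the kernel; the representing vector is
  a multiple of \<open>w\<close>.\<close>

lemma hilbert_riesz:
  fixes f :: "'a::{real_inner,banach} \<Rightarrow> real"
  assumes "bounded_linear f"
  obtains z where "\<And>x. f x = x \<bullet> z"
proof (cases "\<forall>x. f x = 0")
  case True
  then show ?thesis using that[of 0] by simp
next
  case False
  interpret bounded_linear f by fact
  define S where "S = {x. f x = 0}"
  have "closed S" unfolding S_def
    by (intro closed_Collect_eq continuous_intros linear_continuous_on assms)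
  moreover have sub: "subspace S" by (auto simp: S_def subspace_def add scaleR)
  moreover obtain x where x: "f x \<noteq> 0" using False by blast
  ultimately obtain s where s: "s \<in> S" "\<And>y. y \<in> S \<Longrightarrow> (x - s) \<bullet> y = 0"
    using hilbert_orthogonal_decomposition[of S x] by blast
  define w where "w = x - s"
  have fw: "f w \<noteq> 0" using x s(1) by (simp add: w_def S_def diff)
  then have ww: "w \<bullet> w \<noteq> 0" by (auto simp: zero)
  have "f y = y \<bullet> ((f w / (w \<bullet> w)) *\<^sub>R w)" for y
  proof -
    have "y - (f y / f w) *\<^sub>R w \<in> S" using fw by (simp add: S_def diff scaleR)
    then have "w \<bullet> (y - (f y / f w) *\<^sub>R w) = 0" using s(2) by (simp add: w_def)
    then have "w \<bullet> y = (f y / f w) * (w \<bullet> w)" by (simp add: inner_simps)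
    then show ?thesis using fw ww by (simp add: inner_commute field_simps)
  qed
  then show ?thesis by (rule that)
qed

lemma norm_le_if_inner_le:
  fixes x :: "'a::real_inner"
  assumes "\<And>y. x \<bullet> y \<le> C * norm y" "0 \<le> C"
  shows "norm x \<le> C"
  using assms(1)[of x] assms(2)
  by (cases "x = 0") (auto simp: power2_norm_eq_inner[symmetric] power2_eq_square)

lemma hilbert_riesz_bounded:
  fixes f :: "'a::{real_inner,banach} \<Rightarrow> real"
  assumes "linear f" "\<And>x. \<bar>f x\<bar> \<le> C * norm x" "0 \<le> C"
  obtains z where "\<And>x. f x = x \<bullet> z" "norm z \<le> C"
proof -
  have "bounded_linear f"
    using assms(1,2) by (auto simp: linear_conv_bounded_linear bounded_linear_def bounded_linear_axioms_def
        mult.commute intro!: exI[of _ C])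
  then obtain z where z: "\<And>x. f x = x \<bullet> z" using hilbert_riesz by blast
  have "norm z \<le> C"
  proof (rule norm_le_if_inner_le[OF _ assms(3)])
    show "z \<bullet> y \<le> C * norm y" for y using assms(2)[of y] z[of y] by (simp add: inner_commute)
  qed
  with z show ?thesis by (rule that)
qed

lemma hilbert_adjoint:
  fixes T :: "'a::{real_inner,banach} \<Rightarrow> 'a"
  assumes "bounded_linear T"
  obtains S where "\<And>x y. T x \<bullet> y = x \<bullet> S y"
proof -
  have "\<exists>z. \<forall>x. T x \<bullet> y = x \<bullet> z" for y
    using hilbert_riesz[OF bounded_linear_compose[OF bounded_linear_inner_left assms], of y] by metis
  then show ?thesis using that by metis
qed

subsection \<open>Weak limits\<close>

text \<open>Instead of extracting subsequences, which would need separability, limits are taken along a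
  filter finer than \<open>sequentially\<close> obtained from Tychonoff's theorem.\<close>

lemma pointwise_limit_along_filter:
  fixes X :: "nat \<Rightarrow> 'i \<Rightarrow> real"
  assumes "\<And>n i. \<bar>X n i\<bar> \<le> B i"
  obtains G x where "G \<noteq> bot" "G \<le> sequentially" "\<And>i. ((\<lambda>n. X n i) \<longlongrightarrow> x i) G"
proof -
  define K where "K = (\<Pi>\<^sub>E i\<in>UNIV. {- B i..B i})"
  have "compactin (product_topology (\<lambda>i. euclidean) UNIV) K"
    unfolding K_def by (auto simp: compactin_PiE)
  then have "compact K" by (simp add: euclidean_product_topology)
  moreover have "eventually (\<lambda>x. x \<in> K) (filtermap X sequentially)"
    using assms by (auto simp: eventually_filtermap K_def abs_le_iff minus_le_iff intro!: always_eventually)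
  moreover have "filtermap X sequentially \<noteq> bot" by (simp add: filtermap_bot_iff)
  ultimately obtain x where x: "inf (nhds x) (filtermap X sequentially) \<noteq> bot"
    unfolding compact_filter by blast
  \<comment> \<open>Every neighbourhood of the cluster point \<open>x\<close> meets the tails of
    \<open>X\<close>. Pulled back along \<open>X\<close> and intersected with the tails, these
    neighbourhoods form a proper filter along which \<open>X\<close> converges.\<close>
  define G where "G = inf sequentially (filtercomap X (nhds x))"
  have G1: "G \<noteq> bot"
  proof
    assume "G = bot"
    then have "eventually (\<lambda>_. False) (inf sequentially (filtercomap X (nhds x)))" by (simp add: G_def)
    then obtain P Q where PQ: "eventually P sequentially" "eventually Q (filtercomap X (nhds x))"
      "\<And>n. P n \<Longrightarrow> Q n \<Longrightarrow> False" unfolding eventually_inf by auto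
    then obtain R where R: "eventually R (nhds x)" "\<And>n. R (X n) \<Longrightarrow> Q n"
      unfolding eventually_filtercomap by auto
    have "eventually (\<lambda>y. \<not> R y) (filtermap X sequentially)"
      unfolding eventually_filtermap using PQ(1) by eventually_elim (use PQ(3) R(2) in blast)
    then have "eventually (\<lambda>_. False) (inf (nhds x) (filtermap X sequentially))"
      unfolding eventually_inf using R(1) by (intro exI[of _ R] exI[of _ "\<lambda>y. \<not> R y"]) auto
    then show False using x by (simp add: trivial_limit_def)
  qed
  have G2: "G \<le> sequentially" by (simp add: G_def)
  have "(X \<longlongrightarrow> x) G"
    unfolding filterlim_def using filtermap_filtercomap[of X "nhds x"]
    unfolding G_def by (rule order_trans[OF filtermap_mono[OF inf_le2]])
  moreover have "continuous_on UNIV (\<lambda>y :: 'i \<Rightarrow> real. y i)" for i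
    using continuous_map_product_projection[of i UNIV "\<lambda>_. euclidean :: real topology"]
    by (simp add: euclidean_product_topology)
  ultimately have "((\<lambda>n. X n i) \<longlongrightarrow> x i) G" for i
    using continuous_on_tendsto_compose[of UNIV "\<lambda>y. y i" X x G] by simp
  then show ?thesis by (rule that[OF G1 G2])
qed

text \<open>The coordinates of the product space are all pairs of a time and a test vector, so one
  filter serves every \<open>t\<close> at once. The limit functionals are linear and bounded, and
  Riesz represents them.\<close>

lemma weak_limit_along_filter:
  fixes u :: "nat \<Rightarrow> 't \<Rightarrow> 'a::{real_inner,banach}"
  assumes "\<And>n t. norm (u n t) \<le> C t"
  obtains G v where "G \<noteq> bot" "G \<le> sequentially"
    "\<And>t x. ((\<lambda>n. u n t \<bullet> x) \<longlongrightarrow> v t \<bullet> x) G" "\<And>t. norm (v t) \<le> C t"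
proof -
  have bd: "\<bar>u n t \<bullet> x\<bar> \<le> C t * norm x" for n t x
    using Cauchy_Schwarz_ineq2[of "u n t" x] assms[of n t]
    by (meson mult_right_mono norm_ge_zero order_trans)
  then obtain G f where G: "G \<noteq> bot" "G \<le> sequentially"
    and f: "\<And>i. ((\<lambda>n. u n (fst i) \<bullet> snd i) \<longlongrightarrow> f i) G"
    by (rule pointwise_limit_along_filter[of "\<lambda>n i. u n (fst i) \<bullet> snd i" "\<lambda>i. C (fst i) * norm (snd i)"])
      blast+
  have lim: "((\<lambda>n. u n t \<bullet> x) \<longlongrightarrow> f (t, x)) G" for t x using f[of "(t, x)"] by simp
  have C0: "0 \<le> C t" for t using assms[of 0 t] norm_ge_zero order_trans by blast
  have "\<exists>z. (\<forall>x. f (t, x) = x \<bullet> z) \<and> norm z \<le> C t" for t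
  proof -
    have "linear (\<lambda>x. f (t, x))"
    proof (rule linearI)
      fix x y and r :: real
      have "((\<lambda>n. u n t \<bullet> (x + y)) \<longlongrightarrow> f (t, x) + f (t, y)) G"
        unfolding inner_add_right by (intro tendsto_add lim)
      then show "f (t, x + y) = f (t, x) + f (t, y)" using tendsto_unique[OF G(1) lim] by blast
      have "((\<lambda>n. u n t \<bullet> (r *\<^sub>R x)) \<longlongrightarrow> r * f (t, x)) G"
        unfolding inner_scaleR_right by (intro tendsto_mult tendsto_const lim)
      then show "f (t, r *\<^sub>R x) = r *\<^sub>R f (t, x)" using tendsto_unique[OF G(1) lim] by simp
    qed
    moreover have "\<bar>f (t, x)\<bar> \<le> C t * norm x" for x
      by (rule tendsto_upperbound[OF tendsto_rabs[OF lim] _ G(1)]) (simp add: bd)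
    ultimately show ?thesis using hilbert_riesz_bounded[of "\<lambda>x. f (t, x)" "C t"] C0 by metis
  qed
  then obtain v where v: "\<And>t x. f (t, x) = x \<bullet> v t" "\<And>t. norm (v t) \<le> C t" by metis
  show ?thesis
  proof (rule that[OF G])
    show "((\<lambda>n. u n t \<bullet> x) \<longlongrightarrow> v t \<bullet> x) G" for t x using lim[of t x] v(1) by (simp add: inner_commute)
  qed (rule v)
qed

subsection \<open>Linear evolution equations\<close>

definition exp_flow :: "('a::banach \<Rightarrow> 'a) \<Rightarrow> 'a \<Rightarrow> real \<Rightarrow> 'a" where
  "exp_flow A x t = (\<Sum>n. (t ^ n / fact n) *\<^sub>R (A ^^ n) x)"

lemma exp_series_has_vector_derivative:
  fixes A :: "'a::banach \<Rightarrow> 'a" and x :: 'a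
  assumes A: "bounded_linear A"
  shows "exp_flow A x 0 = x"
    and "(exp_flow A x has_vector_derivative A (exp_flow A x t)) (at t)"
    and "A (exp_flow A x t) = exp_flow A (A x) t"
proof -
  let ?E = "exp_flow A"
  interpret A: bounded_linear A by fact
  obtain K where K: "0 \<le> K" "\<And>x. norm (A x) \<le> norm x * K" using A.nonneg_bounded by blast
  have pow: "norm ((A ^^ n) y) \<le> K ^ n * norm y" for n y
  proof (induction n)
    case (Suc n)
    have "norm ((A ^^ Suc n) y) \<le> norm ((A ^^ n) y) * K" using K(2) by simp
    also have "\<dots> \<le> (K ^ n * norm y) * K" using Suc K(1) by (rule mult_right_mono)
    finally show ?case by (simp add: algebra_simps)
  qed simp
  define f where "f y n t = (t ^ n / fact n) *\<^sub>R (A ^^ n) y" for y n and t :: real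
  \<comment> \<open>Differentiating the \<open>n\<close>-th term gives the term of index
    \<open>n - 1\<close> of the series for \<open>A y\<close>; the constant term contributes
    0.\<close>
  define f' where "f' y n t = (if n = 0 then 0 else f (A y) (n - 1) t)" for y n and t :: real
  have fb: "norm (f y n t) \<le> (R * K) ^ n / fact n * norm y" if "\<bar>t\<bar> \<le> R" for y n t R
  proof -
    have "norm (f y n t) \<le> (\<bar>t\<bar> ^ n / fact n) * (K ^ n * norm y)"
      unfolding f_def norm_scaleR by (intro mult_mono pow) (auto simp: power_abs)
    also have "\<dots> \<le> (R ^ n / fact n) * (K ^ n * norm y)"
      using that K by (intro mult_right_mono divide_right_mono power_mono) auto
    finally show ?thesis by (simp add: power_mult_distrib)
  qed
  have sumM: "summable (\<lambda>n. (R * K) ^ n / fact n * norm y)" for R y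
    using summable_mult2[OF summable_exp[of "R * K"], of "norm y"] by (simp add: inverse_eq_divide)
  have sumf: "summable (\<lambda>n. f y n t)" for y t
    by (rule summable_comparison_test'[OF sumM[of "\<bar>t\<bar>" y], of 0]) (use fb in auto)
  have E: "?E y t = (\<Sum>n. f y n t)" for y t by (simp add: exp_flow_def f_def)
  have Af: "A (f y n t) = f (A y) n t" for y n t
    by (simp add: f_def A.scaleR funpow_swap1)
  show AE: "A (?E x t) = ?E (A x) t" for x t
    unfolding E using A.suminf[OF sumf] Af by simp
  have "(\<Sum>n. f y n 0) = (\<Sum>n. if n = 0 then y else 0)" for y
    by (intro suminf_cong) (auto simp: f_def)
  then show "?E x 0 = x" unfolding E using suminf_finite[of "{0}" "\<lambda>n::nat. if n = 0 then x else 0"] by simp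
  have sumf': "summable (\<lambda>n. f' y n t)" for y t
    unfolding summable_Suc_iff[symmetric, of "\<lambda>n. f' y n t"] using sumf[of "A y" t] by (simp add: f'_def)
  have E': "(\<Sum>n. f' y n t) = A (?E y t)" for y t
    using suminf_split_head[OF sumf'[of y t]] unfolding AE by (simp add: f'_def E)
  define R where "R = \<bar>t\<bar> + 1"
  have ul0: "uniform_limit {-R..R} (\<lambda>n t. \<Sum>i<n. f' x i t) (\<lambda>t. \<Sum>i. f' x i t) sequentially"
  proof (rule Weierstrass_m_test)
    define M where "M n = (if n = 0 then 0 else (R * K) ^ (n - 1) / fact (n - 1) * norm (A x))" for n :: nat
    show "norm (f' x n t) \<le> M n" if "t \<in> {-R..R}" for n t
      using that fb[of t R "A x" "n - 1"] by (auto simp: f'_def M_def)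
    show "summable M"
      unfolding summable_Suc_iff[symmetric, of M] using sumM[of R "A x"] by (simp add: M_def)
  qed
  have ul: "\<forall>\<^sub>F n in sequentially. \<forall>s\<in>{-R..R}. norm ((\<Sum>i<n. f' x i s) - A (?E x s)) < e" if "0 < e" for e
    using uniform_limitD[OF ul0 that] by (simp add: dist_norm E')
  have "\<exists>g. \<forall>s\<in>{-R..R}. (\<lambda>n. f x n s) sums g s \<and>
      (g has_derivative (\<lambda>h. h *\<^sub>R A (?E x s))) (at s within {-R..R})"
  proof (rule has_derivative_series[where f' = "\<lambda>n s h. h *\<^sub>R f' x n s"])
    fix n s assume "s \<in> {-R..R}"
    show "(f x n has_derivative (\<lambda>h. h *\<^sub>R f' x n s)) (at s within {-R..R})"
    proof (cases n)
      case 0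
      have "f x 0 = (\<lambda>t. x)" by (simp add: f_def fun_eq_iff)
      then show ?thesis by (simp add: 0 f'_def)
    next
      case (Suc m)
      have "((\<lambda>t. t ^ Suc m / fact (Suc m)) has_real_derivative s ^ m / fact m) (at s within {-R..R})"
        by (rule derivative_eq_intros refl | simp)+
      then have "(f x n has_vector_derivative (s ^ m / fact m) *\<^sub>R (A ^^ Suc m) x) (at s within {-R..R})"
        unfolding f_def Suc by (rule has_vector_derivative_scaleR[THEN has_vector_derivative_eq_rhs])
          (auto intro: has_vector_derivative_const)
      then show ?thesis by (simp add: Suc f'_def f_def has_vector_derivative_def funpow_swap1)
    qed
  next
    fix e :: real assume "0 < e"
    from ul[OF this] show "\<forall>\<^sub>F n in sequentially. \<forall>s\<in>{-R..R}. \<forall>h.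
        norm ((\<Sum>i<n. h *\<^sub>R f' x i s) - h *\<^sub>R A (?E x s)) \<le> e * norm h"
    proof eventually_elim
      case (elim n)
      have "norm ((\<Sum>i<n. h *\<^sub>R f' x i s) - h *\<^sub>R A (?E x s)) \<le> e * norm h" if "s \<in> {-R..R}" for s h
        using mult_right_mono[OF less_imp_le[OF bspec[OF elim that]], of "norm h"]
        by (simp add: scaleR_sum_right[symmetric] scaleR_diff_right[symmetric] mult.commute)
      then show ?case by blast
    qed
  next
    show "0 \<in> {-R..R}" by (simp add: R_def)
    show "(\<lambda>n. f x n 0) sums (\<Sum>n. f x n 0)" using sumf by (rule summable_sums)
  qed simp
  then obtain g where g: "\<And>s. s \<in> {-R..R} \<Longrightarrow> (\<lambda>n. f x n s) sums g s"
    "\<And>s. s \<in> {-R..R} \<Longrightarrow> (g has_vector_derivative A (?E x s)) (at s within {-R..R})"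
    unfolding has_vector_derivative_def by blast
  have tR: "t \<in> {-R<..<R}" by (auto simp: R_def)
  then have "(g has_vector_derivative A (?E x t)) (at t)"
    using g(2)[of t] at_within_interior[of t "{-R..R}"] by (simp add: interior_atLeastAtMost_real)
  moreover have "g s = ?E x s" if "s \<in> {-R<..<R}" for s
    using g(1)[of s] that by (auto simp: E sums_iff)
  ultimately show "(?E x has_vector_derivative A (?E x t)) (at t)"
    using has_vector_derivative_transform_within_open[of g _ t "{-R<..<R}" "?E x"] tR by simp
qed

text \<open>Gronwall: \<open>exp (- 2 C t)\<close> times the squared norm is nonincreasing. Only the
  one-sided bound on \<open>u' \<bullet> u\<close> enters, so skew parts of a generator cost
  nothing.\<close>

lemma exp_growth_bound:
  fixes u u' :: "real \<Rightarrow> 'a::real_inner"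
  assumes der: "\<And>t. 0 \<le> t \<Longrightarrow> (u has_vector_derivative u' t) (at t)"
    and diss: "\<And>t. 0 \<le> t \<Longrightarrow> u' t \<bullet> u t \<le> C * (norm (u t))\<^sup>2" and "0 \<le> t"
  shows "norm (u t) \<le> exp (C * t) * norm (u 0)"
proof -
  define g where "g t = exp (- 2 * C * t) * (u t \<bullet> u t)" for t
  have "g t \<le> g 0"
  proof (rule DERIV_nonpos_imp_nonincreasing[OF \<open>0 \<le> t\<close>])
    fix s assume s: "0 \<le> s" "s \<le> t"
    have "((\<lambda>t. u t \<bullet> u t) has_vector_derivative (u s \<bullet> u' s + u' s \<bullet> u s)) (at s)"
      by (rule bounded_bilinear.has_vector_derivative[OF bounded_bilinear_inner der der]) (use s in auto)
    then have "((\<lambda>t. u t \<bullet> u t) has_real_derivative (2 * (u' s \<bullet> u s))) (at s)"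
      by (simp add: has_real_derivative_iff_has_vector_derivative inner_commute)
    moreover have "((\<lambda>t. exp (- 2 * C * t)) has_real_derivative exp (- 2 * C * s) * (- 2 * C)) (at s)"
      by (auto intro!: derivative_eq_intros)
    ultimately have "(g has_real_derivative
        exp (- 2 * C * s) * (2 * (u' s \<bullet> u s)) + (exp (- 2 * C * s) * (- 2 * C)) * (u s \<bullet> u s)) (at s)"
      unfolding g_def by (intro DERIV_cong[OF DERIV_mult]) auto
    moreover have "exp (- 2 * C * s) * (2 * (u' s \<bullet> u s)) + (exp (- 2 * C * s) * (- 2 * C)) * (u s \<bullet> u s)
        = 2 * exp (- 2 * C * s) * (u' s \<bullet> u s - C * (norm (u s))\<^sup>2)"
      by (simp add: algebra_simps power2_norm_eq_inner)
    moreover have "\<dots> \<le> 0" using diss[OF s(1)] by (intro mult_nonneg_nonpos) auto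
    ultimately show "\<exists>y. DERIV g s :> y \<and> y \<le> 0" by metis
  qed
  then have "exp (- 2 * C * t) * (norm (u t))\<^sup>2 \<le> (norm (u 0))\<^sup>2"
    by (simp add: g_def power2_norm_eq_inner)
  then have "exp (2 * C * t) * (exp (- 2 * C * t) * (norm (u t))\<^sup>2) \<le> exp (2 * C * t) * (norm (u 0))\<^sup>2"
    by (rule mult_left_mono) simp
  then have "(norm (u t))\<^sup>2 \<le> exp (2 * C * t) * (norm (u 0))\<^sup>2"
    by (simp add: mult.assoc[symmetric] exp_add[symmetric])
  also have "\<dots> = (exp (C * t) * norm (u 0))\<^sup>2"
    by (simp add: power_mult_distrib exp_double[symmetric] mult.assoc)
  finally show ?thesis by (rule power2_le_imp_le) simp
qed

lemma norm_increment_le: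
  fixes u u' :: "real \<Rightarrow> 'a::real_inner"
  assumes "s \<le> t" and "\<And>r. s \<le> r \<Longrightarrow> r \<le> t \<Longrightarrow> (u has_vector_derivative u' r) (at r)"
    and B: "\<And>r. s \<le> r \<Longrightarrow> r \<le> t \<Longrightarrow> norm (u' r) \<le> B"
  shows "norm (u t - u s) \<le> B * (t - s)"
proof (cases "s = t")
  case False
  then have "s < t" using assms by simp
  moreover have "continuous_on {s..t} u"
    using assms(2) by (intro continuous_at_imp_continuous_on ballI has_vector_derivative_continuous) auto
  ultimately obtain r where "r \<in> {s<..<t}" "norm (u t - u s) \<le> norm ((t - s) *\<^sub>R u' r)"
    using mvt_general[of s t u "\<lambda>r h. h *\<^sub>R u' r"] assms(2) unfolding has_vector_derivative_def
    by (metis less_imp_le)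
  then have "norm (u t - u s) \<le> norm (u' r) * (t - s)" "norm (u' r) \<le> B"
    using B[of r] by (auto simp: mult.commute)
  then show ?thesis using mult_right_mono[of "norm (u' r)" B "t - s"] \<open>s < t\<close> by linarith
qed simp

text \<open>Neither bound involves the operator norm of \<open>A\<close>, so both stay uniform along
  bounded approximations of an unbounded generator. For the increment, the derivative
  \<open>A (u t)\<close> is itself the flow started at \<open>A x\<close>.\<close>

lemma dissipative_ode:
  fixes A :: "'a::{real_inner,banach} \<Rightarrow> 'a"
  assumes A: "bounded_linear A" and diss: "\<And>x. A x \<bullet> x \<le> C * (norm x)\<^sup>2" and "0 \<le> C"
  obtains u where "u 0 = x" "\<And>t. (u has_vector_derivative A (u t)) (at t)"
    "\<And>t. 0 \<le> t \<Longrightarrow> norm (u t) \<le> exp (C * t) * norm x"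
    "\<And>s t. 0 \<le> s \<Longrightarrow> s \<le> t \<Longrightarrow> norm (u t - u s) \<le> exp (C * t) * norm (A x) * (t - s)"
proof -
  define E where "E = exp_flow A"
  note ser = exp_series_has_vector_derivative[OF A, folded E_def]
  have gr: "norm (E y t) \<le> exp (C * t) * norm y" if "0 \<le> t" for y t
    using exp_growth_bound[of "E y" "\<lambda>t. A (E y t)" C t] ser(1,2) diss that by simp
  show ?thesis
  proof (rule that[of "E x"])
    fix s t :: real assume st: "0 \<le> s" "s \<le> t"
    show "norm (E x t - E x s) \<le> exp (C * t) * norm (A x) * (t - s)"
    proof (rule norm_increment_le[OF st(2) ser(2)])
      fix r assume r: "s \<le> r" "r \<le> t"
      have "norm (A (E x r)) \<le> exp (C * r) * norm (A x)" using gr r st by (simp add: ser(3))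
      also have "\<dots> \<le> exp (C * t) * norm (A x)" using r \<open>0 \<le> C\<close> by (intro mult_right_mono) (auto simp: mult_left_mono)
      finally show "norm (A (E x r)) \<le> exp (C * t) * norm (A x)" .
    qed
  qed (use ser gr in auto)
qed

lemma has_derivativeI_quadratic:
  fixes f :: "'a::real_normed_vector \<Rightarrow> 'b::real_normed_vector"
  assumes D: "bounded_linear D" and K: "0 \<le> K" and "0 < e"
    and le: "\<And>y. y \<in> S \<Longrightarrow> norm (y - x) < e \<Longrightarrow> norm (f y - f x - D (y - x)) \<le> K * (norm (y - x))\<^sup>2"
  shows "(f has_derivative D) (at x within S)"
  unfolding has_derivative_within_alt
proof (intro conjI allI impI D)
  fix d :: real assume d: "0 < d"
  define \<delta> where "\<delta> = min e (d / (K + 1))"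
  have "0 < \<delta>" using d \<open>0 < e\<close> K by (simp add: \<delta>_def)
  moreover have "norm (f y - f x - D (y - x)) \<le> d * norm (y - x)" if y: "y \<in> S" "norm (y - x) < \<delta>" for y
  proof -
    have "norm (f y - f x - D (y - x)) \<le> (K * norm (y - x)) * norm (y - x)"
      using le[of y] y by (simp add: \<delta>_def power2_eq_square mult.assoc)
    moreover have "K * norm (y - x) \<le> K * (d / (K + 1))"
      using y K by (intro mult_left_mono) (auto simp: \<delta>_def)
    moreover have "K * (d / (K + 1)) \<le> d" using K d by (simp add: divide_le_eq algebra_simps)
    ultimately show ?thesis by (meson mult_right_mono norm_ge_zero order_trans)
  qed
  ultimately show "\<exists>d'>0. \<forall>y\<in>S. norm (y - x) < d' \<longrightarrow> norm (f y - f x - D (y - x)) \<le> d * norm (y - x)"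
    by blast
qed

text \<open>A bound on the initial time derivative makes the approximations equi-Lipschitz, so that the
  weak limit is again strongly continuous in time.\<close>

lemma weak_evolution_compactness:
  fixes u :: "nat \<Rightarrow> real \<Rightarrow> 'a::{real_inner,banach}" and \<psi> :: "nat \<Rightarrow> 'i \<Rightarrow> 'a"
  assumes u0: "\<And>n. u n 0 = x" and L0: "\<And>t. 0 \<le> t \<Longrightarrow> 0 \<le> L t"
    and Lmono: "\<And>s t. 0 \<le> s \<Longrightarrow> s \<le> t \<Longrightarrow> L s \<le> L t"
    and bound: "\<And>n t. 0 \<le> t \<Longrightarrow> norm (u n t) \<le> C t"
    and lip: "\<And>n s t. 0 \<le> s \<Longrightarrow> s \<le> t \<Longrightarrow> norm (u n t - u n s) \<le> L t * (t - s)"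
    and der: "\<And>n i t. i \<in> I \<Longrightarrow> 0 \<le> t \<Longrightarrow>
      ((\<lambda>s. u n s \<bullet> \<phi> i) has_real_derivative u n t \<bullet> \<psi> n i) (at t within {0..})"
    and conv: "\<And>i. i \<in> I \<Longrightarrow> (\<lambda>n. \<psi> n i) \<longlonglongrightarrow> \<psi>' i"
  obtains v where "v 0 = x" "\<And>t. 0 \<le> t \<Longrightarrow> norm (v t) \<le> C t"
    "\<And>s t. 0 \<le> s \<Longrightarrow> s \<le> t \<Longrightarrow> norm (v t - v s) \<le> L t * (t - s)"
    "\<And>i t. i \<in> I \<Longrightarrow> 0 \<le> t \<Longrightarrow>
      ((\<lambda>s. v s \<bullet> \<phi> i) has_real_derivative v t \<bullet> \<psi>' i) (at t within {0..})"
proof -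
  obtain G v where G: "G \<noteq> bot" "G \<le> sequentially"
    and wlim: "\<And>t y. ((\<lambda>n. u n (max 0 t) \<bullet> y) \<longlongrightarrow> v t \<bullet> y) G"
    and vb: "\<And>t. norm (v t) \<le> C (max 0 t)"
    using weak_limit_along_filter[of "\<lambda>n t. u n (max 0 t)" "\<lambda>t. C (max 0 t)"] bound
    by (metis max.cobounded1)
  have wl: "((\<lambda>n. u n t \<bullet> y) \<longlongrightarrow> v t \<bullet> y) G" if "0 \<le> t" for t y
    using wlim[of t y] that by simp
  show ?thesis
  proof (rule that[of v])
    show "v 0 = x"
    proof -
      have "v 0 \<bullet> y = x \<bullet> y" for y
        using tendsto_unique[OF G(1) wl[OF order_refl, of y]] u0 by simp
      then have "(v 0 - x) \<bullet> (v 0 - x) = 0" by (simp add: inner_diff_left)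
      then show ?thesis by simp
    qed
    show "norm (v t) \<le> C t" if "0 \<le> t" for t using vb[of t] that by simp
    show lipv: "norm (v t - v s) \<le> L t * (t - s)" if st: "0 \<le> s" "s \<le> t" for s t
    proof (rule norm_le_if_inner_le)
      fix y
      have "((\<lambda>n. (u n t - u n s) \<bullet> y) \<longlongrightarrow> (v t - v s) \<bullet> y) G"
        unfolding inner_diff_left using st by (intro tendsto_diff wl) auto
      moreover have "(u n t - u n s) \<bullet> y \<le> L t * (t - s) * norm y" for n
        using norm_cauchy_schwarz[of "u n t - u n s" y] mult_right_mono[OF lip[OF st, of n], of "norm y"] by simp
      ultimately show "(v t - v s) \<bullet> y \<le> L t * (t - s) * norm y"
        by (intro tendsto_upperbound[OF _ _ G(1)]) auto
    qed (use L0[of t] st in simp)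
    fix i t assume i: "i \<in> I" and t: "(0::real) \<le> t"
    \<comment> \<open>Differentiability does not pass to weak limits, but a quadratic Taylor
      remainder does. It comes from the mean value theorem and the common Lipschitz bound; the only
      dependence on \<open>n\<close> is through the convergent \<open>\<psi> n i\<close>.\<close>
    have taylor: "\<bar>u n s \<bullet> \<phi> i - u n t \<bullet> \<phi> i - (s - t) * (u n t \<bullet> \<psi> n i)\<bar>
        \<le> L (t + 1) * (s - t)\<^sup>2 * norm (\<psi> n i)" if s: "0 \<le> s" "s \<le> t + 1" for n s
    proof -
      define a where "a = min s t"
      define b where "b = max s t"
      have ab: "a \<le> b" "0 \<le> a" "b \<le> t + 1" "t \<in> {a..b}" "b - a = \<bar>s - t\<bar>"
        using s t by (auto simp: a_def b_def)
      have "\<exists>r\<in>{a..b}. u n b \<bullet> \<phi> i - u n a \<bullet> \<phi> i = (u n r \<bullet> \<psi> n i) * (b - a)"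
      proof (rule mvt_very_simple[OF ab(1)])
        fix r assume "a \<le> r" "r \<le> b"
        then show "((\<lambda>s. u n s \<bullet> \<phi> i) has_derivative (*) (u n r \<bullet> \<psi> n i)) (at r within {a..b})"
          using has_field_derivative_subset[OF der[OF i, of r n], of "{a..b}"] ab
          by (auto simp: has_field_derivative_def)
      qed
      then obtain r where r: "r \<in> {a..b}" "u n b \<bullet> \<phi> i - u n a \<bullet> \<phi> i = (u n r \<bullet> \<psi> n i) * (b - a)" by blast
      then have eq: "u n s \<bullet> \<phi> i - u n t \<bullet> \<phi> i = (s - t) * (u n r \<bullet> \<psi> n i)"
        by (cases "s \<le> t") (auto simp: a_def b_def algebra_simps)
      have "norm (u n r - u n t) \<le> L (t + 1) * \<bar>r - t\<bar>"
      proof (cases "t \<le> r")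
        case True
        then have "norm (u n r - u n t) \<le> L r * (r - t)" using lip t by simp
        also have "\<dots> \<le> L (t + 1) * (r - t)" using True r ab t by (intro mult_right_mono Lmono) auto
        finally show ?thesis using True by simp
      next
        case False
        then have "norm (u n t - u n r) \<le> L t * (t - r)" using lip r ab by simp
        also have "\<dots> \<le> L (t + 1) * (t - r)" using False t by (intro mult_right_mono Lmono) auto
        finally show ?thesis using False by (simp add: norm_minus_commute)
      qed
      also have "\<dots> \<le> L (t + 1) * \<bar>s - t\<bar>"
        using r ab L0[of "t + 1"] t by (intro mult_left_mono) auto
      finally have "\<bar>(u n r - u n t) \<bullet> \<psi> n i\<bar> \<le> (L (t + 1) * \<bar>s - t\<bar>) * norm (\<psi> n i)"
        by (meson Cauchy_Schwarz_ineq2 mult_right_mono norm_ge_zero order_trans)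
      then have "\<bar>s - t\<bar> * \<bar>(u n r - u n t) \<bullet> \<psi> n i\<bar>
          \<le> \<bar>s - t\<bar> * ((L (t + 1) * \<bar>s - t\<bar>) * norm (\<psi> n i))"
        by (rule mult_left_mono) simp
      also have "\<dots> = L (t + 1) * (s - t)\<^sup>2 * norm (\<psi> n i)"
        using abs_mult_self_eq[of "s - t"] by (simp add: power2_eq_square)
      also have "\<bar>s - t\<bar> * \<bar>(u n r - u n t) \<bullet> \<psi> n i\<bar>
          = \<bar>u n s \<bullet> \<phi> i - u n t \<bullet> \<phi> i - (s - t) * (u n t \<bullet> \<psi> n i)\<bar>"
        unfolding eq by (simp add: abs_mult[symmetric] inner_diff_left algebra_simps)
      finally show ?thesis .
    qed
    have cG: "((\<lambda>n. \<psi> n i) \<longlongrightarrow> \<psi>' i) G"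
      using filterlim_mono[OF conv[OF i] order_refl G(2)] .
    \<comment> \<open>Here \<open>u n r\<close> converges only weakly, which suffices because
      \<open>\<psi> n i\<close> converges in norm and \<open>u n r\<close> is bounded.\<close>
    have pair: "((\<lambda>n. u n r \<bullet> \<psi> n i) \<longlongrightarrow> v r \<bullet> \<psi>' i) G" if r: "0 \<le> r" for r
    proof -
      have "((\<lambda>n. u n r \<bullet> (\<psi> n i - \<psi>' i)) \<longlongrightarrow> 0) G"
      proof (rule Lim_null_comparison)
        show "\<forall>\<^sub>F n in G. norm (u n r \<bullet> (\<psi> n i - \<psi>' i)) \<le> C r * norm (\<psi> n i - \<psi>' i)"
          unfolding real_norm_def
          by (intro always_eventually allI order_trans[OF Cauchy_Schwarz_ineq2] mult_right_mono bound[OF r]) simp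
        have "((\<lambda>n. C r * norm (\<psi> n i - \<psi>' i)) \<longlongrightarrow> C r * norm (\<psi>' i - \<psi>' i)) G"
          by (intro tendsto_intros cG)
        then show "((\<lambda>n. C r * norm (\<psi> n i - \<psi>' i)) \<longlongrightarrow> 0) G" by simp
      qed
      then have "((\<lambda>n. u n r \<bullet> \<psi>' i + u n r \<bullet> (\<psi> n i - \<psi>' i)) \<longlongrightarrow> v r \<bullet> \<psi>' i + 0) G"
        by (intro tendsto_add wl r)
      then show ?thesis by (simp add: inner_diff_right)
    qed
    have taylor_v: "\<bar>v s \<bullet> \<phi> i - v t \<bullet> \<phi> i - (s - t) * (v t \<bullet> \<psi>' i)\<bar>
        \<le> L (t + 1) * (s - t)\<^sup>2 * norm (\<psi>' i)" if s: "0 \<le> s" "s \<le> t + 1" for s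
    proof (rule tendsto_le[OF G(1)])
      show "((\<lambda>n. \<bar>u n s \<bullet> \<phi> i - u n t \<bullet> \<phi> i - (s - t) * (u n t \<bullet> \<psi> n i)\<bar>) \<longlongrightarrow>
          \<bar>v s \<bullet> \<phi> i - v t \<bullet> \<phi> i - (s - t) * (v t \<bullet> \<psi>' i)\<bar>) G"
        using s t by (intro tendsto_intros wl pair)
      show "((\<lambda>n. L (t + 1) * (s - t)\<^sup>2 * norm (\<psi> n i)) \<longlongrightarrow> L (t + 1) * (s - t)\<^sup>2 * norm (\<psi>' i)) G"
        by (intro tendsto_intros cG)
    qed (use taylor[OF s] in simp)
    show "((\<lambda>s. v s \<bullet> \<phi> i) has_real_derivative v t \<bullet> \<psi>' i) (at t within {0..})"
      unfolding has_field_derivative_def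
    proof (rule has_derivativeI_quadratic)
      show "bounded_linear ((*) (v t \<bullet> \<psi>' i))" by (rule bounded_linear_mult_right)
      show "0 \<le> L (t + 1) * norm (\<psi>' i)" using L0[of "t + 1"] t by simp
      show "norm (v s \<bullet> \<phi> i - v t \<bullet> \<phi> i - v t \<bullet> \<psi>' i * (s - t)) \<le> L (t + 1) * norm (\<psi>' i) * (norm (s - t))\<^sup>2"
        if "s \<in> {0..}" "norm (s - t) < 1" for s
        using taylor_v[of s] that by (simp add: abs_less_iff mult.commute mult.left_commute)
    qed simp
  qed
qed

text \<open>If \<open>u' = - A u\<close>, then \<open>r\<close> stands for
  \<open>l (l + A)^-1 (u 0)\<close>: with \<open>\<psi>\<close> in the role of minus the adjoint of
  \<open>A\<close> at \<open>\<phi>\<close>, the conclusion is \<open>(l + A) r = l u 0\<close>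
  tested against \<open>\<phi>\<close>. The weight \<open>l exp (- l t)\<close> has total mass 1, so
  the bound \<open>M\<close> is inherited.\<close>

lemma laplace_resolvent:
  fixes u :: "real \<Rightarrow> 'a::{real_inner,banach}"
  assumes cont: "continuous_on {0..} u" and bound: "\<And>t. 0 \<le> t \<Longrightarrow> norm (u t) \<le> M" and "0 < l"
  obtains r where "norm r \<le> M"
    "\<And>\<phi> \<psi>. (\<And>t. 0 \<le> t \<Longrightarrow> ((\<lambda>s. u s \<bullet> \<phi>) has_real_derivative u t \<bullet> \<psi>) (at t within {0..})) \<Longrightarrow>
       r \<bullet> (l *\<^sub>R \<phi> - \<psi>) = l * (u 0 \<bullet> \<phi>)"
proof -
  have M0: "0 \<le> M" using bound[of 0] norm_ge_zero order_trans by (meson order_refl)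
  define g where "g t = (l * exp (- l * t)) *\<^sub>R u t" for t
  \<comment> \<open>Truncated Laplace integrals of a continuous integrand; \<open>r\<close> is their
    weak limit, so no integral over the half-line has to be formed.\<close>
  define R where "R n = integral {0..real n} g" for n
  have contg: "continuous_on {0..real n} g" for n
    unfolding g_def by (intro continuous_intros continuous_on_subset[OF cont]) auto
  have gint: "(g has_integral R n) {0..real n}" for n
    unfolding R_def by (intro integrable_integral integrable_continuous_real contg)
  have "((\<lambda>t. M * (l * exp (- l * t))) has_integral
      (M * (- exp (- l * real n)) - M * (- exp (- l * 0)))) {0..real n}" for n
    by (intro fundamental_theorem_of_calculus)
      (auto simp: has_real_derivative_iff_has_vector_derivative[symmetric] intro!: derivative_eq_intros)
  then have "norm (R n) \<le> M * (- exp (- l * real n)) - M * (- exp (- l * 0))" for n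
    unfolding R_def
    using integral_norm_bound_integral[of g "{0..real n}" "\<lambda>t. M * (l * exp (- l * t))"] contg bound \<open>0 < l\<close>
    by (smt (verit, ccfv_SIG) atLeastAtMost_iff g_def has_integral_integrable_integral integrable_continuous_real
        mult.commute mult_right_mono norm_scaleR exp_gt_zero mult_pos_pos abs_of_pos)
  then have Rb: "norm (R n) \<le> M" for n
    using M0 by (smt (verit) exp_gt_zero mult_nonneg_nonneg mult_minus_right mult_zero_right exp_zero mult_cancel_left1 less_imp_le)
  obtain G r where G: "G \<noteq> bot" "G \<le> sequentially"
    and wl: "\<And>y. ((\<lambda>n. R n \<bullet> y) \<longlongrightarrow> r \<bullet> y) G" and rb: "norm r \<le> M"
    using weak_limit_along_filter[of "\<lambda>n (_::unit). R n" "\<lambda>_. M"] Rb by metis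
  show ?thesis
  proof (rule that[OF rb])
    fix \<phi> \<psi>
    assume der: "\<And>t. 0 \<le> t \<Longrightarrow> ((\<lambda>s. u s \<bullet> \<phi>) has_real_derivative u t \<bullet> \<psi>) (at t within {0..})"
    have R: "R n \<bullet> (l *\<^sub>R \<phi> - \<psi>) = l * (u 0 \<bullet> \<phi>) - l * exp (- l * real n) * (u (real n) \<bullet> \<phi>)" for n
    proof -
      have "((\<lambda>t. - l * exp (- l * t) * (u t \<bullet> \<phi>)) has_real_derivative g t \<bullet> (l *\<^sub>R \<phi> - \<psi>)) (at t within {0..real n})"
        if "t \<in> {0..real n}" for t
      proof -
        have 1: "((\<lambda>s. u s \<bullet> \<phi>) has_real_derivative u t \<bullet> \<psi>) (at t within {0..real n})"
          using has_field_derivative_subset[OF der[of t], of "{0..real n}"] that by auto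
        have 2: "((\<lambda>t. - l * exp (- l * t)) has_real_derivative l * l * exp (- l * t)) (at t within {0..real n})"
          by (auto intro!: derivative_eq_intros)
        show ?thesis
          by (rule DERIV_cong[OF DERIV_mult[OF 2 1]]) (simp add: g_def inner_diff_right algebra_simps)
      qed
      then have 1: "((\<lambda>t. g t \<bullet> (l *\<^sub>R \<phi> - \<psi>)) has_integral
          (- l * exp (- l * real n) * (u (real n) \<bullet> \<phi>) - (- l * exp (- l * 0) * (u 0 \<bullet> \<phi>)))) {0..real n}"
        by (intro fundamental_theorem_of_calculus) (auto simp: has_real_derivative_iff_has_vector_derivative)
      have 2: "((\<lambda>t. g t \<bullet> (l *\<^sub>R \<phi> - \<psi>)) has_integral R n \<bullet> (l *\<^sub>R \<phi> - \<psi>)) {0..real n}"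
        using has_integral_linear[OF gint bounded_linear_inner_left[of "l *\<^sub>R \<phi> - \<psi>"]]
        unfolding o_def .
      show ?thesis unfolding has_integral_unique[OF 2 1] by simp
    qed
    have "(\<lambda>n. l * exp (- l * real n) * (u (real n) \<bullet> \<phi>)) \<longlonglongrightarrow> 0"
    proof (rule Lim_null_comparison)
      have "\<bar>u (real n) \<bullet> \<phi>\<bar> \<le> M * norm \<phi>" for n
        by (meson Cauchy_Schwarz_ineq2 bound mult_right_mono norm_ge_zero of_nat_0_le_iff order_trans)
      then show "\<forall>\<^sub>F n in sequentially. norm (l * exp (- l * real n) * (u (real n) \<bullet> \<phi>))
          \<le> l * exp (- l * real n) * (M * norm \<phi>)"
        using \<open>0 < l\<close> by (auto simp: abs_mult intro!: mult_left_mono)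
      have "filterlim (\<lambda>n. (- l) * real n) at_bot sequentially"
        using \<open>0 < l\<close> by (intro filterlim_tendsto_neg_mult_at_bot[OF tendsto_const _ filterlim_real_sequentially]) simp
      then have "(\<lambda>n. exp (- l * real n)) \<longlonglongrightarrow> 0" by (rule filterlim_compose[OF exp_at_bot])
      then show "(\<lambda>n. l * exp (- l * real n) * (M * norm \<phi>)) \<longlonglongrightarrow> 0"
        using tendsto_mult[OF tendsto_mult[OF tendsto_const[of l]] tendsto_const[of "M * norm \<phi>"]] by fastforce
    qed
    then have "((\<lambda>n. l * exp (- l * real n) * (u (real n) \<bullet> \<phi>)) \<longlongrightarrow> 0) G"
      using filterlim_mono[OF _ order_refl G(2)] by blast
    then have "((\<lambda>n. R n \<bullet> (l *\<^sub>R \<phi> - \<psi>)) \<longlongrightarrow> l * (u 0 \<bullet> \<phi>) - 0) G"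
      unfolding R by (intro tendsto_diff tendsto_const)
    then show "r \<bullet> (l *\<^sub>R \<phi> - \<psi>) = l * (u 0 \<bullet> \<phi>)"
      using tendsto_unique[OF G(1) wl] by fastforce
  qed
qed

section \<open>The Hilbert space of square integrable functions\<close>

lemma square_integrable_borel: "square_integrable f \<Longrightarrow> f \<in> borel_measurable borel"
  by (simp add: square_integrable_def)

lemma square_integrable_0 [simp]: "square_integrable (\<lambda>_. 0)"
  by (simp add: square_integrable_def)

lemma square_integrable_bound:
  assumes "square_integrable g" "f \<in> borel_measurable borel" "\<And>y. cmod (f y) \<le> C * cmod (g y)"
  shows "square_integrable f"
  unfolding square_integrable_def
proof
  show "f \<in> borel_measurable lborel" using assms by simp
  have g: "integrable lborel (\<lambda>y. C\<^sup>2 * (cmod (g y))\<^sup>2)"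
    using assms by (simp add: square_integrable_def)
  show "integrable lborel (\<lambda>y. (cmod (f y))\<^sup>2)"
  proof (rule Bochner_Integration.integrable_bound[OF g])
    show "(\<lambda>y. (cmod (f y))\<^sup>2) \<in> borel_measurable lborel" using assms by measurable
    have "(cmod (f y))\<^sup>2 \<le> C\<^sup>2 * (cmod (g y))\<^sup>2" for y
      using power_mono[OF assms(3), of y 2] by (simp add: power_mult_distrib)
    then show "AE y in lborel. norm ((cmod (f y))\<^sup>2) \<le> norm (C\<^sup>2 * (cmod (g y))\<^sup>2)" by simp
  qed
qed

lemma square_integrable_cmult:
  assumes "square_integrable f"
  shows "square_integrable (\<lambda>y. c * f y)"
proof (rule square_integrable_bound[OF assms, of _ "cmod c"])
  note [measurable] = square_integrable_borel[OF assms]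
  show "(\<lambda>y. c * f y) \<in> borel_measurable borel" by measurable
qed (simp add: norm_mult)

lemma square_integrable_scaleR: "square_integrable f \<Longrightarrow> square_integrable (\<lambda>y. r *\<^sub>R f y)"
  using square_integrable_cmult[of f "of_real r"] by (simp add: scaleR_conv_of_real)

lemma square_integrable_uminus: "square_integrable f \<Longrightarrow> square_integrable (\<lambda>y. - f y)"
  using square_integrable_cmult[of f "-1"] by simp

lemma borel_measurable_cnj [measurable (raw)]:
  "f \<in> borel_measurable M \<Longrightarrow> (\<lambda>y. cnj (f y)) \<in> borel_measurable M"
  by (rule measurable_compose[OF _ borel_measurable_continuous_onI[OF continuous_on_cnj[OF continuous_on_id]]])

lemma square_integrable_cnj:
  assumes "square_integrable f"
  shows "square_integrable (\<lambda>y. cnj (f y))"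
proof (rule square_integrable_bound[OF assms, of _ 1])
  note [measurable] = square_integrable_borel[OF assms]
  show "(\<lambda>y. cnj (f y)) \<in> borel_measurable borel" by measurable
qed simp

lemma square_integrable_cmod:
  assumes "square_integrable f"
  shows "square_integrable (\<lambda>y. of_real (cmod (f y)))"
proof (rule square_integrable_bound[OF assms, of _ 1])
  note [measurable] = square_integrable_borel[OF assms]
  show "(\<lambda>y. complex_of_real (cmod (f y))) \<in> borel_measurable borel" by measurable
qed simp

lemma square_integrable_add:
  assumes "square_integrable f" "square_integrable g"
  shows "square_integrable (\<lambda>y. f y + g y)"
  unfolding square_integrable_def
proof
  note [measurable] = square_integrable_borel[OF assms(1)] square_integrable_borel[OF assms(2)]
  show "(\<lambda>y. f y + g y) \<in> borel_measurable lborel" by simp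
  have i: "integrable lborel (\<lambda>y. 2 * (cmod (f y))\<^sup>2 + 2 * (cmod (g y))\<^sup>2)"
    using assms by (simp add: square_integrable_def)
  show "integrable lborel (\<lambda>y. (cmod (f y + g y))\<^sup>2)"
  proof (rule Bochner_Integration.integrable_bound[OF i])
    have "(cmod (a + b))\<^sup>2 \<le> 2 * (cmod a)\<^sup>2 + 2 * (cmod b)\<^sup>2" for a b
      using parallelogram_id[of a b] zero_le_power2[of "cmod (a - b)"] by linarith
    then show "AE y in lborel. norm ((cmod (f y + g y))\<^sup>2) \<le> norm (2 * (cmod (f y))\<^sup>2 + 2 * (cmod (g y))\<^sup>2)"
      by simp
  qed measurable
qed

lemma square_integrable_diff:
  "square_integrable f \<Longrightarrow> square_integrable g \<Longrightarrow> square_integrable (\<lambda>y. f y - g y)"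
  using square_integrable_add[OF _ square_integrable_uminus, of f g] by simp

lemma square_integrable_mult_integrable:
  assumes "square_integrable f" "square_integrable g"
  shows "integrable lborel (\<lambda>y. f y * g y)"
proof -
  note [measurable] = square_integrable_borel[OF assms(1)] square_integrable_borel[OF assms(2)]
  have i: "integrable lborel (\<lambda>y. (cmod (f y))\<^sup>2 + (cmod (g y))\<^sup>2)"
    using assms by (simp add: square_integrable_def)
  show ?thesis
  proof (rule Bochner_Integration.integrable_bound[OF i])
    have "cmod a * cmod b \<le> (cmod a)\<^sup>2 + (cmod b)\<^sup>2" for a b
    proof -
      have "0 \<le> cmod a * cmod b" by simp
      then show ?thesis using sum_squares_bound[of "cmod a" "cmod b"] by linarith
    qed
    then show "AE y in lborel. norm (f y * g y) \<le> norm ((cmod (f y))\<^sup>2 + (cmod (g y))\<^sup>2)"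
      by (simp add: norm_mult)
  qed measurable
qed

text \<open>A partial equivalence: only square integrable functions are related to themselves, so
  the quotient consists of exactly their classes.\<close>

definition l2_rel :: "(real \<Rightarrow> complex) \<Rightarrow> (real \<Rightarrow> complex) \<Rightarrow> bool" where
  "l2_rel f g \<longleftrightarrow> square_integrable f \<and> square_integrable g \<and> (AE y in lborel. f y = g y)"

lemma l2_relD:
  assumes "l2_rel f g"
  shows "square_integrable f" "square_integrable g" "AE y in lborel. f y = g y"
    "f \<in> borel_measurable borel" "g \<in> borel_measurable borel"
  using assms by (simp_all add: l2_rel_def square_integrable_borel)

lemma l2_relI: "square_integrable f \<Longrightarrow> (\<And>y. f y = g y) \<Longrightarrow> l2_rel f g"
proof -
  assume "square_integrable f" "\<And>y. f y = g y"
  moreover from this(2) have "g = f" by auto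
  ultimately show ?thesis by (simp add: l2_rel_def)
qed

lemma l2_rel_self: "l2_rel f f \<longleftrightarrow> square_integrable f"
  by (simp add: l2_rel_def)

quotient_type l2 = "real \<Rightarrow> complex" / partial: l2_rel
proof (rule part_equivpI)
  show "\<exists>x. l2_rel x x"
    by (rule exI[of _ "\<lambda>_. 0"]) (simp add: l2_rel_def)
  show "symp l2_rel"
  proof (rule sympI)
    fix f g assume "l2_rel f g"
    note d = l2_relD[OF this]
    from d(3) have "AE y in lborel. g y = f y" by eventually_elim simp
    with d show "l2_rel g f" by (simp add: l2_rel_def)
  qed
  show "transp l2_rel"
  proof (rule transpI)
    fix f g h assume "l2_rel f g" "l2_rel g h"
    note d = l2_relD[OF this(1)] l2_relD[OF this(2)]
    from d(3,8) have "AE y in lborel. f y = h y" by eventually_elim simp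
    with d show "l2_rel f h" by (simp add: l2_rel_def)
  qed
qed

lemma AE_eq_compose2:
  assumes "AE y in M. f y = f' y" "AE y in M. g y = g' y"
  shows "AE y in M. h (f y) (g y) = h (f' y) (g' y)"
  using assms by eventually_elim simp

instantiation l2 :: real_vector
begin

lift_definition zero_l2 :: l2 is "\<lambda>_. 0" by (simp add: l2_rel_def)
lift_definition plus_l2 :: "l2 \<Rightarrow> l2 \<Rightarrow> l2" is "\<lambda>f g y. f y + g y"
  unfolding l2_rel_def by (intro conjI square_integrable_add AE_eq_compose2[where h="(+)"]) blast+
lift_definition minus_l2 :: "l2 \<Rightarrow> l2 \<Rightarrow> l2" is "\<lambda>f g y. f y - g y"
  unfolding l2_rel_def by (intro conjI square_integrable_diff AE_eq_compose2[where h="(-)"]) blast+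
lift_definition uminus_l2 :: "l2 \<Rightarrow> l2" is "\<lambda>f y. - f y"
  unfolding l2_rel_def by (intro conjI square_integrable_uminus AE_eq_compose2[where h="\<lambda>a _. - a" and g="\<lambda>_. ()" and g'="\<lambda>_. ()"]) auto
lift_definition scaleR_l2 :: "real \<Rightarrow> l2 \<Rightarrow> l2" is "\<lambda>r f y. r *\<^sub>R f y"
  unfolding l2_rel_def by (intro conjI square_integrable_scaleR AE_eq_compose2[where h="\<lambda>a _. _ *\<^sub>R a" and g="\<lambda>_. ()" and g'="\<lambda>_. ()"]) auto

instance
proof
  fix u v w :: l2 and r s :: real
  note sq = l2_rel_self square_integrable_add square_integrable_uminus square_integrable_scaleR square_integrable_diff
  show "u + v + w = u + (v + w)"
    by (transfer, rule l2_relI) (simp_all add: sq algebra_simps)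
  show "u + v = v + u"
    by (transfer, rule l2_relI) (simp_all add: sq algebra_simps)
  show "0 + u = u"
    by (transfer, rule l2_relI) (simp_all add: sq algebra_simps)
  show "- u + u = 0"
    by (transfer, rule l2_relI) (simp_all add: sq algebra_simps)
  show "u - v = u + - v"
    by (transfer, rule l2_relI) (simp_all add: sq algebra_simps)
  show "r *\<^sub>R (u + v) = r *\<^sub>R u + r *\<^sub>R v"
    by (transfer, rule l2_relI) (simp_all add: sq algebra_simps)
  show "(r + s) *\<^sub>R u = r *\<^sub>R u + s *\<^sub>R u"
    by (transfer, rule l2_relI) (simp_all add: sq algebra_simps)
  show "r *\<^sub>R s *\<^sub>R u = (r * s) *\<^sub>R u"
    by (transfer, rule l2_relI) (simp_all add: sq algebra_simps)
  show "1 *\<^sub>R u = u"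
    by (transfer, rule l2_relI) (simp_all add: sq algebra_simps)
qed

end

instantiation l2 :: real_inner
begin

text \<open>Only the real part of the Hermitian product is kept, so that \<open>l2\<close> is a real
  Hilbert space and the lemmas above apply. Complex identities are recovered by testing with
  \<open>z = 1\<close> and \<open>z = \<i>\<close>, and complex scalars act through
  \<open>l2_cmult\<close>.\<close>

lift_definition inner_l2 :: "l2 \<Rightarrow> l2 \<Rightarrow> real" is "\<lambda>f g. Re (\<integral>y. f y * cnj (g y) \<partial>lborel)"
proof -
  fix f f' g g' assume a: "l2_rel f f'" "l2_rel g g'"
  note [measurable] = l2_relD(4,5)[OF a(1)] l2_relD(4,5)[OF a(2)]
  show "Re (\<integral>y. f y * cnj (g y) \<partial>lborel) = Re (\<integral>y. f' y * cnj (g' y) \<partial>lborel)"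
    by (intro arg_cong[where f=Re] integral_cong_AE
        AE_eq_compose2[OF l2_relD(3)[OF a(1)] l2_relD(3)[OF a(2)], where h="\<lambda>a b. a * cnj b"]) measurable
qed

definition norm_l2 :: "l2 \<Rightarrow> real" where "norm_l2 u = sqrt (u \<bullet> u)"
definition dist_l2 :: "l2 \<Rightarrow> l2 \<Rightarrow> real" where "dist_l2 u v = norm (u - v)"
definition sgn_l2 :: "l2 \<Rightarrow> l2" where "sgn_l2 u = u /\<^sub>R norm u"
definition uniformity_l2 :: "(l2 \<times> l2) filter" where
  "uniformity_l2 = (INF e\<in>{0<..}. principal {(u, v). dist u v < e})"
definition open_l2 :: "l2 set \<Rightarrow> bool" where
  "open_l2 U \<longleftrightarrow> (\<forall>x\<in>U. \<forall>\<^sub>F (x', y) in uniformity. x' = x \<longrightarrow> y \<in> U)"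

instance
proof
  fix u v w :: l2 and r :: real and U :: "l2 set"
  show "dist u v = norm (u - v)" by (rule dist_l2_def)
  show "sgn u = u /\<^sub>R norm u" by (rule sgn_l2_def)
  show "uniformity = (INF e\<in>{0<..}. principal {(x::l2, y). dist x y < e})" by (rule uniformity_l2_def)
  show "open U \<longleftrightarrow> (\<forall>x\<in>U. \<forall>\<^sub>F (x', y) in uniformity. x' = x \<longrightarrow> y \<in> U)" by (rule open_l2_def)
  show "norm u = sqrt (u \<bullet> u)" by (rule norm_l2_def)
  show "u \<bullet> v = v \<bullet> u"
  proof (transfer, goal_cases)
    case (1 f g)
    have "(\<integral>y. g y * cnj (f y) \<partial>lborel) = (\<integral>y. cnj (f y * cnj (g y)) \<partial>lborel)"
      by (simp add: mult.commute)
    also have "\<dots> = cnj (\<integral>y. f y * cnj (g y) \<partial>lborel)" by (rule Bochner_Integration.integral_cnj)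
    finally show ?case by simp
  qed
  show "(u + v) \<bullet> w = u \<bullet> w + v \<bullet> w"
  proof (transfer, goal_cases)
    case (1 f g h)
    then have "integrable lborel (\<lambda>y. f y * cnj (h y))" "integrable lborel (\<lambda>y. g y * cnj (h y))"
      by (auto simp: l2_rel_def intro!: square_integrable_mult_integrable square_integrable_cnj)
    then show ?case by (simp add: distrib_right)
  qed
  show "r *\<^sub>R u \<bullet> v = r * (u \<bullet> v)" by transfer simp
  have sq: "(\<integral>y. f y * cnj (f y) \<partial>lborel) = of_real (\<integral>y. (cmod (f y))\<^sup>2 \<partial>lborel)" for f
    unfolding complex_norm_square[symmetric] by (rule integral_complex_of_real)
  show "0 \<le> u \<bullet> u" by transfer (simp add: sq)
  show "u \<bullet> u = 0 \<longleftrightarrow> u = 0"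
  proof (transfer, goal_cases)
    case (1 f)
    then have "integrable lborel (\<lambda>y. (cmod (f y))\<^sup>2)" by (auto simp: l2_rel_def square_integrable_def)
    then show ?case using 1
      by (subst sq) (simp add: integral_nonneg_eq_0_iff_AE l2_rel_def)
  qed
qed

end

section \<open>Classes, representatives and norms in \<open>l2\<close>\<close>

lemma l2_rel_rep: "l2_rel (rep_l2 u) (rep_l2 u)"
  by (rule Quotient_rep_reflp[OF Quotient_l2])

lemma square_integrable_rep [simp]: "square_integrable (rep_l2 u)"
  using l2_rel_rep by (simp add: l2_rel_def)

lemma rep_l2_borel [measurable]: "rep_l2 u \<in> borel_measurable borel"
  by (rule square_integrable_borel) simp

lemma abs_rep_l2 [simp]: "abs_l2 (rep_l2 u) = u"
  by (rule Quotient_abs_rep[OF Quotient_l2])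

lemma abs_l2_eq_iff:
  "square_integrable f \<Longrightarrow> square_integrable g \<Longrightarrow> abs_l2 f = abs_l2 g \<longleftrightarrow> (AE y in lborel. f y = g y)"
  using Quotient_rel[OF Quotient_l2, of f g] by (simp add: l2_rel_def)

lemma rep_abs_l2: "square_integrable f \<Longrightarrow> AE y in lborel. rep_l2 (abs_l2 f) y = f y"
  by (simp flip: abs_l2_eq_iff)

lemma abs_l2_add: "square_integrable f \<Longrightarrow> square_integrable g \<Longrightarrow> abs_l2 f + abs_l2 g = abs_l2 (\<lambda>y. f y + g y)"
  by (simp add: plus_l2.abs_eq l2_rel_def)

lemma abs_l2_diff: "square_integrable f \<Longrightarrow> square_integrable g \<Longrightarrow> abs_l2 f - abs_l2 g = abs_l2 (\<lambda>y. f y - g y)"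
  by (simp add: minus_l2.abs_eq l2_rel_def)

lemma abs_l2_scaleR: "square_integrable f \<Longrightarrow> r *\<^sub>R abs_l2 f = abs_l2 (\<lambda>y. r *\<^sub>R f y)"
  by (simp add: scaleR_l2.abs_eq l2_rel_def)

lemma abs_l2_0: "abs_l2 (\<lambda>_. 0) = 0"
  by (simp add: zero_l2.abs_eq)

lemma inner_abs_l2: "square_integrable f \<Longrightarrow> square_integrable g \<Longrightarrow>
  abs_l2 f \<bullet> abs_l2 g = Re (\<integral>y. f y * cnj (g y) \<partial>lborel)"
  by (simp add: inner_l2.abs_eq l2_rel_def)

lemma norm_abs_l2: "square_integrable f \<Longrightarrow> norm (abs_l2 f) = L2_norm f"
  by (simp only: norm_eq_sqrt_inner inner_abs_l2 L2_norm_def complex_norm_square[symmetric]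
      integral_complex_of_real Re_complex_of_real)

lemma norm_l2_rep: "norm u = L2_norm (rep_l2 u)"
  using norm_abs_l2[of "rep_l2 u", OF square_integrable_rep] unfolding abs_rep_l2 .

lemma L2_norm_nonneg [simp]: "0 \<le> L2_norm f"
  by (simp add: L2_norm_def integral_nonneg_AE)

lemma L2_norm_square: "(L2_norm f)\<^sup>2 = (\<integral>y. (cmod (f y))\<^sup>2 \<partial>lborel)"
  unfolding L2_norm_def by (rule real_sqrt_pow2) (simp add: integral_nonneg_AE)

lemma norm_l2_square: "(norm u)\<^sup>2 = (\<integral>y. (cmod (rep_l2 u y))\<^sup>2 \<partial>lborel)"
  unfolding norm_l2_rep by (rule L2_norm_square)

lemma L2_norm_cmod [simp]: "L2_norm (\<lambda>y. of_real (cmod (f y))) = L2_norm f"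
  by (simp add: L2_norm_def)

lemma L2_norm_mono:
  assumes "square_integrable g" "f \<in> borel_measurable borel" "\<And>y. cmod (f y) \<le> C * cmod (g y)" "0 \<le> C"
  shows "L2_norm f \<le> C * L2_norm g"
proof -
  have "(\<integral>y. (cmod (f y))\<^sup>2 \<partial>lborel) \<le> (\<integral>y. C\<^sup>2 * (cmod (g y))\<^sup>2 \<partial>lborel)"
  proof (rule integral_mono)
    show "integrable lborel (\<lambda>y. (cmod (f y))\<^sup>2)"
      using square_integrable_bound[OF assms(1-3)] by (simp add: square_integrable_def)
    show "integrable lborel (\<lambda>y. C\<^sup>2 * (cmod (g y))\<^sup>2)" using assms(1) by (simp add: square_integrable_def)
    show "(cmod (f y))\<^sup>2 \<le> C\<^sup>2 * (cmod (g y))\<^sup>2" for y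
      using power_mono[OF assms(3), of y 2] by (simp add: power_mult_distrib)
  qed
  then have "(L2_norm f)\<^sup>2 \<le> (C * L2_norm g)\<^sup>2"
    by (simp only: L2_norm_square power_mult_distrib integral_mult_right_zero)
  then show ?thesis by (rule power2_le_imp_le) (simp add: assms(4))
qed

lemma Cauchy_Schwarz_integral:
  assumes "square_integrable f" "square_integrable g"
  shows "(\<integral>y. cmod (f y) * cmod (g y) \<partial>lborel) \<le> L2_norm f * L2_norm g"
    and "cmod (\<integral>y. f y * g y \<partial>lborel) \<le> L2_norm f * L2_norm g"
proof -
  have "abs_l2 (\<lambda>y. of_real (cmod (f y))) \<bullet> abs_l2 (\<lambda>y. of_real (cmod (g y)))
      \<le> norm (abs_l2 (\<lambda>y. of_real (cmod (f y)))) * norm (abs_l2 (\<lambda>y. of_real (cmod (g y))))"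
    by (rule norm_cauchy_schwarz)
  then show 1: "(\<integral>y. cmod (f y) * cmod (g y) \<partial>lborel) \<le> L2_norm f * L2_norm g"
    using assms by (simp add: inner_abs_l2 norm_abs_l2 square_integrable_cmod of_real_mult[symmetric]
        del: of_real_mult)
  have "cmod (\<integral>y. f y * g y \<partial>lborel) \<le> (\<integral>y. cmod (f y * g y) \<partial>lborel)" by (rule integral_norm_bound)
  with 1 show "cmod (\<integral>y. f y * g y \<partial>lborel) \<le> L2_norm f * L2_norm g" by (simp add: norm_mult)
qed

text \<open>Riesz--Fischer: a rapidly convergent subsequence converges almost everywhere, and Fatou's
  lemma identifies the pointwise limit with the limit in norm.\<close>

lemma l2_Cauchy_convergent:
  fixes X :: "nat \<Rightarrow> l2"
  assumes "Cauchy X"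
  shows "convergent X"
proof -
  have "\<exists>N. \<forall>m\<ge>N. \<forall>n\<ge>N. norm (X m - X n) < (1/2) ^ k" for k
    using CauchyD[OF assms, of "(1/2) ^ k"] by simp
  then obtain N where N: "\<And>k m n. N k \<le> m \<Longrightarrow> N k \<le> n \<Longrightarrow> norm (X m - X n) < (1/2) ^ k" by metis
  \<comment> \<open>Partial sums make the index monotone while still dominating
    \<open>N\<close>.\<close>
  define r where "r k = (\<Sum>j\<le>k. N j)" for k
  have rN: "N k \<le> r k" for k unfolding r_def by (rule member_le_sum) auto
  have rmono: "r k \<le> r m" if "k \<le> m" for k m unfolding r_def using that by (intro sum_mono2) auto
  have Xr: "norm (X m - X (r k)) \<le> (1/2) ^ k" if "r k \<le> m" for k m
    using N[of k m "r k"] rN[of k] that by simp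
  \<comment> \<open>The squared norms of these increments are at most \<open>(1/4)^k\<close>, so
    they remain summable after multiplication by \<open>2^k\<close>. This surplus gives absolute
    convergence almost everywhere.\<close>
  define d where "d k = rep_l2 (X (r (Suc k)) - X (r k))" for k
  define S where "S n y = rep_l2 (X (r 0)) y + (\<Sum>k<n. d k y)" for n y
  have sqd: "square_integrable (d k)" for k by (simp add: d_def)
  have [measurable]: "d k \<in> borel_measurable borel" for k by (simp add: d_def)
  have S: "square_integrable (S n) \<and> abs_l2 (S n) = X (r n)" for n
  proof (induction n)
    case (Suc n)
    have e: "S (Suc n) = (\<lambda>y. S n y + d n y)" by (simp add: S_def fun_eq_iff)
    have "abs_l2 (S n) + abs_l2 (d n) = abs_l2 (\<lambda>y. S n y + d n y)"
      using Suc sqd by (intro abs_l2_add) auto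
    then show ?case unfolding e using Suc sqd by (auto simp: d_def intro: square_integrable_add)
  qed (simp add: S_def)
  have [measurable]: "S n \<in> borel_measurable borel" for n using S square_integrable_borel by blast
  have nd: "(\<integral>\<^sup>+y. ennreal ((cmod (rep_l2 u y))\<^sup>2) \<partial>lborel) = ennreal ((norm u)\<^sup>2)" for u
    unfolding norm_l2_square
    by (rule nn_integral_eq_integral) (use square_integrable_rep[of u] in \<open>auto simp: square_integrable_def\<close>)
  have "(\<integral>\<^sup>+y. (\<Sum>k. ennreal (2 ^ k * (cmod (d k y))\<^sup>2)) \<partial>lborel)
      = (\<Sum>k. \<integral>\<^sup>+y. ennreal (2 ^ k * (cmod (d k y))\<^sup>2) \<partial>lborel)"
    by (rule nn_integral_suminf) measurable
  also have "\<dots> \<le> (\<Sum>k. ennreal ((1/2) ^ k))"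
  proof (intro suminf_le allI summableI)
    fix k
    have "(\<integral>\<^sup>+y. ennreal (2 ^ k * (cmod (d k y))\<^sup>2) \<partial>lborel)
        = ennreal (2 ^ k) * (\<integral>\<^sup>+y. ennreal ((cmod (d k y))\<^sup>2) \<partial>lborel)"
      by (subst nn_integral_cmult[symmetric]) (auto simp: ennreal_mult)
    also have "\<dots> = ennreal (2 ^ k * (norm (X (r (Suc k)) - X (r k)))\<^sup>2)"
      unfolding d_def nd by (simp add: ennreal_mult)
    also have "2 ^ k * (norm (X (r (Suc k)) - X (r k)))\<^sup>2 \<le> 2 ^ k * ((1/2) ^ k)\<^sup>2"
      using Xr[OF rmono, of k "Suc k"] by (intro mult_left_mono power_mono) auto
    also have "\<dots> = (1/2 :: real) ^ k"
      by (simp add: power2_eq_square power_one_over)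
    finally show "(\<integral>\<^sup>+y. ennreal (2 ^ k * (cmod (d k y))\<^sup>2) \<partial>lborel) \<le> ennreal ((1/2) ^ k)"
      by (simp add: ennreal_leI)
  qed
  also have "\<dots> = ennreal (\<Sum>k. (1/2 :: real) ^ k)"
    by (intro suminf_ennreal_eq) (auto intro!: summable_sums summable_geometric)
  finally have "(\<integral>\<^sup>+y. (\<Sum>k. ennreal (2 ^ k * (cmod (d k y))\<^sup>2)) \<partial>lborel) \<noteq> \<infinity>"
    by (auto simp: top_unique)
  then have "AE y in lborel. (\<Sum>k. ennreal (2 ^ k * (cmod (d k y))\<^sup>2)) \<noteq> \<infinity>"
    by (intro nn_integral_PInf_AE) auto
  then have conv: "AE y in lborel. convergent (\<lambda>n. S n y)"
  proof eventually_elim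
    case (elim y)
    then have s: "summable (\<lambda>k. 2 ^ k * (cmod (d k y))\<^sup>2)"
      by (intro summable_suminf_not_top) auto
    have "summable (\<lambda>k. cmod (d k y))"
    proof (rule summable_comparison_test'[of "\<lambda>k. 2 ^ k * (cmod (d k y))\<^sup>2 + (1/2) ^ k" 0])
      show "summable (\<lambda>k. 2 ^ k * (cmod (d k y))\<^sup>2 + (1/2) ^ k)"
        by (intro summable_add s summable_geometric) simp
      fix k :: nat
      \<comment> \<open>Expanding the square bounds \<open>2 cmod (d k y)\<close> by the weighted
        square plus \<open>(1/2)^k\<close>.\<close>
      have "0 \<le> (2 ^ k * cmod (d k y) - 1)\<^sup>2 / 2 ^ k" by simp
      also have "\<dots> = 2 ^ k * (cmod (d k y))\<^sup>2 - 2 * cmod (d k y) + (1/2) ^ k"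
        by (simp add: power2_eq_square field_simps power_one_over)
      finally show "norm (cmod (d k y)) \<le> 2 ^ k * (cmod (d k y))\<^sup>2 + (1/2) ^ k"
        using norm_ge_zero[of "d k y"] unfolding real_norm_def abs_norm_cancel by linarith
    qed
    then have "summable (\<lambda>k. d k y)" by (rule summable_norm_cancel)
    then have "(\<lambda>n. \<Sum>k<n. d k y) \<longlonglongrightarrow> (\<Sum>k. d k y)" by (rule summable_LIMSEQ)
    then have "(\<lambda>n. S n y) \<longlonglongrightarrow> rep_l2 (X (r 0)) y + (\<Sum>k. d k y)"
      unfolding S_def by (intro tendsto_add tendsto_const)
    then show ?case by (rule convergentI)
  qed
  define f where "f y = lim (\<lambda>n. S n y)" for y
  have [measurable]: "f \<in> borel_measurable borel" unfolding f_def by measurable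
  have fat: "(\<integral>\<^sup>+y. ennreal ((cmod (f y - S n y))\<^sup>2) \<partial>lborel) \<le> ennreal (((1/2) ^ n)\<^sup>2)" for n
  proof -
    have "(\<integral>\<^sup>+y. ennreal ((cmod (f y - S n y))\<^sup>2) \<partial>lborel)
        = (\<integral>\<^sup>+y. liminf (\<lambda>m. ennreal ((cmod (S m y - S n y))\<^sup>2)) \<partial>lborel)"
    proof (rule nn_integral_cong_AE, use conv in eventually_elim)
      case (elim y)
      then have "(\<lambda>m. S m y) \<longlonglongrightarrow> f y" by (simp add: f_def convergent_LIMSEQ_iff)
      then have "(\<lambda>m. ennreal ((cmod (S m y - S n y))\<^sup>2)) \<longlonglongrightarrow> ennreal ((cmod (f y - S n y))\<^sup>2)"
        by (intro tendsto_intros)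
      then show ?case by (rule lim_imp_Liminf[OF sequentially_bot, symmetric])
    qed
    also have "\<dots> \<le> liminf (\<lambda>m. \<integral>\<^sup>+y. ennreal ((cmod (S m y - S n y))\<^sup>2) \<partial>lborel)"
      by (rule nn_integral_liminf) measurable
    also have "\<dots> \<le> ennreal (((1/2) ^ n)\<^sup>2)"
    proof (rule order_trans[OF Liminf_le_Limsup Limsup_bounded])
      show "\<forall>\<^sub>F m in sequentially. (\<integral>\<^sup>+y. ennreal ((cmod (S m y - S n y))\<^sup>2) \<partial>lborel) \<le> ennreal (((1/2) ^ n)\<^sup>2)"
      proof (rule eventually_sequentiallyI[of n])
        fix m assume "n \<le> m"
        have "(\<integral>\<^sup>+y. ennreal ((cmod (S m y - S n y))\<^sup>2) \<partial>lborel)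
            = (\<integral>\<^sup>+y. ennreal ((cmod (rep_l2 (X (r m) - X (r n)) y))\<^sup>2) \<partial>lborel)"
        proof (rule nn_integral_cong_AE)
          have e: "abs_l2 (\<lambda>y. S m y - S n y) = X (r m) - X (r n)" using S by (simp flip: abs_l2_diff)
          have "AE y in lborel. rep_l2 (abs_l2 (\<lambda>y. S m y - S n y)) y = S m y - S n y"
            using S by (intro rep_abs_l2 square_integrable_diff) auto
          then show "AE y in lborel. ennreal ((cmod (S m y - S n y))\<^sup>2)
              = ennreal ((cmod (rep_l2 (X (r m) - X (r n)) y))\<^sup>2)"
            unfolding e by eventually_elim simp
        qed
        also have "\<dots> = ennreal ((norm (X (r m) - X (r n)))\<^sup>2)" by (rule nd)
        also have "\<dots> \<le> ennreal (((1/2) ^ n)\<^sup>2)"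
          using Xr[OF rmono, OF \<open>n \<le> m\<close>] by (intro ennreal_leI power_mono) auto
        finally show "(\<integral>\<^sup>+y. ennreal ((cmod (S m y - S n y))\<^sup>2) \<partial>lborel) \<le> ennreal (((1/2) ^ n)\<^sup>2)" .
      qed
    qed simp
    finally show ?thesis .
  qed
  have fS: "square_integrable (\<lambda>y. f y - S n y)" for n
    unfolding square_integrable_def using fat[of n]
    by (auto intro!: integrableI_bounded simp: top_unique intro: le_less_trans)
  have bn: "norm (abs_l2 (\<lambda>y. f y - S n y)) \<le> (1/2) ^ n" for n
  proof -
    have "ennreal ((L2_norm (\<lambda>y. f y - S n y))\<^sup>2) = (\<integral>\<^sup>+y. ennreal ((cmod (f y - S n y))\<^sup>2) \<partial>lborel)"
      unfolding L2_norm_square using fS[of n]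
      by (intro nn_integral_eq_integral[symmetric]) (auto simp: square_integrable_def)
    then have "ennreal ((L2_norm (\<lambda>y. f y - S n y))\<^sup>2) \<le> ennreal (((1/2) ^ n)\<^sup>2)"
      using fat[of n] by (simp only:)
    then have "(L2_norm (\<lambda>y. f y - S n y))\<^sup>2 \<le> ((1/2) ^ n)\<^sup>2"
      by (subst (asm) ennreal_le_iff) simp_all
    then have "L2_norm (\<lambda>y. f y - S n y) \<le> (1/2) ^ n" by (rule power2_le_imp_le) simp
    then show ?thesis using norm_abs_l2[OF fS[of n]] by simp
  qed
  have sqf: "square_integrable f"
    using square_integrable_add[OF fS[of 0], of "S 0"] S by simp
  have "norm (X m - abs_l2 f) \<le> 2 * (1/2) ^ n" if "r n \<le> m" for m n
  proof -
    have "abs_l2 (\<lambda>y. f y - S n y) = abs_l2 f - X (r n)" using S sqf by (simp flip: abs_l2_diff)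
    then have "norm (X m - abs_l2 f) = norm ((X m - X (r n)) - abs_l2 (\<lambda>y. f y - S n y))" by simp
    then show ?thesis using norm_triangle_ineq4[of "X m - X (r n)" "abs_l2 (\<lambda>y. f y - S n y)"]
        Xr[OF that] bn[of n] by linarith
  qed
  note est = this
  have "X \<longlonglongrightarrow> abs_l2 f"
  proof (rule LIMSEQ_I)
    fix e :: real assume "0 < e"
    obtain n where n: "(1/2 :: real) ^ n < e / 2" using real_arch_pow_inv[of "e / 2" "1/2"] \<open>0 < e\<close> by auto
    have "norm (X m - abs_l2 f) < e" if "r n \<le> m" for m
      using est[OF that] n by linarith
    then show "\<exists>no. \<forall>m\<ge>no. norm (X m - abs_l2 f) < e" by blast
  qed
  then show ?thesis by (rule convergentI)
qed

instance l2 :: banach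
  by standard (rule l2_Cauchy_convergent)

subsection \<open>Pairings and multiplication operators\<close>

text \<open>Bilinear, without conjugation, to match the integrals in the definition of a
  solution.\<close>

definition l2_pair :: "l2 \<Rightarrow> (real \<Rightarrow> complex) \<Rightarrow> complex" where
  "l2_pair u \<phi> = (\<integral>y. rep_l2 u y * \<phi> y \<partial>lborel)"

lemma l2_pair_integrable: "square_integrable \<phi> \<Longrightarrow> integrable lborel (\<lambda>y. rep_l2 u y * \<phi> y)"
  by (rule square_integrable_mult_integrable) simp_all

lemma l2_pair_eq_inner:
  assumes "square_integrable \<phi>"
  shows "l2_pair u \<phi> = Complex (u \<bullet> abs_l2 (\<lambda>y. cnj (\<phi> y))) (u \<bullet> abs_l2 (\<lambda>y. \<i> * cnj (\<phi> y)))"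
proof -
  have 1: "u \<bullet> abs_l2 (\<lambda>y. cnj (\<phi> y)) = Re (\<integral>y. rep_l2 u y * \<phi> y \<partial>lborel)"
    using inner_abs_l2[OF square_integrable_rep[of u] square_integrable_cnj[OF assms]] by simp
  have "u \<bullet> abs_l2 (\<lambda>y. \<i> * cnj (\<phi> y)) = Re (\<integral>y. rep_l2 u y * cnj (\<i> * cnj (\<phi> y)) \<partial>lborel)"
    using inner_abs_l2[OF square_integrable_rep[of u] square_integrable_cmult[OF square_integrable_cnj[OF assms]]]
    by simp
  also have "(\<lambda>y. rep_l2 u y * cnj (\<i> * cnj (\<phi> y))) = (\<lambda>y. - \<i> * (rep_l2 u y * \<phi> y))"
    by (simp add: fun_eq_iff)
  also have "Re (\<integral>y. - \<i> * (rep_l2 u y * \<phi> y) \<partial>lborel) = Im (\<integral>y. rep_l2 u y * \<phi> y \<partial>lborel)"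
    by (simp only: integral_mult_right_zero) simp
  finally show ?thesis unfolding l2_pair_def 1 by (simp add: complex_eq_iff)
qed

lemma l2_pair_abs:
  assumes "square_integrable f" "square_integrable \<phi>"
  shows "l2_pair (abs_l2 f) \<phi> = (\<integral>y. f y * \<phi> y \<partial>lborel)"
  unfolding l2_pair_def
proof (rule integral_cong_AE)
  note [measurable] = square_integrable_borel[OF assms(1)] square_integrable_borel[OF assms(2)]
  show "(\<lambda>y. rep_l2 (abs_l2 f) y * \<phi> y) \<in> borel_measurable lborel" "(\<lambda>y. f y * \<phi> y) \<in> borel_measurable lborel"
    by measurable
  show "AE y in lborel. rep_l2 (abs_l2 f) y * \<phi> y = f y * \<phi> y"
    using rep_abs_l2[OF assms(1)] by eventually_elim simp
qed

lemma l2_pair_add: "square_integrable \<phi> \<Longrightarrow> l2_pair (u + v) \<phi> = l2_pair u \<phi> + l2_pair v \<phi>"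
  by (simp add: l2_pair_eq_inner inner_add_left complex_eq_iff)

lemma l2_pair_diff: "square_integrable \<phi> \<Longrightarrow> l2_pair (u - v) \<phi> = l2_pair u \<phi> - l2_pair v \<phi>"
  by (simp add: l2_pair_eq_inner inner_diff_left complex_eq_iff)

lemma l2_pair_bound: "square_integrable \<phi> \<Longrightarrow> cmod (l2_pair u \<phi>) \<le> norm u * L2_norm \<phi>"
  unfolding l2_pair_def norm_l2_rep by (rule Cauchy_Schwarz_integral(2)) simp_all

lemma bounded_linear_l2_pair:
  assumes "square_integrable \<phi>"
  shows "bounded_linear (\<lambda>u. l2_pair u \<phi>)"
proof (rule bounded_linear_intro)
  show "l2_pair (u + v) \<phi> = l2_pair u \<phi> + l2_pair v \<phi>" for u v by (rule l2_pair_add[OF assms])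
  show "l2_pair (r *\<^sub>R u) \<phi> = r *\<^sub>R l2_pair u \<phi>" for r u
    by (simp add: l2_pair_eq_inner[OF assms] complex_eq_iff)
  show "norm (l2_pair u \<phi>) \<le> norm u * L2_norm \<phi>" for u by (rule l2_pair_bound[OF assms])
qed

definition l2_mult :: "(real \<Rightarrow> complex) \<Rightarrow> l2 \<Rightarrow> l2" where
  "l2_mult m u = abs_l2 (\<lambda>y. m y * rep_l2 u y)"

lemma square_integrable_mult_bounded:
  assumes "square_integrable f" "m \<in> borel_measurable borel" "\<And>y. cmod (m y) \<le> C"
  shows "square_integrable (\<lambda>y. m y * f y)"
proof (rule square_integrable_bound[OF assms(1)])
  note [measurable] = square_integrable_borel[OF assms(1)] assms(2)
  show "(\<lambda>y. m y * f y) \<in> borel_measurable borel" by measurable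
  show "cmod (m y * f y) \<le> C * cmod (f y)" for y
    unfolding norm_mult by (rule mult_right_mono[OF assms(3)]) simp
qed

lemma l2_mult_abs:
  assumes "m \<in> borel_measurable borel" "\<And>y. cmod (m y) \<le> C" "square_integrable f"
  shows "l2_mult m (abs_l2 f) = abs_l2 (\<lambda>y. m y * f y)"
proof -
  have "AE y in lborel. m y * rep_l2 (abs_l2 f) y = m y * f y"
    using rep_abs_l2[OF assms(3)] by eventually_elim simp
  then show ?thesis unfolding l2_mult_def
    by (subst abs_l2_eq_iff) (simp_all add: square_integrable_mult_bounded[OF _ assms(1,2)] assms(3))
qed

lemma bounded_linear_l2_mult:
  assumes m: "m \<in> borel_measurable borel" "\<And>y. cmod (m y) \<le> C"
  shows "bounded_linear (l2_mult m)" "norm (l2_mult m u) \<le> C * norm u"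
proof -
  have C: "0 \<le> C" using m(2)[of 0] norm_ge_zero order_trans by blast
  note sq = square_integrable_mult_bounded[OF square_integrable_rep m]
  have add: "l2_mult m (u + v) = l2_mult m u + l2_mult m v" for u v
  proof -
    have "u + v = abs_l2 (\<lambda>y. rep_l2 u y + rep_l2 v y)"
      using abs_l2_add[OF square_integrable_rep[of u] square_integrable_rep[of v]] by simp
    then have "l2_mult m (u + v) = abs_l2 (\<lambda>y. m y * (rep_l2 u y + rep_l2 v y))"
      by (simp add: l2_mult_abs[OF m] square_integrable_add)
    then show ?thesis unfolding l2_mult_def
      by (subst abs_l2_add) (simp_all add: sq distrib_left)
  qed
  have scale: "l2_mult m (r *\<^sub>R u) = r *\<^sub>R l2_mult m u" for r u
  proof -
    have "r *\<^sub>R u = abs_l2 (\<lambda>y. r *\<^sub>R rep_l2 u y)"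
      using abs_l2_scaleR[OF square_integrable_rep[of u], of r] by simp
    then have "l2_mult m (r *\<^sub>R u) = abs_l2 (\<lambda>y. m y * (r *\<^sub>R rep_l2 u y))"
      by (simp add: l2_mult_abs[OF m] square_integrable_scaleR del: scaleR_conv_of_real)
    then show ?thesis unfolding l2_mult_def
      by (subst abs_l2_scaleR) (simp_all add: sq)
  qed
  show bd: "norm (l2_mult m u) \<le> C * norm u" for u
    unfolding l2_mult_def norm_abs_l2[OF sq] norm_l2_rep[of u]
  proof (rule L2_norm_mono[OF square_integrable_rep square_integrable_borel[OF sq] _ C])
    show "cmod (m y * rep_l2 u y) \<le> C * cmod (rep_l2 u y)" for y
      unfolding norm_mult by (rule mult_right_mono[OF m(2)]) simp
  qed
  show "bounded_linear (l2_mult m)"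
    by (rule bounded_linear_intro[where K=C]) (use add scale bd in \<open>simp_all add: mult.commute\<close>)
qed

lemma inner_l2_mult:
  assumes m: "m \<in> borel_measurable borel" "\<And>y. cmod (m y) \<le> C"
  shows "l2_mult m u \<bullet> v = u \<bullet> l2_mult (\<lambda>y. cnj (m y)) v"
proof -
  have m': "(\<lambda>y. cnj (m y)) \<in> borel_measurable borel" "\<And>y. cmod (cnj (m y)) \<le> C"
    using m by (simp_all add: borel_measurable_cnj)
  note sq = square_integrable_mult_bounded[OF square_integrable_rep]
  have "l2_mult m u \<bullet> abs_l2 (rep_l2 v) = Re (\<integral>y. m y * rep_l2 u y * cnj (rep_l2 v y) \<partial>lborel)"
    unfolding l2_mult_def by (rule inner_abs_l2[OF sq[OF m] square_integrable_rep])
  also have "\<dots> = Re (\<integral>y. rep_l2 u y * cnj (cnj (m y) * rep_l2 v y) \<partial>lborel)" by (simp add: mult_ac)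
  also have "\<dots> = abs_l2 (rep_l2 u) \<bullet> l2_mult (\<lambda>y. cnj (m y)) v"
    unfolding l2_mult_def by (rule inner_abs_l2[OF square_integrable_rep sq[OF m'], symmetric])
  finally show ?thesis by simp
qed

text \<open>This is why the transport term, multiplication by \<open>- \<i> k b\<close>, does not
  contribute to the energy, however large the truncation of \<open>b\<close>.\<close>

lemma inner_l2_mult_imaginary:
  assumes "(\<lambda>y. \<i> * of_real (m y)) \<in> borel_measurable borel" "\<And>y. \<bar>m y\<bar> \<le> C"
  shows "l2_mult (\<lambda>y. \<i> * of_real (m y)) u \<bullet> u = 0"
proof -
  have b: "cmod (\<i> * of_real (m y)) \<le> C" for y using assms(2) by (simp add: norm_mult)
  have "l2_mult (\<lambda>y. \<i> * of_real (m y)) u \<bullet> abs_l2 (rep_l2 u)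
      = Re (\<integral>y. \<i> * of_real (m y) * rep_l2 u y * cnj (rep_l2 u y) \<partial>lborel)"
    unfolding l2_mult_def
    by (rule inner_abs_l2[OF square_integrable_mult_bounded[OF square_integrable_rep assms(1) b] square_integrable_rep])
  also have "(\<lambda>y. \<i> * of_real (m y) * rep_l2 u y * cnj (rep_l2 u y))
      = (\<lambda>y. \<i> * of_real (m y * (cmod (rep_l2 u y))\<^sup>2))"
    by (simp add: fun_eq_iff mult.assoc complex_norm_square[symmetric])
  also have "Re (\<integral>y. \<i> * of_real (m y * (cmod (rep_l2 u y))\<^sup>2) \<partial>lborel) = 0"
    by (simp only: integral_mult_right_zero integral_complex_of_real) simp
  finally show ?thesis by simp
qed

abbreviation l2_cmult :: "complex \<Rightarrow> l2 \<Rightarrow> l2" where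
  "l2_cmult z \<equiv> l2_mult (\<lambda>_. z)"

lemma l2_cmult_abs: "square_integrable f \<Longrightarrow> l2_cmult z (abs_l2 f) = abs_l2 (\<lambda>y. z * f y)"
  by (rule l2_mult_abs[of _ "cmod z"]) simp_all

lemma norm_l2_cmult: "norm (l2_cmult z u) = cmod z * norm u"
proof (cases "z = 0")
  case True
  then show ?thesis by (simp add: l2_mult_def abs_l2_0)
next
  case False
  have b: "norm (l2_cmult z u) \<le> cmod z * norm u" for z u
    by (rule bounded_linear_l2_mult(2)) simp_all
  have "l2_cmult (inverse z) (l2_cmult z u) = abs_l2 (\<lambda>y. inverse z * (z * rep_l2 u y))"
    unfolding l2_mult_def[of "\<lambda>_. z"] by (rule l2_cmult_abs) (simp add: square_integrable_cmult)
  also have "\<dots> = u" using False by (simp add: mult.assoc[symmetric])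
  finally have "norm u \<le> cmod (inverse z) * norm (l2_cmult z u)" using b[of "inverse z" "l2_cmult z u"] by simp
  then have "cmod z * norm u \<le> cmod z * (cmod (inverse z) * norm (l2_cmult z u))"
    by (rule mult_left_mono) simp
  also have "\<dots> = norm (l2_cmult z u)"
    using False by (simp add: norm_inverse mult.assoc[symmetric])
  finally have "cmod z * norm u \<le> norm (l2_cmult z u)" .
  with b[of z u] show ?thesis by simp
qed

lemma l2_pair_cmult: "square_integrable \<phi> \<Longrightarrow> l2_pair (l2_cmult z u) \<phi> = z * l2_pair u \<phi>"
  unfolding l2_mult_def
  by (subst l2_pair_abs) (simp_all add: square_integrable_cmult l2_pair_def mult.assoc)

subsection \<open>Density of continuous functions\<close>

definition compactly_supported :: "(real \<Rightarrow> complex) \<Rightarrow> bool" where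
  "compactly_supported \<phi> \<longleftrightarrow> (\<exists>r. \<forall>y. r < \<bar>y\<bar> \<longrightarrow> \<phi> y = 0)"

lemma square_integrable_indicator:
  "square_integrable (\<lambda>y. of_real (indicator {a..b} y))"
proof -
  have "(\<lambda>y. (cmod (of_real (indicator {a..b} y)))\<^sup>2) = (indicator {a..b} :: real \<Rightarrow> real)"
    by (simp add: fun_eq_iff indicator_def)
  then show ?thesis unfolding square_integrable_def
    by (simp add: emeasure_lborel_Icc_eq ennreal_less_top)
qed

lemma square_integrable_compact_support:
  assumes "f \<in> borel_measurable borel" "\<And>y. cmod (f y) \<le> C" "\<And>y. r < \<bar>y\<bar> \<Longrightarrow> f y = 0"
  shows "square_integrable f"
proof (rule square_integrable_bound[OF square_integrable_indicator[of "-r" r] assms(1)])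
  show "cmod (f y) \<le> C * cmod (complex_of_real (indicator {-r..r} y))" for y
    using assms(2)[of y] assms(3)[of y] by (cases "r < \<bar>y\<bar>") (auto simp: indicator_def)
qed

lemma continuous_compact_support_bounded:
  fixes f :: "real \<Rightarrow> 'a::real_normed_vector"
  assumes "continuous_on UNIV f" "\<And>y. r < \<bar>y\<bar> \<Longrightarrow> f y = 0"
  obtains C where "0 < C" "\<And>y. norm (f y) \<le> C"
proof -
  have "compact (f ` {-r..r})"
    by (intro compact_continuous_image continuous_on_subset[OF assms(1)]) auto
  then obtain C where C: "\<And>y. y \<in> {-r..r} \<Longrightarrow> norm (f y) \<le> C"
    using compact_imp_bounded bounded_iff by (metis imageI)
  have "norm (f y) \<le> max C 1" for y
  proof (cases "r < \<bar>y\<bar>")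
    case False
    then have "y \<in> {-r..r}" by (simp add: not_less abs_le_iff minus_le_iff)
    then show ?thesis using C by (simp add: le_max_iff_disj)
  qed (simp add: assms(2))
  then show ?thesis by (intro that[of "max C 1"]) auto
qed

lemma square_integrable_continuous_compact_support:
  assumes "continuous_on UNIV f" "compactly_supported f"
  shows "square_integrable f"
proof -
  obtain r where r: "\<And>y. r < \<bar>y\<bar> \<Longrightarrow> f y = 0" using assms(2) by (auto simp: compactly_supported_def)
  obtain C where "\<And>y. cmod (f y) \<le> C" using continuous_compact_support_bounded[OF assms(1) r] by metis
  then show ?thesis
    by (intro square_integrable_compact_support[of f C r] borel_measurable_continuous_onI[OF assms(1)] r)
qed

text \<open>An element \<open>f\<close> orthogonal to all these functions is an almost everywhere
  limit of continuous \<open>g n\<close>, which come with no bound and no decay. The bounded map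
  \<open>q\<close> and the tent \<open>\<theta>\<close> turn them into admissible, dominated
  functions, and in the limit orthogonality says that the integral of
  \<open>\<theta> |f|^2 / (1 + |f|)\<close> vanishes.\<close>

lemma l2_continuous_dense:
  "closure {abs_l2 \<phi> |\<phi>. continuous_on UNIV \<phi> \<and> compactly_supported \<phi>} = UNIV" (is "closure ?D = _")
proof (rule dense_subspace_if_orthogonal_trivial)
  note sq = square_integrable_continuous_compact_support
  show "subspace ?D"
  proof (rule subspaceI)
    show "0 \<in> ?D" unfolding abs_l2_0[symmetric] compactly_supported_def
      by (intro CollectI exI[of _ "\<lambda>_. 0"]) simp
  next
    fix x y assume "x \<in> ?D" "y \<in> ?D"
    then obtain f g where f: "x = abs_l2 f" "continuous_on UNIV f" "compactly_supported f"
      and g: "y = abs_l2 g" "continuous_on UNIV g" "compactly_supported g" by blast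
    obtain r s where rs: "\<forall>y. r < \<bar>y\<bar> \<longrightarrow> f y = 0" "\<forall>y. s < \<bar>y\<bar> \<longrightarrow> g y = 0"
      using f g unfolding compactly_supported_def by blast
    have "compactly_supported (\<lambda>y. f y + g y)"
      unfolding compactly_supported_def by (rule exI[of _ "max r s"]) (use rs in simp)
    moreover have "continuous_on UNIV (\<lambda>y. f y + g y)" using f g by (intro continuous_on_add)
    moreover have "x + y = abs_l2 (\<lambda>y. f y + g y)" unfolding f g using f g by (intro abs_l2_add sq)
    ultimately show "x + y \<in> ?D" by blast
  next
    fix x and c :: real assume "x \<in> ?D"
    then obtain f where f: "x = abs_l2 f" "continuous_on UNIV f" "compactly_supported f" by blast
    then have "compactly_supported (\<lambda>y. c *\<^sub>R f y)" by (auto simp: compactly_supported_def)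
    moreover have "continuous_on UNIV (\<lambda>y. c *\<^sub>R f y)" using f by (intro continuous_intros)
    moreover have "c *\<^sub>R x = abs_l2 (\<lambda>y. c *\<^sub>R f y)" unfolding f using f by (intro abs_l2_scaleR sq)
    ultimately show "c *\<^sub>R x \<in> ?D" by blast
  qed
next
  fix u :: l2 assume orth: "\<And>d. d \<in> ?D \<Longrightarrow> u \<bullet> d = 0"
  define f where "f = rep_l2 u"
  have sqf: "square_integrable f" by (simp add: f_def)
  note [measurable] = square_integrable_borel[OF sqf]
  have "f measurable_on UNIV"
    by (rule lebesgue_measurable_imp_measurable_on) (simp_all add: measurable_completion)
  then obtain N g where N: "negligible N" and g': "\<forall>n. continuous_on UNIV (g n)"
    "\<forall>x. x \<notin> N \<longrightarrow> (\<lambda>n. g n x) \<longlonglongrightarrow> f x"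
    unfolding measurable_on_def if_P[OF UNIV_I] by (elim exE conjE)
  have g: "continuous_on UNIV (g n)" "x \<notin> N \<Longrightarrow> (\<lambda>n. g n x) \<longlonglongrightarrow> f x" for n x
    using g' by simp_all
  have aeN: "AE x in lebesgue. x \<notin> N" using N by (simp add: negligible_iff_null_sets AE_not_in)
  have gN: "AE x in lborel. (\<lambda>n. g n x) \<longlonglongrightarrow> f x"
  proof -
    have "AE x in lebesgue. (\<lambda>n. g n x) \<longlonglongrightarrow> f x" using aeN by eventually_elim (rule g(2))
    then show ?thesis by (simp add: AE_completion_iff)
  qed
  have zero: "AE x in lborel. \<bar>x\<bar> < R \<longrightarrow> f x = 0" if R: "0 < R" for R
  proof -
    define \<theta> where "\<theta> x = max 0 (R - \<bar>x\<bar>)" for x :: real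
    define q where "q z = z / of_real (1 + cmod z)" for z :: complex
    have pos: "1 + cmod z \<noteq> 0" for z using norm_ge_zero[of z] by linarith
    have pos': "0 < 1 + cmod z" for z using norm_ge_zero[of z] by linarith
    have q: "cmod (q z) \<le> 1" for z
    proof -
      have "cmod (complex_of_real (1 + cmod z)) = 1 + cmod z"
        unfolding norm_of_real using pos'[of z] by linarith
      then show ?thesis unfolding q_def norm_divide using pos'[of z] by (simp only: divide_le_eq_1_pos)
    qed
    have qc: "continuous_on UNIV q" unfolding q_def
      by (intro continuous_intros ballI) (simp only: of_real_eq_0_iff pos not_False_eq_True)
    have [measurable]: "q \<in> borel_measurable borel" by (rule borel_measurable_continuous_onI[OF qc])
    have \<theta>c: "continuous_on UNIV \<theta>" unfolding \<theta>_def by (intro continuous_intros)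
    have [measurable]: "\<theta> \<in> borel_measurable borel" by (rule borel_measurable_continuous_onI[OF \<theta>c])
    have \<theta>: "0 \<le> \<theta> x" "\<theta> x \<le> R * indicator {-R..R} x" for x
      using R by (auto simp: \<theta>_def indicator_def)
    define \<phi> where "\<phi> n x = of_real (\<theta> x) * q (g n x)" for n x
    have \<phi>c: "continuous_on UNIV (\<phi> n)" for n
      unfolding \<phi>_def by (intro continuous_intros \<theta>c continuous_on_compose2[OF qc g(1)]) auto
    have \<phi>s: "compactly_supported (\<phi> n)" for n
      unfolding compactly_supported_def \<phi>_def by (rule exI[of _ R]) (simp add: \<theta>_def)
    have [measurable]: "\<phi> n \<in> borel_measurable borel" for n by (rule borel_measurable_continuous_onI[OF \<phi>c])
    have int0: "Re (\<integral>x. f x * cnj (\<phi> n x) \<partial>lborel) = 0" for n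
    proof -
      have "u \<bullet> abs_l2 (\<phi> n) = 0" using \<phi>c \<phi>s by (intro orth) blast
      moreover have "u = abs_l2 f" by (simp add: f_def)
      ultimately show ?thesis
        using inner_abs_l2[OF sqf square_integrable_continuous_compact_support[OF \<phi>c \<phi>s]] by simp
    qed
    have dom: "integrable lborel (\<lambda>x. R * (cmod (f x) * indicator {-R..R} x))"
    proof -
      have "integrable lborel (\<lambda>x. of_real (cmod (f x)) * complex_of_real (indicator {-R..R} x))"
        by (intro square_integrable_mult_integrable square_integrable_cmod sqf square_integrable_indicator)
      then have "integrable lborel (\<lambda>x. complex_of_real (cmod (f x) * indicator {-R..R} x))"
        by (simp only: of_real_mult)
      then have "integrable lborel (\<lambda>x. cmod (f x) * indicator {-R..R} x)"
        by (simp only: complex_of_real_integrable_eq)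
      then show ?thesis by (rule integrable_mult_right)
    qed
    have lim: "(\<lambda>n. \<integral>x. f x * cnj (\<phi> n x) \<partial>lborel) \<longlonglongrightarrow> (\<integral>x. f x * cnj (of_real (\<theta> x) * q (f x)) \<partial>lborel)"
    proof (rule integral_dominated_convergence[OF _ _ dom])
      show "AE x in lborel. (\<lambda>n. f x * cnj (\<phi> n x)) \<longlonglongrightarrow> f x * cnj (of_real (\<theta> x) * q (f x))"
        using gN
      proof eventually_elim
        case (elim x)
        have "(\<lambda>n. q (g n x)) \<longlonglongrightarrow> q (f x)"
          using continuous_on_tendsto_compose[OF qc elim] by simp
        then show ?case unfolding \<phi>_def by (intro tendsto_intros)
      qed
      show "AE x in lborel. norm (f x * cnj (\<phi> n x)) \<le> R * (cmod (f x) * indicator {-R..R} x)" for n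
      proof (rule AE_I2)
        fix x
        have "\<theta> x * cmod (q (g n x)) \<le> (R * indicator {-R..R} x) * 1"
          using \<theta> q R by (intro mult_mono) auto
        then have "cmod (f x) * (\<theta> x * cmod (q (g n x))) \<le> cmod (f x) * (R * indicator {-R..R} x)"
          by (intro mult_left_mono) auto
        then show "norm (f x * cnj (\<phi> n x)) \<le> R * (cmod (f x) * indicator {-R..R} x)"
          using \<theta>(1)[of x] by (simp add: \<phi>_def norm_mult mult_ac)
      qed
    qed measurable
    define h where "h x = \<theta> x * ((cmod (f x))\<^sup>2 / (1 + cmod (f x)))" for x
    have h: "f x * cnj (of_real (\<theta> x) * q (f x)) = of_real (h x)" for x
      unfolding q_def h_def complex_cnj_mult complex_cnj_divide complex_cnj_complex_of_real of_real_mult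
        of_real_divide complex_norm_square
      by (simp only: times_divide_eq_right times_divide_eq_left mult_ac)
    have h0: "0 \<le> h x" for x unfolding h_def
      by (intro mult_nonneg_nonneg divide_nonneg_nonneg \<theta>(1) zero_le_power2 less_imp_le[OF pos'])
    have hint: "integrable lborel h"
    proof (rule Bochner_Integration.integrable_bound[OF dom])
      show "h \<in> borel_measurable lborel" unfolding h_def by measurable
      have "norm (f x * cnj (of_real (\<theta> x) * q (f x))) \<le> R * (cmod (f x) * indicator {-R..R} x)" for x
      proof -
        have "\<theta> x * cmod (q (f x)) \<le> (R * indicator {-R..R} x) * 1"
          using \<theta> q R by (intro mult_mono) auto
        then have "cmod (f x) * (\<theta> x * cmod (q (f x))) \<le> cmod (f x) * (R * indicator {-R..R} x)"
          by (intro mult_left_mono) auto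
        then show ?thesis using \<theta>(1)[of x] by (simp add: norm_mult mult_ac)
      qed
      then have hb: "\<bar>h x\<bar> \<le> R * (cmod (f x) * indicator {-R..R} x)" for x unfolding h norm_of_real .
      show "AE x in lborel. norm (h x) \<le> norm (R * (cmod (f x) * indicator {-R..R} x))"
        unfolding real_norm_def by (intro AE_I2 order_trans[OF hb abs_ge_self])
    qed
    have "(\<lambda>n. Re (\<integral>x. f x * cnj (\<phi> n x) \<partial>lborel)) \<longlonglongrightarrow> Re (\<integral>x. of_real (h x) \<partial>lborel)"
      using tendsto_Re[OF lim] unfolding h .
    then have "Re (\<integral>x. of_real (h x) \<partial>lborel) = 0" unfolding int0 by (simp only: LIMSEQ_const_iff)
    then have "(\<integral>x. h x \<partial>lborel) = 0" by (simp only: integral_complex_of_real Re_complex_of_real)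
    then have "AE x in lborel. h x = 0"
      using integral_nonneg_eq_0_iff_AE[OF hint AE_I2[OF h0]] by (simp only:)
    then show ?thesis
    proof eventually_elim
      case (elim x)
      then show ?case using pos[of "f x"] by (auto simp: h_def \<theta>_def)
    qed
  qed
  have "AE x in lborel. \<forall>n::nat. \<bar>x\<bar> < real (Suc n) \<longrightarrow> f x = 0"
    unfolding AE_all_countable by (intro allI zero) simp
  then have "AE x in lborel. f x = 0"
  proof eventually_elim
    case (elim x)
    obtain n where "\<bar>x\<bar> < real n" using reals_Archimedean2 by blast
    then have "\<bar>x\<bar> < real (Suc n)" by simp
    then show ?case using elim by blast
  qed
  then have "abs_l2 f = abs_l2 (\<lambda>_. 0)" using sqf by (subst abs_l2_eq_iff) simp_all
  then show "u = 0" by (simp add: f_def abs_l2_0)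
qed

subsection \<open>Convolution\<close>

definition convol :: "(real \<Rightarrow> real) \<Rightarrow> (real \<Rightarrow> complex) \<Rightarrow> real \<Rightarrow> complex" where
  "convol J f x = (\<integral>y. of_real (J (x - y)) * f y \<partial>lborel)"

text \<open>Integrability is what Young's inequality uses. Boundedness makes the kernel square
  integrable as well, so that each single value of a convolution is a pairing in
  \<open>L^2\<close>.\<close>

definition bounded_kernel :: "(real \<Rightarrow> real) \<Rightarrow> bool" where
  "bounded_kernel J \<longleftrightarrow> integrable lborel J \<and> (\<exists>B. \<forall>z. \<bar>J z\<bar> \<le> B)"

lemma bounded_kernel_square_integrable:
  assumes "bounded_kernel J"
  shows "square_integrable (\<lambda>y. of_real (J y))"
proof -
  obtain B where B: "\<And>z. \<bar>J z\<bar> \<le> B" and J: "integrable lborel J"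
    using assms by (auto simp: bounded_kernel_def)
  have "integrable lborel (\<lambda>y. (J y)\<^sup>2)"
  proof (rule Bochner_Integration.integrable_bound)
    show "integrable lborel (\<lambda>y. B * J y)" using J by simp
    show "(\<lambda>y. (J y)\<^sup>2) \<in> borel_measurable lborel" using borel_measurable_integrable[OF J] by measurable
    have "\<bar>J y\<bar> * \<bar>J y\<bar> \<le> B * \<bar>J y\<bar>" for y by (rule mult_right_mono[OF B]) simp
    moreover have "0 \<le> B" using B[of 0] by linarith
    ultimately show "AE y in lborel. norm ((J y)\<^sup>2) \<le> norm (B * J y)"
      by (simp add: power2_eq_square abs_mult)
  qed
  then show ?thesis using borel_measurable_integrable[OF J] by (simp add: square_integrable_def)
qed

lemma bounded_kernel_reflect:
  assumes "bounded_kernel J"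
  shows "bounded_kernel (\<lambda>y. J (x - y))"
proof -
  have "integrable lborel (\<lambda>y. J (x + (- 1) * y))"
    using assms by (intro lborel_integrable_real_affine) (auto simp: bounded_kernel_def)
  then show ?thesis using assms by (auto simp: bounded_kernel_def)
qed

lemma square_integrable_kernel_reflect:
  "bounded_kernel J \<Longrightarrow> square_integrable (\<lambda>y. of_real (J (x - y)))"
  by (rule bounded_kernel_square_integrable[OF bounded_kernel_reflect])

lemma convol_measurable:
  assumes [measurable]: "J \<in> borel_measurable borel" "f \<in> borel_measurable borel"
  shows "convol J f \<in> borel_measurable borel"
proof -
  have "(\<lambda>x. \<integral>y. of_real (J (x - y)) * f y \<partial>lborel) \<in> borel_measurable lborel"
    by (rule lborel.borel_measurable_lebesgue_integral) measurable
  then show ?thesis by (simp add: convol_def[abs_def])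
qed

text \<open>Split \<open>|J| |f|\<close> as \<open>sqrt |J|\<close> times
  \<open>sqrt |J| |f|\<close>, apply Cauchy--Schwarz in \<open>y\<close>, and interchange the
  integrals.\<close>

lemma young_inequality:
  assumes J: "bounded_kernel J" and f: "square_integrable f"
  shows "square_integrable (convol J f)" "L2_norm (convol J f) \<le> (\<integral>z. \<bar>J z\<bar> \<partial>lborel) * L2_norm f"
proof -
  obtain B where B: "\<And>z. \<bar>J z\<bar> \<le> B" and Ji: "integrable lborel J"
    using J by (auto simp: bounded_kernel_def)
  have B0: "0 \<le> B" using B[of 0] by linarith
  have [measurable]: "J \<in> borel_measurable borel" using borel_measurable_integrable[OF Ji] by simp
  note [measurable] = square_integrable_borel[OF f] convol_measurable[of J f]
  define A where "A = (\<integral>z. \<bar>J z\<bar> \<partial>lborel)"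
  have A0: "0 \<le> A" unfolding A_def by (rule integral_nonneg_AE) simp
  have nA: "(\<integral>\<^sup>+z. ennreal \<bar>J z\<bar> \<partial>lborel) = ennreal A"
    unfolding A_def using Ji by (intro nn_integral_eq_integral) auto
  have nAx: "(\<integral>\<^sup>+x. ennreal \<bar>J (x - y)\<bar> \<partial>lborel) = ennreal A" for y
    using nn_integral_real_affine[of "\<lambda>z. ennreal \<bar>J z\<bar>" 1 "- y"] nA by simp
  have nAy: "(\<integral>\<^sup>+y. ennreal \<bar>J (x - y)\<bar> \<partial>lborel) = ennreal A" for x
    using nn_integral_real_affine[of "\<lambda>z. ennreal \<bar>J z\<bar>" "-1" x] nA by simp
  have pw: "ennreal ((cmod (convol J f x))\<^sup>2) \<le> ennreal A * (\<integral>\<^sup>+y. ennreal (\<bar>J (x - y)\<bar> * (cmod (f y))\<^sup>2) \<partial>lborel)" for x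
  proof -
    define a where "a y = complex_of_real (sqrt \<bar>J (x - y)\<bar>)" for y
    define c where "c y = complex_of_real (sqrt \<bar>J (x - y)\<bar> * cmod (f y))" for y
    have [measurable]: "a \<in> borel_measurable borel" "c \<in> borel_measurable borel"
      unfolding a_def c_def by measurable
    have iJ: "integrable lborel (\<lambda>y. \<bar>J (x - y)\<bar>)"
      using bounded_kernel_reflect[OF J, of x] by (simp add: bounded_kernel_def)
    have sa: "square_integrable a" unfolding square_integrable_def a_def using iJ by simp
    have sc: "square_integrable c"
    proof (rule square_integrable_bound[OF f, of _ "sqrt B"])
      show "cmod (c y) \<le> sqrt B * cmod (f y)" for y
        using mult_right_mono[OF real_sqrt_le_mono[OF B[of "x - y"]], of "cmod (f y)"]
        by (simp add: c_def norm_mult del: real_sqrt_le_iff)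
    qed measurable
    have na: "(L2_norm a)\<^sup>2 = A"
    proof -
      have "ennreal (\<integral>y. \<bar>J (x - y)\<bar> \<partial>lborel) = ennreal A"
        using nn_integral_eq_integral[OF iJ] nAy[of x] by simp
      then have "(\<integral>y. \<bar>J (x - y)\<bar> \<partial>lborel) = A"
        using A0 by (subst (asm) ennreal_inj) (simp_all add: integral_nonneg_AE)
      then show ?thesis by (simp add: L2_norm_square a_def)
    qed
    have nc: "ennreal ((L2_norm c)\<^sup>2) = (\<integral>\<^sup>+y. ennreal (\<bar>J (x - y)\<bar> * (cmod (f y))\<^sup>2) \<partial>lborel)"
    proof -
      have e: "(cmod (c y))\<^sup>2 = \<bar>J (x - y)\<bar> * (cmod (f y))\<^sup>2" for y
        by (simp add: c_def norm_mult power_mult_distrib)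
      have "integrable lborel (\<lambda>y. (cmod (c y))\<^sup>2)" using sc by (simp add: square_integrable_def)
      then show ?thesis unfolding L2_norm_square
        using nn_integral_eq_integral[of lborel "\<lambda>y. (cmod (c y))\<^sup>2"] unfolding e by simp
    qed
    have "cmod (convol J f x) \<le> (\<integral>y. cmod (of_real (J (x - y)) * f y) \<partial>lborel)"
      unfolding convol_def by (rule integral_norm_bound)
    also have "(\<lambda>y. cmod (of_real (J (x - y)) * f y)) = (\<lambda>y. cmod (a y) * cmod (c y))"
      by (simp add: a_def c_def norm_mult fun_eq_iff mult.assoc[symmetric])
    also have "(\<integral>y. cmod (a y) * cmod (c y) \<partial>lborel) \<le> L2_norm a * L2_norm c"
      by (rule Cauchy_Schwarz_integral(1)[OF sa sc])
    finally have "(cmod (convol J f x))\<^sup>2 \<le> (L2_norm a * L2_norm c)\<^sup>2" by (rule power_mono) simp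
    then have "(cmod (convol J f x))\<^sup>2 \<le> A * (L2_norm c)\<^sup>2" unfolding power_mult_distrib na .
    then have "ennreal ((cmod (convol J f x))\<^sup>2) \<le> ennreal (A * (L2_norm c)\<^sup>2)" by (rule ennreal_leI)
    also have "\<dots> = ennreal A * ennreal ((L2_norm c)\<^sup>2)" by (rule ennreal_mult[OF A0]) simp
    finally show ?thesis unfolding nc .
  qed
  have nf: "(\<integral>\<^sup>+y. ennreal ((cmod (f y))\<^sup>2) \<partial>lborel) = ennreal ((L2_norm f)\<^sup>2)"
    unfolding L2_norm_square using f by (intro nn_integral_eq_integral) (auto simp: square_integrable_def)
  have "(\<integral>\<^sup>+x. ennreal ((cmod (convol J f x))\<^sup>2) \<partial>lborel)
      \<le> (\<integral>\<^sup>+x. ennreal A * (\<integral>\<^sup>+y. ennreal (\<bar>J (x - y)\<bar> * (cmod (f y))\<^sup>2) \<partial>lborel) \<partial>lborel)"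
    by (rule nn_integral_mono) (rule pw)
  also have "\<dots> = ennreal A * (\<integral>\<^sup>+x. (\<integral>\<^sup>+y. ennreal (\<bar>J (x - y)\<bar> * (cmod (f y))\<^sup>2) \<partial>lborel) \<partial>lborel)"
    by (rule nn_integral_cmult) measurable
  also have "(\<integral>\<^sup>+x. (\<integral>\<^sup>+y. ennreal (\<bar>J (x - y)\<bar> * (cmod (f y))\<^sup>2) \<partial>lborel) \<partial>lborel)
      = (\<integral>\<^sup>+y. (\<integral>\<^sup>+x. ennreal (\<bar>J (x - y)\<bar> * (cmod (f y))\<^sup>2) \<partial>lborel) \<partial>lborel)"
    by (rule lborel_pair.Fubini') measurable
  also have "\<dots> = (\<integral>\<^sup>+y. ennreal A * ennreal ((cmod (f y))\<^sup>2) \<partial>lborel)"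
    by (rule nn_integral_cong) (simp add: ennreal_mult nn_integral_multc nAx)
  also have "\<dots> = ennreal A * ennreal ((L2_norm f)\<^sup>2)"
    unfolding nf[symmetric] by (rule nn_integral_cmult) measurable
  finally have main0: "(\<integral>\<^sup>+x. ennreal ((cmod (convol J f x))\<^sup>2) \<partial>lborel)
      \<le> ennreal A * (ennreal A * ennreal ((L2_norm f)\<^sup>2))" .
  have main: "(\<integral>\<^sup>+x. ennreal ((cmod (convol J f x))\<^sup>2) \<partial>lborel) \<le> ennreal ((A * L2_norm f)\<^sup>2)"
  proof -
    have "ennreal A * (ennreal A * ennreal ((L2_norm f)\<^sup>2)) = ennreal (A * (A * (L2_norm f)\<^sup>2))"
      using A0 by (simp only: ennreal_mult[of A] mult_nonneg_nonneg zero_le_power2)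
    also have "A * (A * (L2_norm f)\<^sup>2) = (A * L2_norm f)\<^sup>2" by (simp add: power2_eq_square)
    finally show ?thesis using main0 by (simp only:)
  qed
  show sq: "square_integrable (convol J f)"
    unfolding square_integrable_def
  proof
    show "convol J f \<in> borel_measurable lborel" by simp
    show "integrable lborel (\<lambda>x. (cmod (convol J f x))\<^sup>2)"
    proof (rule integrableI_bounded)
      show "(\<integral>\<^sup>+x. ennreal (norm ((cmod (convol J f x))\<^sup>2)) \<partial>lborel) < \<infinity>"
        using le_less_trans[OF main ennreal_less_top] by simp
    qed measurable
  qed
  have "ennreal ((L2_norm (convol J f))\<^sup>2) = (\<integral>\<^sup>+x. ennreal ((cmod (convol J f x))\<^sup>2) \<partial>lborel)"
    unfolding L2_norm_square using sq by (intro nn_integral_eq_integral[symmetric]) (auto simp: square_integrable_def)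
  then have "ennreal ((L2_norm (convol J f))\<^sup>2) \<le> ennreal ((A * L2_norm f)\<^sup>2)" using main by (simp only:)
  then have "(L2_norm (convol J f))\<^sup>2 \<le> (A * L2_norm f)\<^sup>2"
    by (subst (asm) ennreal_le_iff) simp_all
  then show "L2_norm (convol J f) \<le> A * L2_norm f"
    by (rule power2_le_imp_le) (simp add: A0)
qed

section \<open>Test functions and mollifiers\<close>

text \<open>The recursion runs through the function instead of iterating \<open>deriv\<close> from
  outside, so closure under sums, products and affine substitution follows by induction from the
  derivative rules.\<close>

primrec smooth_upto :: "nat \<Rightarrow> (real \<Rightarrow> real) \<Rightarrow> bool" where
  "smooth_upto 0 f \<longleftrightarrow> f differentiable_on UNIV"
| "smooth_upto (Suc n) f \<longleftrightarrow> f differentiable_on UNIV \<and> smooth_upto n (deriv f)"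

lemma smooth_upto_iff: "smooth_upto n f \<longleftrightarrow> (\<forall>i\<in>{..n}. (deriv ^^ i) f differentiable_on UNIV)"
proof (induction n arbitrary: f)
  case (Suc n)
  have e: "(deriv ^^ Suc i) f = (deriv ^^ i) (deriv f)" for i by (simp add: funpow_swap1)
  have "(\<forall>i\<in>{..Suc n}. (deriv ^^ i) f differentiable_on UNIV) \<longleftrightarrow>
      f differentiable_on UNIV \<and> (\<forall>i\<in>{..n}. (deriv ^^ Suc i) f differentiable_on UNIV)"
    unfolding atMost_Suc_eq_insert_0 by simp
  then show ?case unfolding e using Suc by simp
qed simp

lemma smooth_upto_differentiable: "smooth_upto n f \<Longrightarrow> f differentiable_on UNIV"
  by (cases n) auto

lemma differentiable_on_UNIV_deriv:
  fixes f :: "real \<Rightarrow> real"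
  assumes "f differentiable_on UNIV"
  shows "(f has_real_derivative deriv f x) (at x)"
  using assms unfolding differentiable_on_def
  by (simp add: DERIV_deriv_iff_real_differentiable)

lemma smooth_upto_antimono: "smooth_upto (Suc n) f \<Longrightarrow> smooth_upto n f"
  unfolding smooth_upto_iff by simp

lemma differentiable_on_UNIV_I:
  fixes f :: "real \<Rightarrow> real"
  assumes "\<And>x. (f has_real_derivative f' x) (at x)"
  shows "f differentiable_on UNIV" "deriv f = f'"
  using assms by (auto simp: differentiable_on_def real_differentiable_def intro!: DERIV_imp_deriv)

lemma smooth_upto_add: "smooth_upto n f \<Longrightarrow> smooth_upto n g \<Longrightarrow> smooth_upto n (\<lambda>x. f x + g x)"
proof (induction n arbitrary: f g)
  case (Suc n)
  have "((\<lambda>x. f x + g x) has_real_derivative deriv f x + deriv g x) (at x)" for x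
    using Suc.prems by (intro DERIV_add differentiable_on_UNIV_deriv) auto
  note d = differentiable_on_UNIV_I[OF this]
  show ?case using d Suc by simp
qed (simp add: differentiable_on_add)

lemma smooth_upto_const: "smooth_upto n (\<lambda>_. c)"
proof (induction n arbitrary: c)
  case (Suc n)
  have "((\<lambda>_. c) has_real_derivative 0) (at x)" for x by simp
  note d = differentiable_on_UNIV_I[OF this]
  show ?case using d Suc by simp
qed simp

lemma smooth_upto_mult: "smooth_upto n f \<Longrightarrow> smooth_upto n g \<Longrightarrow> smooth_upto n (\<lambda>x. f x * g x)"
proof (induction n arbitrary: f g)
  case (Suc n)
  have "((\<lambda>x. f x * g x) has_real_derivative deriv f x * g x + deriv g x * f x) (at x)" for x
    using Suc.prems by (intro DERIV_mult differentiable_on_UNIV_deriv) auto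
  note d = differentiable_on_UNIV_I[OF this]
  have "smooth_upto n (\<lambda>x. deriv f x * g x + deriv g x * f x)"
    using Suc.prems smooth_upto_antimono by (intro smooth_upto_add Suc.IH) auto
  then show ?case using d by simp
qed (simp add: differentiable_on_mult)

lemma smooth_upto_affine: "smooth_upto n f \<Longrightarrow> smooth_upto n (\<lambda>x. f (a * x + c))"
proof (induction n arbitrary: f)
  case 0
  have "((\<lambda>x. f (a * x + c)) has_real_derivative deriv f (a * x + c) * a) (at x)" for x
    using 0 by (intro DERIV_chain2[of f] differentiable_on_UNIV_deriv) (auto intro!: derivative_eq_intros)
  from differentiable_on_UNIV_I(1)[OF this] show ?case by simp
next
  case (Suc n)
  have "((\<lambda>x. f (a * x + c)) has_real_derivative deriv f (a * x + c) * a) (at x)" for x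
    using Suc.prems by (intro DERIV_chain2[of f] differentiable_on_UNIV_deriv) (auto intro!: derivative_eq_intros)
  note d = differentiable_on_UNIV_I[OF this]
  have "smooth_upto n (\<lambda>x. deriv f (a * x + c) * a)"
    using Suc by (intro smooth_upto_mult smooth_upto_const Suc.IH) auto
  then show ?case using d by simp
qed

lemma test_function_iff:
  "test_function \<phi> \<longleftrightarrow> (\<forall>n. smooth_upto n \<phi>) \<and> (\<exists>r. \<forall>y. r < \<bar>y\<bar> \<longrightarrow> \<phi> y = 0)"
  unfolding test_function_def smooth_upto_iff by blast

lemma test_function_has_derivative: "test_function \<phi> \<Longrightarrow> (\<phi> has_real_derivative deriv \<phi> x) (at x)"
  unfolding test_function_iff using smooth_upto_differentiable[of 0] by (blast intro: differentiable_on_UNIV_deriv)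

lemma test_function_continuous: "test_function \<phi> \<Longrightarrow> continuous_on S \<phi>"
  by (meson DERIV_isCont continuous_at_imp_continuous_on test_function_has_derivative)

lemma test_function_deriv:
  assumes "test_function \<phi>"
  shows "test_function (deriv \<phi>)"
proof -
  obtain r where r: "\<And>y. r < \<bar>y\<bar> \<Longrightarrow> \<phi> y = 0" using assms by (auto simp: test_function_iff)
  have "deriv \<phi> y = 0" if "r < \<bar>y\<bar>" for y
  proof -
    have "open {y :: real. r < \<bar>y\<bar>}" by (intro open_Collect_less continuous_intros)
    moreover have "((\<lambda>_. 0) has_real_derivative 0) (at y)" by simp
    ultimately have "(\<phi> has_real_derivative 0) (at y)"
      using that r by (rule_tac has_field_derivative_transform_within_open[of "\<lambda>_. 0" _ _ "{y. r < \<bar>y\<bar>}"]) auto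
    then show ?thesis by (rule DERIV_imp_deriv)
  qed
  moreover have "smooth_upto n (deriv \<phi>)" for n
    using assms smooth_upto.simps(2)[of n \<phi>] unfolding test_function_iff by blast
  ultimately show ?thesis unfolding test_function_iff by blast
qed

lemma test_function_add: "test_function \<phi> \<Longrightarrow> test_function \<eta> \<Longrightarrow> test_function (\<lambda>y. \<phi> y + \<eta> y)"
proof -
  assume a: "test_function \<phi>" "test_function \<eta>"
  obtain r s where r: "\<And>y. r < \<bar>y\<bar> \<Longrightarrow> \<phi> y = 0" "\<And>y. s < \<bar>y\<bar> \<Longrightarrow> \<eta> y = 0"
    using a by (auto simp: test_function_iff)
  have "\<forall>y. max r s < \<bar>y\<bar> \<longrightarrow> \<phi> y + \<eta> y = 0" using r by simp
  then show ?thesis using a smooth_upto_add unfolding test_function_iff by blast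
qed

lemma test_function_cmult: "test_function \<phi> \<Longrightarrow> test_function (\<lambda>y. c * \<phi> y)"
  unfolding test_function_iff by (auto intro!: smooth_upto_mult smooth_upto_const)

lemma test_function_affine:
  assumes "test_function \<phi>" "a \<noteq> 0"
  shows "test_function (\<lambda>y. \<phi> (a * y + c))"
proof -
  obtain r where r: "\<And>y. r < \<bar>y\<bar> \<Longrightarrow> \<phi> y = 0" using assms by (auto simp: test_function_iff)
  have "\<phi> (a * y + c) = 0" if "(\<bar>r\<bar> + \<bar>c\<bar>) / \<bar>a\<bar> < \<bar>y\<bar>" for y
  proof (rule r)
    have "\<bar>r\<bar> + \<bar>c\<bar> < \<bar>a\<bar> * \<bar>y\<bar>" using that assms(2) by (simp add: divide_less_eq mult.commute)
    then have "\<bar>r\<bar> + \<bar>c\<bar> < \<bar>a * y\<bar>" by (simp add: abs_mult)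
    then show "r < \<bar>a * y + c\<bar>" by linarith
  qed
  then show ?thesis using assms smooth_upto_affine unfolding test_function_iff by blast
qed

lemma test_function_reflect: "test_function \<phi> \<Longrightarrow> test_function (\<lambda>y. \<phi> (x - y))"
  using test_function_affine[of \<phi> "-1" x] by simp

lemma deriv_reflect:
  assumes "test_function \<phi>"
  shows "deriv (\<lambda>y. \<phi> (x - y)) = (\<lambda>y. - deriv \<phi> (x - y))"
    and "deriv (deriv (\<lambda>y. \<phi> (x - y))) = (\<lambda>y. deriv (deriv \<phi>) (x - y))"
proof -
  have d: "((\<lambda>y. \<phi> (x - y)) has_real_derivative - deriv \<phi> (x - y)) (at y)" if "test_function \<phi>" for y \<phi>
  proof -
    have "((\<lambda>y. x - y) has_real_derivative -1) (at y)" by (auto intro!: derivative_eq_intros)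
    from DERIV_chain2[OF test_function_has_derivative[OF that] this] show ?thesis by simp
  qed
  show 1: "deriv (\<lambda>y. \<phi> (x - y)) = (\<lambda>y. - deriv \<phi> (x - y))"
    using differentiable_on_UNIV_I(2)[OF d[OF assms]] .
  have "((\<lambda>y. - deriv \<phi> (x - y)) has_real_derivative - (- deriv (deriv \<phi>) (x - y))) (at y)" for y
    by (rule DERIV_minus[OF d[OF test_function_deriv[OF assms]]])
  then show "deriv (deriv (\<lambda>y. \<phi> (x - y))) = (\<lambda>y. deriv (deriv \<phi>) (x - y))"
    unfolding 1 by (intro differentiable_on_UNIV_I(2)) simp
qed

lemma test_function_bounded:
  assumes "test_function \<phi>"
  obtains B where "0 < B" "\<And>y. \<bar>\<phi> y\<bar> \<le> B"
proof -
  obtain r where r: "\<And>y. r < \<bar>y\<bar> \<Longrightarrow> \<phi> y = 0" using assms by (auto simp: test_function_iff)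
  show ?thesis
    by (rule continuous_compact_support_bounded[OF test_function_continuous[OF assms] r]) (use that in auto)
qed

lemma test_function_borel: "test_function \<phi> \<Longrightarrow> \<phi> \<in> borel_measurable borel"
  by (rule borel_measurable_continuous_onI[OF test_function_continuous])

lemma test_function_square_integrable:
  assumes "test_function \<phi>"
  shows "square_integrable (\<lambda>y. of_real (\<phi> y))"
proof (rule square_integrable_continuous_compact_support)
  show "continuous_on UNIV (\<lambda>y. complex_of_real (\<phi> y))"
    by (intro continuous_on_of_real test_function_continuous[OF assms])
  show "compactly_supported (\<lambda>y. of_real (\<phi> y))"
    using assms by (auto simp: compactly_supported_def test_function_iff)
qed

lemma integrable_bounded_support:
  fixes f :: "real \<Rightarrow> real"
  assumes "f \<in> borel_measurable borel" "\<And>y. \<bar>f y\<bar> \<le> B" "\<And>y. r < \<bar>y\<bar> \<Longrightarrow> f y = 0"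
  shows "integrable lborel f"
proof (rule Bochner_Integration.integrable_bound)
  show "integrable lborel (\<lambda>y. B * indicator {-r..r} y)"
    by (simp add: emeasure_lborel_Icc_eq ennreal_less_top)
  have "\<bar>f y\<bar> \<le> B * indicator {-r..r} y" for y
    using assms(2)[of y] assms(3)[of y] by (cases "r < \<bar>y\<bar>") (auto simp: indicator_def)
  then show "AE y in lborel. norm (f y) \<le> norm (B * indicator {-r..r} y)"
    unfolding real_norm_def by (intro AE_I2 order_trans[OF _ abs_ge_self])
qed (use assms in simp)

lemma test_function_bounded_kernel:
  assumes "test_function \<phi>"
  shows "bounded_kernel \<phi>"
proof -
  obtain r where r: "\<And>y. r < \<bar>y\<bar> \<Longrightarrow> \<phi> y = 0" using assms by (auto simp: test_function_iff)
  obtain B where B: "\<And>y. \<bar>\<phi> y\<bar> \<le> B" using test_function_bounded[OF assms] by blast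
  show ?thesis unfolding bounded_kernel_def
    using integrable_bounded_support[OF test_function_borel[OF assms] B r] B by blast
qed

subsection \<open>A bump function\<close>

text \<open>For \<open>p = 1\<close> this is the classical flat function
  \<open>exp (- 1 / x)\<close>. The polynomial factor in \<open>1 / x\<close> makes the family
  closed under differentiation.\<close>

definition flat_fun :: "real poly \<Rightarrow> real \<Rightarrow> real" where
  "flat_fun p x = (if 0 < x then poly p (1 / x) * exp (- (1 / x)) else 0)"

lemma poly_times_exp_tendsto_0: "((\<lambda>t::real. t ^ n * poly p t * exp (- t)) \<longlongrightarrow> 0) at_top"
proof (induction p arbitrary: n)
  case (pCons a p)
  have "((\<lambda>t::real. a * (t ^ n / exp t) + t ^ Suc n * poly p t * exp (- t)) \<longlongrightarrow> a * 0 + 0) at_top"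
    by (intro tendsto_add tendsto_mult tendsto_const tendsto_power_div_exp_0 pCons.IH)
  moreover have "a * (t ^ n / exp t) + t ^ Suc n * poly p t * exp (- t) = t ^ n * poly (pCons a p) t * exp (- t)" for t
    by (simp add: exp_minus field_simps)
  ultimately show ?case by simp
qed simp

text \<open>The factor \<open>[:0, 0, 1:]\<close> is the \<open>1 / x^2\<close> of the chain rule.
  At 0 the right difference quotient is \<open>t p(t) exp (- t)\<close> with
  \<open>t = 1 / h\<close>, which tends to 0.\<close>

lemma flat_fun_has_derivative:
  "(flat_fun p has_real_derivative flat_fun ([:0, 0, 1:] * (p - pderiv p)) x) (at x)"
proof -
  consider "0 < x" | "x < 0" | "x = 0" by linarith
  then show ?thesis
  proof cases
    case 1
    have i: "((\<lambda>x. 1 / x) has_real_derivative - (1 / x\<^sup>2)) (at x)"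
      using 1 by (auto intro!: derivative_eq_intros simp: power2_eq_square)
    have p: "((\<lambda>x. poly p (1 / x)) has_real_derivative poly (pderiv p) (1 / x) * - (1 / x\<^sup>2)) (at x)"
      by (rule DERIV_chain2[OF poly_DERIV i])
    have e: "((\<lambda>x. exp (- (1 / x))) has_real_derivative exp (- (1 / x)) * - (- (1 / x\<^sup>2))) (at x)"
      by (rule DERIV_chain2[OF DERIV_exp DERIV_minus[OF i]])
    have "((\<lambda>x. poly p (1 / x) * exp (- (1 / x))) has_real_derivative flat_fun ([:0, 0, 1:] * (p - pderiv p)) x) (at x)"
      by (rule DERIV_cong[OF DERIV_mult[OF p e]]) (use 1 in \<open>simp add: flat_fun_def power2_eq_square field_simps\<close>)
    then show ?thesis
      by (rule has_field_derivative_transform_within_open[of _ _ _ "{0<..}"]) (use 1 in \<open>auto simp: flat_fun_def\<close>)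
  next
    case 2
    have "((\<lambda>_. 0) has_real_derivative 0) (at x)" by simp
    then have "(flat_fun p has_real_derivative 0) (at x)"
      by (rule has_field_derivative_transform_within_open[of _ _ _ "{..<0}"]) (use 2 in \<open>auto simp: flat_fun_def\<close>)
    then show ?thesis using 2 by (simp add: flat_fun_def)
  next
    case 3
    have r: "((\<lambda>h. flat_fun p h / h) \<longlongrightarrow> 0) (at_right 0)"
    proof -
      have "((\<lambda>h. (1 / h) ^ 1 * poly p (1 / h) * exp (- (1 / h))) \<longlongrightarrow> 0) (at_right 0)"
        using filterlim_compose[OF poly_times_exp_tendsto_0[of 1 p] filterlim_inverse_at_top_right]
        by (simp add: inverse_eq_divide)
      moreover have "\<forall>\<^sub>F h in at_right 0. (1 / h) ^ 1 * poly p (1 / h) * exp (- (1 / h)) = flat_fun p h / h"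
        unfolding eventually_at_right_field by (rule exI[of _ 1]) (simp add: flat_fun_def)
      ultimately show ?thesis by (rule Lim_transform_eventually)
    qed
    have l: "((\<lambda>h. flat_fun p h / h) \<longlongrightarrow> 0) (at_left 0)"
    proof (rule Lim_transform_eventually[OF tendsto_const])
      show "\<forall>\<^sub>F h in at_left 0. 0 = flat_fun p h / h"
        unfolding eventually_at_left_field by (rule exI[of _ "-1"]) (simp add: flat_fun_def)
    qed
    have "((\<lambda>h. (flat_fun p (0 + h) - flat_fun p 0) / h) \<longlongrightarrow> 0) (at 0)"
      using filterlim_split_at[OF l r] by (simp add: flat_fun_def[of p 0])
    then show ?thesis unfolding 3 DERIV_def by (simp add: flat_fun_def)
  qed
qed

lemma smooth_upto_flat_fun: "smooth_upto n (flat_fun p)"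
proof (induction n arbitrary: p)
  case 0
  show ?case using differentiable_on_UNIV_I(1)[OF flat_fun_has_derivative] by simp
next
  case (Suc n)
  show ?case using differentiable_on_UNIV_I[OF flat_fun_has_derivative] Suc by simp
qed

definition mollifier :: "real \<Rightarrow> (real \<Rightarrow> real) \<Rightarrow> bool" where
  "mollifier \<epsilon> \<rho> \<longleftrightarrow> test_function \<rho> \<and> (\<forall>z. 0 \<le> \<rho> z) \<and> (\<forall>z. \<epsilon> < \<bar>z\<bar> \<longrightarrow> \<rho> z = 0)
     \<and> (\<integral>z. \<rho> z \<partial>lborel) = 1"

lemma mollifier_exists:
  assumes "0 < \<epsilon>"
  obtains \<rho> where "mollifier \<epsilon> \<rho>"
proof -
  \<comment> \<open>One of the two factors vanishes outside the interval from
    \<open>- \<epsilon>\<close> to \<open>\<epsilon>\<close>, and both are positive in its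
    interior.\<close>
  define \<beta> where "\<beta> x = flat_fun 1 (1 * x + \<epsilon>) * flat_fun 1 ((- 1) * x + \<epsilon>)" for x
  have s: "smooth_upto n \<beta>" for n
    unfolding \<beta>_def[abs_def] by (intro smooth_upto_mult smooth_upto_affine smooth_upto_flat_fun)
  have z: "\<beta> x = 0" if "\<epsilon> < \<bar>x\<bar>" for x
    using that by (auto simp: \<beta>_def flat_fun_def abs_if split: if_splits)
  have t: "test_function \<beta>" unfolding test_function_iff using s z by blast
  have n: "0 \<le> \<beta> x" for x by (simp add: \<beta>_def flat_fun_def)
  have p: "0 < \<beta> x" if "x \<in> {-\<epsilon><..<\<epsilon>}" for x using that by (simp add: \<beta>_def flat_fun_def)
  have i: "integrable lborel \<beta>" using test_function_bounded_kernel[OF t] by (simp add: bounded_kernel_def)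
  have "(\<integral>x. \<beta> x \<partial>lborel) \<noteq> 0"
  proof
    assume "(\<integral>x. \<beta> x \<partial>lborel) = 0"
    then have "AE x in lborel. \<beta> x = 0" using integral_nonneg_eq_0_iff_AE[OF i AE_I2[OF n]] by (simp only:)
    then have "AE x in lborel. x \<notin> {-\<epsilon><..<\<epsilon>}" by eventually_elim (use p in force)
    then have "emeasure lborel {-\<epsilon><..<\<epsilon>} = 0"
      by (subst (asm) AE_iff_measurable[OF _ refl]) (simp_all add: greaterThanLessThan_def greaterThan_def lessThan_def Collect_conj_eq)
    then show False using assms by simp
  qed
  moreover have "0 \<le> (\<integral>x. \<beta> x \<partial>lborel)" by (rule integral_nonneg_AE) (use n in simp)
  ultimately have I: "0 < (\<integral>x. \<beta> x \<partial>lborel)" by simp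
  have "mollifier \<epsilon> (\<lambda>x. (1 / (\<integral>x. \<beta> x \<partial>lborel)) * \<beta> x)"
    unfolding mollifier_def
  proof (intro conjI allI impI)
    show "(\<integral>z. 1 / (\<integral>x. \<beta> x \<partial>lborel) * \<beta> z \<partial>lborel) = 1" using I by simp
    show "test_function (\<lambda>x. 1 / (\<integral>x. \<beta> x \<partial>lborel) * \<beta> x)" by (rule test_function_cmult[OF t])
  qed (use I z n in simp_all)
  then show ?thesis by (rule that)
qed

subsection \<open>Convergence of mollifications\<close>

definition l2_convol :: "(real \<Rightarrow> real) \<Rightarrow> l2 \<Rightarrow> l2" where
  "l2_convol J u = abs_l2 (convol J (rep_l2 u))"

lemma convol_cong_AE:
  assumes "J \<in> borel_measurable borel" "square_integrable f" "square_integrable g" "AE y in lborel. f y = g y"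
  shows "convol J f = convol J g"
proof
  fix x
  note [measurable] = assms(1) square_integrable_borel[OF assms(2)] square_integrable_borel[OF assms(3)]
  show "convol J f x = convol J g x" unfolding convol_def
  proof (rule integral_cong_AE)
    show "AE y in lborel. of_real (J (x - y)) * f y = of_real (J (x - y)) * g y"
      using assms(4) by eventually_elim simp
  qed measurable
qed

lemma bounded_kernel_borel: "bounded_kernel J \<Longrightarrow> J \<in> borel_measurable borel"
  using borel_measurable_integrable[of lborel J] by (simp add: bounded_kernel_def)

lemma l2_convol_abs:
  assumes "bounded_kernel J" "square_integrable f"
  shows "l2_convol J (abs_l2 f) = abs_l2 (convol J f)"
  unfolding l2_convol_def
  by (subst convol_cong_AE[OF bounded_kernel_borel[OF assms(1)] square_integrable_rep assms(2) rep_abs_l2[OF assms(2)]])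
    (rule refl)

lemma convol_pair: "convol J (rep_l2 u) x = l2_pair u (\<lambda>y. of_real (J (x - y)))"
  by (simp add: convol_def l2_pair_def mult.commute)

lemma l2_convol_diff:
  assumes "bounded_kernel J"
  shows "l2_convol J (u - v) = l2_convol J u - l2_convol J v"
proof -
  have "convol J (rep_l2 (u - v)) = (\<lambda>x. convol J (rep_l2 u) x - convol J (rep_l2 v) x)"
    unfolding convol_pair by (simp add: l2_pair_diff[OF square_integrable_kernel_reflect[OF assms]])
  then show ?thesis unfolding l2_convol_def
    by (simp add: abs_l2_diff young_inequality(1)[OF assms])
qed

lemma norm_l2_convol:
  assumes "bounded_kernel J"
  shows "norm (l2_convol J u) \<le> (\<integral>z. \<bar>J z\<bar> \<partial>lborel) * norm u"
  unfolding l2_convol_def norm_abs_l2[OF young_inequality(1)[OF assms square_integrable_rep]] norm_l2_rep[of u]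
  by (rule young_inequality(2)[OF assms square_integrable_rep])

lemma mollifierD:
  assumes "mollifier \<epsilon> \<rho>"
  shows "test_function \<rho>" "0 \<le> \<rho> z" "\<epsilon> < \<bar>z\<bar> \<Longrightarrow> \<rho> z = 0" "(\<integral>z. \<rho> z \<partial>lborel) = 1"
    "(\<integral>z. \<bar>\<rho> z\<bar> \<partial>lborel) = 1" "bounded_kernel \<rho>" "(\<integral>y. \<rho> (x - y) \<partial>lborel) = 1"
    "integrable lborel (\<lambda>y. \<rho> (x - y))"
proof -
  show 1: "test_function \<rho>" "0 \<le> \<rho> z" "\<epsilon> < \<bar>z\<bar> \<Longrightarrow> \<rho> z = 0" "(\<integral>z. \<rho> z \<partial>lborel) = 1" for z
    using assms by (simp_all add: mollifier_def)
  show "(\<integral>z. \<bar>\<rho> z\<bar> \<partial>lborel) = 1" using 1 by (simp only: abs_of_nonneg)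
  show 2: "bounded_kernel \<rho>" by (rule test_function_bounded_kernel[OF 1(1)])
  show "(\<integral>y. \<rho> (x - y) \<partial>lborel) = 1"
    using lborel_integral_real_affine[of "-1" \<rho> x] 1(4) by simp
  show "integrable lborel (\<lambda>y. \<rho> (x - y))"
    using bounded_kernel_reflect[OF 2, of x] by (simp add: bounded_kernel_def)
qed

lemma mollifier_uniform:
  assumes g: "continuous_on UNIV g" "\<And>y. r < \<bar>y\<bar> \<Longrightarrow> g y = 0" and "0 < \<delta>"
  obtains d where "0 < d" "d \<le> 1"
    "\<And>\<epsilon> \<rho> x. mollifier \<epsilon> \<rho> \<Longrightarrow> \<epsilon> < d \<Longrightarrow> cmod (convol \<rho> g x - g x) \<le> \<delta> * indicator {- (r + 1)..r + 1} x"
proof -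
  have "uniformly_continuous_on {- (r + 2)..r + 2} g"
    by (intro compact_uniformly_continuous continuous_on_subset[OF g(1)]) auto
  then obtain d0 where d0: "0 < d0" "\<And>x y. x \<in> {- (r + 2)..r + 2} \<Longrightarrow> y \<in> {- (r + 2)..r + 2} \<Longrightarrow>
      dist y x < d0 \<Longrightarrow> dist (g y) (g x) < \<delta>"
    unfolding uniformly_continuous_on_def using \<open>0 < \<delta>\<close> by metis
  \<comment> \<open>The bound 1 keeps the supports of all these mollifications inside one interval,
    so a uniform estimate gives an \<open>L^2\<close> estimate.\<close>
  define d where "d = min d0 1"
  show ?thesis
  proof (rule that[of d])
    show "0 < d" "d \<le> 1" using d0 by (auto simp: d_def)
    fix \<epsilon> \<rho> x assume m: "mollifier \<epsilon> \<rho>" and \<epsilon>: "\<epsilon> < d"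
    note M = mollifierD[OF m]
    have sqg: "square_integrable g"
      by (rule square_integrable_continuous_compact_support[OF g(1)])
        (use g(2) in \<open>auto simp: compactly_supported_def\<close>)
    have i1: "integrable lborel (\<lambda>y. of_real (\<rho> (x - y)) * g y)"
      by (rule square_integrable_mult_integrable[OF square_integrable_kernel_reflect[OF M(6)] sqg])
    have i2: "integrable lborel (\<lambda>y. of_real (\<rho> (x - y)) * g x)"
      using M(8) by (intro integrable_mult_left integrable_of_real)
    have "(\<integral>y. of_real (\<rho> (x - y)) * g x \<partial>lborel) = g x"
      using M(7) by simp
    then have e: "convol \<rho> g x - g x = (\<integral>y. of_real (\<rho> (x - y)) * (g y - g x) \<partial>lborel)"
      unfolding convol_def using Bochner_Integration.integral_diff[OF i1 i2] by (simp add: right_diff_distrib)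
    have pt: "cmod (of_real (\<rho> (x - y)) * (g y - g x)) \<le> \<rho> (x - y) * (\<delta> * indicator {- (r + 1)..r + 1} x)" for y
    proof (cases "\<epsilon> < \<bar>x - y\<bar>")
      case True
      then show ?thesis using M(3) by simp
    next
      case False
      then have xy: "\<bar>x - y\<bar> < d0" "\<bar>x - y\<bar> < 1" using \<epsilon> by (auto simp: d_def)
      have "cmod (g y - g x) \<le> \<delta> * indicator {- (r + 1)..r + 1} x"
      proof (cases "x \<in> {- (r + 1)..r + 1}")
        case True
        then have "x \<in> {- (r + 2)..r + 2}" "y \<in> {- (r + 2)..r + 2}" using xy by (auto simp: abs_less_iff)
        then have "dist (g y) (g x) < \<delta>" by (rule d0(2)) (use xy in \<open>simp add: dist_real_def abs_minus_commute\<close>)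
        then show ?thesis using True by (simp add: dist_norm)
      next
        case False
        then have "r + 1 < \<bar>x\<bar>" by (auto simp: abs_if)
        then have "r < \<bar>x\<bar>" "r < \<bar>y\<bar>" using xy by linarith+
        then show ?thesis using False g(2) by simp
      qed
      then show ?thesis using M(2)[of "x - y"] by (simp add: norm_mult mult_left_mono)
    qed
    have "cmod (convol \<rho> g x - g x) \<le> (\<integral>y. cmod (of_real (\<rho> (x - y)) * (g y - g x)) \<partial>lborel)"
      unfolding e by (rule integral_norm_bound)
    also have "\<dots> \<le> (\<integral>y. \<rho> (x - y) * (\<delta> * indicator {- (r + 1)..r + 1} x) \<partial>lborel)"
    proof (rule integral_mono[OF _ _ pt])
      show "integrable lborel (\<lambda>y. cmod (of_real (\<rho> (x - y)) * (g y - g x)))"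
        using Bochner_Integration.integrable_diff[OF i1 i2] by (intro integrable_norm) (simp add: right_diff_distrib)
      show "integrable lborel (\<lambda>y. \<rho> (x - y) * (\<delta> * indicator {- (r + 1)..r + 1} x))"
        by (rule integrable_mult_left[OF M(8)])
    qed
    also have "\<dots> = \<delta> * indicator {- (r + 1)..r + 1} x" using M(7) by simp
    finally show "cmod (convol \<rho> g x - g x) \<le> \<delta> * indicator {- (r + 1)..r + 1} x" .
  qed
qed

text \<open>Convolution with a mollifier is a contraction on \<open>l2\<close>, since its kernel has
  mass 1. It therefore suffices to have convergence on the dense class of continuous compactly
  supported functions, where it is uniform.\<close>

lemma l2_mollify_tendsto:
  assumes m: "\<And>n. mollifier (e n) (\<rho> n)" and e: "e \<longlonglongrightarrow> 0"
  shows "(\<lambda>n. l2_convol (\<rho> n) u) \<longlonglongrightarrow> u"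
proof (rule LIMSEQ_I)
  fix \<epsilon> :: real assume \<epsilon>: "0 < \<epsilon>"
  have "u \<in> closure {abs_l2 \<phi> |\<phi>. continuous_on UNIV \<phi> \<and> compactly_supported \<phi>}"
    unfolding l2_continuous_dense by simp
  then obtain g where g: "continuous_on UNIV g" "compactly_supported g" and gu: "dist (abs_l2 g) u < \<epsilon> / 3"
    unfolding closure_approachable using \<epsilon> by (elim allE[of _ "\<epsilon> / 3"]) auto
  obtain r where r: "\<And>y. r < \<bar>y\<bar> \<Longrightarrow> g y = 0" using g(2) by (auto simp: compactly_supported_def)
  have sqg: "square_integrable g" by (rule square_integrable_continuous_compact_support[OF g])
  define I where "I y = complex_of_real (indicator {- (r + 1)..r + 1} y)" for y
  have sqI: "square_integrable I" unfolding I_def by (rule square_integrable_indicator)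
  \<comment> \<open>The \<open>+ 1\<close> keeps the denominator of \<open>\<delta>\<close>
    positive, and the 6 there leaves room for a strict inequality.\<close>
  define L where "L = L2_norm I + 1"
  have L: "0 < L" "L2_norm I \<le> L" using L2_norm_nonneg[of I] unfolding L_def by linarith+
  define \<delta> where "\<delta> = \<epsilon> / (6 * L)"
  have \<delta>: "0 < \<delta>" using \<epsilon> L by (simp add: \<delta>_def)
  obtain d where d: "0 < d"
    "\<And>\<epsilon> \<rho> x. mollifier \<epsilon> \<rho> \<Longrightarrow> \<epsilon> < d \<Longrightarrow> cmod (convol \<rho> g x - g x) \<le> \<delta> * indicator {- (r + 1)..r + 1} x"
    using mollifier_uniform[OF g(1) r \<delta>] by metis
  obtain N where N: "\<And>n. N \<le> n \<Longrightarrow> e n < d"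
    using order_tendstoD(2)[OF e d(1)] unfolding eventually_sequentially by blast
  have "norm (l2_convol (\<rho> n) u - u) < \<epsilon>" if n: "N \<le> n" for n
  proof -
    note M = mollifierD[OF m[of n]]
    have sqc: "square_integrable (convol (\<rho> n) g)" by (rule young_inequality(1)[OF M(6) sqg])
    have "norm (l2_convol (\<rho> n) (abs_l2 g) - abs_l2 g) = L2_norm (\<lambda>x. convol (\<rho> n) g x - g x)"
      unfolding l2_convol_abs[OF M(6) sqg] abs_l2_diff[OF sqc sqg]
      by (rule norm_abs_l2[OF square_integrable_diff[OF sqc sqg]])
    also have "\<dots> \<le> \<delta> * L2_norm I"
    proof (rule L2_norm_mono[OF sqI square_integrable_borel[OF square_integrable_diff[OF sqc sqg]]])
      show "cmod (convol (\<rho> n) g x - g x) \<le> \<delta> * cmod (I x)" for x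
        using d(2)[OF m N[OF n], of x] by (simp add: I_def)
    qed (use \<delta> in simp)
    also have "\<dots> < \<epsilon> / 3"
    proof -
      have "\<delta> * L2_norm I \<le> \<delta> * L" using \<delta> L by (intro mult_left_mono) auto
      also have "\<dots> = \<epsilon> / 6" using L(1) by (simp add: \<delta>_def)
      finally show ?thesis using \<epsilon> by linarith
    qed
    finally have 1: "norm (l2_convol (\<rho> n) (abs_l2 g) - abs_l2 g) < \<epsilon> / 3" .
    have 2: "norm (l2_convol (\<rho> n) (u - abs_l2 g)) < \<epsilon> / 3"
      using norm_l2_convol[OF M(6), of "u - abs_l2 g"] gu unfolding M(5) dist_norm
      by (simp add: norm_minus_commute)
    have 3: "norm (abs_l2 g - u) < \<epsilon> / 3" using gu by (simp add: dist_norm)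
    have "l2_convol (\<rho> n) u - u = l2_convol (\<rho> n) (u - abs_l2 g)
        + ((l2_convol (\<rho> n) (abs_l2 g) - abs_l2 g) + (abs_l2 g - u))"
      unfolding l2_convol_diff[OF M(6)] by simp
    then have "norm (l2_convol (\<rho> n) u - u) \<le> norm (l2_convol (\<rho> n) (u - abs_l2 g))
        + (norm (l2_convol (\<rho> n) (abs_l2 g) - abs_l2 g) + norm (abs_l2 g - u))"
      by (metis norm_triangle_ineq norm_triangle_le add_left_mono)
    then show ?thesis using 1 2 3 by linarith
  qed
  then show "\<exists>no. \<forall>n\<ge>no. norm (l2_convol (\<rho> n) u - u) < \<epsilon>" by blast
qed

lemma mollifier_sequence:
  obtains \<rho> where "\<And>n. mollifier (1 / real (Suc n)) (\<rho> n)" "\<And>u. (\<lambda>n. l2_convol (\<rho> n) u) \<longlonglongrightarrow> u"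
proof -
  have "\<exists>\<rho>. mollifier (1 / real (Suc n)) \<rho>" for n by (rule mollifier_exists[of "1 / real (Suc n)"]) auto
  then obtain \<rho> where \<rho>: "\<And>n. mollifier (1 / real (Suc n)) (\<rho> n)" by metis
  have "(\<lambda>n. 1 / real (Suc n)) \<longlonglongrightarrow> 0" using LIMSEQ_inverse_real_of_nat by (simp add: inverse_eq_divide)
  from l2_mollify_tendsto[OF \<rho> this] show ?thesis using \<rho> by (rule that[rotated])
qed

text \<open>Each value of a mollification of \<open>F\<close> is an integral of \<open>F\<close>
  against a reflected kernel, which is a test function, so the mollifications vanish and so does
  their limit.\<close>

lemma du_bois_reymond:
  assumes F: "\<And>R. square_integrable (\<lambda>y. of_real (indicator {-R..R} y) * F y)"
    and zero: "\<And>\<phi>. test_function \<phi> \<Longrightarrow> (\<integral>y. F y * of_real (\<phi> y) \<partial>lborel) = 0"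
  shows "AE y in lborel. F y = 0"
proof -
  obtain \<rho> where \<rho>: "\<And>n. mollifier (1 / real (Suc n)) (\<rho> n)" and lim: "\<And>u. (\<lambda>n. l2_convol (\<rho> n) u) \<longlonglongrightarrow> u"
    using mollifier_sequence by blast
  have main: "AE y in lborel. \<bar>y\<bar> \<le> R \<longrightarrow> F y = 0" for R
  proof -
    \<comment> \<open>Cutting off one unit beyond \<open>R\<close> does not change mollifications at
      points of \<open>{-R..R}\<close>, because the kernels have radius at most 1.\<close>
    define f where "f y = of_real (indicator {-(R+1)..R+1} y) * F y" for y
    have sqf: "square_integrable f" unfolding f_def by (rule F)
    define I where "I y = complex_of_real (indicator {-R..R} y)" for y
    have I: "I \<in> borel_measurable borel" "\<And>y. cmod (I y) \<le> 1" unfolding I_def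
      by (rule square_integrable_borel[OF square_integrable_indicator], simp add: indicator_def)
    have "l2_mult I (l2_convol (\<rho> n) (abs_l2 f)) = 0" for n
    proof -
      note M = mollifierD[OF \<rho>[of n]]
      have h0: "I x * convol (\<rho> n) f x = 0" for x
      proof (cases "x \<in> {-R..R}")
        case True
        have pt: "of_real (\<rho> n (x - y)) * f y = F y * of_real (\<rho> n (x - y))" for y
        proof (cases "y \<in> {-(R+1)..R+1}")
          case False
          then have "1 < \<bar>x - y\<bar>" using True by (auto simp: abs_if)
          moreover have "1 / real (Suc n) \<le> 1" by simp
          ultimately have "1 / real (Suc n) < \<bar>x - y\<bar>" by linarith
          then show ?thesis using M(3) by simp
        qed (simp add: f_def)
        have "convol (\<rho> n) f x = (\<integral>y. F y * of_real (\<rho> n (x - y)) \<partial>lborel)"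
          unfolding convol_def by (simp only: pt)
        also have "\<dots> = 0" by (rule zero[OF test_function_reflect[OF M(1)]])
        finally show ?thesis by simp
      qed (simp add: I_def)
      then show ?thesis
        unfolding l2_convol_abs[OF M(6) sqf]
        by (subst l2_mult_abs[OF I young_inequality(1)[OF M(6) sqf]]) (simp only: h0 abs_l2_0)
    qed
    moreover have "(\<lambda>n. l2_mult I (l2_convol (\<rho> n) (abs_l2 f))) \<longlonglongrightarrow> l2_mult I (abs_l2 f)"
      by (rule bounded_linear.tendsto[OF bounded_linear_l2_mult(1)[OF I] lim])
    ultimately have "l2_mult I (abs_l2 f) = 0" by (simp add: LIMSEQ_const_iff)
    then have "abs_l2 (\<lambda>y. I y * f y) = abs_l2 (\<lambda>_. 0)"
      unfolding l2_mult_abs[OF I sqf] abs_l2_0 .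
    then have "AE y in lborel. I y * f y = 0"
      by (subst (asm) abs_l2_eq_iff) (simp_all add: square_integrable_mult_bounded[OF sqf I])
    then show ?thesis
    proof eventually_elim
      case (elim y)
      show ?case
      proof
        assume "\<bar>y\<bar> \<le> R"
        then have "y \<in> {-R..R}" "y \<in> {-(R+1)..R+1}" by (auto simp: abs_le_iff)
        then show "F y = 0" using elim by (simp add: I_def f_def)
      qed
    qed
  qed
  have "AE y in lborel. \<forall>n::nat. \<bar>y\<bar> \<le> real n \<longrightarrow> F y = 0"
    unfolding AE_all_countable by (intro allI main)
  then show ?thesis
  proof eventually_elim
    case (elim y)
    then show ?case using real_arch_simple[of "\<bar>y\<bar>"] by blast
  qed
qed

text \<open>Test functions are real valued, so a complex one is given by its real and imaginary
  parts. These vectors serve as initial data.\<close>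

definition test_vectors :: "l2 set" where
  "test_vectors = {abs_l2 (\<lambda>y. Complex (\<phi> y) (\<eta> y)) |\<phi> \<eta>. test_function \<phi> \<and> test_function \<eta>}"

lemma square_integrable_Complex_test:
  assumes "test_function \<phi>" "test_function \<eta>"
  shows "square_integrable (\<lambda>y. Complex (\<phi> y) (\<eta> y))"
proof -
  have "(\<lambda>y. Complex (\<phi> y) (\<eta> y)) = (\<lambda>y. of_real (\<phi> y) + \<i> * of_real (\<eta> y))"
    by (simp add: fun_eq_iff complex_eq_iff)
  then show ?thesis
    using assms by (simp add: square_integrable_add square_integrable_cmult test_function_square_integrable)
qed

lemma test_vectorsI:
  "test_function \<phi> \<Longrightarrow> test_function \<eta> \<Longrightarrow> abs_l2 (\<lambda>y. Complex (\<phi> y) (\<eta> y)) \<in> test_vectors"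
  unfolding test_vectors_def by blast

lemma subspace_test_vectors: "subspace test_vectors"
proof (rule subspaceI)
  have z: "test_function (\<lambda>_. 0)" by (auto simp: test_function_iff smooth_upto_const)
  show "0 \<in> test_vectors"
  proof -
    have "(\<lambda>y::real. Complex 0 0) = (\<lambda>_. 0)" by (simp add: fun_eq_iff complex_eq_iff)
    then show ?thesis using test_vectorsI[OF z z] by (simp only: abs_l2_0)
  qed
next
  fix x y assume "x \<in> test_vectors" "y \<in> test_vectors"
  then obtain \<phi> \<eta> \<phi>' \<eta>' where t: "test_function \<phi>" "test_function \<eta>" "test_function \<phi>'" "test_function \<eta>'"
    and x: "x = abs_l2 (\<lambda>y. Complex (\<phi> y) (\<eta> y))" and y: "y = abs_l2 (\<lambda>y. Complex (\<phi>' y) (\<eta>' y))"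
    unfolding test_vectors_def by blast
  have "x + y = abs_l2 (\<lambda>y. Complex (\<phi> y + \<phi>' y) (\<eta> y + \<eta>' y))"
    unfolding x y by (subst abs_l2_add) (simp_all add: square_integrable_Complex_test t complex_add)
  also have "\<dots> \<in> test_vectors" by (intro test_vectorsI test_function_add t)
  finally show "x + y \<in> test_vectors" .
next
  fix x and c :: real assume "x \<in> test_vectors"
  then obtain \<phi> \<eta> where t: "test_function \<phi>" "test_function \<eta>" and x: "x = abs_l2 (\<lambda>y. Complex (\<phi> y) (\<eta> y))"
    unfolding test_vectors_def by blast
  have "c *\<^sub>R x = abs_l2 (\<lambda>y. Complex (c * \<phi> y) (c * \<eta> y))"
    unfolding x by (subst abs_l2_scaleR) (simp_all add: square_integrable_Complex_test t scaleR_complex.ctr)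
  also have "\<dots> \<in> test_vectors" by (intro test_vectorsI test_function_cmult t)
  finally show "c *\<^sub>R x \<in> test_vectors" .
qed

lemma test_vectors_dense: "closure test_vectors = UNIV"
proof (rule dense_subspace_if_orthogonal_trivial[OF subspace_test_vectors])
  fix u assume orth: "\<And>d. d \<in> test_vectors \<Longrightarrow> u \<bullet> d = 0"
  have z: "test_function (\<lambda>_. 0)" by (auto simp: test_function_iff smooth_upto_const)
  have "l2_pair u (\<lambda>y. of_real (\<phi> y)) = 0" if \<phi>: "test_function \<phi>" for \<phi>
  proof -
    have "abs_l2 (\<lambda>y. Complex (\<phi> y) 0) \<in> test_vectors" "abs_l2 (\<lambda>y. Complex 0 (\<phi> y)) \<in> test_vectors"
      by (rule test_vectorsI[OF \<phi> z], rule test_vectorsI[OF z \<phi>])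
    moreover have "(\<lambda>y. cnj (of_real (\<phi> y))) = (\<lambda>y. Complex (\<phi> y) 0)"
      "(\<lambda>y. \<i> * cnj (of_real (\<phi> y))) = (\<lambda>y. Complex 0 (\<phi> y))"
      by (simp_all add: fun_eq_iff complex_eq_iff)
    ultimately show ?thesis
      unfolding l2_pair_eq_inner[OF test_function_square_integrable[OF \<phi>]] using orth by (simp add: complex_eq_iff)
  qed
  then have "AE y in lborel. rep_l2 u y = 0"
    by (intro du_bois_reymond) (simp_all add: l2_pair_def square_integrable_mult_bounded[of _ _ 1] indicator_def)
  then have "abs_l2 (rep_l2 u) = abs_l2 (\<lambda>_. 0)" by (subst abs_l2_eq_iff) simp_all
  then show "u = 0" by (simp add: abs_l2_0)
qed

subsection \<open>Differentiation of convolutions\<close>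

lemma test_function_taylor:
  assumes "test_function \<phi>" and B: "\<And>y. \<bar>deriv (deriv \<phi>) y\<bar> \<le> B"
  shows "\<bar>\<phi> (a + h) - \<phi> a - h * deriv \<phi> a\<bar> \<le> B * h\<^sup>2"
proof -
  have B0: "0 \<le> B" using B[of 0] by linarith
  have d1: "norm (deriv \<phi> y - deriv \<phi> a) \<le> B * norm (y - a)" for y
    by (rule field_differentiable_bound[of UNIV "deriv \<phi>" "deriv (deriv \<phi>)"])
      (use assms test_function_has_derivative[OF test_function_deriv] in auto)
  define S where "S = {a - \<bar>h\<bar>..a + \<bar>h\<bar>}"
  have "norm ((\<phi> (a + h) - (a + h) * deriv \<phi> a) - (\<phi> a - a * deriv \<phi> a)) \<le> (B * \<bar>h\<bar>) * norm ((a + h) - a)"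
  proof (rule field_differentiable_bound[of S "\<lambda>y. \<phi> y - y * deriv \<phi> a" "\<lambda>y. deriv \<phi> y - deriv \<phi> a"])
    fix y assume y: "y \<in> S"
    have "((\<lambda>y. \<phi> y - y * deriv \<phi> a) has_real_derivative deriv \<phi> y - 1 * deriv \<phi> a) (at y)"
      by (intro DERIV_diff test_function_has_derivative[OF assms(1)] DERIV_cmult_right DERIV_ident)
    then show "((\<lambda>y. \<phi> y - y * deriv \<phi> a) has_field_derivative deriv \<phi> y - deriv \<phi> a) (at y within S)"
      using has_field_derivative_at_within by fastforce
    have "\<bar>y - a\<bar> \<le> \<bar>h\<bar>" using y by (auto simp: S_def abs_le_iff)
    then show "norm (deriv \<phi> y - deriv \<phi> a) \<le> B * \<bar>h\<bar>"
      using d1[of y] mult_left_mono[of "\<bar>y - a\<bar>" "\<bar>h\<bar>" B] B0 by simp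
  qed (auto simp: S_def)
  moreover have "(\<phi> (a + h) - (a + h) * deriv \<phi> a) - (\<phi> a - a * deriv \<phi> a) = \<phi> (a + h) - \<phi> a - h * deriv \<phi> a"
    by (simp add: algebra_simps)
  moreover have "(B * \<bar>h\<bar>) * norm ((a + h) - a) = B * h\<^sup>2"
    using abs_mult_self_eq[of h] by (simp add: power2_eq_square)
  ultimately show ?thesis by (simp only: real_norm_def)
qed

text \<open>All regularity comes from the kernel: its Taylor remainder is quadratic, uniformly on an
  interval \<open>I\<close> that contains the relevant supports for all \<open>z\<close> within
  distance 1 of \<open>x\<close>, and on \<open>I\<close> the function \<open>f\<close> is
  integrable.\<close>

lemma convol_has_vector_derivative:
  assumes \<phi>: "test_function \<phi>" and f: "square_integrable f"
  shows "(convol \<phi> f has_vector_derivative convol (deriv \<phi>) f x) (at x)"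
proof -
  obtain r where r: "\<And>y. r < \<bar>y\<bar> \<Longrightarrow> \<phi> y = 0" using \<phi> by (auto simp: test_function_iff)
  obtain r' where r': "\<And>y. r' < \<bar>y\<bar> \<Longrightarrow> deriv \<phi> y = 0"
    using test_function_deriv[OF \<phi>] by (auto simp: test_function_iff)
  obtain B where B: "0 < B" "\<And>y. \<bar>deriv (deriv \<phi>) y\<bar> \<le> B"
    using test_function_bounded[OF test_function_deriv[OF test_function_deriv[OF \<phi>]]] by blast
  define I where "I y = complex_of_real (indicator {x - (\<bar>r\<bar> + \<bar>r'\<bar> + 1)..x + (\<bar>r\<bar> + \<bar>r'\<bar> + 1)} y)" for y
  have sqI: "square_integrable I" unfolding I_def by (rule square_integrable_indicator)
  note int = square_integrable_mult_integrable[OF square_integrable_kernel_reflect[OF test_function_bounded_kernel] f]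
  define K where "K = B * (\<integral>y. cmod (I y) * cmod (f y) \<partial>lborel)"
  have K0: "0 \<le> K" using B by (simp add: K_def integral_nonneg_AE)
  show ?thesis unfolding has_vector_derivative_def
  proof (rule has_derivativeI_quadratic[where K=K and e=1])
    fix z assume z: "norm (z - x) < 1"
    define q where "q y = \<phi> (z - y) - \<phi> (x - y) - (z - x) * deriv \<phi> (x - y)" for y
    have e: "convol \<phi> f z - convol \<phi> f x - (z - x) *\<^sub>R convol (deriv \<phi>) f x = (\<integral>y. of_real (q y) * f y \<partial>lborel)"
    proof -
      have "(\<lambda>y. of_real (q y) * f y) = (\<lambda>y. (of_real (\<phi> (z - y)) * f y - of_real (\<phi> (x - y)) * f y)
          - of_real (z - x) * (of_real (deriv \<phi> (x - y)) * f y))"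
        by (simp add: q_def fun_eq_iff left_diff_distrib mult.assoc)
      then show ?thesis
        unfolding convol_def scaleR_conv_of_real
        by (simp only: Bochner_Integration.integral_diff[OF Bochner_Integration.integrable_diff[OF int[OF \<phi>] int[OF \<phi>]]
              integrable_mult_right[OF int[OF test_function_deriv[OF \<phi>]]]]
            Bochner_Integration.integral_diff[OF int[OF \<phi>] int[OF \<phi>]] integral_mult_right_zero)
    qed
    have qb: "cmod (of_real (q y) * f y) \<le> (B * (norm (z - x))\<^sup>2) * (cmod (I y) * cmod (f y))" for y
    proof (cases "\<bar>x - y\<bar> \<le> \<bar>r\<bar> + \<bar>r'\<bar> + 1")
      case True
      then have "I y = 1" by (auto simp: I_def indicator_def abs_le_iff)
      moreover have "\<bar>q y\<bar> \<le> B * (z - x)\<^sup>2"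
        using test_function_taylor[OF \<phi> B(2), of "x - y" "z - x"] by (simp add: q_def)
      ultimately show ?thesis by (simp add: norm_mult mult_right_mono)
    next
      case False
      then have "r < \<bar>x - y\<bar>" "r' < \<bar>x - y\<bar>" "r < \<bar>z - y\<bar>" using z unfolding real_norm_def by linarith+
      then have "q y = 0" by (simp add: q_def r r')
      then show ?thesis using B(1) by simp
    qed
    have i0: "integrable lborel (\<lambda>y. cmod (I y) * cmod (f y))"
      using integrable_norm[OF square_integrable_mult_integrable[OF sqI f]] by (simp add: norm_mult)
    have "norm (\<integral>y. of_real (q y) * f y \<partial>lborel) \<le> (\<integral>y. (B * (norm (z - x))\<^sup>2) * (cmod (I y) * cmod (f y)) \<partial>lborel)"
    proof (rule order_trans[OF integral_norm_bound integral_mono'])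
      show "integrable lborel (\<lambda>y. (B * (norm (z - x))\<^sup>2) * (cmod (I y) * cmod (f y)))"
        by (rule integrable_mult_right[OF i0])
      show "cmod (of_real (q y) * f y) \<le> (B * (norm (z - x))\<^sup>2) * (cmod (I y) * cmod (f y))" for y by (rule qb)
      show "0 \<le> (B * (norm (z - x))\<^sup>2) * (cmod (I y) * cmod (f y))" for y using B(1) by simp
    qed
    then show "norm (convol \<phi> f z - convol \<phi> f x - (z - x) *\<^sub>R convol (deriv \<phi>) f x) \<le> K * (norm (z - x))\<^sup>2"
      unfolding e K_def integral_mult_right_zero by (simp only: mult_ac)
  qed (use K0 in \<open>simp_all add: bounded_linear_scaleR_left\<close>)
qed

section \<open>The Green function of the Helmholtz operator\<close>

text \<open>The decaying fundamental solution of
  \<open>\<psi>'' - \<kappa>^2 \<psi> = \<delta>\<close>. Its derivative \<open>green'\<close> away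
  from 0 jumps by 1 at the origin.\<close>

definition green :: "real \<Rightarrow> real \<Rightarrow> real" where
  "green \<kappa> z = - exp (- \<kappa> * \<bar>z\<bar>) / (2 * \<kappa>)"

definition green' :: "real \<Rightarrow> real \<Rightarrow> real" where
  "green' \<kappa> z = sgn z * exp (- \<kappa> * \<bar>z\<bar>) / 2"

lemma integrable_exp_abs:
  fixes \<kappa> :: real
  assumes "0 < \<kappa>"
  shows "integrable lborel (\<lambda>z. exp (- \<kappa> * \<bar>z\<bar>))"
proof -
  have "(\<integral>\<^sup>+z. ennreal (exp (- \<kappa> * z)) * indicator {0..} z \<partial>lborel) = ennreal (0 - (- exp (- \<kappa> * 0) / \<kappa>))"
  proof (rule nn_integral_FTC_atLeast)
    show "((\<lambda>z. - exp (- \<kappa> * z) / \<kappa>) has_real_derivative exp (- \<kappa> * x)) (at x)" for x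
      using assms by (auto intro!: derivative_eq_intros)
    have "filterlim (\<lambda>z. (- \<kappa>) * z) at_bot at_top"
      using assms by (intro filterlim_tendsto_neg_mult_at_bot[OF tendsto_const _ filterlim_ident]) simp
    then have "((\<lambda>z. exp (- \<kappa> * z)) \<longlongrightarrow> 0) at_top" by (rule filterlim_compose[OF exp_at_bot])
    then have "((\<lambda>z. - exp (- \<kappa> * z) / \<kappa>) \<longlongrightarrow> - 0 / \<kappa>) at_top"
      using assms by (intro tendsto_intros) auto
    then show "((\<lambda>z. - exp (- \<kappa> * z) / \<kappa>) \<longlongrightarrow> 0) at_top" by simp
  qed simp_all
  then have "(\<integral>\<^sup>+z. ennreal (norm (exp (- \<kappa> * z) * indicator {0..} z)) \<partial>lborel) < \<infinity>"
    by (subst nn_integral_cong[of _ _ "\<lambda>z. ennreal (exp (- \<kappa> * z)) * indicator {0..} z"])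
      (simp_all add: indicator_def ennreal_less_top)
  then have i: "integrable lborel (\<lambda>z. exp (- \<kappa> * z) * indicator {0..} z)"
    by (intro integrableI_bounded) simp_all
  have "integrable lborel (\<lambda>z. exp (- \<kappa> * (0 + (-1) * z)) * indicator {0..} (0 + (-1) * z))"
    by (rule lborel_integrable_real_affine[OF i]) simp
  then have "integrable lborel (\<lambda>z. exp (- \<kappa> * z) * indicator {0..} z + exp (- \<kappa> * (- z)) * indicator {0..} (- z))"
    by (intro Bochner_Integration.integrable_add[OF i]) simp
  then show ?thesis
  proof (rule Bochner_Integration.integrable_bound)
    show "AE z in lborel. norm (exp (- \<kappa> * \<bar>z\<bar>))
        \<le> norm (exp (- \<kappa> * z) * indicator {0..} z + exp (- \<kappa> * (- z)) * indicator {0..} (- z))"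
      by (rule AE_I2) (simp add: indicator_def abs_if)
  qed simp
qed

lemma bounded_kernel_green: "0 < \<kappa> \<Longrightarrow> bounded_kernel (green \<kappa>)"
proof -
  assume \<kappa>: "0 < \<kappa>"
  have "green \<kappa> = (\<lambda>z. (- 1 / (2 * \<kappa>)) * exp (- \<kappa> * \<bar>z\<bar>))" by (simp add: green_def fun_eq_iff)
  then have "integrable lborel (green \<kappa>)" using integrable_exp_abs[OF \<kappa>] by simp
  moreover have "\<bar>green \<kappa> z\<bar> \<le> 1 / (2 * \<kappa>)" for z
    using \<kappa> by (simp add: green_def abs_mult divide_right_mono)
  ultimately show ?thesis unfolding bounded_kernel_def by blast
qed

lemma bounded_kernel_green': "0 < \<kappa> \<Longrightarrow> bounded_kernel (green' \<kappa>)"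
proof -
  assume \<kappa>: "0 < \<kappa>"
  have b: "\<bar>green' \<kappa> z\<bar> \<le> exp (- \<kappa> * \<bar>z\<bar>)" for z by (simp add: green'_def abs_mult abs_sgn_eq)
  have "integrable lborel (green' \<kappa>)"
  proof (rule Bochner_Integration.integrable_bound[OF integrable_exp_abs[OF \<kappa>]])
    show "green' \<kappa> \<in> borel_measurable lborel" unfolding green'_def[abs_def] by simp
    show "AE z in lborel. norm (green' \<kappa> z) \<le> norm (exp (- \<kappa> * \<bar>z\<bar>))" using b by simp
  qed
  moreover have "\<bar>green' \<kappa> z\<bar> \<le> 1" for z
    using order_trans[OF b[of z]] \<kappa> by simp
  ultimately show ?thesis unfolding bounded_kernel_def by blast
qed

lemma green_minus [simp]: "green \<kappa> (- z) = green \<kappa> z"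
  by (simp add: green_def)

lemma integral_FTC_compact:
  fixes F f :: "real \<Rightarrow> real"
  assumes "a \<le> b" "\<And>x. (F has_real_derivative f x) (at x)" "continuous_on UNIV f"
  shows "integrable lborel (\<lambda>x. indicator {a..b} x * f x)" "(\<integral>x. indicator {a..b} x * f x \<partial>lborel) = F b - F a"
proof -
  have "has_bochner_integral lborel (\<lambda>x. f x * indicator {a..b} x) (F b - F a)"
    by (rule has_bochner_integral_FTC_Icc_real)
      (use assms in \<open>auto simp: continuous_on_eq_continuous_at\<close>)
  then show "integrable lborel (\<lambda>x. indicator {a..b} x * f x)" "(\<integral>x. indicator {a..b} x * f x \<partial>lborel) = F b - F a"
    by (simp_all add: has_bochner_integral_iff mult.commute)
qed

text \<open>Together the two identities say that \<open>green\<close> is a fundamental solution in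
  the sense of distributions. On either side of \<open>y\<close> the integrands combine to the
  derivatives \<open>p\<close> and \<open>q\<close> of an exponential times \<open>\<phi>\<close>.
  The boundary values at \<open>y\<close> cancel in the first identity and add up to
  \<open>- \<phi> y\<close> in the second.\<close>

lemma green_integration_by_parts:
  assumes \<kappa>: "0 < \<kappa>" and \<phi>: "test_function \<phi>"
  shows "(\<integral>x. green \<kappa> (x - y) * deriv \<phi> x \<partial>lborel) = - (\<integral>x. green' \<kappa> (x - y) * \<phi> x \<partial>lborel)"
    and "(\<integral>x. green' \<kappa> (x - y) * deriv \<phi> x \<partial>lborel) = - \<phi> y - \<kappa>\<^sup>2 * (\<integral>x. green \<kappa> (x - y) * \<phi> x \<partial>lborel)"
proof -
  obtain r where r: "\<And>y. r < \<bar>y\<bar> \<Longrightarrow> \<phi> y = 0" using \<phi> by (auto simp: test_function_iff)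
  obtain r' where r': "\<And>y. r' < \<bar>y\<bar> \<Longrightarrow> deriv \<phi> y = 0"
    using test_function_deriv[OF \<phi>] by (auto simp: test_function_iff)
  define R where "R = \<bar>r\<bar> + \<bar>r'\<bar> + \<bar>y\<bar> + 1"
  have R: "- R \<le> y" "y \<le> R" "\<phi> R = 0" "\<phi> (- R) = 0" by (auto simp: R_def intro!: r)
  define p where "p x = exp (- \<kappa> * (x - y)) * (deriv \<phi> x - \<kappa> * \<phi> x)" for x
  define q where "q x = exp (\<kappa> * (x - y)) * (deriv \<phi> x + \<kappa> * \<phi> x)" for x
  have cont: "continuous_on UNIV p" "continuous_on UNIV q"
    unfolding p_def q_def
    by (intro continuous_intros test_function_continuous[OF \<phi>] test_function_continuous[OF test_function_deriv[OF \<phi>]])+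
  have dp: "((\<lambda>x. exp (- \<kappa> * (x - y)) * \<phi> x) has_real_derivative p x) (at x)" for x
  proof -
    have "((\<lambda>x. exp (- \<kappa> * (x - y))) has_real_derivative exp (- \<kappa> * (x - y)) * - \<kappa>) (at x)"
      by (auto intro!: derivative_eq_intros)
    from DERIV_mult[OF this test_function_has_derivative[OF \<phi>]] show ?thesis
      by (rule DERIV_cong) (simp add: p_def algebra_simps)
  qed
  have dq: "((\<lambda>x. exp (\<kappa> * (x - y)) * \<phi> x) has_real_derivative q x) (at x)" for x
  proof -
    have "((\<lambda>x. exp (\<kappa> * (x - y))) has_real_derivative exp (\<kappa> * (x - y)) * \<kappa>) (at x)"
      by (auto intro!: derivative_eq_intros)
    from DERIV_mult[OF this test_function_has_derivative[OF \<phi>]] show ?thesis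
      by (rule DERIV_cong) (simp add: q_def algebra_simps)
  qed
  note P = integral_FTC_compact[OF R(2) dp cont(1), unfolded R, simplified]
  note Q = integral_FTC_compact[OF R(1) dq cont(2), unfolded R, simplified]
  have zero: "\<phi> x = 0" "deriv \<phi> x = 0" if "x \<notin> {-R..R}" for x
    using that by (auto simp: R_def intro!: r r')
  have ae: "AE x in lborel. x \<noteq> y" by (rule AE_lborel_singleton)
  have int: "integrable lborel (\<lambda>x. J (x - y) * \<eta> x)" if "bounded_kernel J" "test_function \<eta>" for J \<eta>
  proof -
    have "bounded_kernel (\<lambda>x. J (x - y))"
      using that(1) lborel_integrable_real_affine[of J 1 "- y"] by (auto simp: bounded_kernel_def)
    then have "integrable lborel (\<lambda>x. complex_of_real (J (x - y)) * complex_of_real (\<eta> x))"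
      by (intro square_integrable_mult_integrable bounded_kernel_square_integrable test_function_square_integrable that)
    then show ?thesis by (simp only: of_real_mult[symmetric] complex_of_real_integrable_eq)
  qed
  note G = int[OF bounded_kernel_green[OF \<kappa>]] and G' = int[OF bounded_kernel_green'[OF \<kappa>]]
  note \<phi>' = test_function_deriv[OF \<phi>]
  have pt: "green \<kappa> (x - y) * deriv \<phi> x + green' \<kappa> (x - y) * \<phi> x
      = (- 1 / (2 * \<kappa>)) * (indicator {y..R} x * p x) + (- 1 / (2 * \<kappa>)) * (indicator {-R..y} x * q x)"
    "green' \<kappa> (x - y) * deriv \<phi> x + \<kappa>\<^sup>2 * (green \<kappa> (x - y) * \<phi> x)
      = (1 / 2) * (indicator {y..R} x * p x) + (- 1 / 2) * (indicator {-R..y} x * q x)" if xy: "x \<noteq> y" for x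
  proof (atomize(full), cases "x \<in> {-R..R}")
    case False
    then have "x \<notin> {y..R}" "x \<notin> {-R..y}" using R by auto
    then show "(green \<kappa> (x - y) * deriv \<phi> x + green' \<kappa> (x - y) * \<phi> x
      = (- 1 / (2 * \<kappa>)) * (indicator {y..R} x * p x) + (- 1 / (2 * \<kappa>)) * (indicator {-R..y} x * q x)) \<and>
    (green' \<kappa> (x - y) * deriv \<phi> x + \<kappa>\<^sup>2 * (green \<kappa> (x - y) * \<phi> x)
      = (1 / 2) * (indicator {y..R} x * p x) + (- 1 / 2) * (indicator {-R..y} x * q x))"
      using zero[OF False] by simp
  next
    case True
    show "(green \<kappa> (x - y) * deriv \<phi> x + green' \<kappa> (x - y) * \<phi> x
      = (- 1 / (2 * \<kappa>)) * (indicator {y..R} x * p x) + (- 1 / (2 * \<kappa>)) * (indicator {-R..y} x * q x)) \<and>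
    (green' \<kappa> (x - y) * deriv \<phi> x + \<kappa>\<^sup>2 * (green \<kappa> (x - y) * \<phi> x)
      = (1 / 2) * (indicator {y..R} x * p x) + (- 1 / 2) * (indicator {-R..y} x * q x))"
    proof (cases "y < x")
      case y: True
      define E where "E = exp (- \<kappa> * (x - y))"
      have e: "green \<kappa> (x - y) = - E / (2 * \<kappa>)" "green' \<kappa> (x - y) = E / 2" "p x = E * (deriv \<phi> x - \<kappa> * \<phi> x)"
        "indicator {y..R} x = (1::real)" "indicator {-R..y} x = (0::real)"
        using y True by (simp_all add: green_def green'_def p_def E_def)
      show ?thesis unfolding e using \<kappa> by (simp add: field_simps power2_eq_square)
    next
      case y: False
      define E where "E = exp (\<kappa> * (x - y))"
      have e: "green \<kappa> (x - y) = - E / (2 * \<kappa>)" "green' \<kappa> (x - y) = - E / 2" "q x = E * (deriv \<phi> x + \<kappa> * \<phi> x)"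
        "indicator {y..R} x = (0::real)" "indicator {-R..y} x = (1::real)"
        using y xy True by (simp_all add: green_def green'_def q_def E_def algebra_simps)
      show ?thesis unfolding e using \<kappa> by (simp add: field_simps power2_eq_square)
    qed
  qed
  have "(\<integral>x. green \<kappa> (x - y) * deriv \<phi> x + green' \<kappa> (x - y) * \<phi> x \<partial>lborel)
      = (\<integral>x. (- 1 / (2 * \<kappa>)) * (indicator {y..R} x * p x) + (- 1 / (2 * \<kappa>)) * (indicator {-R..y} x * q x) \<partial>lborel)"
  proof (rule integral_cong_AE)
    show "AE x in lborel. green \<kappa> (x - y) * deriv \<phi> x + green' \<kappa> (x - y) * \<phi> x
      = (- 1 / (2 * \<kappa>)) * (indicator {y..R} x * p x) + (- 1 / (2 * \<kappa>)) * (indicator {-R..y} x * q x)"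
      using ae by eventually_elim (rule pt(1))
  qed (intro borel_measurable_integrable Bochner_Integration.integrable_add integrable_mult_right P Q G[OF \<phi>'] G'[OF \<phi>])+
  also have "\<dots> = (- 1 / (2 * \<kappa>)) * (- \<phi> y) + (- 1 / (2 * \<kappa>)) * \<phi> y"
    by (subst Bochner_Integration.integral_add)
      (simp_all only: P Q integrable_mult_right integral_mult_right_zero)
  finally show "(\<integral>x. green \<kappa> (x - y) * deriv \<phi> x \<partial>lborel) = - (\<integral>x. green' \<kappa> (x - y) * \<phi> x \<partial>lborel)"
    unfolding Bochner_Integration.integral_add[OF G[OF \<phi>'] G'[OF \<phi>]] by simp
  have "(\<integral>x. green' \<kappa> (x - y) * deriv \<phi> x + \<kappa>\<^sup>2 * (green \<kappa> (x - y) * \<phi> x) \<partial>lborel)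
      = (\<integral>x. (1 / 2) * (indicator {y..R} x * p x) + (- 1 / 2) * (indicator {-R..y} x * q x) \<partial>lborel)"
  proof (rule integral_cong_AE)
    show "AE x in lborel. green' \<kappa> (x - y) * deriv \<phi> x + \<kappa>\<^sup>2 * (green \<kappa> (x - y) * \<phi> x)
      = (1 / 2) * (indicator {y..R} x * p x) + (- 1 / 2) * (indicator {-R..y} x * q x)"
      using ae by eventually_elim (rule pt(2))
  qed (intro borel_measurable_integrable Bochner_Integration.integrable_add integrable_mult_right P Q G[OF \<phi>] G'[OF \<phi>'])+
  also have "\<dots> = (1 / 2) * (- \<phi> y) + (- 1 / 2) * \<phi> y"
    by (subst Bochner_Integration.integral_add)
      (simp_all only: P Q integrable_mult_right integral_mult_right_zero)
  finally show "(\<integral>x. green' \<kappa> (x - y) * deriv \<phi> x \<partial>lborel) = - \<phi> y - \<kappa>\<^sup>2 * (\<integral>x. green \<kappa> (x - y) * \<phi> x \<partial>lborel)"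
    unfolding Bochner_Integration.integral_add[OF G'[OF \<phi>'] integrable_mult_right[OF G[OF \<phi>]]]
      integral_mult_right_zero by simp
qed

text \<open>Absolute integrability of the double integral follows from Young's inequality for
  \<open>|J|\<close> and \<open>|f|\<close>, paired with \<open>g\<close>.\<close>

lemma convol_fubini:
  assumes J: "bounded_kernel J" and f: "square_integrable f" and g: "square_integrable g"
  shows "(\<integral>x. convol J f x * g x \<partial>lborel) = (\<integral>y. f y * convol (\<lambda>z. J (- z)) g y \<partial>lborel)"
proof -
  define h where "h x y = of_real (J (x - y)) * f y * g x" for x y
  note [measurable] = bounded_kernel_borel[OF J] square_integrable_borel[OF f] square_integrable_borel[OF g]
  have Ja: "bounded_kernel (\<lambda>z. \<bar>J z\<bar>)" using J by (auto simp: bounded_kernel_def)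
  have h: "case_prod h \<in> borel_measurable (lborel \<Otimes>\<^sub>M lborel)" unfolding h_def by measurable
  have nh: "(\<integral>y. norm (h x y) \<partial>lborel) = cmod (convol (\<lambda>z. \<bar>J z\<bar>) (\<lambda>y. of_real (cmod (f y))) x * g x)" for x
  proof -
    have "(\<integral>y. norm (h x y) \<partial>lborel) = (\<integral>y. \<bar>J (x - y)\<bar> * cmod (f y) \<partial>lborel) * cmod (g x)"
      by (simp add: h_def norm_mult)
    moreover have "convol (\<lambda>z. \<bar>J z\<bar>) (\<lambda>y. of_real (cmod (f y))) x = of_real (\<integral>y. \<bar>J (x - y)\<bar> * cmod (f y) \<partial>lborel)"
      unfolding convol_def of_real_mult[symmetric] by (rule integral_complex_of_real)
    moreover have "0 \<le> (\<integral>y. \<bar>J (x - y)\<bar> * cmod (f y) \<partial>lborel)" by (rule integral_nonneg_AE) simp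
    ultimately show ?thesis by (simp add: norm_mult)
  qed
  have "integrable (lborel \<Otimes>\<^sub>M lborel) (case_prod h)"
  proof (rule lborel_pair.Fubini_integrable[OF h])
    show "integrable lborel (\<lambda>x. \<integral>y. norm (case (x, y) of (x, y) \<Rightarrow> h x y) \<partial>lborel)"
      unfolding case_prod_conv nh
      by (intro integrable_norm square_integrable_mult_integrable young_inequality(1)[OF Ja] square_integrable_cmod f g)
    show "AE x in lborel. integrable lborel (\<lambda>y. case (x, y) of (x, y) \<Rightarrow> h x y)"
      unfolding case_prod_conv h_def
      by (intro AE_I2 integrable_mult_left square_integrable_mult_integrable square_integrable_kernel_reflect J f)
  qed
  then have "(\<integral>x. \<integral>y. h x y \<partial>lborel \<partial>lborel) = (\<integral>y. \<integral>x. h x y \<partial>lborel \<partial>lborel)"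
    by (rule lborel_pair.Fubini_integral[symmetric])
  moreover have "(\<integral>y. h x y \<partial>lborel) = convol J f x * g x" for x
    by (simp only: h_def convol_def integral_mult_left_zero)
  moreover have "(\<integral>x. h x y \<partial>lborel) = f y * convol (\<lambda>z. J (- z)) g y" for y
  proof -
    have "(\<lambda>x. h x y) = (\<lambda>x. f y * (of_real (J (- (y - x))) * g x))" by (simp add: h_def fun_eq_iff)
    then show ?thesis by (simp only: convol_def integral_mult_right_zero)
  qed
  ultimately show ?thesis by simp
qed

lemma square_integrable_locally_integrable:
  assumes "square_integrable f"
  shows "locally_integrable f"
  unfolding locally_integrable_def set_integrable_def
proof (intro allI)
  fix a b :: real
  have "integrable lborel (\<lambda>x. of_real (indicator {a..b} x) * f x)"
    by (intro square_integrable_mult_integrable square_integrable_indicator assms)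
  then show "integrable lborel (\<lambda>x. indicator {a..b} x *\<^sub>R f x)" by (simp only: scaleR_conv_of_real)
qed

lemma helmholtz_solution_green:
  assumes k: "k \<noteq> 0" and f: "square_integrable f"
  defines "\<kappa> \<equiv> \<bar>real_of_int k\<bar>"
  shows "helmholtz_solution k f (convol (green \<kappa>) f)"
proof -
  have \<kappa>: "0 < \<kappa>" using k by (simp add: \<kappa>_def)
  note K = bounded_kernel_green[OF \<kappa>] and K' = bounded_kernel_green'[OF \<kappa>]
  note sq = young_inequality(1)[OF K f] young_inequality(1)[OF K' f]
  have ct: "convol (\<lambda>z. green \<kappa> (- z)) (\<lambda>x. of_real (\<phi> x)) y = of_real (\<integral>x. green \<kappa> (x - y) * \<phi> x \<partial>lborel)" for \<phi> y
  proof -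
    have "green \<kappa> (y - x) = green \<kappa> (x - y)" for x using green_minus[of \<kappa> "x - y"] by simp
    then show ?thesis unfolding convol_def of_real_mult[symmetric] integral_complex_of_real by simp
  qed
  have ct': "convol (\<lambda>z. green' \<kappa> (- z)) (\<lambda>x. of_real (\<phi> x)) y = of_real (\<integral>x. green' \<kappa> (x - y) * \<phi> x \<partial>lborel)" for \<phi> y
  proof -
    have "green' \<kappa> (- (y - x)) = green' \<kappa> (x - y)" for x by (simp only: minus_diff_eq)
    then show ?thesis unfolding convol_def of_real_mult[symmetric] integral_complex_of_real by simp
  qed
  have w1: "weak_derivative 1 (convol (green \<kappa>) f) (convol (green' \<kappa>) f)"
    unfolding weak_derivative_def
  proof (intro conjI allI impI square_integrable_locally_integrable sq)
    fix \<phi> assume \<phi>: "test_function \<phi>"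
    have "(\<integral>y. convol (green \<kappa>) f y * of_real ((deriv ^^ 1) \<phi> y) \<partial>lborel)
        = (\<integral>y. f y * of_real (- (\<integral>x. green' \<kappa> (x - y) * \<phi> x \<partial>lborel)) \<partial>lborel)"
      using convol_fubini[OF K f test_function_square_integrable[OF test_function_deriv[OF \<phi>]]]
      unfolding ct green_integration_by_parts(1)[OF \<kappa> \<phi>] by simp
    also have "\<dots> = - (\<integral>y. convol (green' \<kappa>) f y * of_real (\<phi> y) \<partial>lborel)"
      using convol_fubini[OF K' f test_function_square_integrable[OF \<phi>]] unfolding ct' by simp
    finally show "(\<integral>y. convol (green \<kappa>) f y * of_real ((deriv ^^ 1) \<phi> y) \<partial>lborel)
        = (- 1) ^ 1 * (\<integral>y. convol (green' \<kappa>) f y * of_real (\<phi> y) \<partial>lborel)" by simp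
  qed
  define g where "g y = f y + (of_int k)\<^sup>2 * convol (green \<kappa>) f y" for y
  have sqg: "square_integrable g" unfolding g_def by (intro square_integrable_add square_integrable_cmult f sq)
  have w2: "weak_derivative 2 (convol (green \<kappa>) f) g"
    unfolding weak_derivative_def
  proof (intro conjI allI impI square_integrable_locally_integrable sq sqg)
    fix \<phi> assume \<phi>: "test_function \<phi>"
    note \<phi>' = test_function_deriv[OF \<phi>]
    note sq\<phi> = test_function_square_integrable[OF \<phi>]
    have k2: "of_real (\<kappa>\<^sup>2) = (of_int k :: complex)\<^sup>2" by (simp only: \<kappa>_def power2_abs of_real_power of_real_of_int_eq)
    have "(\<integral>y. convol (green \<kappa>) f y * of_real ((deriv ^^ 2) \<phi> y) \<partial>lborel)
        = (\<integral>y. f y * of_real (\<integral>x. green \<kappa> (x - y) * deriv (deriv \<phi>) x \<partial>lborel) \<partial>lborel)"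
      using convol_fubini[OF K f test_function_square_integrable[OF test_function_deriv[OF \<phi>']]]
      unfolding ct by (simp add: numeral_2_eq_2)
    also have "(\<lambda>y. f y * of_real (\<integral>x. green \<kappa> (x - y) * deriv (deriv \<phi>) x \<partial>lborel))
        = (\<lambda>y. f y * of_real (\<phi> y) + of_real (\<kappa>\<^sup>2) * (f y * convol (\<lambda>z. green \<kappa> (- z)) (\<lambda>x. of_real (\<phi> x)) y))"
      unfolding green_integration_by_parts(1)[OF \<kappa> \<phi>'] green_integration_by_parts(2)[OF \<kappa> \<phi>] ct
      by (simp add: fun_eq_iff algebra_simps)
    also have "(\<integral>y. f y * of_real (\<phi> y) + of_real (\<kappa>\<^sup>2) * (f y * convol (\<lambda>z. green \<kappa> (- z)) (\<lambda>x. of_real (\<phi> x)) y) \<partial>lborel)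
        = (\<integral>y. f y * of_real (\<phi> y) \<partial>lborel)
          + of_real (\<kappa>\<^sup>2) * (\<integral>y. f y * convol (\<lambda>z. green \<kappa> (- z)) (\<lambda>x. of_real (\<phi> x)) y \<partial>lborel)"
    proof (subst Bochner_Integration.integral_add)
      show "integrable lborel (\<lambda>y. f y * complex_of_real (\<phi> y))"
        by (rule square_integrable_mult_integrable[OF f sq\<phi>])
      show "integrable lborel (\<lambda>y. of_real (\<kappa>\<^sup>2) * (f y * convol (\<lambda>z. green \<kappa> (- z)) (\<lambda>x. of_real (\<phi> x)) y))"
        by (simp only: green_minus) (intro integrable_mult_right square_integrable_mult_integrable f young_inequality(1)[OF K sq\<phi>])
    qed (simp only: integral_mult_right_zero)
    also have "\<dots> = (\<integral>y. f y * of_real (\<phi> y) \<partial>lborel)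
          + of_real (\<kappa>\<^sup>2) * (\<integral>y. convol (green \<kappa>) f y * of_real (\<phi> y) \<partial>lborel)"
      unfolding convol_fubini[OF K f sq\<phi>] ..
    also have "\<dots> = (\<integral>y. f y * of_real (\<phi> y) + of_real (\<kappa>\<^sup>2) * (convol (green \<kappa>) f y * of_real (\<phi> y)) \<partial>lborel)"
      by (subst Bochner_Integration.integral_add)
        (simp_all only: square_integrable_mult_integrable[OF f sq\<phi>] square_integrable_mult_integrable[OF sq(1) sq\<phi>]
          integrable_mult_right integral_mult_right_zero)
    also have "(\<lambda>y. f y * of_real (\<phi> y) + of_real (\<kappa>\<^sup>2) * (convol (green \<kappa>) f y * of_real (\<phi> y))) = (\<lambda>y. g y * of_real (\<phi> y))"
      unfolding k2 by (simp add: g_def fun_eq_iff algebra_simps)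
    finally show "(\<integral>y. convol (green \<kappa>) f y * of_real ((deriv ^^ 2) \<phi> y) \<partial>lborel)
        = (- 1)\<^sup>2 * (\<integral>y. g y * of_real (\<phi> y) \<partial>lborel)" by simp
  qed
  have "{1..2} = {1, 2::nat}" by auto
  then show ?thesis unfolding helmholtz_solution_def sobolev_def using w1 w2 sq sqg unfolding g_def by auto
qed

text \<open>Such a function is a constant vector times \<open>exp (c x)\<close>, which is unbounded
  in one direction unless the vector is 0.\<close>

lemma bounded_exponential_zero:
  fixes f :: "real \<Rightarrow> complex"
  assumes der: "\<And>x. (f has_vector_derivative c *\<^sub>R f x) (at x)" and "c \<noteq> 0" and B: "\<And>x. cmod (f x) \<le> B"
  shows "f x = 0"
proof -
  have "((\<lambda>x. exp (- c * x) *\<^sub>R f x) has_vector_derivative 0) (at x)" for x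
  proof -
    have "((\<lambda>x. exp (- c * x)) has_real_derivative exp (- c * x) * - c) (at x)"
      by (auto intro!: derivative_eq_intros)
    from has_vector_derivative_scaleR[OF this der[of x]] show ?thesis by (simp add: mult.commute)
  qed
  then obtain a where a: "\<And>x. exp (- c * x) *\<^sub>R f x = a"
    using has_vector_derivative_zero_constant[of UNIV "\<lambda>x. exp (- c * x) *\<^sub>R f x"] by auto
  have f: "f x = exp (c * x) *\<^sub>R a" for x
  proof -
    have "exp (c * x) *\<^sub>R (exp (- c * x) *\<^sub>R f x) = f x"
      by (simp only: scaleR_scaleR exp_add[symmetric]) simp
    then show ?thesis unfolding a by simp
  qed
  have "a = 0"
  proof (rule ccontr)
    assume "a \<noteq> 0"
    then have p: "0 < cmod a" by simp
    define t where "t = B / cmod a"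
    have "exp t * cmod a \<le> B" using B[of "t / c"] \<open>c \<noteq> 0\<close> unfolding f by simp
    moreover have "(1 + t) * cmod a \<le> exp t * cmod a" using p exp_ge_add_one_self by (intro mult_right_mono) auto
    moreover have "(1 + t) * cmod a = cmod a + B" using p by (simp add: t_def distrib_right)
    ultimately show False using p by linarith
  qed
  then show ?thesis unfolding f by simp
qed

text \<open>Mollifying the difference gives a bounded smooth solution of
  \<open>v'' = \<kappa>^2 v\<close>. Factor the operator: \<open>v' + \<kappa> v\<close> solves a
  first-order exponential equation and is bounded, hence 0, and then \<open>v\<close> does as
  well.\<close>

lemma helmholtz_solution_unique:
  assumes k: "k \<noteq> 0" and s: "helmholtz_solution k f \<psi>" "helmholtz_solution k f \<psi>'"
  shows "AE y in lborel. \<psi> y = \<psi>' y"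
proof -
  define d where "d y = \<psi> y - \<psi>' y" for y
  have sq: "square_integrable \<psi>" "square_integrable \<psi>'" using s by (auto simp: helmholtz_solution_def sobolev_def)
  have sqd: "square_integrable d" unfolding d_def by (rule square_integrable_diff[OF sq])
  \<comment> \<open>Here \<open>\<kappa>\<close> keeps the sign of \<open>k\<close>; the
    factorisation works for either sign.\<close>
  define \<kappa> where "\<kappa> = real_of_int k"
  have \<kappa>: "\<kappa> \<noteq> 0" using k by (simp add: \<kappa>_def)
  have weak: "(\<integral>y. d y * of_real (deriv (deriv \<phi>) y) \<partial>lborel) = of_real (\<kappa>\<^sup>2) * (\<integral>y. d y * of_real (\<phi> y) \<partial>lborel)"
    if \<phi>: "test_function \<phi>" for \<phi>
  proof -
    have sq\<phi>: "square_integrable (\<lambda>y. of_real (\<phi> y))" by (rule test_function_square_integrable[OF \<phi>])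
    have sq\<phi>'': "square_integrable (\<lambda>y. of_real (deriv (deriv \<phi>) y))"
      by (intro test_function_square_integrable test_function_deriv \<phi>)
    have "(deriv ^^ 2) \<phi> = deriv (deriv \<phi>)" by (simp add: numeral_2_eq_2)
    then have w: "(\<integral>y. p y * of_real (deriv (deriv \<phi>) y) \<partial>lborel)
        = (\<integral>y. (f y + (of_int k)\<^sup>2 * p y) * of_real (\<phi> y) \<partial>lborel)"
      and li: "locally_integrable (\<lambda>y. f y + (of_int k)\<^sup>2 * p y)"
      if "helmholtz_solution k f p" for p
      using that \<phi> unfolding helmholtz_solution_def weak_derivative_def by auto
    have ig: "integrable lborel (\<lambda>y. (f y + (of_int k)\<^sup>2 * p y) * of_real (\<phi> y))" if hp: "helmholtz_solution k f p" for p
    proof -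
      obtain r where r: "\<And>y. r < \<bar>y\<bar> \<Longrightarrow> \<phi> y = 0" using \<phi> by (auto simp: test_function_iff)
      obtain B where B: "\<And>y. \<bar>\<phi> y\<bar> \<le> B" using test_function_bounded[OF \<phi>] by blast
      define h where "h y = f y + (of_int k)\<^sup>2 * p y" for y
      have ih: "integrable lborel (\<lambda>y. indicator {-r..r} y *\<^sub>R h y)"
        using li[OF hp] unfolding locally_integrable_def set_integrable_def h_def by blast
      have "integrable lborel (\<lambda>y. of_real (\<phi> y) * (indicator {-r..r} y *\<^sub>R h y))"
      proof (rule Bochner_Integration.integrable_bound[OF integrable_mult_right[OF ih, of "of_real B"]])
        show "(\<lambda>y. of_real (\<phi> y) * (indicator {-r..r} y *\<^sub>R h y)) \<in> borel_measurable lborel"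
          using test_function_borel[OF \<phi>] borel_measurable_integrable[OF ih]
          by (intro borel_measurable_times borel_measurable_of_real) simp_all
        have "\<bar>\<phi> y\<bar> * c \<le> \<bar>B\<bar> * c" if "0 \<le> c" for y c
          using B[of y] that by (intro mult_right_mono) auto
        then show "AE y in lborel. norm (of_real (\<phi> y) * (indicator {-r..r} y *\<^sub>R h y))
            \<le> norm (of_real B * (indicator {-r..r} y *\<^sub>R h y))"
          by (simp only: norm_mult norm_of_real norm_ge_zero AE_I2)
      qed
      also have "(\<lambda>y. of_real (\<phi> y) * (indicator {-r..r} y *\<^sub>R h y)) = (\<lambda>y. h y * of_real (\<phi> y))"
      proof
        fix y show "of_real (\<phi> y) * (indicator {-r..r} y *\<^sub>R h y) = h y * of_real (\<phi> y)"
        proof (cases "y \<in> {-r..r}")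
          case False
          then have "r < \<bar>y\<bar>" by (auto simp: abs_if)
          then show ?thesis using r by simp
        qed simp
      qed
      finally show ?thesis by (simp only: h_def)
    qed
    have "(\<integral>y. d y * of_real (deriv (deriv \<phi>) y) \<partial>lborel)
        = (\<integral>y. \<psi> y * of_real (deriv (deriv \<phi>) y) \<partial>lborel) - (\<integral>y. \<psi>' y * of_real (deriv (deriv \<phi>) y) \<partial>lborel)"
      unfolding d_def left_diff_distrib
      by (rule Bochner_Integration.integral_diff; rule square_integrable_mult_integrable[OF _ sq\<phi>'']; rule sq)
    also have "\<dots> = (\<integral>y. (f y + (of_int k)\<^sup>2 * \<psi> y) * of_real (\<phi> y) - (f y + (of_int k)\<^sup>2 * \<psi>' y) * of_real (\<phi> y) \<partial>lborel)"
      unfolding w[OF s(1)] w[OF s(2)] by (rule Bochner_Integration.integral_diff[symmetric]; rule ig; rule s)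
    also have "(\<lambda>y. (f y + (of_int k)\<^sup>2 * \<psi> y) * of_real (\<phi> y) - (f y + (of_int k)\<^sup>2 * \<psi>' y) * of_real (\<phi> y))
        = (\<lambda>y. of_real (\<kappa>\<^sup>2) * (d y * of_real (\<phi> y)))"
      by (simp add: fun_eq_iff d_def \<kappa>_def algebra_simps)
    finally show ?thesis by (simp only: integral_mult_right_zero)
  qed
  obtain \<rho> where \<rho>: "\<And>n. mollifier (1 / real (Suc n)) (\<rho> n)" and lim: "\<And>u. (\<lambda>n. l2_convol (\<rho> n) u) \<longlonglongrightarrow> u"
    using mollifier_sequence by blast
  have "l2_convol (\<rho> n) (abs_l2 d) = 0" for n
  proof -
    note M = mollifierD[OF \<rho>[of n]]
    note t1 = test_function_deriv[OF M(1)]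
    define v where "v = convol (\<rho> n) d"
    define v' where "v' = convol (deriv (\<rho> n)) d"
    have dv: "(v has_vector_derivative v' x) (at x)" for x
      unfolding v_def v'_def by (rule convol_has_vector_derivative[OF M(1) sqd])
    have dv': "(v' has_vector_derivative of_real (\<kappa>\<^sup>2) * v x) (at x)" for x
    proof -
      have "convol (deriv (deriv (\<rho> n))) d x = of_real (\<kappa>\<^sup>2) * v x"
        using weak[OF test_function_reflect[OF M(1), of x]]
        unfolding deriv_reflect(2)[OF M(1)] by (simp add: convol_def v_def mult.commute)
      then show ?thesis using convol_has_vector_derivative[OF t1 sqd, of x] by (simp add: v'_def)
    qed
    have bd: "\<exists>B. \<forall>x. cmod (convol J d x) \<le> B" if J: "bounded_kernel J" for J
    proof (intro exI allI)
      fix x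
      have "cmod (convol J d x) \<le> L2_norm (\<lambda>y. of_real (J (x - y))) * L2_norm d"
        unfolding convol_def by (rule Cauchy_Schwarz_integral(2)[OF square_integrable_kernel_reflect[OF J] sqd])
      also have "L2_norm (\<lambda>y. complex_of_real (J (x - y))) = L2_norm (\<lambda>y. of_real (J y))"
        using lborel_integral_real_affine[of "-1" "\<lambda>z. (J z)\<^sup>2" x] by (simp add: L2_norm_def)
      finally show "cmod (convol J d x) \<le> L2_norm (\<lambda>y. of_real (J y)) * L2_norm d" .
    qed
    obtain B where B: "\<And>x. cmod (v x) \<le> B" using bd[OF M(6)] unfolding v_def by blast
    obtain B' where B': "\<And>x. cmod (v' x) \<le> B'"
      using bd[OF test_function_bounded_kernel[OF t1]] unfolding v'_def by blast
    have w: "v' x + \<kappa> *\<^sub>R v x = 0" for x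
    proof (rule bounded_exponential_zero[of "\<lambda>x. v' x + \<kappa> *\<^sub>R v x" \<kappa>])
      fix x
      have "((\<lambda>x. v' x + \<kappa> *\<^sub>R v x) has_vector_derivative of_real (\<kappa>\<^sup>2) * v x + \<kappa> *\<^sub>R v' x) (at x)"
        by (intro has_vector_derivative_add dv' has_vector_derivative_scaleR[THEN has_vector_derivative_eq_rhs])
          (auto intro!: derivative_eq_intros dv)
      then show "((\<lambda>x. v' x + \<kappa> *\<^sub>R v x) has_vector_derivative \<kappa> *\<^sub>R (v' x + \<kappa> *\<^sub>R v x)) (at x)"
        by (simp add: scaleR_conv_of_real algebra_simps power2_eq_square)
      have "cmod (v' x + \<kappa> *\<^sub>R v x) \<le> cmod (v' x) + \<bar>\<kappa>\<bar> * cmod (v x)"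
        using norm_triangle_ineq[of "v' x" "\<kappa> *\<^sub>R v x"] by simp
      also have "\<dots> \<le> B' + \<bar>\<kappa>\<bar> * B" using B B' by (intro add_mono mult_left_mono) auto
      finally show "cmod (v' x + \<kappa> *\<^sub>R v x) \<le> B' + \<bar>\<kappa>\<bar> * B" .
    qed (rule \<kappa>)
    have "v x = 0" for x
    proof (rule bounded_exponential_zero[of v "- \<kappa>", OF _ _ B])
      have "v' x = - \<kappa> *\<^sub>R v x" for x using w[of x] by (simp add: add_eq_0_iff2 scaleR_minus_left)
      then show "(v has_vector_derivative - \<kappa> *\<^sub>R v x) (at x)" for x using dv[of x] by simp
    qed (use \<kappa> in simp)
    then have "v = (\<lambda>_. 0)" by auto
    then show ?thesis unfolding l2_convol_abs[OF M(6) sqd] v_def[symmetric] by (simp add: abs_l2_0)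
  qed
  then have "abs_l2 d = 0" using lim[of "abs_l2 d"] by (simp add: LIMSEQ_const_iff)
  then have "abs_l2 d = abs_l2 (\<lambda>_. 0)" by (simp add: abs_l2_0)
  then have "AE y in lborel. d y = 0" using sqd by (subst (asm) abs_l2_eq_iff) simp_all
  then show ?thesis by eventually_elim (simp add: d_def)
qed

lemma helmholtz_inverse_green:
  assumes "k \<noteq> 0" "square_integrable f"
  shows "AE y in lborel. helmholtz_inverse k f y = convol (green \<bar>real_of_int k\<bar>) f y"
proof (rule helmholtz_solution_unique[OF assms(1)])
  show "helmholtz_solution k f (convol (green \<bar>real_of_int k\<bar>) f)"
    by (rule helmholtz_solution_green[OF assms])
  then show "helmholtz_solution k f (helmholtz_inverse k f)"
    unfolding helmholtz_inverse_def by (rule someI[of "helmholtz_solution k f"])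
qed

subsection \<open>Convolution followed by multiplication\<close>

definition l2_mconv :: "(real \<Rightarrow> real) \<Rightarrow> (real \<Rightarrow> real) \<Rightarrow> l2 \<Rightarrow> l2" where
  "l2_mconv m J u = abs_l2 (\<lambda>y. of_real (m y) * convol J (rep_l2 u) y)"

lemma L2_norm_reflect: "L2_norm (\<lambda>y. complex_of_real (J (x - y))) = L2_norm (\<lambda>y. of_real (J y))"
  using lborel_integral_real_affine[of "-1" "\<lambda>z. (J z)\<^sup>2" x] by (simp add: L2_norm_def)

lemma convol_bound:
  assumes "bounded_kernel J" "square_integrable f"
  shows "cmod (convol J f x) \<le> L2_norm (\<lambda>y. of_real (J y)) * L2_norm f"
  using Cauchy_Schwarz_integral(2)[OF square_integrable_kernel_reflect[OF assms(1)] assms(2), of x]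
  unfolding L2_norm_reflect convol_def .

text \<open>The coefficient \<open>m\<close> is only in \<open>L^2\<close>. The convolution is
  bounded pointwise by Cauchy--Schwarz, and the product inherits square integrability from
  \<open>m\<close>.\<close>

lemma square_integrable_mconv:
  assumes m: "square_integrable (\<lambda>y. of_real (m y))" and J: "bounded_kernel J" and f: "square_integrable f"
  shows "square_integrable (\<lambda>y. of_real (m y) * convol J f y)"
    and "L2_norm (\<lambda>y. of_real (m y) * convol J f y) \<le> L2_norm (\<lambda>y. of_real (m y)) * L2_norm (\<lambda>y. of_real (J y)) * L2_norm f"
proof -
  define C where "C = L2_norm (\<lambda>y. complex_of_real (J y)) * L2_norm f"
  have C: "0 \<le> C" by (simp add: C_def)
  have b: "cmod (of_real (m y) * convol J f y) \<le> C * cmod (complex_of_real (m y))" for y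
    using mult_left_mono[OF convol_bound[OF J f, of y], of "\<bar>m y\<bar>"] by (simp add: norm_mult C_def mult.commute)
  note [measurable] = square_integrable_borel[OF m] square_integrable_borel[OF young_inequality(1)[OF J f]]
  have me: "(\<lambda>y. of_real (m y) * convol J f y) \<in> borel_measurable borel" by (rule borel_measurable_times) measurable
  show "square_integrable (\<lambda>y. of_real (m y) * convol J f y)"
    by (rule square_integrable_bound[OF m me b])
  have "L2_norm (\<lambda>y. of_real (m y) * convol J f y) \<le> C * L2_norm (\<lambda>y. of_real (m y))"
    by (rule L2_norm_mono[OF m me b C])
  then show "L2_norm (\<lambda>y. of_real (m y) * convol J f y) \<le> L2_norm (\<lambda>y. of_real (m y)) * L2_norm (\<lambda>y. of_real (J y)) * L2_norm f"
    by (simp add: C_def mult_ac)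
qed

lemma bounded_linear_l2_mconv:
  assumes m: "square_integrable (\<lambda>y. of_real (m y))" and J: "bounded_kernel J"
  shows "bounded_linear (l2_mconv m J)"
    and "norm (l2_mconv m J u) \<le> L2_norm (\<lambda>y. of_real (m y)) * L2_norm (\<lambda>y. of_real (J y)) * norm u"
proof -
  note sq = square_integrable_mconv(1)[OF m J square_integrable_rep]
  show bd: "norm (l2_mconv m J u) \<le> L2_norm (\<lambda>y. of_real (m y)) * L2_norm (\<lambda>y. of_real (J y)) * norm u" for u
    unfolding l2_mconv_def norm_abs_l2[OF sq] norm_l2_rep[of u]
    by (rule square_integrable_mconv(2)[OF m J square_integrable_rep])
  note r = square_integrable_kernel_reflect[OF J]
  show "bounded_linear (l2_mconv m J)"
  proof (rule bounded_linear_intro)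
    fix u v and c :: real
    have "(\<lambda>y. of_real (m y) * convol J (rep_l2 (u + v)) y)
        = (\<lambda>y. of_real (m y) * convol J (rep_l2 u) y + of_real (m y) * convol J (rep_l2 v) y)"
      unfolding convol_pair by (simp add: l2_pair_add[OF r] distrib_left)
    then show "l2_mconv m J (u + v) = l2_mconv m J u + l2_mconv m J v"
      unfolding l2_mconv_def by (simp add: abs_l2_add[OF sq sq])
    have "l2_pair (c *\<^sub>R u) \<phi> = c *\<^sub>R l2_pair u \<phi>" if "square_integrable \<phi>" for \<phi>
      using bounded_linear.linear[OF bounded_linear_l2_pair[OF that]] by (rule linear_scale)
    then have "(\<lambda>y. of_real (m y) * convol J (rep_l2 (c *\<^sub>R u)) y)
        = (\<lambda>y. c *\<^sub>R (of_real (m y) * convol J (rep_l2 u) y))"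
      unfolding convol_pair by (simp add: r)
    then show "l2_mconv m J (c *\<^sub>R u) = c *\<^sub>R l2_mconv m J u"
      unfolding l2_mconv_def by (simp only: abs_l2_scaleR[OF sq])
    show "norm (l2_mconv m J u) \<le> norm u * (L2_norm (\<lambda>y. of_real (m y)) * L2_norm (\<lambda>y. of_real (J y)))"
      using bd[of u] by (simp only: mult.commute)
  qed
qed

lemma l2_mconv_abs:
  assumes m: "square_integrable (\<lambda>y. of_real (m y))" and J: "bounded_kernel J" and f: "square_integrable f"
  shows "l2_mconv m J (abs_l2 f) = abs_l2 (\<lambda>y. of_real (m y) * convol J f y)"
  unfolding l2_mconv_def convol_cong_AE[OF bounded_kernel_borel[OF J] square_integrable_rep f rep_abs_l2[OF f]] ..

lemma l2_mconv_cmult: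
  assumes m: "square_integrable (\<lambda>y. of_real (m y))" and J: "bounded_kernel J"
  shows "l2_mconv m J (l2_cmult z u) = l2_cmult z (l2_mconv m J u)"
proof -
  have sz: "square_integrable (\<lambda>y. z * rep_l2 u y)" by (intro square_integrable_cmult square_integrable_rep)
  have "l2_mconv m J (l2_cmult z u) = abs_l2 (\<lambda>y. of_real (m y) * convol J (\<lambda>y. z * rep_l2 u y) y)"
    unfolding l2_mult_def[of "\<lambda>_. z"] by (rule l2_mconv_abs[OF m J sz])
  also have "(\<lambda>y. of_real (m y) * convol J (\<lambda>y. z * rep_l2 u y) y) = (\<lambda>y. z * (of_real (m y) * convol J (rep_l2 u) y))"
  proof
    fix x
    have "(\<lambda>y. of_real (J (x - y)) * (z * rep_l2 u y)) = (\<lambda>y. z * (of_real (J (x - y)) * rep_l2 u y))"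
      by (simp add: fun_eq_iff)
    then have "convol J (\<lambda>y. z * rep_l2 u y) x = z * convol J (rep_l2 u) x"
      by (simp only: convol_def integral_mult_right_zero)
    then show "of_real (m x) * convol J (\<lambda>y. z * rep_l2 u y) x = z * (of_real (m x) * convol J (rep_l2 u) x)"
      by (simp only: mult.left_commute)
  qed
  finally show ?thesis unfolding l2_mconv_def
    by (simp only: l2_cmult_abs[OF square_integrable_mconv(1)[OF m J square_integrable_rep]])
qed

section \<open>The linearised evolution\<close>

lemma inner_real_test:
  assumes "square_integrable (\<lambda>y. of_real (\<phi> y))"
  shows "u \<bullet> abs_l2 (\<lambda>y. z * of_real (\<phi> y)) = Re (cnj z * l2_pair u (\<lambda>y. of_real (\<phi> y)))"
proof -
  have "abs_l2 (rep_l2 u) \<bullet> abs_l2 (\<lambda>y. z * of_real (\<phi> y))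
      = Re (\<integral>y. rep_l2 u y * cnj (z * of_real (\<phi> y)) \<partial>lborel)"
    by (rule inner_abs_l2[OF square_integrable_rep square_integrable_cmult[OF assms]])
  also have "(\<lambda>y. rep_l2 u y * cnj (z * of_real (\<phi> y))) = (\<lambda>y. cnj z * (rep_l2 u y * of_real (\<phi> y)))"
    by (simp add: fun_eq_iff)
  finally show ?thesis by (simp only: integral_mult_right_zero l2_pair_def abs_rep_l2)
qed

lemma inner_l2_convol:
  assumes J: "bounded_kernel J"
  shows "l2_convol J u \<bullet> v = u \<bullet> l2_convol (\<lambda>z. J (- z)) v"
proof -
  have J': "bounded_kernel (\<lambda>z. J (- z))" using bounded_kernel_reflect[OF J, of 0] by simp
  note sv = square_integrable_cnj[OF square_integrable_rep[of v]]
  have "l2_convol J u \<bullet> abs_l2 (rep_l2 v) = Re (\<integral>x. convol J (rep_l2 u) x * cnj (rep_l2 v x) \<partial>lborel)"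
    unfolding l2_convol_def by (rule inner_abs_l2[OF young_inequality(1)[OF J square_integrable_rep] square_integrable_rep])
  also have "(\<integral>x. convol J (rep_l2 u) x * cnj (rep_l2 v x) \<partial>lborel)
      = (\<integral>y. rep_l2 u y * convol (\<lambda>z. J (- z)) (\<lambda>y. cnj (rep_l2 v y)) y \<partial>lborel)"
    by (rule convol_fubini[OF J square_integrable_rep sv])
  also have "convol (\<lambda>z. J (- z)) (\<lambda>y. cnj (rep_l2 v y)) = (\<lambda>y. cnj (convol (\<lambda>z. J (- z)) (rep_l2 v) y))"
  proof
    fix y
    have "(\<lambda>x. of_real (J (- (y - x))) * cnj (rep_l2 v x)) = (\<lambda>x. cnj (of_real (J (- (y - x))) * rep_l2 v x))"
      by (simp add: fun_eq_iff)
    then show "convol (\<lambda>z. J (- z)) (\<lambda>y. cnj (rep_l2 v y)) y = cnj (convol (\<lambda>z. J (- z)) (rep_l2 v) y)"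
      by (simp only: convol_def Bochner_Integration.integral_cnj)
  qed
  also have "Re (\<integral>y. rep_l2 u y * cnj (convol (\<lambda>z. J (- z)) (rep_l2 v) y) \<partial>lborel)
      = abs_l2 (rep_l2 u) \<bullet> l2_convol (\<lambda>z. J (- z)) v"
    unfolding l2_convol_def
    by (rule inner_abs_l2[OF square_integrable_rep young_inequality(1)[OF J' square_integrable_rep], symmetric])
  finally show ?thesis by simp
qed

lemma bounded_linear_l2_convol:
  assumes J: "bounded_kernel J"
  shows "bounded_linear (l2_convol J)"
proof (rule bounded_linear_intro)
  note r = square_integrable_kernel_reflect[OF J]
  fix u v and c :: real
  have "convol J (rep_l2 (u + v)) = (\<lambda>x. convol J (rep_l2 u) x + convol J (rep_l2 v) x)"
    unfolding convol_pair by (simp add: l2_pair_add[OF r])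
  then show "l2_convol J (u + v) = l2_convol J u + l2_convol J v"
    unfolding l2_convol_def by (simp add: abs_l2_add young_inequality(1)[OF J])
  have "l2_pair (c *\<^sub>R u) \<phi> = c *\<^sub>R l2_pair u \<phi>" if "square_integrable \<phi>" for \<phi>
    using bounded_linear.linear[OF bounded_linear_l2_pair[OF that]] by (rule linear_scale)
  then have "convol J (rep_l2 (c *\<^sub>R u)) = (\<lambda>x. c *\<^sub>R convol J (rep_l2 u) x)"
    unfolding convol_pair by (simp add: r)
  then show "l2_convol J (c *\<^sub>R u) = c *\<^sub>R l2_convol J u"
    unfolding l2_convol_def by (simp only: abs_l2_scaleR[OF young_inequality(1)[OF J square_integrable_rep]])
  show "norm (l2_convol J u) \<le> norm u * (\<integral>z. \<bar>J z\<bar> \<partial>lborel)"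
    using norm_l2_convol[OF J, of u] by (simp only: mult.commute)
qed

text \<open>Dual to \<open>convol_has_vector_derivative\<close>: the derivative passes from the
  mollifier to a smooth argument. This is what identifies the regularised second derivative on test
  vectors.\<close>

lemma convol_integration_by_parts:
  assumes \<rho>: "test_function \<rho>" and F: "\<And>x. (F has_vector_derivative F' x) (at x)" and c: "continuous_on UNIV F'"
  shows "convol (deriv \<rho>) F x = convol \<rho> F' x"
proof -
  obtain r where r: "\<And>y. r < \<bar>y\<bar> \<Longrightarrow> \<rho> y = 0" using \<rho> by (auto simp: test_function_iff)
  obtain r' where r': "\<And>y. r' < \<bar>y\<bar> \<Longrightarrow> deriv \<rho> y = 0"
    using test_function_deriv[OF \<rho>] by (auto simp: test_function_iff)
  define R where "R = \<bar>r\<bar> + \<bar>r'\<bar> + \<bar>x\<bar> + 1"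
  have cF: "continuous_on UNIV F"
    by (intro continuous_at_imp_continuous_on ballI has_vector_derivative_continuous[OF F])
  have c\<rho>: "continuous_on UNIV (\<lambda>y. \<rho> (x - y))" "continuous_on UNIV (\<lambda>y. deriv \<rho> (x - y))"
    by (intro test_function_continuous test_function_reflect test_function_deriv \<rho>)+
  define p where "p y = of_real (\<rho> (x - y)) * F' y - of_real (deriv \<rho> (x - y)) * F y" for y
  have cp: "continuous_on UNIV p" unfolding p_def by (intro continuous_intros c c\<rho> cF)
  have dp: "((\<lambda>y. \<rho> (x - y) *\<^sub>R F y) has_vector_derivative p y) (at y)" for y
  proof -
    have "((\<lambda>y. \<rho> (x - y)) has_real_derivative - deriv \<rho> (x - y)) (at y)"
      using test_function_has_derivative[OF test_function_reflect[OF \<rho>, of x], of y]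
      unfolding deriv_reflect(1)[OF \<rho>] .
    from has_vector_derivative_scaleR[OF this F[of y]] show ?thesis
      by (rule has_vector_derivative_eq_rhs) (simp add: p_def scaleR_conv_of_real)
  qed
  have out: "\<rho> (x - y) = 0" "deriv \<rho> (x - y) = 0" if "y \<notin> {-R<..<R}" for y
    using that by (auto simp: R_def abs_if intro!: r r' split: if_splits)
  have "has_bochner_integral lborel (\<lambda>y. indicator {-R..R} y *\<^sub>R p y) (\<rho> (x - R) *\<^sub>R F R - \<rho> (x - (- R)) *\<^sub>R F (- R))"
    by (rule has_bochner_integral_FTC_Icc)
      (use has_vector_derivative_at_within[OF dp] continuous_on_subset[OF cp] in \<open>auto simp: R_def\<close>)
  moreover have "(\<lambda>y. indicator {-R..R} y *\<^sub>R p y) = p"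
  proof
    fix y show "indicator {-R..R} y *\<^sub>R p y = p y"
      using out[of y] by (cases "y \<in> {-R<..<R}") (auto simp: p_def indicator_def)
  qed
  moreover have "\<rho> (x - R) = 0" "\<rho> (x - (- R)) = 0" using out(1)[of R] out(1)[of "- R"] by simp_all
  ultimately have z: "(\<integral>y. p y \<partial>lborel) = 0" by (simp add: has_bochner_integral_iff)
  have cs: "integrable lborel (\<lambda>y. g y)" if "continuous_on UNIV g" "\<And>y. y \<notin> {-R<..<R} \<Longrightarrow> g y = 0" for g :: "real \<Rightarrow> complex"
  proof -
    have "set_integrable lborel {-R..R} g"
      by (rule borel_integrable_atLeastAtMost') (rule continuous_on_subset[OF that(1)], simp)
    moreover have "(\<lambda>y. indicator {-R..R} y *\<^sub>R g y) = g"
    proof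
      fix y show "indicator {-R..R} y *\<^sub>R g y = g y"
        using that(2)[of y] by (cases "y \<in> {-R<..<R}") (auto simp: indicator_def)
    qed
    ultimately show ?thesis by (simp add: set_integrable_def)
  qed
  have "(\<integral>y. p y \<partial>lborel) = (\<integral>y. of_real (\<rho> (x - y)) * F' y \<partial>lborel) - (\<integral>y. of_real (deriv \<rho> (x - y)) * F y \<partial>lborel)"
    unfolding p_def
  proof (rule Bochner_Integration.integral_diff)
    show "integrable lborel (\<lambda>y. of_real (\<rho> (x - y)) * F' y)"
      by (rule cs) (intro continuous_intros c c\<rho>, simp add: out)
    show "integrable lborel (\<lambda>y. of_real (deriv \<rho> (x - y)) * F y)"
      by (rule cs) (intro continuous_intros cF c\<rho>, simp add: out)
  qed
  then show ?thesis using z by (simp add: convol_def)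
qed

section \<open>The shear flow and its evolution equation in weak form\<close>

locale monotone_shear =
  fixes b :: "real \<Rightarrow> real" and k :: int and c\<^sub>m :: real
  assumes k: "k \<noteq> 0"
    and b_diff: "b differentiable_on UNIV"
    and cm: "0 < c\<^sub>m"
    and b'_bounds: "\<And>y. c\<^sub>m \<le> deriv b y \<and> deriv b y \<le> inverse c\<^sub>m"
    and b'_diff: "deriv b differentiable_on UNIV"
    and b''_sq: "square_integrable (\<lambda>y. of_real (deriv (deriv b) y))"
begin

definition "\<kappa> = \<bar>real_of_int k\<bar>"

abbreviation "b'' \<equiv> deriv (deriv b)"

text \<open>The nonlocal part of the Rayleigh operator, \<open>b''\<close> times the Helmholtz
  inverse. It is bounded, so all unboundedness of the inviscid operator lies in the multiplication
  by \<open>b\<close>.\<close>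

definition T :: "l2 \<Rightarrow> l2" where "T = l2_mconv b'' (green \<kappa>)"

definition "T_bound = L2_norm (\<lambda>y. complex_of_real (b'' y)) * L2_norm (\<lambda>y. complex_of_real (green \<kappa> y))"

lemma \<kappa>: "0 < \<kappa>"
  using k by (simp add: \<kappa>_def)

lemma T_bound_nonneg: "0 \<le> T_bound"
  by (simp add: T_bound_def)

lemma T_linear: "bounded_linear T" and T_norm: "norm (T u) \<le> T_bound * norm u"
  unfolding T_def T_bound_def by (rule bounded_linear_l2_mconv[OF b''_sq bounded_kernel_green[OF \<kappa>]])+

lemma T_abs: "square_integrable f \<Longrightarrow> T (abs_l2 f) = abs_l2 (\<lambda>y. of_real (b'' y) * convol (green \<kappa>) f y)"
  unfolding T_def by (rule l2_mconv_abs[OF b''_sq bounded_kernel_green[OF \<kappa>]])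

lemma T_cmult: "T (l2_cmult z u) = l2_cmult z (T u)"
  unfolding T_def by (rule l2_mconv_cmult[OF b''_sq bounded_kernel_green[OF \<kappa>]])

definition T_adj :: "l2 \<Rightarrow> l2" where
  "T_adj = (SOME S. \<forall>x y. T x \<bullet> y = x \<bullet> S y)"

lemma T_adj: "T x \<bullet> y = x \<bullet> T_adj y"
proof -
  have "\<exists>S. \<forall>x y. T x \<bullet> y = x \<bullet> S y" using hilbert_adjoint[OF T_linear] by metis
  then have "\<forall>x y. T x \<bullet> y = x \<bullet> T_adj y" unfolding T_adj_def by (rule someI_ex)
  then show ?thesis by blast
qed

lemma b_has_derivative: "(b has_real_derivative deriv b x) (at x)"
  by (rule differentiable_on_UNIV_deriv[OF b_diff])

lemma b_continuous: "continuous_on S b"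
  by (meson DERIV_isCont continuous_at_imp_continuous_on b_has_derivative)

lemma b_borel [measurable]: "b \<in> borel_measurable borel"
  by (rule borel_measurable_continuous_onI[OF b_continuous])

lemma b_lipschitz: "\<bar>b x - b y\<bar> \<le> inverse c\<^sub>m * \<bar>x - y\<bar>"
proof -
  have "norm (b x - b y) \<le> inverse c\<^sub>m * norm (x - y)"
  proof (rule field_differentiable_bound[of UNIV b "deriv b"])
    show "norm (deriv b z) \<le> inverse c\<^sub>m" for z using b'_bounds[of z] cm by simp
  qed (use b_has_derivative in simp_all)
  then show ?thesis by (simp only: real_norm_def)
qed

lemma square_integrable_b_test:
  assumes "test_function \<phi>"
  shows "square_integrable (\<lambda>y. of_real (b y * \<phi> y))"
proof (rule square_integrable_continuous_compact_support)
  show "continuous_on UNIV (\<lambda>y. complex_of_real (b y * \<phi> y))"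
    by (intro continuous_intros b_continuous test_function_continuous[OF assms])
  show "compactly_supported (\<lambda>y. of_real (b y * \<phi> y))"
    using assms by (auto simp: compactly_supported_def test_function_iff)
qed

lemma square_integrable_helmholtz_test:
  assumes "test_function \<phi>"
  shows "square_integrable (\<lambda>y. of_real (deriv (deriv \<phi>) y - (of_int k)\<^sup>2 * \<phi> y))"
proof -
  have "square_integrable (\<lambda>y. of_real (deriv (deriv \<phi>) y) - of_real ((of_int k)\<^sup>2) * of_real (\<phi> y))"
    by (intro square_integrable_diff square_integrable_cmult test_function_square_integrable test_function_deriv assms)
  then show ?thesis by (simp only: of_real_diff of_real_mult)
qed

text \<open>\<open>gen \<nu> u \<phi>\<close> is minus the Orr--Sommerfeld distribution of \<open>u\<close> tested against \<open>\<phi>\<close>.\<close>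

definition gen :: "real \<Rightarrow> l2 \<Rightarrow> (real \<Rightarrow> real) \<Rightarrow> complex" where
  "gen \<nu> u \<phi> = - (\<i> * of_int k) * (l2_pair u (\<lambda>y. of_real (b y * \<phi> y)) - l2_pair (T u) (\<lambda>y. of_real (\<phi> y)))
     + of_real \<nu> * l2_pair u (\<lambda>y. of_real (deriv (deriv \<phi>) y - (of_int k)\<^sup>2 * \<phi> y))"

lemma rayleigh_borel:
  assumes "square_integrable f"
  shows "rayleigh b k f \<in> borel_measurable borel"
proof -
  have "helmholtz_solution k f (helmholtz_inverse k f)"
    unfolding helmholtz_inverse_def
    by (rule someI[of "helmholtz_solution k f"], rule helmholtz_solution_green[OF k assms])
  then have "square_integrable (helmholtz_inverse k f)" by (simp add: helmholtz_solution_def sobolev_def)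
  note [measurable] = square_integrable_borel[OF this] square_integrable_borel[OF assms] square_integrable_borel[OF b''_sq]
  show ?thesis unfolding rayleigh_def[abs_def]
    by (intro borel_measurable_diff borel_measurable_times borel_measurable_of_real) measurable
qed

lemma rayleigh_AE:
  assumes "square_integrable f"
  shows "AE y in lborel. rayleigh b k f y = of_real (b y) * f y - of_real (b'' y) * convol (green \<kappa>) f y"
  using helmholtz_inverse_green[OF k assms] unfolding rayleigh_def \<kappa>_def by eventually_elim simp

lemma rayleigh_AE_T:
  "AE y in lborel. rayleigh b k (rep_l2 u) y = of_real (b y) * rep_l2 u y - rep_l2 (T u) y"
proof -
  have "AE y in lborel. rep_l2 (T u) y = of_real (b'' y) * convol (green \<kappa>) (rep_l2 u) y"
    unfolding T_def l2_mconv_def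
    by (rule rep_abs_l2[OF square_integrable_mconv(1)[OF b''_sq bounded_kernel_green[OF \<kappa>] square_integrable_rep]])
  then show ?thesis using rayleigh_AE[OF square_integrable_rep[of u]] by eventually_elim simp
qed

lemma gen_orr_sommerfeld:
  assumes f: "square_integrable f" and \<phi>: "test_function \<phi>"
  shows "- orr_sommerfeld b k \<nu> f \<phi> = gen \<nu> (abs_l2 f) \<phi>"
proof -
  note sq\<phi> = test_function_square_integrable[OF \<phi>]
  define h where "h y = of_real (b'' y) * convol (green \<kappa>) f y" for y
  have sqh: "square_integrable h"
    unfolding h_def by (rule square_integrable_mconv(1)[OF b''_sq bounded_kernel_green[OF \<kappa>] f])
  define g where "g y = f y * of_real (b y * \<phi> y) - h y * of_real (\<phi> y)" for y
  have i1: "integrable lborel (\<lambda>y. f y * of_real (b y * \<phi> y))"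
    by (rule square_integrable_mult_integrable[OF f square_integrable_b_test[OF \<phi>]])
  have i2: "integrable lborel (\<lambda>y. h y * of_real (\<phi> y))"
    by (rule square_integrable_mult_integrable[OF sqh sq\<phi>])
  note [measurable] = rayleigh_borel[OF f] square_integrable_borel[OF sq\<phi>]
  have "(\<integral>y. rayleigh b k f y * of_real (\<phi> y) \<partial>lborel) = (\<integral>y. g y \<partial>lborel)"
  proof (rule integral_cong_AE)
    show "(\<lambda>y. rayleigh b k f y * of_real (\<phi> y)) \<in> borel_measurable lborel"
      by (intro borel_measurable_times) measurable
    show "g \<in> borel_measurable lborel"
      unfolding g_def[abs_def] by (intro borel_measurable_integrable Bochner_Integration.integrable_diff i1 i2)
    show "AE y in lborel. rayleigh b k f y * of_real (\<phi> y) = g y"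
      using rayleigh_AE[OF f]
    proof eventually_elim
      case (elim y)
      show ?case unfolding elim by (simp add: g_def h_def algebra_simps)
    qed
  qed
  also have "\<dots> = l2_pair (abs_l2 f) (\<lambda>y. of_real (b y * \<phi> y)) - l2_pair (T (abs_l2 f)) (\<lambda>y. of_real (\<phi> y))"
    unfolding g_def Bochner_Integration.integral_diff[OF i1 i2] T_abs[OF f] h_def[symmetric]
      l2_pair_abs[OF f square_integrable_b_test[OF \<phi>]] l2_pair_abs[OF sqh sq\<phi>] ..
  finally have 1: "(\<integral>y. rayleigh b k f y * of_real (\<phi> y) \<partial>lborel)
      = l2_pair (abs_l2 f) (\<lambda>y. of_real (b y * \<phi> y)) - l2_pair (T (abs_l2 f)) (\<lambda>y. of_real (\<phi> y))" .
  show ?thesis unfolding orr_sommerfeld_def gen_def 1 l2_pair_abs[OF f square_integrable_helmholtz_test[OF \<phi>]]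
    by simp
qed

definition weak_solution :: "real \<Rightarrow> (real \<Rightarrow> l2) \<Rightarrow> bool" where
  "weak_solution \<nu> u \<longleftrightarrow> (\<forall>\<phi>. test_function \<phi> \<longrightarrow> (\<forall>t\<ge>0.
     ((\<lambda>s. l2_pair (u s) (\<lambda>y. of_real (\<phi> y))) has_vector_derivative gen \<nu> (u t) \<phi>) (at t within {0..})))"

text \<open>Together with the lemma after it, this makes solutions as functions and continuous weak
  solutions in \<open>l2\<close> interchangeable: existence is transferred in one direction, the
  lower bound in the other.\<close>

lemma orr_sommerfeld_solution_l2:
  assumes s: "orr_sommerfeld_solution b k \<nu> f \<omega>" and f: "square_integrable f"
  shows "continuous_on {0..} (\<lambda>t. abs_l2 (\<omega> t))" "abs_l2 (\<omega> 0) = abs_l2 f" "weak_solution \<nu> (\<lambda>t. abs_l2 (\<omega> t))"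
proof -
  have sq: "square_integrable (\<omega> t)" if "0 \<le> t" for t using s that by (simp add: orr_sommerfeld_solution_def)
  show "continuous_on {0..} (\<lambda>t. abs_l2 (\<omega> t))" unfolding continuous_on_def
  proof
    fix t :: real assume "t \<in> {0..}"
    then have t: "0 \<le> t" by simp
    have "((\<lambda>s. L2_norm (\<lambda>y. \<omega> s y - \<omega> t y)) \<longlongrightarrow> 0) (at t within {0..})"
      using s t by (simp add: orr_sommerfeld_solution_def)
    moreover have "\<forall>\<^sub>F s in at t within {0..}. L2_norm (\<lambda>y. \<omega> s y - \<omega> t y) = norm (abs_l2 (\<omega> s) - abs_l2 (\<omega> t))"
      unfolding eventually_at_filter
      by (intro always_eventually allI impI)
        (simp add: abs_l2_diff[OF sq sq] norm_abs_l2[OF square_integrable_diff[OF sq sq]] t)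
    ultimately have "((\<lambda>s. norm (abs_l2 (\<omega> s) - abs_l2 (\<omega> t))) \<longlongrightarrow> 0) (at t within {0..})"
      by (rule Lim_transform_eventually)
    then show "((\<lambda>s. abs_l2 (\<omega> s)) \<longlongrightarrow> abs_l2 (\<omega> t)) (at t within {0..})"
      by (rule LIM_zero_cancel[OF tendsto_norm_zero_cancel])
  qed
  have "AE y in lborel. \<omega> 0 y = f y" using s by (simp add: orr_sommerfeld_solution_def)
  then show "abs_l2 (\<omega> 0) = abs_l2 f" using sq[of 0] f by (simp add: abs_l2_eq_iff)
  show "weak_solution \<nu> (\<lambda>t. abs_l2 (\<omega> t))" unfolding weak_solution_def
  proof (intro allI impI)
    fix \<phi> and t :: real assume \<phi>: "test_function \<phi>" and t: "0 \<le> t"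
    have "((\<lambda>s. \<integral>y. \<omega> s y * of_real (\<phi> y) \<partial>lborel) has_vector_derivative gen \<nu> (abs_l2 (\<omega> t)) \<phi>) (at t within {0..})"
      unfolding gen_orr_sommerfeld[OF sq[OF t] \<phi>, symmetric]
      using s \<phi> t by (simp add: orr_sommerfeld_solution_def)
    then show "((\<lambda>s. l2_pair (abs_l2 (\<omega> s)) (\<lambda>y. of_real (\<phi> y))) has_vector_derivative gen \<nu> (abs_l2 (\<omega> t)) \<phi>) (at t within {0..})"
      by (rule has_vector_derivative_transform[rotated 2])
        (use t in \<open>simp_all add: l2_pair_abs[OF sq test_function_square_integrable[OF \<phi>]]\<close>)
  qed
qed

lemma l2_orr_sommerfeld_solution:
  assumes c: "continuous_on {0..} u" and w: "weak_solution \<nu> u" and u0: "u 0 = abs_l2 f" and f: "square_integrable f"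
  shows "orr_sommerfeld_solution b k \<nu> f (\<lambda>t. rep_l2 (u t))"
  unfolding orr_sommerfeld_solution_def
proof (intro conjI allI impI)
  show "AE y in lborel. rep_l2 (u 0) y = f y" unfolding u0 by (rule rep_abs_l2[OF f])
  fix t :: real assume t: "0 \<le> t"
  have "(u \<longlongrightarrow> u t) (at t within {0..})" using c t by (simp add: continuous_on_def)
  then have "((\<lambda>s. norm (u s - u t)) \<longlongrightarrow> 0) (at t within {0..})"
    by (rule tendsto_norm_zero[OF LIM_zero])
  moreover have "norm (u s - u t) = L2_norm (\<lambda>y. rep_l2 (u s) y - rep_l2 (u t) y)" for s
  proof -
    have "abs_l2 (\<lambda>y. rep_l2 (u s) y - rep_l2 (u t) y) = u s - u t"
      using abs_l2_diff[OF square_integrable_rep[of "u s"] square_integrable_rep[of "u t"]] by simp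
    then show ?thesis
      using norm_abs_l2[OF square_integrable_diff[OF square_integrable_rep[of "u s"] square_integrable_rep[of "u t"]]] by simp
  qed
  ultimately show "((\<lambda>s. L2_norm (\<lambda>y. rep_l2 (u s) y - rep_l2 (u t) y)) \<longlongrightarrow> 0) (at t within {0..})" by simp
  fix \<phi> assume \<phi>: "test_function \<phi>"
  show "((\<lambda>s. \<integral>y. rep_l2 (u s) y * of_real (\<phi> y) \<partial>lborel) has_vector_derivative - orr_sommerfeld b k \<nu> (rep_l2 (u t)) \<phi>) (at t within {0..})"
    using w[unfolded weak_solution_def l2_pair_def, rule_format, OF \<phi> t]
    unfolding gen_orr_sommerfeld[OF square_integrable_rep \<phi>] abs_rep_l2 .
qed (rule square_integrable_rep)

text \<open>The adjoint of the generator applied to \<open>z \<phi>\<close>. It is an element of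
  \<open>l2\<close> because \<open>\<phi>\<close> has compact support, which tames \<open>b\<close>
  and the second derivative, and because \<open>T_adj\<close> acts on all of
  \<open>l2\<close>.\<close>

definition gen_adj :: "real \<Rightarrow> complex \<Rightarrow> (real \<Rightarrow> real) \<Rightarrow> l2" where
  "gen_adj \<nu> z \<phi> = abs_l2 (\<lambda>y. (z * (\<i> * of_int k)) * of_real (b y * \<phi> y))
     + T_adj (abs_l2 (\<lambda>y. (z * (- \<i> * of_int k)) * of_real (\<phi> y)))
     + abs_l2 (\<lambda>y. (z * of_real \<nu>) * of_real (deriv (deriv \<phi>) y - (of_int k)\<^sup>2 * \<phi> y))"

lemma gen_adj:
  assumes \<phi>: "test_function \<phi>"
  shows "Re (cnj z * gen \<nu> u \<phi>) = u \<bullet> gen_adj \<nu> z \<phi>"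
  unfolding gen_adj_def inner_add_right T_adj[symmetric]
    inner_real_test[OF square_integrable_b_test[OF \<phi>]] inner_real_test[OF test_function_square_integrable[OF \<phi>]]
    inner_real_test[OF square_integrable_helmholtz_test[OF \<phi>]] plus_complex.sel(1)[symmetric] gen_def
  by (rule arg_cong[where f=Re]) (simp add: algebra_simps)

text \<open>The two values of \<open>z\<close> give the real and imaginary parts of the equation. In
  this form, inner products with fixed vectors, weak limits of solutions can be taken.\<close>

lemma weak_solution_inner:
  "weak_solution \<nu> u \<longleftrightarrow> (\<forall>\<phi> z t. test_function \<phi> \<and> z \<in> {1, \<i>} \<and> 0 \<le> t \<longrightarrow>
     ((\<lambda>s. u s \<bullet> abs_l2 (\<lambda>y. z * of_real (\<phi> y))) has_real_derivative u t \<bullet> gen_adj \<nu> z \<phi>) (at t within {0..}))"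
proof -
  have "((\<lambda>s. l2_pair (u s) (\<lambda>y. of_real (\<phi> y))) has_vector_derivative gen \<nu> (u t) \<phi>) (at t within {0..}) \<longleftrightarrow>
      (\<forall>z\<in>{1, \<i>}. ((\<lambda>s. u s \<bullet> abs_l2 (\<lambda>y. z * of_real (\<phi> y))) has_real_derivative u t \<bullet> gen_adj \<nu> z \<phi>) (at t within {0..}))"
    if \<phi>: "test_function \<phi>" for \<phi> t
    unfolding has_vector_derivative_complex_iff
    using inner_real_test[OF test_function_square_integrable[OF \<phi>]]
    by (simp add: gen_adj[OF \<phi>, symmetric])
  then show ?thesis unfolding weak_solution_def by blast
qed

end

section \<open>A bounded substitute for the second derivative\<close>

lemma abs_l2_uminus: "square_integrable f \<Longrightarrow> abs_l2 (\<lambda>y. - f y) = - abs_l2 f"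
  by (simp add: uminus_l2.abs_eq l2_rel_self)

lemma mollifier_reflect:
  assumes "mollifier \<epsilon> \<rho>"
  shows "mollifier \<epsilon> (\<lambda>z. \<rho> (- z))"
  unfolding mollifier_def
proof (intro conjI allI impI)
  note M = mollifierD[OF assms]
  show "test_function (\<lambda>z. \<rho> (- z))" using test_function_reflect[OF M(1), of 0] by simp
  show "(\<integral>z. \<rho> (- z) \<partial>lborel) = 1" using M(7)[of 0] by simp
qed (use mollifierD[OF assms] in simp_all)

text \<open>A bounded symmetric nonpositive approximation of the second derivative.\<close>

definition l2_laplace :: "(real \<Rightarrow> real) \<Rightarrow> l2 \<Rightarrow> l2" where
  "l2_laplace \<rho> u = l2_convol (\<lambda>z. - deriv \<rho> (- z)) (l2_convol (deriv \<rho>) u)"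

lemma bounded_kernel_deriv:
  assumes "test_function \<rho>"
  shows "bounded_kernel (deriv \<rho>)" "bounded_kernel (\<lambda>z. - deriv \<rho> (- z))"
proof -
  show 1: "bounded_kernel (deriv \<rho>)" by (intro test_function_bounded_kernel test_function_deriv assms)
  show "bounded_kernel (\<lambda>z. - deriv \<rho> (- z))"
    using bounded_kernel_reflect[OF 1, of 0] by (simp add: bounded_kernel_def)
qed

lemma bounded_linear_l2_laplace: "test_function \<rho> \<Longrightarrow> bounded_linear (l2_laplace \<rho>)"
  unfolding l2_laplace_def[abs_def]
  by (intro bounded_linear_compose[OF bounded_linear_l2_convol bounded_linear_l2_convol] bounded_kernel_deriv)

lemma inner_l2_laplace:
  assumes "test_function \<rho>"
  shows "l2_laplace \<rho> u \<bullet> v = - (l2_convol (deriv \<rho>) u \<bullet> l2_convol (deriv \<rho>) v)"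
proof -
  note B = bounded_kernel_deriv[OF assms]
  have "convol (\<lambda>z. - deriv \<rho> z) (rep_l2 v) = (\<lambda>x. - convol (deriv \<rho>) (rep_l2 v) x)"
    by (simp add: convol_def fun_eq_iff)
  then have "l2_convol (\<lambda>z. - deriv \<rho> z) v = - l2_convol (deriv \<rho>) v"
    unfolding l2_convol_def by (simp add: abs_l2_uminus young_inequality(1)[OF B(1)])
  then show ?thesis unfolding l2_laplace_def inner_l2_convol[OF B(2)] by simp
qed

text \<open>On test vectors both derivatives move onto the function and leave a twice mollified
  second derivative, which converges in norm.\<close>

lemma l2_laplace_test:
  assumes m: "mollifier \<epsilon> \<rho>" and \<phi>: "test_function \<phi>"
  shows "l2_laplace \<rho> (abs_l2 (\<lambda>y. z * of_real (\<phi> y)))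
    = l2_convol (\<lambda>z. \<rho> (- z)) (l2_convol \<rho> (abs_l2 (\<lambda>y. z * of_real (deriv (deriv \<phi>) y))))"
proof -
  note M = mollifierD[OF m] and M' = mollifierD[OF mollifier_reflect[OF m]]
  note B = bounded_kernel_deriv[OF M(1)]
  note \<phi>' = test_function_deriv[OF \<phi>]
  note \<phi>'' = test_function_deriv[OF \<phi>']
  have sq: "square_integrable (\<lambda>y. z * of_real (\<eta> y))" if "test_function \<eta>" for \<eta>
    by (intro square_integrable_cmult test_function_square_integrable that)
  have d: "((\<lambda>y. z * of_real (\<eta> y)) has_vector_derivative z * of_real (deriv \<eta> x)) (at x)" if "test_function \<eta>" for \<eta> x
    using test_function_has_derivative[OF that, of x]
    by (intro has_vector_derivative_mult_right has_vector_derivative_of_real)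
      (simp add: has_real_derivative_iff_has_vector_derivative)
  have c: "continuous_on UNIV (\<lambda>y. z * of_real (\<eta> y))" if "test_function \<eta>" for \<eta>
    by (intro continuous_intros test_function_continuous that)
  have 1: "convol (deriv \<rho>) (\<lambda>y. z * of_real (\<eta> y)) = convol \<rho> (\<lambda>y. z * of_real (deriv \<eta> y))"
    if "test_function \<eta>" for \<eta>
    by (rule ext, rule convol_integration_by_parts[OF M(1) d c]) (intro that test_function_deriv)+
  define F where "F = convol \<rho> (\<lambda>y. z * of_real (deriv \<phi> y))"
  define F' where "F' = convol \<rho> (\<lambda>y. z * of_real (deriv (deriv \<phi>) y))"
  have dF: "(F has_vector_derivative F' x) (at x)" for x
    using convol_has_vector_derivative[OF M(1) sq[OF \<phi>'], of x] unfolding F_def F'_def 1[OF \<phi>'] .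
  have cF': "continuous_on UNIV F'" unfolding F'_def
    by (intro continuous_at_imp_continuous_on ballI
        has_vector_derivative_continuous[OF convol_has_vector_derivative[OF M(1) sq[OF \<phi>'']]])
  have dr: "deriv (\<lambda>z. \<rho> (- z)) = (\<lambda>z. - deriv \<rho> (- z))"
    using deriv_reflect(1)[OF M(1), of 0] by simp
  have 2: "convol (\<lambda>z. - deriv \<rho> (- z)) F = convol (\<lambda>z. \<rho> (- z)) F'"
    unfolding dr[symmetric] by (rule ext, rule convol_integration_by_parts[OF M'(1) dF cF'])
  have "l2_laplace \<rho> (abs_l2 (\<lambda>y. z * of_real (\<phi> y))) = l2_convol (\<lambda>z. - deriv \<rho> (- z)) (abs_l2 F)"
    unfolding l2_laplace_def l2_convol_abs[OF B(1) sq[OF \<phi>]] 1[OF \<phi>] F_def ..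
  also have "\<dots> = abs_l2 (convol (\<lambda>z. \<rho> (- z)) F')"
    unfolding 2[symmetric] F_def by (rule l2_convol_abs[OF B(2) young_inequality(1)[OF M(6) sq[OF \<phi>']]])
  also have "\<dots> = l2_convol (\<lambda>z. \<rho> (- z)) (abs_l2 F')"
    unfolding F'_def by (rule l2_convol_abs[OF M'(6) young_inequality(1)[OF M(6) sq[OF \<phi>'']], symmetric])
  also have "abs_l2 F' = l2_convol \<rho> (abs_l2 (\<lambda>y. z * of_real (deriv (deriv \<phi>) y)))"
    unfolding F'_def by (rule l2_convol_abs[OF M(6) sq[OF \<phi>''], symmetric])
  finally show ?thesis .
qed

lemma l2_mollify_twice_tendsto:
  assumes m: "\<And>n. mollifier (e n) (\<rho> n)" and e: "e \<longlonglongrightarrow> 0"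
  shows "(\<lambda>n. l2_convol (\<lambda>z. \<rho> n (- z)) (l2_convol (\<rho> n) u)) \<longlonglongrightarrow> u"
proof (rule Lim_null[THEN iffD2], rule Lim_null_comparison)
  note t1 = l2_mollify_tendsto[OF m e, of u]
  note t2 = l2_mollify_tendsto[OF mollifier_reflect[OF m] e, of u]
  have "(\<lambda>n. norm (l2_convol (\<rho> n) u - u) + norm (l2_convol (\<lambda>z. \<rho> n (- z)) u - u)) \<longlonglongrightarrow> 0 + 0"
    by (intro tendsto_add tendsto_norm_zero LIM_zero t1 t2)
  then show "(\<lambda>n. norm (l2_convol (\<rho> n) u - u) + norm (l2_convol (\<lambda>z. \<rho> n (- z)) u - u)) \<longlonglongrightarrow> 0" by simp
  have "norm (l2_convol (\<lambda>z. \<rho> n (- z)) (l2_convol (\<rho> n) u) - u)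
      \<le> norm (l2_convol (\<rho> n) u - u) + norm (l2_convol (\<lambda>z. \<rho> n (- z)) u - u)" for n
  proof -
    note M' = mollifierD[OF mollifier_reflect[OF m[of n]]]
    have "l2_convol (\<lambda>z. \<rho> n (- z)) (l2_convol (\<rho> n) u) - u
        = l2_convol (\<lambda>z. \<rho> n (- z)) (l2_convol (\<rho> n) u - u) + (l2_convol (\<lambda>z. \<rho> n (- z)) u - u)"
      by (simp add: l2_convol_diff[OF M'(6)])
    then have "norm (l2_convol (\<lambda>z. \<rho> n (- z)) (l2_convol (\<rho> n) u) - u)
        \<le> norm (l2_convol (\<lambda>z. \<rho> n (- z)) (l2_convol (\<rho> n) u - u)) + norm (l2_convol (\<lambda>z. \<rho> n (- z)) u - u)"
      by (simp only: norm_triangle_ineq)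
    then show ?thesis using norm_l2_convol[OF M'(6), of "l2_convol (\<rho> n) u - u"] unfolding M'(5) by linarith
  qed
  then show "\<forall>\<^sub>F n in sequentially. norm (l2_convol (\<lambda>z. \<rho> n (- z)) (l2_convol (\<rho> n) u) - u)
      \<le> norm (l2_convol (\<rho> n) u - u) + norm (l2_convol (\<lambda>z. \<rho> n (- z)) u - u)" by (intro always_eventually allI)
qed

lemma test_vector_split:
  assumes "test_function \<phi>" "test_function \<eta>"
  shows "abs_l2 (\<lambda>y. Complex (\<phi> y) (\<eta> y)) = abs_l2 (\<lambda>y. 1 * of_real (\<phi> y)) + abs_l2 (\<lambda>y. \<i> * of_real (\<eta> y))"
proof -
  have "(\<lambda>y. Complex (\<phi> y) (\<eta> y)) = (\<lambda>y. 1 * of_real (\<phi> y) + \<i> * of_real (\<eta> y))"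
    by (simp add: fun_eq_iff complex_eq_iff)
  then show ?thesis
    by (simp only: abs_l2_add square_integrable_cmult test_function_square_integrable assms)
qed

lemma continuous_on_if_locally_lipschitz:
  fixes u :: "real \<Rightarrow> 'a::real_normed_vector"
  assumes L: "\<And>s t. 0 \<le> s \<Longrightarrow> s \<le> t \<Longrightarrow> L s \<le> L t"
    and lip: "\<And>s t. 0 \<le> s \<Longrightarrow> s \<le> t \<Longrightarrow> norm (u t - u s) \<le> L t * (t - s)"
  shows "continuous_on {0..} u"
  unfolding continuous_on_def
proof
  fix t :: real assume "t \<in> {0..}"
  then have t: "0 \<le> t" by simp
  have "norm (u s - u t) \<le> \<bar>L (t + 1)\<bar> * \<bar>s - t\<bar>" if s: "0 \<le> s" "\<bar>s - t\<bar> < 1" for s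
  proof (cases "s \<le> t")
    case True
    have "norm (u s - u t) \<le> L t * (t - s)" using lip[OF s(1) True] by (simp add: norm_minus_commute)
    also have "\<dots> \<le> \<bar>L (t + 1)\<bar> * (t - s)" using L[of t "t + 1"] t True by (intro mult_right_mono) auto
    finally show ?thesis using True by simp
  next
    case False
    then have "norm (u s - u t) \<le> L s * (s - t)" using lip[of t s] t by simp
    also have "\<dots> \<le> \<bar>L (t + 1)\<bar> * (s - t)" using L[of s "t + 1"] s False by (intro mult_right_mono) auto
    finally show ?thesis using False by simp
  qed
  moreover have "\<forall>\<^sub>F s in at t within {0..}. 0 \<le> s \<and> \<bar>s - t\<bar> < 1"
    unfolding eventually_at by (intro exI[of _ 1]) (auto simp: dist_real_def)
  ultimately have ev: "\<forall>\<^sub>F s in at t within {0..}. norm (u s - u t) \<le> \<bar>L (t + 1)\<bar> * \<bar>s - t\<bar>"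
    by (auto elim: eventually_mono)
  have "((\<lambda>s. \<bar>L (t + 1)\<bar> * \<bar>s - t\<bar>) \<longlongrightarrow> \<bar>L (t + 1)\<bar> * \<bar>t - t\<bar>) (at t within {0..})"
    by (intro tendsto_intros)
  then have "((\<lambda>s. u s - u t) \<longlongrightarrow> 0) (at t within {0..})"
    by (intro Lim_null_comparison[OF ev]) simp
  then show "(u \<longlongrightarrow> u t) (at t within {0..})" by (rule LIM_zero_cancel)
qed

section \<open>Existence of weak solutions by bounded approximation\<close>

context monotone_shear
begin

lemma gen_adj_tendsto:
  assumes "\<nu> \<longlonglongrightarrow> \<nu>'" and \<phi>: "test_function \<phi>"
  shows "(\<lambda>n. gen_adj (\<nu> n) z \<phi>) \<longlonglongrightarrow> gen_adj \<nu>' z \<phi>"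
proof -
  define h where "h y = z * of_real (deriv (deriv \<phi>) y - (of_int k)\<^sup>2 * \<phi> y)" for y
  have sq: "square_integrable h" unfolding h_def by (intro square_integrable_cmult square_integrable_helmholtz_test \<phi>)
  have "abs_l2 (\<lambda>y. (z * of_real a) * of_real (deriv (deriv \<phi>) y - (of_int k)\<^sup>2 * \<phi> y)) = a *\<^sub>R abs_l2 h" for a
    unfolding abs_l2_scaleR[OF sq] by (rule arg_cong[where f=abs_l2]) (simp add: h_def fun_eq_iff scaleR_conv_of_real)
  then show ?thesis unfolding gen_adj_def by (simp only:) (intro tendsto_intros assms(1))
qed

text \<open>The truncation is real, so multiplication by it still drops out of the energy, and on
  any fixed compact set it agrees with \<open>b\<close> once \<open>n\<close> is large.\<close>

definition "clip n y = max (- real n) (min (b y) (real n))"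

lemma clip_borel [measurable]: "clip n \<in> borel_measurable borel"
  unfolding clip_def[abs_def] by measurable

lemma clip_bounds: "\<bar>clip n y\<bar> \<le> real n" "\<bar>clip n y\<bar> \<le> \<bar>b y\<bar>"
  by (auto simp: clip_def)

text \<open>A bounded version of minus the Orr--Sommerfeld operator: \<open>b\<close> is truncated
  at \<open>n\<close> and the second derivative replaced by \<open>l2_laplace\<close>.\<close>

definition approx :: "(real \<Rightarrow> real) \<Rightarrow> nat \<Rightarrow> real \<Rightarrow> l2 \<Rightarrow> l2" where
  "approx \<rho> n \<nu> u = l2_mult (\<lambda>y. \<i> * of_real (- of_int k * clip n y)) u + l2_cmult (\<i> * of_int k) (T u)
     + \<nu> *\<^sub>R (l2_laplace \<rho> u - (of_int k)\<^sup>2 *\<^sub>R u)"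

definition approx_adj :: "(real \<Rightarrow> real) \<Rightarrow> nat \<Rightarrow> real \<Rightarrow> l2 \<Rightarrow> l2" where
  "approx_adj \<rho> n \<nu> v = l2_mult (\<lambda>y. \<i> * of_real (of_int k * clip n y)) v + T_adj (l2_cmult (- \<i> * of_int k) v)
     + \<nu> *\<^sub>R (l2_laplace \<rho> v - (of_int k)\<^sup>2 *\<^sub>R v)"

lemma clip_mult:
  "(\<lambda>y. \<i> * of_real (a * clip n y)) \<in> borel_measurable borel"
  "\<bar>a * clip n y\<bar> \<le> \<bar>a\<bar> * real n"
  "cmod (\<i> * of_real (a * clip n y)) \<le> \<bar>a\<bar> * real n"
proof -
  show "(\<lambda>y. \<i> * of_real (a * clip n y)) \<in> borel_measurable borel"
    by (intro borel_measurable_times borel_measurable_of_real) measurable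
  show 1: "\<bar>a * clip n y\<bar> \<le> \<bar>a\<bar> * real n"
    unfolding abs_mult by (intro mult_left_mono clip_bounds) simp
  then show "cmod (\<i> * of_real (a * clip n y)) \<le> \<bar>a\<bar> * real n" by (simp only: norm_mult norm_of_real norm_ii mult_1)
qed

lemma approx_linear:
  assumes "test_function \<rho>"
  shows "bounded_linear (approx \<rho> n \<nu>)"
  unfolding approx_def[abs_def]
  by (intro bounded_linear_add bounded_linear_l2_mult(1)[OF clip_mult(1,3)]
      bounded_linear_compose[OF bounded_linear_l2_mult(1) T_linear, of "\<lambda>_. \<i> * of_int k" "\<bar>of_int k\<bar>"]
      bounded_linear_compose[OF bounded_linear_scaleR_right] bounded_linear_sub
      bounded_linear_l2_laplace[OF assms] bounded_linear_scaleR_right)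
    (simp_all add: norm_mult)

lemma T_inner_le: "l2_cmult (\<i> * of_int k) (T u) \<bullet> u \<le> (\<kappa> * T_bound) * (norm u)\<^sup>2"
proof -
  have "l2_cmult (\<i> * of_int k) (T u) \<bullet> u \<le> norm (l2_cmult (\<i> * of_int k) (T u)) * norm u" by (rule norm_cauchy_schwarz)
  also have "norm (l2_cmult (\<i> * of_int k) (T u)) = \<kappa> * norm (T u)" by (simp add: norm_l2_cmult norm_mult \<kappa>_def)
  also have "\<kappa> * norm (T u) * norm u \<le> \<kappa> * (T_bound * norm u) * norm u"
    using \<kappa> by (intro mult_right_mono mult_left_mono T_norm) auto
  finally show ?thesis by (simp add: power2_eq_square mult.assoc)
qed

text \<open>The multiplication is skew and the regularised Laplacian nonpositive, so only
  \<open>T\<close> contributes, and the constant depends neither on the truncation nor on the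
  mollifier nor on \<open>\<nu>\<close>.\<close>

lemma approx_dissipative:
  assumes "test_function \<rho>" "0 \<le> \<nu>"
  shows "approx \<rho> n \<nu> u \<bullet> u \<le> (\<kappa> * T_bound) * (norm u)\<^sup>2"
proof -
  have "l2_mult (\<lambda>y. \<i> * of_real (- of_int k * clip n y)) u \<bullet> u = 0"
    by (rule inner_l2_mult_imaginary[OF clip_mult(1,2)])
  moreover have "(l2_laplace \<rho> u - (of_int k)\<^sup>2 *\<^sub>R u) \<bullet> u \<le> 0"
    unfolding inner_diff_left inner_l2_laplace[OF assms(1)] inner_scaleR_left
    using inner_ge_zero[of "l2_convol (deriv \<rho>) u"] mult_nonneg_nonneg[OF zero_le_power2[of "real_of_int k"] inner_ge_zero[of u]]
    by linarith
  then have "\<nu> * ((l2_laplace \<rho> u - (of_int k)\<^sup>2 *\<^sub>R u) \<bullet> u) \<le> 0" by (intro mult_nonneg_nonpos assms(2))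
  ultimately show ?thesis unfolding approx_def inner_add_left inner_scaleR_left using T_inner_le[of u] by linarith
qed

lemma approx_adj:
  assumes "test_function \<rho>"
  shows "approx \<rho> n \<nu> u \<bullet> v = u \<bullet> approx_adj \<rho> n \<nu> v"
proof -
  have 1: "l2_mult (\<lambda>y. \<i> * of_real (- of_int k * clip n y)) u \<bullet> v = u \<bullet> l2_mult (\<lambda>y. \<i> * of_real (of_int k * clip n y)) v"
    unfolding inner_l2_mult[OF clip_mult(1,3)] by simp
  have "l2_cmult (\<i> * of_int k) (T u) \<bullet> v = T u \<bullet> l2_cmult (cnj (\<i> * of_int k)) v"
    by (rule inner_l2_mult[of _ "\<bar>of_int k\<bar>"]) (simp_all add: norm_mult)
  then have 2: "l2_cmult (\<i> * of_int k) (T u) \<bullet> v = u \<bullet> T_adj (l2_cmult (- \<i> * of_int k) v)" by (simp add: T_adj)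
  have "l2_laplace \<rho> u \<bullet> v = u \<bullet> l2_laplace \<rho> v"
    using inner_l2_laplace[OF assms, of u v] inner_l2_laplace[OF assms, of v u] by (simp add: inner_commute)
  then show ?thesis unfolding approx_def approx_adj_def inner_add_left inner_add_right 1 2
    by (simp add: inner_diff_left inner_diff_right)
qed

text \<open>Convergence in norm takes place on the adjoint side, at test vectors; this is what
  weakly convergent solutions can be paired with. The truncation is eventually inactive on the
  support of \<open>\<phi>\<close>, and the Laplacian becomes a vanishing mollification of
  \<open>\<phi>''\<close>.\<close>

lemma approx_adj_tendsto:
  assumes m: "\<And>n. mollifier (e n) (\<rho> n)" "e \<longlonglongrightarrow> 0" and \<phi>: "test_function \<phi>"
  shows "(\<lambda>n. approx_adj (\<rho> n) n \<nu> (abs_l2 (\<lambda>y. z * of_real (\<phi> y)))) \<longlonglongrightarrow> gen_adj \<nu> z \<phi>"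
proof -
  define f where "f y = z * complex_of_real (\<phi> y)" for y
  have sqf: "square_integrable f" unfolding f_def by (intro square_integrable_cmult test_function_square_integrable \<phi>)
  have sq2: "square_integrable (\<lambda>y. z * of_real (deriv (deriv \<phi>) y))"
    by (intro square_integrable_cmult test_function_square_integrable test_function_deriv \<phi>)
  \<comment> \<open>In this form \<open>B\<close> bounds \<open>b\<close> wherever
    \<open>\<phi>\<close> does not vanish, without reference to the support.\<close>
  obtain B where B: "\<And>y. \<bar>b y * \<phi> y\<bar> \<le> B * \<bar>\<phi> y\<bar>"
  proof -
    obtain r where r: "\<And>y. r < \<bar>y\<bar> \<Longrightarrow> \<phi> y = 0" using \<phi> by (auto simp: test_function_iff)
    have "compact (b ` {-r..r})" by (intro compact_continuous_image b_continuous) simp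
    then obtain B where B: "\<And>y. y \<in> {-r..r} \<Longrightarrow> \<bar>b y\<bar> \<le> B"
      using compact_imp_bounded bounded_real by (metis imageI)
    have "\<bar>b y * \<phi> y\<bar> \<le> B * \<bar>\<phi> y\<bar>" for y
    proof (cases "y \<in> {-r..r}")
      case True
      then show ?thesis unfolding abs_mult by (intro mult_right_mono B) auto
    next
      case False
      then have "r < \<bar>y\<bar>" by (auto simp: abs_if)
      then show ?thesis using r by simp
    qed
    then show ?thesis by (rule that)
  qed
  have "\<forall>\<^sub>F n in sequentially. l2_mult (\<lambda>y. \<i> * of_real (of_int k * clip n y)) (abs_l2 f)
      = abs_l2 (\<lambda>y. (z * (\<i> * of_int k)) * of_real (b y * \<phi> y))"
  proof -
    obtain N where N: "B \<le> real N" using real_arch_simple by blast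
    have "l2_mult (\<lambda>y. \<i> * of_real (of_int k * clip n y)) (abs_l2 f)
      = abs_l2 (\<lambda>y. (z * (\<i> * of_int k)) * of_real (b y * \<phi> y))" if n: "N \<le> n" for n
    proof -
      have "clip n y * \<phi> y = b y * \<phi> y" for y
      proof (cases "\<phi> y = 0")
        case False
        have "\<bar>b y\<bar> * \<bar>\<phi> y\<bar> \<le> B * \<bar>\<phi> y\<bar>" using B[of y] by (simp only: abs_mult)
        then have "\<bar>b y\<bar> \<le> B" using False by simp
        then have "\<bar>b y\<bar> \<le> real n" using N n by linarith
        then show ?thesis by (simp add: clip_def abs_le_iff min_absorb1 max_absorb2)
      qed simp
      then have "of_real (clip n y) * complex_of_real (\<phi> y) = of_real (b y * \<phi> y)" for y by (simp only: of_real_mult[symmetric])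
      then have "\<i> * of_real (of_int k * clip n y) * f y = (z * (\<i> * of_int k)) * of_real (b y * \<phi> y)" for y
        unfolding f_def of_real_mult of_real_of_int_eq by (metis mult.assoc mult.commute)
      then show ?thesis by (simp only: l2_mult_abs[OF clip_mult(1,3) sqf])
    qed
    then show ?thesis unfolding eventually_sequentially by blast
  qed
  then have 1: "(\<lambda>n. l2_mult (\<lambda>y. \<i> * of_real (of_int k * clip n y)) (abs_l2 f))
      \<longlonglongrightarrow> abs_l2 (\<lambda>y. (z * (\<i> * of_int k)) * of_real (b y * \<phi> y))"
    by (rule tendsto_eventually)
  have "(\<lambda>y. - \<i> * of_int k * f y) = (\<lambda>y. (z * (- \<i> * of_int k)) * of_real (\<phi> y))"
    by (simp add: fun_eq_iff f_def)
  then have 2: "l2_cmult (- \<i> * of_int k) (abs_l2 f) = abs_l2 (\<lambda>y. (z * (- \<i> * of_int k)) * of_real (\<phi> y))"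
    by (simp only: l2_cmult_abs[OF sqf])
  have "(\<lambda>n. l2_laplace (\<rho> n) (abs_l2 f)) \<longlonglongrightarrow> abs_l2 (\<lambda>y. z * of_real (deriv (deriv \<phi>) y))"
    unfolding f_def l2_laplace_test[OF m(1) \<phi>] by (rule l2_mollify_twice_tendsto[OF m])
  then have "(\<lambda>n. \<nu> *\<^sub>R (l2_laplace (\<rho> n) (abs_l2 f) - (of_int k)\<^sup>2 *\<^sub>R abs_l2 f))
      \<longlonglongrightarrow> \<nu> *\<^sub>R (abs_l2 (\<lambda>y. z * of_real (deriv (deriv \<phi>) y)) - (of_int k)\<^sup>2 *\<^sub>R abs_l2 f)"
    by (intro tendsto_intros)
  also have "\<nu> *\<^sub>R (abs_l2 (\<lambda>y. z * of_real (deriv (deriv \<phi>) y)) - (of_int k)\<^sup>2 *\<^sub>R abs_l2 f)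
      = abs_l2 (\<lambda>y. (z * of_real \<nu>) * of_real (deriv (deriv \<phi>) y - (of_int k)\<^sup>2 * \<phi> y))"
    unfolding abs_l2_scaleR[OF sqf] abs_l2_diff[OF sq2 square_integrable_scaleR[OF sqf]]
      abs_l2_scaleR[OF square_integrable_diff[OF sq2 square_integrable_scaleR[OF sqf]]]
    by (rule arg_cong[where f=abs_l2]) (simp add: fun_eq_iff f_def scaleR_conv_of_real algebra_simps)
  finally have 3: "(\<lambda>n. \<nu> *\<^sub>R (l2_laplace (\<rho> n) (abs_l2 f) - (of_int k)\<^sup>2 *\<^sub>R abs_l2 f))
      \<longlonglongrightarrow> abs_l2 (\<lambda>y. (z * of_real \<nu>) * of_real (deriv (deriv \<phi>) y - (of_int k)\<^sup>2 * \<phi> y))" .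
  show ?thesis unfolding approx_adj_def gen_adj_def f_def[symmetric] 2
    by (intro tendsto_add tendsto_const 1 3)
qed

text \<open>This bounds the time derivative at time 0, uniformly in the approximation and in
  \<open>\<nu>\<close> up to 1, and is the source of the common Lipschitz bound
  \<open>L\<close>.\<close>

lemma approx_bounded:
  assumes m: "\<And>n. mollifier (e n) (\<rho> n)" "e \<longlonglongrightarrow> 0" and f: "f \<in> test_vectors"
  obtains B where "0 \<le> B" "\<And>n \<nu>. 0 \<le> \<nu> \<Longrightarrow> \<nu> \<le> 1 \<Longrightarrow> norm (approx (\<rho> n) n \<nu> f) \<le> B"
proof -
  have single: "\<exists>B. \<forall>n \<nu>. 0 \<le> \<nu> \<longrightarrow> \<nu> \<le> 1 \<longrightarrow> norm (approx (\<rho> n) n \<nu> (abs_l2 (\<lambda>y. z * of_real (\<phi> y)))) \<le> B"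
    if \<phi>: "test_function \<phi>" for z \<phi>
  proof -
    define g where "g y = z * complex_of_real (\<phi> y)" for y
    have sqg: "square_integrable g" unfolding g_def by (intro square_integrable_cmult test_function_square_integrable \<phi>)
    have "convergent (\<lambda>n. l2_laplace (\<rho> n) (abs_l2 g))"
      unfolding g_def l2_laplace_test[OF m(1) \<phi>] by (rule convergentI[OF l2_mollify_twice_tendsto[OF m]])
    then obtain D where D: "\<And>n. norm (l2_laplace (\<rho> n) (abs_l2 g)) \<le> D"
      using convergent_imp_Bseq Bseq_def by metis
    define h where "h y = complex_of_real (b y * \<phi> y)" for y
    have sqh: "square_integrable h" unfolding h_def by (rule square_integrable_b_test[OF \<phi>])
    define B where "B = \<kappa> * cmod z * L2_norm h + \<kappa> * (T_bound * norm (abs_l2 g)) + (D + \<kappa>\<^sup>2 * norm (abs_l2 g))"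
    have "norm (approx (\<rho> n) n \<nu> (abs_l2 g)) \<le> B" if \<nu>: "0 \<le> \<nu>" "\<nu> \<le> 1" for n \<nu>
    proof -
      note sqm = square_integrable_mult_bounded[OF sqg clip_mult(1,3)]
      have 1: "norm (l2_mult (\<lambda>y. \<i> * of_real (- of_int k * clip n y)) (abs_l2 g)) \<le> \<kappa> * cmod z * L2_norm h"
        unfolding l2_mult_abs[OF clip_mult(1,3) sqg] norm_abs_l2[OF sqm]
      proof (rule L2_norm_mono[OF sqh square_integrable_borel[OF sqm]])
        show "cmod (\<i> * of_real (- of_int k * clip n y) * g y) \<le> \<kappa> * cmod z * cmod (h y)" for y
        proof -
          have "\<bar>clip n y\<bar> * (\<kappa> * (cmod z * \<bar>\<phi> y\<bar>)) \<le> \<bar>b y\<bar> * (\<kappa> * (cmod z * \<bar>\<phi> y\<bar>))"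
            using \<kappa> by (intro mult_right_mono clip_bounds mult_nonneg_nonneg) auto
          then show ?thesis by (simp add: g_def h_def norm_mult abs_mult \<kappa>_def mult_ac)
        qed
      qed (use \<kappa> in simp)
      have 2: "norm (l2_cmult (\<i> * of_int k) (T (abs_l2 g))) \<le> \<kappa> * (T_bound * norm (abs_l2 g))"
        unfolding norm_l2_cmult using mult_left_mono[OF T_norm[of "abs_l2 g"], of \<kappa>] \<kappa> by (simp add: norm_mult \<kappa>_def)
      have "norm (l2_laplace (\<rho> n) (abs_l2 g) - (of_int k)\<^sup>2 *\<^sub>R abs_l2 g) \<le> D + \<kappa>\<^sup>2 * norm (abs_l2 g)"
        using norm_triangle_ineq4[of "l2_laplace (\<rho> n) (abs_l2 g)" "(of_int k)\<^sup>2 *\<^sub>R abs_l2 g"] D[of n]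
        by (simp add: \<kappa>_def)
      moreover have "\<nu> * norm (l2_laplace (\<rho> n) (abs_l2 g) - (of_int k)\<^sup>2 *\<^sub>R abs_l2 g)
          \<le> norm (l2_laplace (\<rho> n) (abs_l2 g) - (of_int k)\<^sup>2 *\<^sub>R abs_l2 g)"
        using \<nu> by (intro mult_left_le_one_le) auto
      ultimately have 3: "norm (\<nu> *\<^sub>R (l2_laplace (\<rho> n) (abs_l2 g) - (of_int k)\<^sup>2 *\<^sub>R abs_l2 g)) \<le> D + \<kappa>\<^sup>2 * norm (abs_l2 g)"
        using \<nu> by simp
      show ?thesis unfolding approx_def B_def
        by (rule order_trans[OF norm_triangle_ineq add_mono[OF order_trans[OF norm_triangle_ineq add_mono[OF 1 2]] 3]])
    qed
    then show ?thesis unfolding g_def by blast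
  qed
  obtain \<phi> \<eta> where t: "test_function \<phi>" "test_function \<eta>" and fe: "f = abs_l2 (\<lambda>y. Complex (\<phi> y) (\<eta> y))"
    using f unfolding test_vectors_def by blast
  obtain B1 where B1: "\<And>n \<nu>. 0 \<le> \<nu> \<Longrightarrow> \<nu> \<le> 1 \<Longrightarrow> norm (approx (\<rho> n) n \<nu> (abs_l2 (\<lambda>y. 1 * of_real (\<phi> y)))) \<le> B1"
    using single[OF t(1), of 1] by blast
  obtain B2 where B2: "\<And>n \<nu>. 0 \<le> \<nu> \<Longrightarrow> \<nu> \<le> 1 \<Longrightarrow> norm (approx (\<rho> n) n \<nu> (abs_l2 (\<lambda>y. \<i> * of_real (\<eta> y)))) \<le> B2"
    using single[OF t(2), of \<i>] by blast
  have bd: "norm (approx (\<rho> n) n \<nu> f) \<le> B1 + B2" if "0 \<le> \<nu>" "\<nu> \<le> 1" for n \<nu>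
    unfolding fe test_vector_split[OF t] linear_add[OF bounded_linear.linear[OF approx_linear[OF mollifierD(1)[OF m(1)]]]]
    by (rule order_trans[OF norm_triangle_ineq add_mono[OF B1[OF that] B2[OF that]]])
  then have "0 \<le> B1 + B2" using norm_ge_zero order_trans by (meson order_refl zero_le_one)
  then show ?thesis using bd by (rule that)
qed

text \<open>The order of quantifiers matters: \<open>L\<close> is obtained before
  \<open>\<nu>\<close>, so it can be used for a sequence of viscosities. Each solution is a weak
  limit of the flows of \<open>approx\<close>.\<close>

lemma evolution_exists:
  assumes f: "f \<in> test_vectors"
  obtains L where "\<And>t. 0 \<le> t \<Longrightarrow> 0 \<le> L t" "\<And>s t. 0 \<le> s \<Longrightarrow> s \<le> t \<Longrightarrow> L s \<le> L t"
    "\<And>\<nu>. 0 \<le> \<nu> \<Longrightarrow> \<nu> \<le> 1 \<Longrightarrow> \<exists>u. u 0 = f \<and> weak_solution \<nu> u \<and>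
       (\<forall>t\<ge>0. norm (u t) \<le> exp (\<kappa> * T_bound * t) * norm f) \<and>
       (\<forall>s t. 0 \<le> s \<longrightarrow> s \<le> t \<longrightarrow> norm (u t - u s) \<le> L t * (t - s))"
proof -
  have "\<exists>\<rho>. mollifier (1 / real (Suc n)) \<rho>" for n by (rule mollifier_exists[of "1 / real (Suc n)"]) auto
  then obtain \<rho> where \<rho>: "\<And>n. mollifier (1 / real (Suc n)) (\<rho> n)" by metis
  have e: "(\<lambda>n. 1 / real (Suc n)) \<longlonglongrightarrow> 0" using LIMSEQ_inverse_real_of_nat by (simp add: inverse_eq_divide)
  define C where "C = \<kappa> * T_bound"
  have C: "0 \<le> C" using \<kappa> T_bound_nonneg by (simp add: C_def)
  obtain B where B: "0 \<le> B" "\<And>n \<nu>. 0 \<le> \<nu> \<Longrightarrow> \<nu> \<le> 1 \<Longrightarrow> norm (approx (\<rho> n) n \<nu> f) \<le> B"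
    using approx_bounded[OF \<rho> e f] by blast
  define L where "L t = exp (C * t) * B" for t
  have L0: "0 \<le> L t" for t using B by (simp add: L_def)
  have Lm: "L s \<le> L t" if "s \<le> t" for s t
    unfolding L_def using that C B by (intro mult_right_mono) (simp_all add: mult_left_mono)
  show ?thesis
  proof (rule that[of L])
    fix \<nu> :: real assume \<nu>: "0 \<le> \<nu>" "\<nu> \<le> 1"
    have "\<exists>u. u 0 = f \<and> (\<forall>t. (u has_vector_derivative approx (\<rho> n) n \<nu> (u t)) (at t)) \<and>
        (\<forall>t\<ge>0. norm (u t) \<le> exp (C * t) * norm f) \<and>
        (\<forall>s t. 0 \<le> s \<longrightarrow> s \<le> t \<longrightarrow> norm (u t - u s) \<le> L t * (t - s))" for n
    proof -
      note M = mollifierD[OF \<rho>[of n]]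
      obtain u where u: "u 0 = f" "\<And>t. (u has_vector_derivative approx (\<rho> n) n \<nu> (u t)) (at t)"
        "\<And>t. 0 \<le> t \<Longrightarrow> norm (u t) \<le> exp (C * t) * norm f"
        "\<And>s t. 0 \<le> s \<Longrightarrow> s \<le> t \<Longrightarrow> norm (u t - u s) \<le> exp (C * t) * norm (approx (\<rho> n) n \<nu> f) * (t - s)"
        using dissipative_ode[OF approx_linear[OF M(1)] approx_dissipative[OF M(1) \<nu>(1)] C[unfolded C_def],
            where x=f, folded C_def] by blast
      have "norm (u t - u s) \<le> L t * (t - s)" if "0 \<le> s" "s \<le> t" for s t
      proof -
        have "exp (C * t) * norm (approx (\<rho> n) n \<nu> f) * (t - s) \<le> exp (C * t) * B * (t - s)"
          using that B(2)[OF \<nu>] by (intro mult_right_mono mult_left_mono) auto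
        then show ?thesis using u(4)[OF that] unfolding L_def by linarith
      qed
      then show ?thesis using u by blast
    qed
    then obtain u where u: "\<And>n. u n 0 = f" "\<And>n t. (u n has_vector_derivative approx (\<rho> n) n \<nu> (u n t)) (at t)"
      "\<And>n t. 0 \<le> t \<Longrightarrow> norm (u n t) \<le> exp (C * t) * norm f"
      "\<And>n s t. 0 \<le> s \<Longrightarrow> s \<le> t \<Longrightarrow> norm (u n t - u n s) \<le> L t * (t - s)" by metis
    define I where "I = {(\<phi>, z :: complex). test_function \<phi>}"
    define \<Phi> where "\<Phi> i = abs_l2 (\<lambda>y. snd i * of_real (fst i y))" for i :: "(real \<Rightarrow> real) \<times> complex"
    obtain v where v: "v 0 = f" "\<And>t. 0 \<le> t \<Longrightarrow> norm (v t) \<le> exp (C * t) * norm f"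
      "\<And>s t. 0 \<le> s \<Longrightarrow> s \<le> t \<Longrightarrow> norm (v t - v s) \<le> L t * (t - s)"
      "\<And>i t. i \<in> I \<Longrightarrow> 0 \<le> t \<Longrightarrow>
        ((\<lambda>s. v s \<bullet> \<Phi> i) has_real_derivative v t \<bullet> gen_adj \<nu> (snd i) (fst i)) (at t within {0..})"
    proof (rule weak_evolution_compactness[of u f L "\<lambda>t. exp (C * t) * norm f" I \<Phi>
          "\<lambda>n i. approx_adj (\<rho> n) n \<nu> (\<Phi> i)" "\<lambda>i. gen_adj \<nu> (snd i) (fst i)"])
      fix n i and t :: real
      have "((\<lambda>s. u n s \<bullet> \<Phi> i) has_vector_derivative approx (\<rho> n) n \<nu> (u n t) \<bullet> \<Phi> i) (at t within {0..})"
        by (rule bounded_linear.has_vector_derivative[OF bounded_linear_inner_left has_vector_derivative_at_within[OF u(2)]])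
      then show "((\<lambda>s. u n s \<bullet> \<Phi> i) has_real_derivative u n t \<bullet> approx_adj (\<rho> n) n \<nu> (\<Phi> i)) (at t within {0..})"
        unfolding approx_adj[OF mollifierD(1)[OF \<rho>]] has_real_derivative_iff_has_vector_derivative .
    next
      fix i assume "i \<in> I"
      then show "(\<lambda>n. approx_adj (\<rho> n) n \<nu> (\<Phi> i)) \<longlonglongrightarrow> gen_adj \<nu> (snd i) (fst i)"
        unfolding \<Phi>_def by (intro approx_adj_tendsto[OF \<rho> e]) (auto simp: I_def)
    qed (use u L0 Lm in blast)+
    have "weak_solution \<nu> v" unfolding weak_solution_inner
    proof (intro allI impI)
      fix \<phi> z and t :: real assume a: "test_function \<phi> \<and> z \<in> {1, \<i>} \<and> 0 \<le> t"
      then show "((\<lambda>s. v s \<bullet> abs_l2 (\<lambda>y. z * of_real (\<phi> y))) has_real_derivative v t \<bullet> gen_adj \<nu> z \<phi>) (at t within {0..})"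
        using v(4)[of "(\<phi>, z)" t] by (simp add: I_def \<Phi>_def)
    qed
    then show "\<exists>u. u 0 = f \<and> weak_solution \<nu> u \<and>
       (\<forall>t\<ge>0. norm (u t) \<le> exp (\<kappa> * T_bound * t) * norm f) \<and>
       (\<forall>s t. 0 \<le> s \<longrightarrow> s \<le> t \<longrightarrow> norm (u t - u s) \<le> L t * (t - s))"
      using v unfolding C_def by blast
  qed (use L0 Lm in simp_all)
qed

end

subsection \<open>Uniqueness by an energy estimate\<close>

lemma l2_mult_tendsto:
  assumes m: "\<And>n. m n \<in> borel_measurable borel" "\<And>n y. cmod (m n y) \<le> 1" and lim: "\<And>y. (\<lambda>n. m n y) \<longlonglongrightarrow> 1"
  shows "(\<lambda>n. l2_mult (m n) u) \<longlonglongrightarrow> u"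
proof -
  define f where "f = rep_l2 u"
  have sqf: "square_integrable f" by (simp add: f_def)
  note [measurable] = square_integrable_borel[OF sqf] m(1)
  have "(norm (l2_mult (m n) u - u))\<^sup>2 = (\<integral>y. (cmod (m n y * f y - f y))\<^sup>2 \<partial>lborel)" for n
  proof -
    note sqm = square_integrable_mult_bounded[OF sqf m(1,2), of n]
    have "l2_mult (m n) u - abs_l2 f = abs_l2 (\<lambda>y. m n y * f y - f y)"
      unfolding l2_mult_def f_def[symmetric] by (rule abs_l2_diff[OF sqm sqf])
    then have "norm (l2_mult (m n) u - u) = L2_norm (\<lambda>y. m n y * f y - f y)"
      using norm_abs_l2[OF square_integrable_diff[OF sqm sqf]] by (simp add: f_def)
    then show ?thesis by (simp only: L2_norm_square)
  qed
  moreover have "(\<lambda>n. \<integral>y. (cmod (m n y * f y - f y))\<^sup>2 \<partial>lborel) \<longlonglongrightarrow> (\<integral>y. 0 \<partial>(lborel :: real measure))"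
  proof (rule integral_dominated_convergence)
    show "integrable lborel (\<lambda>y. 4 * (cmod (f y))\<^sup>2)" using sqf by (simp add: square_integrable_def)
    show "AE y in lborel. (\<lambda>n. (cmod (m n y * f y - f y))\<^sup>2) \<longlonglongrightarrow> 0"
    proof (rule AE_I2)
      fix y
      have "(\<lambda>n. (cmod (m n y * f y - f y))\<^sup>2) \<longlonglongrightarrow> (cmod (1 * f y - f y))\<^sup>2" by (intro tendsto_intros lim)
      then show "(\<lambda>n. (cmod (m n y * f y - f y))\<^sup>2) \<longlonglongrightarrow> 0" by simp
    qed
    show "AE y in lborel. norm ((cmod (m n y * f y - f y))\<^sup>2) \<le> 4 * (cmod (f y))\<^sup>2" for n
    proof (rule AE_I2)
      fix y
      have "cmod (m n y * f y) \<le> 1 * cmod (f y)" unfolding norm_mult by (rule mult_right_mono[OF m(2)]) simp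
      then have "cmod (m n y * f y - f y) \<le> 2 * cmod (f y)" using norm_triangle_ineq4[of "m n y * f y" "f y"] by linarith
      then have "(cmod (m n y * f y - f y))\<^sup>2 \<le> (2 * cmod (f y))\<^sup>2" by (rule power_mono) simp
      then show "norm ((cmod (m n y * f y - f y))\<^sup>2) \<le> 4 * (cmod (f y))\<^sup>2" by (simp add: power_mult_distrib)
    qed
  qed measurable
  ultimately have "(\<lambda>n. (norm (l2_mult (m n) u - u))\<^sup>2) \<longlonglongrightarrow> 0" by simp
  then have "(\<lambda>n. sqrt ((norm (l2_mult (m n) u - u))\<^sup>2)) \<longlonglongrightarrow> sqrt 0" by (rule tendsto_real_sqrt)
  then have "(\<lambda>n. norm (l2_mult (m n) u - u)) \<longlonglongrightarrow> 0" by simp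
  then show ?thesis by (rule LIM_zero_cancel[OF tendsto_norm_zero_cancel])
qed

lemma integral_le_lebesgue:
  fixes h H :: "real \<Rightarrow> real"
  assumes h: "continuous_on {-R..R} h" and le: "\<And>x. x \<in> {-R..R} \<Longrightarrow> h x \<le> H x"
    and H: "integrable lborel H" "\<And>x. 0 \<le> H x"
  shows "integral {-R..R} h \<le> (\<integral>x. H x \<partial>lborel)"
proof -
  have i: "(H has_integral (\<integral>x. H x \<partial>lborel)) UNIV" by (rule has_integral_integral_lborel[OF H(1)])
  have j: "H integrable_on {-R..R}"
    using integrable_on_subcbox[of H UNIV "-R" R] i by (auto simp: has_integral_integrable)
  have "integral {-R..R} h \<le> integral {-R..R} H"
    by (rule integral_le[OF integrable_continuous_real[OF h] j le])
  also have "\<dots> \<le> integral UNIV H"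
    by (rule integral_subset_le) (use i j H in \<open>auto simp: has_integral_integrable\<close>)
  finally show ?thesis using i by (simp add: integral_unique)
qed

lemma kernel_translation_continuous:
  assumes m: "continuous_on UNIV m" and J: "test_function J"
  shows "continuous_on UNIV (\<lambda>x. abs_l2 (\<lambda>y. z * of_real (m y * J (x - y))))"
proof -
  obtain r where r: "\<And>y. r < \<bar>y\<bar> \<Longrightarrow> J y = 0" using J by (auto simp: test_function_iff)
  obtain B where B: "0 < B" "\<And>y. \<bar>deriv J y\<bar> \<le> B" using test_function_bounded[OF test_function_deriv[OF J]] by blast
  have lipJ: "\<bar>J a - J c\<bar> \<le> B * \<bar>a - c\<bar>" for a c
    using field_differentiable_bound[of UNIV J "deriv J" B a c] test_function_has_derivative[OF J] B(2)
    by (simp add: real_norm_def)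
  have sq: "square_integrable (\<lambda>y. z * of_real (m y * J (x - y)))" for x
  proof (intro square_integrable_cmult square_integrable_continuous_compact_support)
    show "continuous_on UNIV (\<lambda>y. complex_of_real (m y * J (x - y)))"
      by (intro continuous_intros m test_function_continuous test_function_reflect J)
    show "compactly_supported (\<lambda>y. of_real (m y * J (x - y)))"
      using test_function_reflect[OF J, of x] by (auto simp: compactly_supported_def test_function_iff)
  qed
  have lim: "((\<lambda>x'. abs_l2 (\<lambda>y. z * of_real (m y * J (x' - y))) - abs_l2 (\<lambda>y. z * of_real (m y * J (x - y)))) \<longlongrightarrow> 0) (at x)" for x
  proof -
    have "compact (m ` {x - (\<bar>r\<bar> + 1)..x + (\<bar>r\<bar> + 1)})"
      by (intro compact_continuous_image continuous_on_subset[OF m]) auto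
    then obtain M where M: "\<And>y. y \<in> {x - (\<bar>r\<bar> + 1)..x + (\<bar>r\<bar> + 1)} \<Longrightarrow> \<bar>m y\<bar> \<le> M"
      using compact_imp_bounded bounded_real by (metis imageI)
    have M0: "0 \<le> M" using M[of x] abs_ge_zero[of "m x"] by fastforce
    define I where "I y = complex_of_real (indicator {x - (\<bar>r\<bar> + 1)..x + (\<bar>r\<bar> + 1)} y)" for y
    have sqI: "square_integrable I" unfolding I_def by (rule square_integrable_indicator)
    have est: "norm (abs_l2 (\<lambda>y. z * of_real (m y * J (x' - y))) - abs_l2 (\<lambda>y. z * of_real (m y * J (x - y))))
        \<le> (cmod z * M * B * L2_norm I) * \<bar>x' - x\<bar>" if x': "\<bar>x' - x\<bar> < 1" for x'
    proof -
      have pt: "cmod (z * of_real (m y * J (x' - y)) - z * of_real (m y * J (x - y))) \<le> (cmod z * M * B * \<bar>x' - x\<bar>) * cmod (I y)" for y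
      proof (cases "y \<in> {x - (\<bar>r\<bar> + 1)..x + (\<bar>r\<bar> + 1)}")
        case True
        have "z * of_real (m y * J (x' - y)) - z * of_real (m y * J (x - y)) = z * of_real (m y * (J (x' - y) - J (x - y)))"
          by (simp add: algebra_simps)
        then have "cmod (z * of_real (m y * J (x' - y)) - z * of_real (m y * J (x - y))) = cmod z * (\<bar>m y\<bar> * \<bar>J (x' - y) - J (x - y)\<bar>)"
          by (simp only: norm_mult norm_of_real abs_mult)
        also have "\<dots> \<le> cmod z * (M * (B * \<bar>x' - x\<bar>))"
          using lipJ[of "x' - y" "x - y"] M[OF True] M0 by (intro mult_left_mono mult_mono) auto
        finally show ?thesis using True by (simp add: I_def mult.assoc)
      next
        case False
        then have "r < \<bar>x - y\<bar>" "r < \<bar>x' - y\<bar>" using x' by (auto simp: abs_if split: if_splits)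
        then show ?thesis using r M0 B(1) by simp
      qed
      have "L2_norm (\<lambda>y. z * of_real (m y * J (x' - y)) - z * of_real (m y * J (x - y)))
          \<le> (cmod z * M * B * \<bar>x' - x\<bar>) * L2_norm I"
        by (rule L2_norm_mono[OF sqI square_integrable_borel[OF square_integrable_diff[OF sq sq]] pt])
          (use M0 B(1) in simp)
      then show ?thesis
        unfolding abs_l2_diff[OF sq sq] norm_abs_l2[OF square_integrable_diff[OF sq sq]] by (simp only: mult_ac)
    qed
    have ev: "\<forall>\<^sub>F x' in at x. norm (abs_l2 (\<lambda>y. z * of_real (m y * J (x' - y))) - abs_l2 (\<lambda>y. z * of_real (m y * J (x - y))))
        \<le> (cmod z * M * B * L2_norm I) * \<bar>x' - x\<bar>"
      unfolding eventually_at by (rule exI[of _ 1]) (use est in \<open>simp add: dist_real_def\<close>)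
    have "((\<lambda>x'. (cmod z * M * B * L2_norm I) * \<bar>x' - x\<bar>) \<longlongrightarrow> (cmod z * M * B * L2_norm I) * \<bar>x - x\<bar>) (at x)"
      by (intro tendsto_intros)
    then show ?thesis by (intro Lim_null_comparison[OF ev]) simp
  qed
  show ?thesis unfolding continuous_on_def by (rule ballI, rule LIM_zero_cancel, rule lim)
qed

text \<open>Joint continuity in time and space lets the energy be differentiated under the integral
  sign. It is used with \<open>m\<close> equal to 1 and to \<open>b\<close>.\<close>

lemma l2_pair_kernel_continuous:
  assumes u: "continuous_on U u" and m: "continuous_on UNIV m" and J: "test_function J"
  shows "continuous_on (U \<times> S) (\<lambda>p. l2_pair (u (fst p)) (\<lambda>y. of_real (m y * J (snd p - y))))"
proof -
  have sq: "square_integrable (\<lambda>y. of_real (m y * J (x - y)))" for x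
  proof (intro square_integrable_continuous_compact_support)
    show "continuous_on UNIV (\<lambda>y. complex_of_real (m y * J (x - y)))"
      by (intro continuous_intros m test_function_continuous test_function_reflect J)
    show "compactly_supported (\<lambda>y. of_real (m y * J (x - y)))"
      using test_function_reflect[OF J, of x] by (auto simp: compactly_supported_def test_function_iff)
  qed
  have c: "continuous_on (U \<times> S) (\<lambda>p. u (fst p) \<bullet> abs_l2 (\<lambda>y. z * of_real (m y * J (snd p - y))))" for z
    by (intro continuous_on_inner continuous_on_compose2[OF u] continuous_on_fst continuous_on_id
        continuous_on_compose2[OF kernel_translation_continuous[OF m J]] continuous_on_snd) auto
  have "l2_pair v (\<lambda>y. of_real (m y * J (x - y))) = of_real (v \<bullet> abs_l2 (\<lambda>y. 1 * of_real (m y * J (x - y))))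
      + \<i> * of_real (v \<bullet> abs_l2 (\<lambda>y. \<i> * of_real (m y * J (x - y))))" for v x
    unfolding inner_real_test[OF sq] by (simp add: complex_eq_iff)
  then show ?thesis by (simp only:) (intro continuous_intros c)
qed

section \<open>The equation and the energy inequality for mollified solutions\<close>

context monotone_shear
begin

text \<open>Testing with a translated reflected mollifier turns the weak equation into an ordinary
  differential equation in time for the mollified solution at each point \<open>x\<close>.\<close>

lemma gen_kernel:
  assumes \<rho>: "test_function \<rho>"
  shows "gen \<nu> u (\<lambda>y. \<rho> (x - y)) = - (\<i> * of_int k) * (l2_pair u (\<lambda>y. of_real (b y * \<rho> (x - y))) - convol \<rho> (rep_l2 (T u)) x)
    + of_real \<nu> * (convol (deriv (deriv \<rho>)) (rep_l2 u) x - (of_int k)\<^sup>2 * convol \<rho> (rep_l2 u) x)"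
proof -
  have t: "bounded_kernel \<rho>" "bounded_kernel (deriv (deriv \<rho>))"
    by (intro test_function_bounded_kernel test_function_deriv \<rho>)+
  note i = l2_pair_integrable[OF square_integrable_kernel_reflect[OF t(1)]]
    l2_pair_integrable[OF square_integrable_kernel_reflect[OF t(2)]]
  have "l2_pair u (\<lambda>y. of_real (deriv (deriv (\<lambda>y. \<rho> (x - y))) y - (of_int k)\<^sup>2 * \<rho> (x - y)))
      = (\<integral>y. rep_l2 u y * of_real (deriv (deriv \<rho>) (x - y)) - of_real ((of_int k)\<^sup>2) * (rep_l2 u y * of_real (\<rho> (x - y))) \<partial>lborel)"
    unfolding l2_pair_def deriv_reflect(2)[OF \<rho>]
    by (rule arg_cong[where f="integral\<^sup>L lborel"]) (simp add: fun_eq_iff algebra_simps)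
  also have "\<dots> = convol (deriv (deriv \<rho>)) (rep_l2 u) x - of_real ((of_int k)\<^sup>2) * convol \<rho> (rep_l2 u) x"
    unfolding convol_pair l2_pair_def
    by (subst Bochner_Integration.integral_diff[OF i(2) integrable_mult_right[OF i(1)]]) (simp only: integral_mult_right_zero)
  finally show ?thesis unfolding gen_def convol_pair by simp
qed

text \<open>The kernel only sees points within \<open>\<epsilon>\<close> of \<open>x\<close>, where
  \<open>b\<close> differs from \<open>b x\<close> by at most \<open>\<epsilon>\<close> times its
  Lipschitz constant.\<close>

lemma commutator_bound:
  assumes m: "mollifier \<epsilon> \<rho>"
  shows "cmod (l2_pair u (\<lambda>y. of_real (b y * \<rho> (x - y))) - of_real (b x) * convol \<rho> (rep_l2 u) x)
    \<le> (inverse c\<^sub>m * \<epsilon>) * cmod (convol \<rho> (\<lambda>y. of_real (cmod (rep_l2 u y))) x)"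
proof -
  note M = mollifierD[OF m]
  define f where "f = rep_l2 u"
  have sqf: "square_integrable f" by (simp add: f_def)
  have i1: "integrable lborel (\<lambda>y. f y * of_real (b y * \<rho> (x - y)))"
    by (rule square_integrable_mult_integrable[OF sqf square_integrable_b_test[OF test_function_reflect[OF M(1)]]])
  have i2: "integrable lborel (\<lambda>y. of_real (b x) * (of_real (\<rho> (x - y)) * f y))"
    by (intro integrable_mult_right square_integrable_mult_integrable square_integrable_kernel_reflect M(6) sqf)
  have i3: "integrable lborel (\<lambda>y. \<rho> (x - y) * cmod (f y))"
  proof -
    have "integrable lborel (\<lambda>y. cmod (of_real (\<rho> (x - y)) * f y))"
      by (intro integrable_norm square_integrable_mult_integrable square_integrable_kernel_reflect M(6) sqf)
    then show ?thesis using M(2) by (simp add: norm_mult)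
  qed
  have pt: "cmod (f y * of_real (b y * \<rho> (x - y)) - of_real (b x) * (of_real (\<rho> (x - y)) * f y))
      \<le> (inverse c\<^sub>m * \<epsilon>) * (\<rho> (x - y) * cmod (f y))" for y
  proof -
    have "f y * of_real (b y * \<rho> (x - y)) - of_real (b x) * (of_real (\<rho> (x - y)) * f y)
        = of_real ((b y - b x) * \<rho> (x - y)) * f y" by (simp add: algebra_simps)
    then have e: "cmod (f y * of_real (b y * \<rho> (x - y)) - of_real (b x) * (of_real (\<rho> (x - y)) * f y))
        = \<bar>b y - b x\<bar> * (\<rho> (x - y) * cmod (f y))"
      using M(2)[of "x - y"] by (simp only: norm_mult norm_of_real abs_mult abs_of_nonneg mult.assoc)
    show ?thesis
    proof (cases "\<epsilon> < \<bar>x - y\<bar>")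
      case True
      then show ?thesis unfolding e using M(3) by simp
    next
      case False
      have "\<bar>b y - b x\<bar> \<le> inverse c\<^sub>m * \<bar>y - x\<bar>" by (rule b_lipschitz)
      also have "\<dots> \<le> inverse c\<^sub>m * \<epsilon>" using False cm by (intro mult_left_mono) (auto simp: abs_minus_commute)
      finally show ?thesis unfolding e using M(2)[of "x - y"] by (intro mult_right_mono) auto
    qed
  qed
  have "l2_pair u (\<lambda>y. of_real (b y * \<rho> (x - y))) - of_real (b x) * convol \<rho> (rep_l2 u) x
      = (\<integral>y. f y * of_real (b y * \<rho> (x - y)) - of_real (b x) * (of_real (\<rho> (x - y)) * f y) \<partial>lborel)"
    unfolding l2_pair_def convol_def f_def[symmetric] Bochner_Integration.integral_diff[OF i1 i2] integral_mult_right_zero ..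
  also have "cmod \<dots> \<le> (\<integral>y. cmod (f y * of_real (b y * \<rho> (x - y)) - of_real (b x) * (of_real (\<rho> (x - y)) * f y)) \<partial>lborel)"
    by (rule integral_norm_bound)
  also have "\<dots> \<le> (\<integral>y. (inverse c\<^sub>m * \<epsilon>) * (\<rho> (x - y) * cmod (f y)) \<partial>lborel)"
    by (rule integral_mono[OF integrable_norm[OF Bochner_Integration.integrable_diff[OF i1 i2]] integrable_mult_right[OF i3] pt])
  also have "\<dots> = (inverse c\<^sub>m * \<epsilon>) * (\<integral>y. \<rho> (x - y) * cmod (f y) \<partial>lborel)" by (rule integral_mult_right_zero)
  also have "(\<integral>y. \<rho> (x - y) * cmod (f y) \<partial>lborel) = cmod (convol \<rho> (\<lambda>y. of_real (cmod (rep_l2 u y))) x)"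
    unfolding convol_def of_real_mult[symmetric] integral_complex_of_real norm_of_real f_def
    by (rule abs_of_nonneg[symmetric], rule integral_nonneg_AE) (simp add: M(2))
  finally show ?thesis .
qed

text \<open>Subtracting a real multiple \<open>\<beta> v\<close> from \<open>p\<close> is free,
  since \<open>\<i> k \<beta> v\<close> is orthogonal to \<open>v\<close> as a real vector. With
  \<open>\<beta> = b x\<close> the unbounded transport term is reduced to a commutator. The
  \<open>k^2\<close> term has a favourable sign and is dropped.\<close>

lemma energy_pointwise:
  assumes "0 \<le> \<nu>"
  shows "v \<bullet> (- (\<i> * of_int k) * (p - \<tau>) + of_real \<nu> * (w - (of_int k)\<^sup>2 * v))
    \<le> \<kappa> * (cmod v * (cmod (p - of_real \<beta> * v) + cmod \<tau>)) + \<nu> * (v \<bullet> w)"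
proof -
  define c where "c = p - of_real \<beta> * v"
  have "v \<bullet> (- (\<i> * of_int k) * (p - \<tau>) + of_real \<nu> * (w - (of_int k)\<^sup>2 * v))
      = v \<bullet> (- (\<i> * of_int k) * (c - \<tau>)) + \<nu> * (v \<bullet> w) - \<nu> * ((of_int k)\<^sup>2 * (v \<bullet> v))"
    unfolding c_def inner_complex_def by (simp add: power2_eq_square algebra_simps)
  moreover have "v \<bullet> (- (\<i> * of_int k) * (c - \<tau>)) \<le> cmod v * cmod (- (\<i> * of_int k) * (c - \<tau>))" by (rule norm_cauchy_schwarz)
  moreover have "cmod v * cmod (- (\<i> * of_int k) * (c - \<tau>)) \<le> \<kappa> * (cmod v * (cmod c + cmod \<tau>))"
  proof -
    have "cmod (- (\<i> * of_int k) * (c - \<tau>)) = \<kappa> * cmod (c - \<tau>)" by (simp add: norm_mult \<kappa>_def)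
    also have "\<dots> \<le> \<kappa> * (cmod c + cmod \<tau>)" using \<kappa> by (intro mult_left_mono norm_triangle_ineq4) auto
    finally have "cmod v * cmod (- (\<i> * of_int k) * (c - \<tau>)) \<le> cmod v * (\<kappa> * (cmod c + cmod \<tau>))"
      by (rule mult_left_mono) simp
    then show ?thesis by (simp only: mult.left_commute)
  qed
  moreover have "0 \<le> \<nu> * ((of_int k)\<^sup>2 * (v \<bullet> v))" using assms by simp
  ultimately show ?thesis unfolding c_def by linarith
qed

end

text \<open>Write \<open>2 v \<bullet> v''\<close> as the second derivative of \<open>|v|^2\<close>
  minus \<open>2 |v'|^2\<close>, drop the gradient, and move both derivatives to the weight. The
  weight and its first derivative vanish at the endpoints, so no boundary terms appear, and
  \<open>48 / R^2\<close> bounds its second derivative from above.\<close>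

lemma cutoff_integration_by_parts:
  fixes v v' v'' :: "real \<Rightarrow> complex"
  assumes R: "0 < R" and v: "\<And>x. (v has_vector_derivative v' x) (at x)" "\<And>x. (v' has_vector_derivative v'' x) (at x)"
    and c: "continuous_on UNIV v''"
  shows "integral {-R..R} (\<lambda>x. (1 - x\<^sup>2 / R\<^sup>2) ^ 4 * (2 * (v x \<bullet> v'' x)))
    \<le> integral {-R..R} (\<lambda>x. (48 / R\<^sup>2) * (cmod (v x))\<^sup>2)"
proof -
  define \<theta> where "\<theta> x = (1 - x\<^sup>2 / R\<^sup>2) ^ 4" for x
  define \<theta>' where "\<theta>' x = - (8 * x / R\<^sup>2) * (1 - x\<^sup>2 / R\<^sup>2) ^ 3" for x
  define \<theta>'' where "\<theta>'' x = - (8 / R\<^sup>2) * (1 - x\<^sup>2 / R\<^sup>2) ^ 3 + (48 * x\<^sup>2 / (R\<^sup>2 * R\<^sup>2)) * (1 - x\<^sup>2 / R\<^sup>2) ^ 2" for x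
  have R2: "0 < R\<^sup>2" using R by simp
  have d0: "((\<lambda>x. 1 - x\<^sup>2 / R\<^sup>2) has_real_derivative - (2 * x / R\<^sup>2)) (at x)" for x
    by (rule DERIV_cong[OF DERIV_diff[OF DERIV_const DERIV_cdivide[OF DERIV_pow[of 2]]]]) simp
  have d1: "(\<theta> has_real_derivative \<theta>' x) (at x)" for x
    unfolding \<theta>_def[abs_def] by (rule DERIV_cong[OF DERIV_power[OF d0]]) (simp add: \<theta>'_def)
  have d2: "(\<theta>' has_real_derivative \<theta>'' x) (at x)" for x
  proof -
    have "((\<lambda>x. - (8 * x / R\<^sup>2)) has_real_derivative - (8 / R\<^sup>2)) (at x)"
      by (rule DERIV_cong[OF DERIV_minus[OF DERIV_cdivide[OF DERIV_cmult[OF DERIV_ident]]]]) simp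
    from DERIV_mult[OF this DERIV_power[OF d0, of 3]] show ?thesis
      unfolding \<theta>'_def[abs_def] by (rule DERIV_cong) (simp add: \<theta>''_def power2_eq_square mult_ac)
  qed
  define g where "g x = v x \<bullet> v x" for x
  define g' where "g' x = 2 * (v x \<bullet> v' x)" for x
  define g'' where "g'' x = 2 * (v' x \<bullet> v' x) + 2 * (v x \<bullet> v'' x)" for x
  note ib = bounded_bilinear.has_vector_derivative[OF bounded_bilinear_inner]
  have e1: "(g has_real_derivative g' x) (at x)" for x
    using ib[OF v(1) v(1), of x] unfolding g_def g'_def has_real_derivative_iff_has_vector_derivative
    by (simp add: inner_commute)
  have e2: "(g' has_real_derivative g'' x) (at x)" for x
    using DERIV_cmult[OF ib[OF v(1) v(2), of x, folded has_real_derivative_iff_has_vector_derivative], of 2]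
    unfolding g'_def g''_def by (simp add: algebra_simps)
  have "((\<lambda>x. \<theta> x * g' x - \<theta>' x * g x) has_real_derivative \<theta> x * g'' x - \<theta>'' x * g x) (at x)" for x
    by (rule DERIV_cong[OF DERIV_diff[OF DERIV_mult[OF d1 e2] DERIV_mult[OF d2 e1]]]) (simp add: algebra_simps)
  then have "((\<lambda>x. \<theta> x * g'' x - \<theta>'' x * g x) has_integral (\<theta> R * g' R - \<theta>' R * g R) - (\<theta> (- R) * g' (- R) - \<theta>' (- R) * g (- R))) {-R..R}"
    using R by (intro fundamental_theorem_of_calculus)
      (auto simp: has_real_derivative_iff_has_vector_derivative intro: has_vector_derivative_at_within)
  moreover have "\<theta> R = 0" "\<theta>' R = 0" "\<theta> (- R) = 0" "\<theta>' (- R) = 0" using R by (simp_all add: \<theta>_def \<theta>'_def)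
  ultimately have z: "((\<lambda>x. \<theta> x * g'' x - \<theta>'' x * g x) has_integral 0) {-R..R}" by simp
  have cv: "continuous_on S v" "continuous_on S v'" "continuous_on S v''" for S
    by (intro continuous_at_imp_continuous_on ballI has_vector_derivative_continuous[OF v(1)]
        has_vector_derivative_continuous[OF v(2)] continuous_on_subset[OF c] subset_UNIV)+
  have c\<theta>: "continuous_on S \<theta>" "continuous_on S \<theta>''" for S
    unfolding \<theta>_def[abs_def] \<theta>''_def[abs_def] using R2 by (intro continuous_intros; simp)+
  have i2: "(\<lambda>x. \<theta>'' x * g x) integrable_on {-R..R}" "(\<lambda>x. \<theta> x * (2 * (v x \<bullet> v'' x))) integrable_on {-R..R}"
    "(\<lambda>x. (48 / R\<^sup>2) * (cmod (v x))\<^sup>2) integrable_on {-R..R}"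
    unfolding g_def by (intro integrable_continuous_real continuous_intros cv c\<theta>)+
  have s: "0 \<le> 1 - x\<^sup>2 / R\<^sup>2 \<and> 1 - x\<^sup>2 / R\<^sup>2 \<le> 1 \<and> x\<^sup>2 / R\<^sup>2 \<le> 1" if "x \<in> {-R..R}" for x
  proof -
    have "\<bar>x\<bar> \<le> R" using that by (auto simp: abs_le_iff)
    then have "x\<^sup>2 \<le> R\<^sup>2" using power_mono[of "\<bar>x\<bar>" R 2] by simp
    then show ?thesis using R2 by (simp add: divide_le_eq_1)
  qed
  have "integral {-R..R} (\<lambda>x. \<theta> x * (2 * (v x \<bullet> v'' x))) \<le> integral {-R..R} (\<lambda>x. (\<theta> x * g'' x - \<theta>'' x * g x) + \<theta>'' x * g x)"
  proof (rule integral_le[OF i2(2)])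
    show "(\<lambda>x. (\<theta> x * g'' x - \<theta>'' x * g x) + \<theta>'' x * g x) integrable_on {-R..R}"
      by (intro Henstock_Kurzweil_Integration.integrable_add i2(1) has_integral_integrable[OF z])
    show "\<theta> x * (2 * (v x \<bullet> v'' x)) \<le> (\<theta> x * g'' x - \<theta>'' x * g x) + \<theta>'' x * g x" if "x \<in> {-R..R}" for x
    proof -
      have "0 \<le> \<theta> x * (2 * (v' x \<bullet> v' x))" using s[OF that] by (simp add: \<theta>_def)
      then show ?thesis by (simp add: g''_def distrib_left)
    qed
  qed
  also have "\<dots> = 0 + integral {-R..R} (\<lambda>x. \<theta>'' x * g x)"
    unfolding Henstock_Kurzweil_Integration.integral_add[OF has_integral_integrable[OF z] i2(1)] integral_unique[OF z] ..
  also have "\<dots> \<le> integral {-R..R} (\<lambda>x. (48 / R\<^sup>2) * (cmod (v x))\<^sup>2)"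
  proof (simp only: add_0, rule integral_le[OF i2(1,3)])
    fix x assume x: "x \<in> {-R..R}"
    have "\<theta>'' x \<le> 0 + 48 / R\<^sup>2"
      unfolding \<theta>''_def
    proof (rule add_mono)
      have "0 \<le> (8 / R\<^sup>2) * (1 - x\<^sup>2 / R\<^sup>2) ^ 3" using s[OF x] R2 by simp
      then show "- (8 / R\<^sup>2) * (1 - x\<^sup>2 / R\<^sup>2) ^ 3 \<le> 0" by linarith
      have "(48 / R\<^sup>2) * (x\<^sup>2 / R\<^sup>2 * (1 - x\<^sup>2 / R\<^sup>2) ^ 2) \<le> (48 / R\<^sup>2) * (1 * 1)"
        using s[OF x] R2 by (intro mult_left_mono mult_mono power_le_one) auto
      then show "48 * x\<^sup>2 / (R\<^sup>2 * R\<^sup>2) * (1 - x\<^sup>2 / R\<^sup>2)\<^sup>2 \<le> 48 / R\<^sup>2" by simp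
    qed
    then show "\<theta>'' x * g x \<le> (48 / R\<^sup>2) * (cmod (v x))\<^sup>2"
      unfolding g_def power2_norm_eq_inner by (intro mult_right_mono) auto
  qed
  finally show ?thesis unfolding \<theta>_def .
qed

context monotone_shear
begin

text \<open>The cutoff confines the energy to a bounded interval, because multiplication by
  \<open>b\<close> may leave \<open>L^2\<close>. The commutator error is of order
  \<open>\<epsilon>\<close> and the viscous cutoff error of order \<open>1 / R^2\<close>; what
  remains in the limit is the contribution of \<open>T\<close>.\<close>

lemma mollified_energy_bound:
  assumes c: "continuous_on {0..} u" and w: "weak_solution \<nu> u" and \<nu>: "0 \<le> \<nu>" and u0: "u 0 = 0"
    and m: "mollifier \<epsilon> \<rho>" and \<epsilon>: "0 < \<epsilon>" and R: "0 < R" and t0: "0 \<le> t0"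
  shows "(norm (l2_mult (\<lambda>x. of_real (indicator {-R..R} x * (1 - x\<^sup>2 / R\<^sup>2)\<^sup>2)) (l2_convol \<rho> (u t0))))\<^sup>2
    \<le> (2 * \<kappa> * (inverse c\<^sub>m * \<epsilon> + T_bound) + \<nu> * (48 / R\<^sup>2)) * integral {0..t0} (\<lambda>s. (norm (u s))\<^sup>2)"
proof -
  note M = mollifierD[OF m]
  note \<rho>' = test_function_deriv[OF M(1)]
  note \<rho>'' = test_function_deriv[OF \<rho>']
  define K where "K = 2 * \<kappa> * (inverse c\<^sub>m * \<epsilon> + T_bound) + \<nu> * (48 / R\<^sup>2)"
  define \<theta> where "\<theta> x = (1 - x\<^sup>2 / R\<^sup>2) ^ 4" for x
  define v where "v t x = convol \<rho> (rep_l2 (u t)) x" for t x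
  define v'' where "v'' t x = convol (deriv (deriv \<rho>)) (rep_l2 (u t)) x" for t x
  define \<tau> where "\<tau> t x = convol \<rho> (rep_l2 (T (u t))) x" for t x
  define p where "p t x = l2_pair (u t) (\<lambda>y. of_real (b y * \<rho> (x - y)))" for t x
  define vt where "vt t x = - (\<i> * of_int k) * (p t x - \<tau> t x) + of_real \<nu> * (v'' t x - (of_int k)\<^sup>2 * v t x)" for t x
  have R2: "0 < R\<^sup>2" using R by simp
  have dv: "((\<lambda>s. v s x) has_vector_derivative vt t x) (at t within {0..})" if "0 \<le> t" for t x
    using w[unfolded weak_solution_def, rule_format, OF test_function_reflect[OF M(1), of x] that]
    unfolding v_def vt_def p_def \<tau>_def v''_def gen_kernel[OF M(1)] convol_pair .
  have cT: "continuous_on {0..} (\<lambda>t. T (u t))"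
    by (rule bounded_linear.continuous_on[OF T_linear c])
  have cpr: "continuous_on ({0..} \<times> S) (\<lambda>q. v (fst q) (snd q))" "continuous_on ({0..} \<times> S) (\<lambda>q. v'' (fst q) (snd q))"
    "continuous_on ({0..} \<times> S) (\<lambda>q. \<tau> (fst q) (snd q))" "continuous_on ({0..} \<times> S) (\<lambda>q. p (fst q) (snd q))" for S
    using l2_pair_kernel_continuous[OF c continuous_on_const[of _ 1] M(1), of S]
      l2_pair_kernel_continuous[OF c continuous_on_const[of _ 1] \<rho>'', of S]
      l2_pair_kernel_continuous[OF cT continuous_on_const[of _ 1] M(1), of S]
      l2_pair_kernel_continuous[OF c b_continuous M(1), of S]
    unfolding v_def v''_def \<tau>_def p_def convol_pair by simp_all
  have cx: "continuous_on S (\<lambda>x. f t x)" if "continuous_on ({0..} \<times> S) (\<lambda>q. f (fst q) (snd q))" "0 \<le> t" for f :: "real \<Rightarrow> real \<Rightarrow> complex" and S t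
  proof -
    have "continuous_on S (\<lambda>x. (t, x))" by (intro continuous_on_Pair continuous_on_const continuous_on_id)
    from continuous_on_compose2[OF that(1) this] that(2) show ?thesis by auto
  qed
  have c\<theta>: "continuous_on S \<theta>" for S
    unfolding \<theta>_def[abs_def] using R2 by (intro continuous_intros) simp
  define E where "E t = integral (cbox (-R) R) (\<lambda>x. \<theta> x * (v t x \<bullet> v t x))" for t
  have dE: "(E has_vector_derivative integral (cbox (-R) R) (\<lambda>x. \<theta> x * (2 * (v t x \<bullet> vt t x)))) (at t within {0..})"
    if t: "0 \<le> t" for t
    unfolding E_def
  proof (rule leibniz_rule_vector_derivative)
    fix s x :: real assume "s \<in> {0..}"
    then have s: "0 \<le> s" by simp
    have "((\<lambda>s. v s x \<bullet> v s x) has_vector_derivative (v s x \<bullet> vt s x + vt s x \<bullet> v s x)) (at s within {0..})"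
      by (rule bounded_bilinear.has_vector_derivative[OF bounded_bilinear_inner dv[OF s] dv[OF s]])
    then have "((\<lambda>s. v s x \<bullet> v s x) has_vector_derivative 2 * (v s x \<bullet> vt s x)) (at s within {0..})"
      by (simp add: inner_commute)
    then show "((\<lambda>s. \<theta> x * (v s x \<bullet> v s x)) has_vector_derivative \<theta> x * (2 * (v s x \<bullet> vt s x))) (at s within {0..})"
      by (rule has_vector_derivative_mult_right)
  next
    fix s :: real assume "s \<in> {0..}"
    then have s: "0 \<le> s" by simp
    show "(\<lambda>x. \<theta> x * (v s x \<bullet> v s x)) integrable_on cbox (-R) R"
      unfolding cbox_interval by (intro integrable_continuous_real continuous_intros c\<theta> cx[OF cpr(1) s])
  next
    have "continuous_on ({0..} \<times> cbox (-R) R) (\<lambda>q. \<theta> (snd q) * (2 * (v (fst q) (snd q) \<bullet> vt (fst q) (snd q))))"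
      unfolding vt_def
      by (intro continuous_intros cpr continuous_on_compose2[OF c\<theta>[of UNIV] continuous_on_snd[OF continuous_on_id]]) simp
    then show "continuous_on ({0..} \<times> cbox (-R) R) (\<lambda>(s, x). \<theta> x * (2 * (v s x \<bullet> vt s x)))"
      by (simp add: case_prod_beta)
  qed (use t in auto)
  have bound: "integral (cbox (-R) R) (\<lambda>x. \<theta> x * (2 * (v t x \<bullet> vt t x))) \<le> K * (norm (u t))\<^sup>2" if t: "0 \<le> t" for t
  proof -
    define a where "a = convol \<rho> (\<lambda>y. of_real (cmod (rep_l2 (u t) y)))"
    define h1 where "h1 x = 2 * \<kappa> * (cmod (v t x) * (inverse c\<^sub>m * \<epsilon> * cmod (a x) + cmod (\<tau> t x)))" for x
    define h2 where "h2 x = \<theta> x * (2 * (v t x \<bullet> v'' t x))" for x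
    have sqa: "square_integrable (\<lambda>y. of_real (cmod (rep_l2 (u t) y)))" by (intro square_integrable_cmod square_integrable_rep)
    have ca: "continuous_on S a" for S unfolding a_def
      by (intro continuous_at_imp_continuous_on ballI
          has_vector_derivative_continuous[OF convol_has_vector_derivative[OF M(1) sqa]])
    note cv = cx[OF cpr(1) t] cx[OF cpr(2) t] cx[OF cpr(3) t] cx[OF cpr(4) t]
    have ch1: "continuous_on S h1" for S unfolding h1_def by (intro continuous_intros cv ca)
    have ch2: "continuous_on S h2" for S unfolding h2_def by (intro continuous_intros cv c\<theta>)
    have ce: "0 \<le> inverse c\<^sub>m * \<epsilon>" using cm \<epsilon> by simp
    have h1n: "0 \<le> h1 x" for x using \<kappa> ce by (simp add: h1_def)
    \<comment> \<open>The weight, at most 1, may be dropped from the nonnegative \<open>h1\<close>.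
      It stays inside \<open>h2\<close>, whose sign is unknown and which is integrated by
      parts.\<close>
    have pt: "\<theta> x * (2 * (v t x \<bullet> vt t x)) \<le> h1 x + \<nu> * h2 x" if x: "x \<in> {-R..R}" for x
    proof -
      have "\<bar>x\<bar> \<le> R" using x by (auto simp: abs_le_iff)
      then have "x\<^sup>2 \<le> R\<^sup>2" using power_mono[of "\<bar>x\<bar>" R 2] by simp
      then have th: "0 \<le> \<theta> x" "\<theta> x \<le> 1" using R2 by (simp_all add: \<theta>_def power_le_one divide_le_eq_1)
      have "v t x \<bullet> vt t x \<le> \<kappa> * (cmod (v t x) * (cmod (p t x - of_real (b x) * v t x) + cmod (\<tau> t x))) + \<nu> * (v t x \<bullet> v'' t x)"
        unfolding vt_def by (rule energy_pointwise[OF \<nu>])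
      moreover have "\<kappa> * (cmod (v t x) * (cmod (p t x - of_real (b x) * v t x) + cmod (\<tau> t x)))
          \<le> \<kappa> * (cmod (v t x) * (inverse c\<^sub>m * \<epsilon> * cmod (a x) + cmod (\<tau> t x)))"
        using \<kappa> commutator_bound[OF m, of "u t" x] unfolding p_def v_def a_def
        by (intro mult_left_mono add_mono) auto
      ultimately have "2 * (v t x \<bullet> vt t x) \<le> h1 x + \<nu> * (2 * (v t x \<bullet> v'' t x))" unfolding h1_def by linarith
      then have "\<theta> x * (2 * (v t x \<bullet> vt t x)) \<le> \<theta> x * (h1 x + \<nu> * (2 * (v t x \<bullet> v'' t x)))"
        using th(1) by (rule mult_left_mono)
      also have "\<dots> = \<theta> x * h1 x + \<nu> * h2 x" by (simp add: h2_def algebra_simps)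
      also have "\<theta> x * h1 x \<le> h1 x" using th h1n by (intro mult_left_le_one_le) auto
      finally show ?thesis by simp
    qed
    have "integral {-R..R} (\<lambda>x. \<theta> x * (2 * (v t x \<bullet> vt t x))) \<le> integral {-R..R} (\<lambda>x. h1 x + \<nu> * h2 x)"
    proof (rule integral_le)
      show "(\<lambda>x. \<theta> x * (2 * (v t x \<bullet> vt t x))) integrable_on {-R..R}"
        unfolding vt_def by (intro integrable_continuous_real continuous_intros c\<theta> cv)
      show "(\<lambda>x. h1 x + \<nu> * h2 x) integrable_on {-R..R}"
        by (intro integrable_continuous_real continuous_intros ch1 ch2)
    qed (rule pt)
    also have "\<dots> = integral {-R..R} h1 + \<nu> * integral {-R..R} h2"
      by (subst Henstock_Kurzweil_Integration.integral_add)
        (auto intro!: integrable_continuous_real continuous_intros ch1 ch2)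
    finally have main: "integral {-R..R} (\<lambda>x. \<theta> x * (2 * (v t x \<bullet> vt t x))) \<le> integral {-R..R} h1 + \<nu> * integral {-R..R} h2" .
    have sqv: "square_integrable (v t)" "L2_norm (v t) \<le> norm (u t)"
      using young_inequality[OF M(6) square_integrable_rep[of "u t"]] unfolding M(5) norm_l2_rep[of "u t"] v_def[abs_def] by simp_all
    have sq\<tau>: "square_integrable (\<tau> t)" "L2_norm (\<tau> t) \<le> T_bound * norm (u t)"
      using young_inequality[OF M(6) square_integrable_rep[of "T (u t)"]] T_norm[of "u t"]
      unfolding M(5) norm_l2_rep[of "T (u t)", symmetric] \<tau>_def[abs_def] by simp_all
    have sqa': "square_integrable a" "L2_norm a \<le> norm (u t)"
      using young_inequality[OF M(6) sqa] unfolding M(5) norm_l2_rep[of "u t"] a_def by simp_all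
    have prod_int: "integrable lborel (\<lambda>x. cmod (f x) * cmod (g x))" if "square_integrable f" "square_integrable g" for f g
      using integrable_norm[OF square_integrable_mult_integrable[OF that]] by (simp add: norm_mult)
    have prod: "(\<integral>x. cmod (v t x) * cmod (g x) \<partial>lborel) \<le> norm (u t) * C" if "square_integrable g" "L2_norm g \<le> C" for g C
    proof -
      have "(\<integral>x. cmod (v t x) * cmod (g x) \<partial>lborel) \<le> L2_norm (v t) * L2_norm g"
        by (rule Cauchy_Schwarz_integral(1)[OF sqv(1) that(1)])
      also have "\<dots> \<le> norm (u t) * C" by (intro mult_mono sqv(2) that(2)) auto
      finally show ?thesis .
    qed
    have h1e: "h1 = (\<lambda>x. (2 * \<kappa> * (inverse c\<^sub>m * \<epsilon>)) * (cmod (v t x) * cmod (a x)) + (2 * \<kappa>) * (cmod (v t x) * cmod (\<tau> t x)))"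
      by (simp add: h1_def fun_eq_iff algebra_simps)
    have h1i: "integrable lborel h1" unfolding h1e
      by (intro Bochner_Integration.integrable_add integrable_mult_right prod_int sqv sqa' sq\<tau>)
    have "integral {-R..R} h1 \<le> (\<integral>x. h1 x \<partial>lborel)"
      by (rule integral_le_lebesgue[OF ch1 order_refl h1i h1n])
    also have "\<dots> = (2 * \<kappa> * (inverse c\<^sub>m * \<epsilon>)) * (\<integral>x. cmod (v t x) * cmod (a x) \<partial>lborel) + (2 * \<kappa>) * (\<integral>x. cmod (v t x) * cmod (\<tau> t x) \<partial>lborel)"
      unfolding h1e
      by (subst Bochner_Integration.integral_add)
        (simp_all only: integral_mult_right_zero integrable_mult_right prod_int sqv sqa' sq\<tau>)
    also have "\<dots> \<le> (2 * \<kappa> * (inverse c\<^sub>m * \<epsilon>)) * (norm (u t) * norm (u t)) + (2 * \<kappa>) * (norm (u t) * (T_bound * norm (u t)))"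
      using \<kappa> ce by (intro add_mono mult_left_mono prod sqa' sq\<tau>) auto
    finally have 1: "integral {-R..R} h1 \<le> (2 * \<kappa> * (inverse c\<^sub>m * \<epsilon>)) * (norm (u t) * norm (u t)) + (2 * \<kappa>) * (norm (u t) * (T_bound * norm (u t)))" .
    have "integral {-R..R} h2 \<le> integral {-R..R} (\<lambda>x. (48 / R\<^sup>2) * (cmod (v t x))\<^sup>2)"
      unfolding h2_def \<theta>_def
    proof (rule cutoff_integration_by_parts[OF R])
      show "(v t has_vector_derivative convol (deriv \<rho>) (rep_l2 (u t)) x) (at x)" for x
        unfolding v_def[abs_def] by (rule convol_has_vector_derivative[OF M(1) square_integrable_rep])
      show "(convol (deriv \<rho>) (rep_l2 (u t)) has_vector_derivative v'' t x) (at x)" for x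
        unfolding v''_def[abs_def] by (rule convol_has_vector_derivative[OF \<rho>' square_integrable_rep])
      show "continuous_on UNIV (v'' t)" by (rule cv(2))
    qed
    also have "\<dots> \<le> (\<integral>x. (48 / R\<^sup>2) * (cmod (v t x))\<^sup>2 \<partial>lborel)"
      by (rule integral_le_lebesgue) (use sqv R in \<open>auto simp: square_integrable_def intro!: continuous_intros cv\<close>)
    also have "\<dots> = (48 / R\<^sup>2) * (L2_norm (v t))\<^sup>2" unfolding L2_norm_square by (rule integral_mult_right_zero)
    also have "\<dots> \<le> (48 / R\<^sup>2) * (norm (u t))\<^sup>2"
      by (intro mult_left_mono power_mono sqv(2)) auto
    finally have "\<nu> * integral {-R..R} h2 \<le> \<nu> * ((48 / R\<^sup>2) * (norm (u t))\<^sup>2)" using \<nu> by (rule mult_left_mono)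
    with main 1 show ?thesis unfolding K_def cbox_interval by (simp add: power2_eq_square algebra_simps)
  qed
  \<comment> \<open>The bound on the derivative of \<open>E\<close> says that \<open>E - K h\<close>
    is nonincreasing, and both functions vanish at time 0.\<close>
  define h where "h t = integral {0..t} (\<lambda>s. (norm (u s))\<^sup>2)" for t
  have dh: "(h has_vector_derivative (norm (u r))\<^sup>2) (at r within {0..t0})" if "r \<in> {0..t0}" for r
    unfolding h_def by (rule integral_has_vector_derivative[OF _ that])
      (intro continuous_intros continuous_on_subset[OF c], simp)
  have "\<exists>r\<in>{0..t0}. (E t0 - K * h t0) - (E 0 - K * h 0)
      = (integral (cbox (-R) R) (\<lambda>x. \<theta> x * (2 * (v r x \<bullet> vt r x))) - K * (norm (u r))\<^sup>2) * (t0 - 0)"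
  proof (rule mvt_very_simple[OF t0])
    fix r assume r: "0 \<le> r" "r \<le> t0"
    have "((\<lambda>t. E t - K * h t) has_vector_derivative
        integral (cbox (-R) R) (\<lambda>x. \<theta> x * (2 * (v r x \<bullet> vt r x))) - K * (norm (u r))\<^sup>2) (at r within {0..t0})"
      using r by (intro has_vector_derivative_diff has_vector_derivative_mult_right dh
          has_vector_derivative_within_subset[OF dE]) auto
    then show "((\<lambda>t. E t - K * h t) has_derivative
        (*) (integral (cbox (-R) R) (\<lambda>x. \<theta> x * (2 * (v r x \<bullet> vt r x))) - K * (norm (u r))\<^sup>2)) (at r within {0..t0})"
      by (simp flip: has_real_derivative_iff_has_vector_derivative add: has_field_derivative_def)
  qed
  then obtain r where r: "r \<in> {0..t0}" "(E t0 - K * h t0) - (E 0 - K * h 0)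
      = (integral (cbox (-R) R) (\<lambda>x. \<theta> x * (2 * (v r x \<bullet> vt r x))) - K * (norm (u r))\<^sup>2) * (t0 - 0)" by blast
  have "(integral (cbox (-R) R) (\<lambda>x. \<theta> x * (2 * (v r x \<bullet> vt r x))) - K * (norm (u r))\<^sup>2) * (t0 - 0) \<le> 0"
    using bound[of r] r(1) t0 by (intro mult_nonpos_nonneg) auto
  moreover have "E 0 = 0"
  proof -
    have "v 0 x = 0" for x
      unfolding v_def convol_pair u0
      using linear_0[OF bounded_linear.linear[OF bounded_linear_l2_pair[OF square_integrable_kernel_reflect[OF M(6)]]]] .
    then show ?thesis by (simp add: E_def)
  qed
  moreover have "h 0 = 0" by (simp add: h_def)
  ultimately have EK: "E t0 \<le> K * h t0" using r(2) by simp
  define q where "q x = complex_of_real (indicator {-R..R} x * (1 - x\<^sup>2 / R\<^sup>2)\<^sup>2)" for x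
  have q: "q \<in> borel_measurable borel" unfolding q_def[abs_def] by measurable
  have qb: "cmod (q x) \<le> 1" for x
  proof (cases "x \<in> {-R..R}")
    case True
    then have "\<bar>x\<bar> \<le> R" by (auto simp: abs_le_iff)
    then have "x\<^sup>2 \<le> R\<^sup>2" using power_mono[of "\<bar>x\<bar>" R 2] by simp
    then have "0 \<le> 1 - x\<^sup>2 / R\<^sup>2" "1 - x\<^sup>2 / R\<^sup>2 \<le> 1" using R2 by (simp_all add: divide_le_eq_1)
    then show ?thesis unfolding q_def norm_of_real using True by (simp add: power_le_one)
  qed (simp add: q_def)
  have sqv: "square_integrable (v t0)"
    unfolding v_def[abs_def] by (rule young_inequality(1)[OF M(6) square_integrable_rep])
  have e: "(cmod (q x * v t0 x))\<^sup>2 = indicator {-R..R} x *\<^sub>R (\<theta> x * (v t0 x \<bullet> v t0 x))" for x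
    unfolding q_def \<theta>_def norm_mult norm_of_real power_mult_distrib power2_norm_eq_inner[symmetric] power2_abs
    by (cases "x \<in> {-R..R}") (simp_all add: indicator_def flip: power_mult)
  have "(norm (l2_mult q (l2_convol \<rho> (u t0))))\<^sup>2 = (\<integral>x. (cmod (q x * v t0 x))\<^sup>2 \<partial>lborel)"
  proof -
    have "l2_mult q (l2_convol \<rho> (u t0)) = abs_l2 (\<lambda>x. q x * v t0 x)"
      unfolding l2_convol_def v_def[abs_def, symmetric] using l2_mult_abs[OF q qb sqv] by (simp add: v_def[abs_def])
    then show ?thesis
      by (simp only: norm_abs_l2[OF square_integrable_mult_bounded[OF sqv q qb]] L2_norm_square)
  qed
  also have "\<dots> = E t0"
    unfolding e E_def cbox_interval set_lebesgue_integral_def[symmetric]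
  proof (rule set_borel_integral_eq_integral(2))
    show "set_integrable lborel {-R..R} (\<lambda>x. \<theta> x * (v t0 x \<bullet> v t0 x))"
      by (intro borel_integrable_atLeastAtMost' continuous_intros c\<theta> cx[OF cpr(1) t0])
  qed
  finally show ?thesis using EK unfolding K_def h_def q_def by simp
qed

text \<open>In the limit of the mollified bound the squared norm of \<open>u\<close> is controlled
  by a constant times its own time integral, and Gronwall applies.\<close>

lemma weak_solution_zero:
  assumes c: "continuous_on {0..} u" and w: "weak_solution \<nu> u" and \<nu>: "0 \<le> \<nu>" and u0: "u 0 = 0" and t0: "0 \<le> t0"
  shows "u t0 = 0"
proof -
  obtain \<rho> where \<rho>: "\<And>n. mollifier (1 / real (Suc n)) (\<rho> n)" and lim: "\<And>v. (\<lambda>n. l2_convol (\<rho> n) v) \<longlonglongrightarrow> v"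
    using mollifier_sequence by blast
  define h where "h t = integral {0..t} (\<lambda>s. (norm (u s))\<^sup>2)" for t
  define C where "C = 2 * \<kappa> * T_bound"
  have bound: "(norm (u t))\<^sup>2 \<le> C * h t" if t: "0 \<le> t" for t
  proof -
    \<comment> \<open>One index drives both limits: the cutoff radius is \<open>R n\<close>, and the
      mollifier \<open>\<rho> n\<close> has radius \<open>1 / R n\<close>.\<close>
    define R where "R n = real (Suc n)" for n
    define q where "q n x = complex_of_real (indicator {- R n..R n} x * (1 - x\<^sup>2 / (R n)\<^sup>2)\<^sup>2)" for n x
    have qm: "q n \<in> borel_measurable borel" for n unfolding q_def[abs_def] by measurable
    have qb: "cmod (q n x) \<le> 1" for n x
    proof (cases "x \<in> {- R n..R n}")
      case True
      then have "\<bar>x\<bar> \<le> R n" by (auto simp: abs_le_iff)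
      then have "x\<^sup>2 \<le> (R n)\<^sup>2" using power_mono[of "\<bar>x\<bar>" "R n" 2] by simp
      moreover have "0 < (R n)\<^sup>2" by (simp add: R_def)
      ultimately have "0 \<le> 1 - x\<^sup>2 / (R n)\<^sup>2" "1 - x\<^sup>2 / (R n)\<^sup>2 \<le> 1" by (simp_all add: divide_le_eq_1)
      then show ?thesis unfolding q_def norm_of_real using True by (simp add: power_le_one)
    qed (simp add: q_def)
    have inv: "(\<lambda>n. 1 / R n) \<longlonglongrightarrow> 0" using LIMSEQ_inverse_real_of_nat by (simp add: inverse_eq_divide R_def)
    have ql: "(\<lambda>n. q n x) \<longlonglongrightarrow> 1" for x
    proof -
      obtain N where N: "\<bar>x\<bar> \<le> real N" using real_arch_simple by blast
      have "(\<lambda>n. complex_of_real ((1 - (x * (1 / R n))\<^sup>2)\<^sup>2)) \<longlonglongrightarrow> complex_of_real ((1 - (x * 0)\<^sup>2)\<^sup>2)"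
        by (intro tendsto_intros inv)
      then have "(\<lambda>n. complex_of_real ((1 - (x * (1 / R n))\<^sup>2)\<^sup>2)) \<longlonglongrightarrow> 1" by simp
      moreover have "\<forall>\<^sub>F n in sequentially. complex_of_real ((1 - (x * (1 / R n))\<^sup>2)\<^sup>2) = q n x"
      proof (rule eventually_sequentiallyI[of N])
        fix n assume "N \<le> n"
        then have "\<bar>x\<bar> \<le> R n" using N by (simp add: R_def)
        then have "x \<in> {- R n..R n}" by (auto simp: abs_le_iff)
        then show "complex_of_real ((1 - (x * (1 / R n))\<^sup>2)\<^sup>2) = q n x" by (simp add: q_def power_divide)
      qed
      ultimately show ?thesis by (rule Lim_transform_eventually)
    qed
    have lim1: "(\<lambda>n. l2_mult (q n) (l2_convol (\<rho> n) (u t))) \<longlonglongrightarrow> u t"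
    proof (rule LIM_zero_cancel, rule Lim_null_comparison)
      have "norm (l2_mult (q n) (l2_convol (\<rho> n) (u t)) - u t) \<le> norm (l2_convol (\<rho> n) (u t) - u t) + norm (l2_mult (q n) (u t) - u t)" for n
      proof -
        have "l2_mult (q n) (l2_convol (\<rho> n) (u t)) - u t = l2_mult (q n) (l2_convol (\<rho> n) (u t) - u t) + (l2_mult (q n) (u t) - u t)"
          by (simp add: linear_diff[OF bounded_linear.linear[OF bounded_linear_l2_mult(1)[OF qm qb]]])
        then have "norm (l2_mult (q n) (l2_convol (\<rho> n) (u t)) - u t)
            \<le> norm (l2_mult (q n) (l2_convol (\<rho> n) (u t) - u t)) + norm (l2_mult (q n) (u t) - u t)"
          by (simp only: norm_triangle_ineq)
        then show ?thesis using bounded_linear_l2_mult(2)[OF qm qb, of n "l2_convol (\<rho> n) (u t) - u t"] by linarith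
      qed
      then show "\<forall>\<^sub>F n in sequentially. norm (l2_mult (q n) (l2_convol (\<rho> n) (u t)) - u t)
          \<le> norm (l2_convol (\<rho> n) (u t) - u t) + norm (l2_mult (q n) (u t) - u t)" by (intro always_eventually allI)
      have "(\<lambda>n. norm (l2_convol (\<rho> n) (u t) - u t) + norm (l2_mult (q n) (u t) - u t)) \<longlonglongrightarrow> 0 + 0"
        by (intro tendsto_add tendsto_norm_zero LIM_zero lim l2_mult_tendsto qm qb ql)
      then show "(\<lambda>n. norm (l2_convol (\<rho> n) (u t) - u t) + norm (l2_mult (q n) (u t) - u t)) \<longlonglongrightarrow> 0" by simp
    qed
    have est: "(norm (l2_mult (q n) (l2_convol (\<rho> n) (u t))))\<^sup>2
        \<le> (2 * \<kappa> * (inverse c\<^sub>m * (1 / R n) + T_bound) + \<nu> * (48 * (1 / R n)\<^sup>2)) * h t" for n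
      using mollified_energy_bound[OF c w \<nu> u0 \<rho>[of n] _ _ t, of "R n"]
      unfolding q_def h_def R_def by (simp add: power_divide)
    have "(\<lambda>n. (2 * \<kappa> * (inverse c\<^sub>m * (1 / R n) + T_bound) + \<nu> * (48 * (1 / R n)\<^sup>2)) * h t)
        \<longlonglongrightarrow> (2 * \<kappa> * (inverse c\<^sub>m * 0 + T_bound) + \<nu> * (48 * 0\<^sup>2)) * h t"
      by (intro tendsto_intros inv)
    then have l2: "(\<lambda>n. (2 * \<kappa> * (inverse c\<^sub>m * (1 / R n) + T_bound) + \<nu> * (48 * (1 / R n)\<^sup>2)) * h t) \<longlonglongrightarrow> C * h t"
      by (simp add: C_def)
    have "(\<lambda>n. (norm (l2_mult (q n) (l2_convol (\<rho> n) (u t))))\<^sup>2) \<longlonglongrightarrow> (norm (u t))\<^sup>2"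
      by (intro tendsto_intros lim1)
    then show ?thesis by (rule LIMSEQ_le[OF _ l2]) (use est in blast)
  qed
  have dh: "(h has_vector_derivative (norm (u r))\<^sup>2) (at r within {0..t0})" if "r \<in> {0..t0}" for r
    unfolding h_def by (rule integral_has_vector_derivative[OF _ that])
      (intro continuous_intros continuous_on_subset[OF c], simp)
  have "\<exists>r\<in>{0..t0}. exp (- C * t0) * h t0 - exp (- C * 0) * h 0
      = (exp (- C * r) * ((norm (u r))\<^sup>2 - C * h r)) * (t0 - 0)"
  proof (rule mvt_very_simple[OF t0])
    fix r assume r: "0 \<le> r" "r \<le> t0"
    have 1: "(h has_real_derivative (norm (u r))\<^sup>2) (at r within {0..t0})"
      using dh[of r] r by (simp add: has_real_derivative_iff_has_vector_derivative)
    have 2: "((\<lambda>t. exp (- C * t)) has_real_derivative exp (- C * r) * - C) (at r within {0..t0})"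
      by (auto intro!: derivative_eq_intros)
    have "((\<lambda>t. exp (- C * t) * h t) has_real_derivative exp (- C * r) * ((norm (u r))\<^sup>2 - C * h r)) (at r within {0..t0})"
      by (rule DERIV_cong[OF DERIV_mult[OF 2 1]]) (simp add: algebra_simps)
    then show "((\<lambda>t. exp (- C * t) * h t) has_derivative (*) (exp (- C * r) * ((norm (u r))\<^sup>2 - C * h r))) (at r within {0..t0})"
      by (simp only: has_field_derivative_def)
  qed
  then obtain r where r: "r \<in> {0..t0}" "exp (- C * t0) * h t0 - exp (- C * 0) * h 0
      = (exp (- C * r) * ((norm (u r))\<^sup>2 - C * h r)) * (t0 - 0)" by blast
  have "(exp (- C * r) * ((norm (u r))\<^sup>2 - C * h r)) * (t0 - 0) \<le> 0"
    using bound[of r] r(1) t0 by (intro mult_nonpos_nonneg mult_nonneg_nonpos) auto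
  moreover have "h 0 = 0" by (simp add: h_def)
  ultimately have "exp (- C * t0) * h t0 \<le> 0" using r(2) by simp
  then have "h t0 \<le> 0" by (simp add: mult_le_0_iff)
  moreover have "0 \<le> C" using \<kappa> T_bound_nonneg by (simp add: C_def)
  ultimately have "C * h t0 \<le> 0" by (intro mult_nonneg_nonpos)
  then have "(norm (u t0))\<^sup>2 \<le> 0" using bound[OF t0] by linarith
  then show ?thesis by simp
qed

lemma gen_diff: "test_function \<phi> \<Longrightarrow> gen \<nu> (u - v) \<phi> = gen \<nu> u \<phi> - gen \<nu> v \<phi>"
  by (simp only: gen_def linear_diff[OF bounded_linear.linear[OF T_linear]]
      l2_pair_diff[OF square_integrable_b_test] l2_pair_diff[OF square_integrable_helmholtz_test]
      l2_pair_diff[OF test_function_square_integrable]) (simp add: right_diff_distrib left_diff_distrib)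

lemma weak_solution_unique:
  assumes u: "continuous_on {0..} u" "weak_solution \<nu> u" and v: "continuous_on {0..} v" "weak_solution \<nu> v"
    and "0 \<le> \<nu>" "u 0 = v 0" "0 \<le> t"
  shows "u t = v t"
proof -
  have "u t - v t = 0"
  proof (rule weak_solution_zero[of "\<lambda>t. u t - v t" \<nu>])
    show "continuous_on {0..} (\<lambda>t. u t - v t)" by (intro continuous_intros u v)
    show "weak_solution \<nu> (\<lambda>t. u t - v t)"
      unfolding weak_solution_def
    proof (intro allI impI)
      fix \<phi> and t :: real assume \<phi>: "test_function \<phi>" and t: "0 \<le> t"
      show "((\<lambda>s. l2_pair (u s - v s) (\<lambda>y. of_real (\<phi> y))) has_vector_derivative gen \<nu> (u t - v t) \<phi>) (at t within {0..})"
        unfolding l2_pair_diff[OF test_function_square_integrable[OF \<phi>]] gen_diff[OF \<phi>]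
        using u(2) v(2) \<phi> t unfolding weak_solution_def by (intro has_vector_derivative_diff) blast+
    qed
  qed (use assms in auto)
  then show ?thesis by simp
qed

end

section \<open>The adjoint of the Rayleigh operator has no real eigenvalues\<close>

text \<open>A real convolution for integrable \<open>h\<close>. It is needed because
  \<open>b'' \<eta>\<close>, a product of two square integrable functions, is only
  integrable.\<close>

definition rconv :: "(real \<Rightarrow> real) \<Rightarrow> (real \<Rightarrow> real) \<Rightarrow> real \<Rightarrow> real" where
  "rconv J h x = (\<integral>y. J (x - y) * h y \<partial>lborel)"

lemma rconv_integrable:
  assumes "bounded_kernel J" "integrable lborel h"
  shows "integrable lborel (\<lambda>y. J (x - y) * h y)"
proof -
  obtain B where B: "\<And>z. \<bar>J z\<bar> \<le> B" using assms by (auto simp: bounded_kernel_def)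
  note [measurable] = bounded_kernel_borel[OF assms(1)] borel_measurable_integrable[OF assms(2)]
  show ?thesis
  proof (rule Bochner_Integration.integrable_bound[OF integrable_mult_right[OF assms(2), of B]])
    show "AE y in lborel. norm (J (x - y) * h y) \<le> norm (B * h y)"
      unfolding real_norm_def abs_mult
      by (intro AE_I2 mult_right_mono order_trans[OF B abs_ge_self]) simp
  qed measurable
qed

lemma rconv_borel [measurable]:
  assumes [measurable]: "J \<in> borel_measurable borel" "h \<in> borel_measurable borel"
  shows "rconv J h \<in> borel_measurable borel"
proof -
  have "(\<lambda>x. \<integral>y. J (x - y) * h y \<partial>lborel) \<in> borel_measurable lborel"
    by (rule lborel.borel_measurable_lebesgue_integral) measurable
  then show ?thesis by (simp add: rconv_def[abs_def])
qed

lemma rconv_bound: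
  assumes J: "bounded_kernel J" and B: "\<And>z. \<bar>J z\<bar> \<le> B" and h: "integrable lborel h"
  shows "\<bar>rconv J h x\<bar> \<le> B * (\<integral>y. \<bar>h y\<bar> \<partial>lborel)"
proof -
  have "norm (rconv J h x) \<le> (\<integral>y. norm (J (x - y) * h y) \<partial>lborel)"
    unfolding rconv_def by (rule integral_norm_bound)
  also have "\<dots> \<le> (\<integral>y. B * \<bar>h y\<bar> \<partial>lborel)"
  proof (rule integral_mono[OF integrable_norm[OF rconv_integrable[OF J h]]])
    show "integrable lborel (\<lambda>y. B * \<bar>h y\<bar>)" using h by simp
    show "norm (J (x - y) * h y) \<le> B * \<bar>h y\<bar>" for y
      unfolding real_norm_def abs_mult by (intro mult_right_mono B) simp
  qed
  finally show ?thesis by simp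
qed

lemma rconv_fubini:
  assumes J: "bounded_kernel J" and h: "integrable lborel h" and g: "g \<in> borel_measurable borel" "\<And>x. \<bar>g x\<bar> \<le> C"
  shows "integrable lborel (\<lambda>x. rconv J h x * g x)"
    and "(\<integral>x. rconv J h x * g x \<partial>lborel) = (\<integral>y. h y * (\<integral>x. J (x - y) * g x \<partial>lborel) \<partial>lborel)"
proof -
  define f where "f y x = J (x - y) * h y * g x" for x y
  note [measurable] = bounded_kernel_borel[OF J] borel_measurable_integrable[OF h, simplified] g(1)
  have Ji: "integrable lborel (\<lambda>x. J (x - y))" for y
    using lborel_integrable_real_affine[of J 1 "- y"] J by (simp add: bounded_kernel_def)
  have Jn: "(\<integral>x. \<bar>J (x - y)\<bar> \<partial>lborel) = (\<integral>x. \<bar>J x\<bar> \<partial>lborel)" for y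
    using lborel_integral_real_affine[of 1 "\<lambda>x. \<bar>J x\<bar>" "- y"] by simp
  have Jg: "integrable lborel (\<lambda>x. J (x - y) * g x)" for y
  proof (rule Bochner_Integration.integrable_bound[OF integrable_mult_right[OF Ji, of C]])
    show "AE x in lborel. norm (J (x - y) * g x) \<le> norm (C * J (x - y))"
      unfolding real_norm_def abs_mult mult.commute[of "\<bar>J _\<bar>"]
      by (intro AE_I2 mult_right_mono order_trans[OF g(2) abs_ge_self]) simp
  qed measurable
  have fi: "integrable lborel (f y)" for y
  proof -
    have "f y = (\<lambda>x. h y * (J (x - y) * g x))" by (simp add: f_def fun_eq_iff)
    then show ?thesis using integrable_mult_right[OF Jg] by simp
  qed
  have F: "integrable (lborel \<Otimes>\<^sub>M lborel) (case_prod f)"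
  proof (rule lborel_pair.Fubini_integrable)
    show "case_prod f \<in> borel_measurable (lborel \<Otimes>\<^sub>M lborel)" unfolding f_def by measurable
    have "integrable lborel (\<lambda>y. \<integral>x. norm (f y x) \<partial>lborel)"
    proof (rule Bochner_Integration.integrable_bound)
      show "integrable lborel (\<lambda>y. (C * (\<integral>x. \<bar>J x\<bar> \<partial>lborel)) * h y)" by (rule integrable_mult_right[OF h])
      show "(\<lambda>y. \<integral>x. norm (f y x) \<partial>lborel) \<in> borel_measurable lborel"
        unfolding f_def by (rule lborel.borel_measurable_lebesgue_integral) measurable
      show "AE y in lborel. norm (\<integral>x. norm (f y x) \<partial>lborel) \<le> norm ((C * (\<integral>x. \<bar>J x\<bar> \<partial>lborel)) * h y)"
      proof (rule AE_I2)
        fix y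
        have "(\<integral>x. norm (f y x) \<partial>lborel) \<le> (\<integral>x. (C * \<bar>h y\<bar>) * \<bar>J (x - y)\<bar> \<partial>lborel)"
        proof (rule integral_mono[OF integrable_norm[OF fi]])
          show "integrable lborel (\<lambda>x. (C * \<bar>h y\<bar>) * \<bar>J (x - y)\<bar>)" using Ji by simp
          have "\<bar>g x\<bar> * (\<bar>h y\<bar> * \<bar>J (x - y)\<bar>) \<le> C * (\<bar>h y\<bar> * \<bar>J (x - y)\<bar>)" for x by (intro mult_right_mono g(2)) simp
          then show "norm (f y x) \<le> (C * \<bar>h y\<bar>) * \<bar>J (x - y)\<bar>" for x
            by (simp add: f_def abs_mult mult_ac)
        qed
        also have "\<dots> = (C * \<bar>h y\<bar>) * (\<integral>x. \<bar>J x\<bar> \<partial>lborel)" by (simp only: integral_mult_right_zero Jn)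
        also have "\<dots> = (C * (\<integral>x. \<bar>J x\<bar> \<partial>lborel)) * \<bar>h y\<bar>" by (simp only: mult_ac)
        also have "\<dots> \<le> norm ((C * (\<integral>x. \<bar>J x\<bar> \<partial>lborel)) * h y)"
          unfolding real_norm_def abs_mult[of _ "h y"] by (intro mult_right_mono abs_ge_self abs_ge_zero)
        finally show "norm (\<integral>x. norm (f y x) \<partial>lborel) \<le> norm ((C * (\<integral>x. \<bar>J x\<bar> \<partial>lborel)) * h y)"
          by (simp add: abs_of_nonneg[OF integral_nonneg_AE])
      qed
    qed
    then show "integrable lborel (\<lambda>y. \<integral>x. norm (case (y, x) of (y, x) \<Rightarrow> f y x) \<partial>lborel)" by simp
    show "AE y in lborel. integrable lborel (\<lambda>x. case (y, x) of (y, x) \<Rightarrow> f y x)" using fi by simp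
  qed
  have e1: "(\<integral>y. f y x \<partial>lborel) = rconv J h x * g x" for x
    by (simp only: f_def rconv_def integral_mult_left_zero)
  have e2: "(\<integral>x. f y x \<partial>lborel) = h y * (\<integral>x. J (x - y) * g x \<partial>lborel)" for y
  proof -
    have "f y = (\<lambda>x. h y * (J (x - y) * g x))" by (simp add: f_def fun_eq_iff)
    then show ?thesis by (simp only: integral_mult_right_zero)
  qed
  show "integrable lborel (\<lambda>x. rconv J h x * g x)"
    using lborel_pair.integrable_snd[OF F] unfolding e1 .
  show "(\<integral>x. rconv J h x * g x \<partial>lborel) = (\<integral>y. h y * (\<integral>x. J (x - y) * g x \<partial>lborel) \<partial>lborel)"
    using lborel_pair.Fubini_integral[OF F] unfolding e1 e2 .
qed

lemma green_lipschitz: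
  assumes "0 < \<kappa>"
  shows "\<bar>green \<kappa> a - green \<kappa> c\<bar> \<le> \<bar>a - c\<bar> / 2"
proof -
  have le: "exp (- p) - exp (- q) \<le> q - p" if "0 \<le> p" "p \<le> q" for p q :: real
  proof -
    have "exp (- p) - exp (- q) = exp (- p) * (1 - exp (- (q - p)))" by (simp add: algebra_simps flip: exp_add)
    also have "\<dots> \<le> 1 * (q - p)"
      proof (rule mult_mono)
      have "1 + (p - q) \<le> exp (p - q)" by (rule exp_ge_add_one_self)
      then show "1 - exp (- (q - p)) \<le> q - p" unfolding minus_diff_eq by linarith
    qed (use that in auto)
    finally show ?thesis by simp
  qed
  have "\<bar>exp (- p) - exp (- q)\<bar> \<le> \<bar>p - q\<bar>" if "0 \<le> p" "0 \<le> q" for p q :: real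
  proof (cases "p \<le> q")
    case True
    then show ?thesis using le[of p q] that by simp
  next
    case False
    then show ?thesis using le[of q p] that by (simp add: abs_if)
  qed
  from this[of "\<kappa> * \<bar>a\<bar>" "\<kappa> * \<bar>c\<bar>"]
  have "\<bar>exp (- (\<kappa> * \<bar>a\<bar>)) - exp (- (\<kappa> * \<bar>c\<bar>))\<bar> \<le> \<bar>\<kappa> * \<bar>a\<bar> - \<kappa> * \<bar>c\<bar>\<bar>" using assms by simp
  also have "\<dots> = \<kappa> * \<bar>\<bar>a\<bar> - \<bar>c\<bar>\<bar>" using assms by (simp add: abs_mult flip: right_diff_distrib)
  also have "\<dots> \<le> \<kappa> * \<bar>a - c\<bar>" using assms by (intro mult_left_mono abs_triangle_ineq3) simp
  finally have 1: "\<bar>exp (- (\<kappa> * \<bar>a\<bar>)) - exp (- (\<kappa> * \<bar>c\<bar>))\<bar> \<le> \<kappa> * \<bar>a - c\<bar>" .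
  have "green \<kappa> a - green \<kappa> c = - (exp (- (\<kappa> * \<bar>a\<bar>)) - exp (- (\<kappa> * \<bar>c\<bar>))) / (2 * \<kappa>)"
    by (simp add: green_def diff_divide_distrib)
  then have "\<bar>green \<kappa> a - green \<kappa> c\<bar> = \<bar>exp (- (\<kappa> * \<bar>a\<bar>)) - exp (- (\<kappa> * \<bar>c\<bar>))\<bar> / (2 * \<kappa>)"
    using assms by (simp add: abs_minus_commute)
  also have "\<dots> \<le> (\<kappa> * \<bar>a - c\<bar>) / (2 * \<kappa>)" using 1 assms by (intro divide_right_mono) auto
  finally show ?thesis using assms by simp
qed

lemma green_has_derivative:
  assumes "0 < \<kappa>" "z \<noteq> 0"
  shows "(green \<kappa> has_real_derivative green' \<kappa> z) (at z)"
proof (cases "0 < z")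
  case True
  have "((\<lambda>z. - exp (- \<kappa> * z) / (2 * \<kappa>)) has_real_derivative green' \<kappa> z) (at z)"
    using True assms(1) by (auto intro!: derivative_eq_intros simp: green'_def)
  then show ?thesis
    by (rule has_field_derivative_transform_within_open[of _ _ _ "{0<..}"]) (use True in \<open>auto simp: green_def\<close>)
next
  case False
  then have z: "z < 0" using assms(2) by simp
  have "((\<lambda>z. - exp (\<kappa> * z) / (2 * \<kappa>)) has_real_derivative green' \<kappa> z) (at z)"
    using z assms(1) by (auto intro!: derivative_eq_intros simp: green'_def)
  then show ?thesis
    by (rule has_field_derivative_transform_within_open[of _ _ _ "{..<0}"]) (use z in \<open>auto simp: green_def\<close>)
qed

text \<open>The kernel fails to be differentiable only at \<open>y = x\<close>, a null set, and its
  Lipschitz bound dominates the difference quotients by \<open>|h|\<close>.\<close>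

lemma rconv_green_has_derivative:
  assumes \<kappa>: "0 < \<kappa>" and h: "integrable lborel h"
  shows "(rconv (green \<kappa>) h has_real_derivative rconv (green' \<kappa>) h x) (at x)"
  unfolding DERIV_def tendsto_at_iff_sequentially
proof (intro allI impI)
  fix X :: "nat \<Rightarrow> real" assume X: "\<forall>i. X i \<in> UNIV - {0}" "X \<longlonglongrightarrow> 0"
  note K = bounded_kernel_green[OF \<kappa>] and K' = bounded_kernel_green'[OF \<kappa>]
  note [measurable] = bounded_kernel_borel[OF K] bounded_kernel_borel[OF K'] borel_measurable_integrable[OF h, simplified]
  have e: "(rconv (green \<kappa>) h (x + X n) - rconv (green \<kappa>) h x) / X n
      = (\<integral>y. ((green \<kappa> (x + X n - y) - green \<kappa> (x - y)) / X n) * h y \<partial>lborel)" for n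
  proof -
    have "(\<lambda>y. ((green \<kappa> (x + X n - y) - green \<kappa> (x - y)) / X n) * h y)
        = (\<lambda>y. (green \<kappa> (x + X n - y) * h y - green \<kappa> (x - y) * h y) / X n)"
      by (simp add: fun_eq_iff left_diff_distrib)
    then show ?thesis
      by (simp only: integral_divide_zero Bochner_Integration.integral_diff[OF rconv_integrable[OF K h] rconv_integrable[OF K h]] rconv_def)
  qed
  have "(\<lambda>n. \<integral>y. ((green \<kappa> (x + X n - y) - green \<kappa> (x - y)) / X n) * h y \<partial>lborel) \<longlonglongrightarrow> (\<integral>y. green' \<kappa> (x - y) * h y \<partial>lborel)"
  proof (rule integral_dominated_convergence)
    show "integrable lborel (\<lambda>y. \<bar>h y\<bar>)" using h by simp
    have "AE y in lborel. y \<noteq> x" by (rule AE_lborel_singleton)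
    then show "AE y in lborel. (\<lambda>n. ((green \<kappa> (x + X n - y) - green \<kappa> (x - y)) / X n) * h y) \<longlonglongrightarrow> green' \<kappa> (x - y) * h y"
    proof eventually_elim
      case (elim y)
      have "((\<lambda>t. (green \<kappa> (x - y + t) - green \<kappa> (x - y)) / t) \<longlongrightarrow> green' \<kappa> (x - y)) (at 0)"
        using green_has_derivative[OF \<kappa>, of "x - y"] elim by (simp add: DERIV_def)
      then have "(\<lambda>n. (green \<kappa> (x - y + X n) - green \<kappa> (x - y)) / X n) \<longlonglongrightarrow> green' \<kappa> (x - y)"
        using X unfolding tendsto_at_iff_sequentially o_def by blast
      then have "(\<lambda>n. (green \<kappa> (x - y + X n) - green \<kappa> (x - y)) / X n * h y) \<longlonglongrightarrow> green' \<kappa> (x - y) * h y"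
        by (intro tendsto_mult tendsto_const)
      then show ?case by (simp only: add.commute add_diff_eq diff_add_eq)
    qed
    show "AE y in lborel. norm (((green \<kappa> (x + X n - y) - green \<kappa> (x - y)) / X n) * h y) \<le> \<bar>h y\<bar>" for n
    proof (rule AE_I2)
      fix y
      have "\<bar>green \<kappa> (x + X n - y) - green \<kappa> (x - y)\<bar> \<le> \<bar>X n\<bar> / 2"
        using green_lipschitz[OF \<kappa>, of "x + X n - y" "x - y"] by simp
      also have "\<dots> \<le> \<bar>X n\<bar>" by simp
      finally have "\<bar>(green \<kappa> (x + X n - y) - green \<kappa> (x - y)) / X n\<bar> \<le> 1"
        using X(1) unfolding abs_divide divide_le_eq_1 by auto
      then have "\<bar>(green \<kappa> (x + X n - y) - green \<kappa> (x - y)) / X n\<bar> * \<bar>h y\<bar> \<le> 1 * \<bar>h y\<bar>"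
        by (rule mult_right_mono) simp
      then show "norm (((green \<kappa> (x + X n - y) - green \<kappa> (x - y)) / X n) * h y) \<le> \<bar>h y\<bar>"
        by (simp only: real_norm_def abs_mult mult_1)
    qed
  qed measurable
  then show "((\<lambda>t. (rconv (green \<kappa>) h (x + t) - rconv (green \<kappa>) h x) / t) \<circ> X) \<longlonglongrightarrow> rconv (green' \<kappa>) h x"
    unfolding o_def e rconv_def[of "green' \<kappa>"] .
qed

text \<open>The energy identity at the level of the kernel, formally the equation for one translate
  tested against another. Between \<open>y\<close> and \<open>w\<close> the two products cancel;
  outside they coincide.\<close>

lemma green_product_integral:
  assumes \<kappa>: "0 < \<kappa>"
  shows "(\<integral>x. green' \<kappa> (x - y) * green' \<kappa> (x - w) \<partial>lborel) + \<kappa>\<^sup>2 * (\<integral>x. green \<kappa> (x - y) * green \<kappa> (x - w) \<partial>lborel) = - green \<kappa> (w - y)"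
proof -
  have shift: "bounded_kernel (\<lambda>x. J (x - y))" if "bounded_kernel J" for J y
    using that lborel_integrable_real_affine[of J 1 "- y"] by (auto simp: bounded_kernel_def)
  have int: "integrable lborel (\<lambda>x. J (x - y) * J (x - w))" if "bounded_kernel J" for J y w
  proof -
    have "integrable lborel (\<lambda>x. complex_of_real (J (x - y)) * complex_of_real (J (x - w)))"
      by (intro square_integrable_mult_integrable bounded_kernel_square_integrable shift that)
    then show ?thesis by (simp only: of_real_mult[symmetric] complex_of_real_integrable_eq)
  qed
  note iG = int[OF bounded_kernel_green[OF \<kappa>]] and iG' = int[OF bounded_kernel_green'[OF \<kappa>]]
  have main: "(\<integral>x. green' \<kappa> (x - y) * green' \<kappa> (x - w) + \<kappa>\<^sup>2 * (green \<kappa> (x - y) * green \<kappa> (x - w)) \<partial>lborel) = - green \<kappa> (w - y)"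
    if yw: "y \<le> w" for y w
  proof -
    \<comment> \<open>Outside the interval between the poles, the integrand is the constant
      \<open>E\<close> times the one-sided exponential \<open>e\<close> measured from the nearer
      pole.\<close>
    define E where "E = exp (- \<kappa> * (w - y)) / 2"
    have half: "(\<integral>\<^sup>+x. ennreal (exp (- (2 * \<kappa>) * x)) * indicator {0..} x \<partial>lborel) = ennreal (0 - (- exp (- (2 * \<kappa>) * 0) / (2 * \<kappa>)))"
    proof (rule nn_integral_FTC_atLeast)
      show "((\<lambda>z. - exp (- (2 * \<kappa>) * z) / (2 * \<kappa>)) has_real_derivative exp (- (2 * \<kappa>) * x)) (at x)" for x
        using \<kappa> by (auto intro!: derivative_eq_intros)
      have "filterlim (\<lambda>z. (- (2 * \<kappa>)) * z) at_bot at_top"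
        using \<kappa> by (intro filterlim_tendsto_neg_mult_at_bot[OF tendsto_const _ filterlim_ident]) simp
      then have "((\<lambda>z. exp (- (2 * \<kappa>) * z)) \<longlongrightarrow> 0) at_top" by (rule filterlim_compose[OF exp_at_bot])
      then have "((\<lambda>z. - exp (- (2 * \<kappa>) * z) / (2 * \<kappa>)) \<longlongrightarrow> - 0 / (2 * \<kappa>)) at_top"
        using \<kappa> by (intro tendsto_intros) auto
      then show "((\<lambda>z. - exp (- (2 * \<kappa>) * z) / (2 * \<kappa>)) \<longlongrightarrow> 0) at_top" by simp
    qed simp_all
    define e where "e x = exp (- (2 * \<kappa>) * x) * indicator {0..} x" for x :: real
    have he: "has_bochner_integral lborel e (1 / (2 * \<kappa>))"
    proof (rule has_bochner_integral_nn_integral)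
      show "e \<in> borel_measurable lborel" unfolding e_def[abs_def] by measurable
      have "(\<integral>\<^sup>+x. ennreal (e x) \<partial>lborel) = (\<integral>\<^sup>+x. ennreal (exp (- (2 * \<kappa>) * x)) * indicator {0..} x \<partial>lborel)"
        by (rule nn_integral_cong) (simp add: e_def indicator_def)
      then show "(\<integral>\<^sup>+x. ennreal (e x) \<partial>lborel) = ennreal (1 / (2 * \<kappa>))" using half by simp
    qed (use \<kappa> in \<open>simp_all add: e_def\<close>)
    then have ei: "integrable lborel e" "(\<integral>x. e x \<partial>lborel) = 1 / (2 * \<kappa>)" by (simp_all add: has_bochner_integral_iff)
    have s1: "integrable lborel (\<lambda>x. e (- w + 1 * x))" "(\<integral>x. e (- w + 1 * x) \<partial>lborel) = 1 / (2 * \<kappa>)"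
      using lborel_integrable_real_affine[OF ei(1), of 1 "- w"] lborel_integral_real_affine[of 1 e "- w"] ei(2) by simp_all
    have s2: "integrable lborel (\<lambda>x. e (y + (-1) * x))" "(\<integral>x. e (y + (-1) * x) \<partial>lborel) = 1 / (2 * \<kappa>)"
      using lborel_integrable_real_affine[OF ei(1), of "-1" y] lborel_integral_real_affine[of "-1" e y] ei(2) by simp_all
    have ae: "AE x in lborel. x \<noteq> y \<and> x \<noteq> w"
      using AE_lborel_singleton[of y] AE_lborel_singleton[of w] by eventually_elim simp
    have "(\<integral>x. green' \<kappa> (x - y) * green' \<kappa> (x - w) + \<kappa>\<^sup>2 * (green \<kappa> (x - y) * green \<kappa> (x - w)) \<partial>lborel)
        = (\<integral>x. E * e (- w + 1 * x) + E * e (y + (-1) * x) \<partial>lborel)"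
    proof (rule integral_cong_AE)
      show "(\<lambda>x. green' \<kappa> (x - y) * green' \<kappa> (x - w) + \<kappa>\<^sup>2 * (green \<kappa> (x - y) * green \<kappa> (x - w))) \<in> borel_measurable lborel"
        by (intro borel_measurable_integrable Bochner_Integration.integrable_add integrable_mult_right iG iG')
      show "(\<lambda>x. E * e (- w + 1 * x) + E * e (y + (-1) * x)) \<in> borel_measurable lborel"
        by (intro borel_measurable_integrable Bochner_Integration.integrable_add integrable_mult_right s1 s2)
      show "AE x in lborel. green' \<kappa> (x - y) * green' \<kappa> (x - w) + \<kappa>\<^sup>2 * (green \<kappa> (x - y) * green \<kappa> (x - w))
          = E * e (- w + 1 * x) + E * e (y + (-1) * x)"
        using ae
      proof eventually_elim
        case (elim x)
        have g: "\<kappa>\<^sup>2 * (green \<kappa> (x - y) * green \<kappa> (x - w)) = exp (- \<kappa> * \<bar>x - y\<bar>) * exp (- \<kappa> * \<bar>x - w\<bar>) / 4"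
          using \<kappa> by (simp add: green_def power2_eq_square)
        have g': "green' \<kappa> (x - y) * green' \<kappa> (x - w) = sgn (x - y) * sgn (x - w) * (exp (- \<kappa> * \<bar>x - y\<bar>) * exp (- \<kappa> * \<bar>x - w\<bar>)) / 4"
          by (simp add: green'_def)
        consider "w < x" | "x < y" | "y < x" "x < w" using elim by linarith
        then show ?case
        proof cases
          case 1
          then have "exp (- \<kappa> * \<bar>x - y\<bar>) * exp (- \<kappa> * \<bar>x - w\<bar>) = exp (- \<kappa> * (w - y)) * exp (- (2 * \<kappa>) * (- w + 1 * x))"
            using yw by (simp add: algebra_simps flip: exp_add)
          then show ?thesis unfolding g g' using 1 yw by (simp add: e_def E_def)
        next
          case 2
          then have "exp (- \<kappa> * \<bar>x - y\<bar>) * exp (- \<kappa> * \<bar>x - w\<bar>) = exp (- \<kappa> * (w - y)) * exp (- (2 * \<kappa>) * (y + (-1) * x))"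
            using yw by (simp add: algebra_simps flip: exp_add)
          then show ?thesis unfolding g g' using 2 yw by (simp add: e_def E_def)
        next
          case 3
          then show ?thesis unfolding g g' by (simp add: e_def)
        qed
      qed
    qed
    also have "\<dots> = E * (1 / (2 * \<kappa>)) + E * (1 / (2 * \<kappa>))"
      by (subst Bochner_Integration.integral_add) (simp_all only: integral_mult_right_zero integrable_mult_right s1 s2)
    also have "\<dots> = - green \<kappa> (w - y)" using yw \<kappa> by (simp add: E_def green_def)
    finally show ?thesis .
  qed
  have "(\<integral>x. green' \<kappa> (x - y) * green' \<kappa> (x - w) + \<kappa>\<^sup>2 * (green \<kappa> (x - y) * green \<kappa> (x - w)) \<partial>lborel) = - green \<kappa> (w - y)"
  proof (cases "y \<le> w")
    case True
    then show ?thesis by (rule main)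
  next
    case False
    then have "(\<integral>x. green' \<kappa> (x - w) * green' \<kappa> (x - y) + \<kappa>\<^sup>2 * (green \<kappa> (x - w) * green \<kappa> (x - y)) \<partial>lborel) = - green \<kappa> (y - w)"
      by (intro main) simp
    moreover have "green \<kappa> (y - w) = green \<kappa> (w - y)" using green_minus[of \<kappa> "w - y"] by simp
    ultimately show ?thesis by (simp only: mult.commute)
  qed
  then show ?thesis
    by (simp only: Bochner_Integration.integral_add[OF iG' integrable_mult_right[OF iG]] integral_mult_right_zero)
qed

text \<open>Formally, multiply \<open>\<Psi>'' - \<kappa>^2 \<Psi> = h\<close> by
  \<open>\<Psi>\<close> and integrate by parts. Since \<open>h\<close> is only integrable, the
  quadratic expressions are instead unfolded by Fubini and reduced to
  \<open>green_product_integral\<close>.\<close>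

lemma rconv_energy:
  assumes \<kappa>: "0 < \<kappa>" and h: "integrable lborel h"
  defines "\<Psi> \<equiv> rconv (green \<kappa>) h" and "D \<equiv> rconv (green' \<kappa>) h"
  shows "integrable lborel (\<lambda>x. D x * D x)" "integrable lborel (\<lambda>x. \<Psi> x * \<Psi> x)" "integrable lborel (\<lambda>x. h x * \<Psi> x)"
    "(\<integral>x. D x * D x \<partial>lborel) + \<kappa>\<^sup>2 * (\<integral>x. \<Psi> x * \<Psi> x \<partial>lborel) = - (\<integral>x. h x * \<Psi> x \<partial>lborel)"
proof -
  note K = bounded_kernel_green[OF \<kappa>] and K' = bounded_kernel_green'[OF \<kappa>]
  obtain B where B: "\<And>z. \<bar>green \<kappa> z\<bar> \<le> B" using K by (auto simp: bounded_kernel_def)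
  obtain B' where B': "\<And>z. \<bar>green' \<kappa> z\<bar> \<le> B'" using K' by (auto simp: bounded_kernel_def)
  note [measurable] = bounded_kernel_borel[OF K] bounded_kernel_borel[OF K'] borel_measurable_integrable[OF h, simplified]
  have \<Psi>m: "\<Psi> \<in> borel_measurable borel" and Dm: "D \<in> borel_measurable borel" unfolding \<Psi>_def D_def by measurable
  note \<Psi>b = rconv_bound[OF K B h, folded \<Psi>_def] and Db = rconv_bound[OF K' B' h, folded D_def]
  note F1 = rconv_fubini[OF K h \<Psi>m \<Psi>b, folded \<Psi>_def] and F2 = rconv_fubini[OF K' h Dm Db, folded D_def]
  show 1: "integrable lborel (\<lambda>x. D x * D x)" "integrable lborel (\<lambda>x. \<Psi> x * \<Psi> x)" by (rule F2 F1)+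
  have bint: "integrable lborel (\<lambda>x. h x * g x)" if [measurable]: "g \<in> borel_measurable borel" and "\<And>x. \<bar>g x\<bar> \<le> C" for g C
  proof (rule Bochner_Integration.integrable_bound[OF integrable_mult_right[OF h, of C]])
    show "AE x in lborel. norm (h x * g x) \<le> norm (C * h x)"
      unfolding real_norm_def abs_mult mult.commute[of "\<bar>h _\<bar>"]
      by (intro AE_I2 mult_right_mono order_trans[OF that(2) abs_ge_self]) simp
  qed measurable
  show "integrable lborel (\<lambda>x. h x * \<Psi> x)" by (rule bint[OF \<Psi>m \<Psi>b])
  define p where "p y = (\<integral>x. green' \<kappa> (x - y) * D x \<partial>lborel)" for y
  define q where "q y = (\<integral>x. green \<kappa> (x - y) * \<Psi> x \<partial>lborel)" for y
  have pq: "p y + \<kappa>\<^sup>2 * q y = - \<Psi> y" for y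
  proof -
    have m1: "(\<lambda>x. green' \<kappa> (x - y)) \<in> borel_measurable borel" "(\<lambda>x. green \<kappa> (x - y)) \<in> borel_measurable borel" by measurable
    have p: "p y = (\<integral>w. h w * (\<integral>x. green' \<kappa> (x - w) * green' \<kappa> (x - y) \<partial>lborel) \<partial>lborel)"
      unfolding p_def D_def using rconv_fubini(2)[OF K' h m1(1) B'] by (simp only: mult.commute)
    have q: "q y = (\<integral>w. h w * (\<integral>x. green \<kappa> (x - w) * green \<kappa> (x - y) \<partial>lborel) \<partial>lborel)"
      unfolding q_def \<Psi>_def using rconv_fubini(2)[OF K h m1(2) B] by (simp only: mult.commute)
    define P where "P w = (\<integral>x. green' \<kappa> (x - w) * green' \<kappa> (x - y) \<partial>lborel)" for w
    define Q where "Q w = (\<integral>x. green \<kappa> (x - w) * green \<kappa> (x - y) \<partial>lborel)" for w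
    have PQ: "P w = - green \<kappa> (y - w) - \<kappa>\<^sup>2 * Q w" for w
      using green_product_integral[OF \<kappa>, of w y] by (simp add: P_def Q_def)
    have Qm: "Q \<in> borel_measurable borel"
    proof -
      have "(\<lambda>w. \<integral>x. green \<kappa> (x - w) * green \<kappa> (x - y) \<partial>lborel) \<in> borel_measurable lborel"
        by (rule lborel.borel_measurable_lebesgue_integral) measurable
      then show ?thesis by (simp add: Q_def[abs_def])
    qed
    have Qb: "\<bar>Q w\<bar> \<le> B * (\<integral>x. \<bar>green \<kappa> x\<bar> \<partial>lborel)" for w
    proof -
      have iy: "integrable lborel (\<lambda>x. green \<kappa> (x - y))"
        using K lborel_integrable_real_affine[of "green \<kappa>" 1 "- y"] by (simp add: bounded_kernel_def)
      have sym: "green \<kappa> (w - x) = green \<kappa> (x - w)" for x using green_minus[of \<kappa> "x - w"] by simp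
      have "Q w = rconv (green \<kappa>) (\<lambda>x. green \<kappa> (x - y)) w" unfolding Q_def rconv_def sym ..
      also have "\<bar>\<dots>\<bar> \<le> B * (\<integral>x. \<bar>green \<kappa> (x - y)\<bar> \<partial>lborel)" by (rule rconv_bound[OF K B iy])
      also have "(\<integral>x. \<bar>green \<kappa> (x - y)\<bar> \<partial>lborel) = (\<integral>x. \<bar>green \<kappa> x\<bar> \<partial>lborel)"
        using lborel_integral_real_affine[of 1 "\<lambda>x. \<bar>green \<kappa> x\<bar>" "- y"] by simp
      finally show ?thesis .
    qed
    have i1: "integrable lborel (\<lambda>w. h w * Q w)" by (rule bint[OF Qm Qb])
    have i2: "integrable lborel (\<lambda>w. green \<kappa> (y - w) * h w)" by (rule rconv_integrable[OF K h])
    have "p y = (\<integral>w. - (green \<kappa> (y - w) * h w) - \<kappa>\<^sup>2 * (h w * Q w) \<partial>lborel)"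
      unfolding p P_def[symmetric] PQ by (rule arg_cong[where f="integral\<^sup>L lborel"]) (simp add: fun_eq_iff algebra_simps)
    also have "\<dots> = - \<Psi> y - \<kappa>\<^sup>2 * q y"
      unfolding q Q_def[symmetric] \<Psi>_def rconv_def
      by (subst Bochner_Integration.integral_diff) (simp_all add: i1 i2)
    finally show ?thesis by simp
  qed
  have qm: "q \<in> borel_measurable borel"
  proof -
    note [measurable] = \<Psi>m
    have "(\<lambda>y. \<integral>x. green \<kappa> (x - y) * \<Psi> x \<partial>lborel) \<in> borel_measurable lborel"
      by (rule lborel.borel_measurable_lebesgue_integral) measurable
    then show ?thesis by (simp add: q_def[abs_def])
  qed
  have qb: "\<exists>C. \<forall>y. \<bar>q y\<bar> \<le> C"
  proof -
    have sym: "green \<kappa> (x - y) = green \<kappa> (y - x)" for x y using green_minus[of \<kappa> "y - x"] by simp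
    have "\<bar>q y\<bar> \<le> (B * (\<integral>y. \<bar>h y\<bar> \<partial>lborel)) * (\<integral>x. \<bar>green \<kappa> x\<bar> \<partial>lborel)" for y
    proof -
      have gi: "integrable lborel (\<lambda>x. \<bar>green \<kappa> (x - y)\<bar>)"
        using K lborel_integrable_real_affine[of "green \<kappa>" 1 "- y"] by (simp add: bounded_kernel_def)
      have m2: "(\<lambda>x. green \<kappa> (x - y) * \<Psi> x) \<in> borel_measurable lborel" using \<Psi>m by measurable
      have le: "norm (green \<kappa> (x - y) * \<Psi> x) \<le> (B * (\<integral>y. \<bar>h y\<bar> \<partial>lborel)) * \<bar>green \<kappa> (x - y)\<bar>" for x
        unfolding real_norm_def abs_mult mult.commute[of "\<bar>green \<kappa> (x - y)\<bar>"] by (rule mult_right_mono[OF \<Psi>b]) simp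
      have "\<bar>q y\<bar> \<le> (\<integral>x. norm (green \<kappa> (x - y) * \<Psi> x) \<partial>lborel)"
        unfolding q_def real_norm_def[symmetric] by (rule integral_norm_bound)
      also have "\<dots> \<le> (\<integral>x. (B * (\<integral>y. \<bar>h y\<bar> \<partial>lborel)) * \<bar>green \<kappa> (x - y)\<bar> \<partial>lborel)"
      proof (rule integral_mono[OF _ integrable_mult_right[OF gi] le])
        show "integrable lborel (\<lambda>x. norm (green \<kappa> (x - y) * \<Psi> x))"
          by (rule integrable_norm, rule Bochner_Integration.integrable_bound[OF integrable_mult_right[OF gi, of "B * (\<integral>y. \<bar>h y\<bar> \<partial>lborel)"] m2])
            (intro AE_I2 order_trans[OF le] , simp only: real_norm_def abs_ge_self)
      qed
      also have "\<dots> = (B * (\<integral>y. \<bar>h y\<bar> \<partial>lborel)) * (\<integral>x. \<bar>green \<kappa> x\<bar> \<partial>lborel)"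
        using lborel_integral_real_affine[of 1 "\<lambda>x. \<bar>green \<kappa> x\<bar>" "- y"] by simp
      finally show ?thesis .
    qed
    then show ?thesis by blast
  qed
  then obtain C where C: "\<And>y. \<bar>q y\<bar> \<le> C" by blast
  have i3: "integrable lborel (\<lambda>y. h y * q y)" by (rule bint[OF qm C])
  have i4: "integrable lborel (\<lambda>y. h y * \<Psi> y)" by (rule bint[OF \<Psi>m \<Psi>b])
  have pe: "p y = - \<Psi> y - \<kappa>\<^sup>2 * q y" for y using pq[of y] by simp
  have "(\<integral>x. D x * D x \<partial>lborel) = (\<integral>y. h y * p y \<partial>lborel)" unfolding F2(2) p_def ..
  also have "\<dots> = (\<integral>y. - (h y * \<Psi> y) - \<kappa>\<^sup>2 * (h y * q y) \<partial>lborel)"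
    unfolding pe by (rule arg_cong[where f="integral\<^sup>L lborel"]) (simp add: fun_eq_iff algebra_simps)
  also have "\<dots> = - (\<integral>y. h y * \<Psi> y \<partial>lborel) - \<kappa>\<^sup>2 * (\<integral>y. h y * q y \<partial>lborel)"
    by (subst Bochner_Integration.integral_diff) (simp_all add: i3 i4)
  also have "(\<integral>y. h y * q y \<partial>lborel) = (\<integral>x. \<Psi> x * \<Psi> x \<partial>lborel)" unfolding F1(2) q_def ..
  finally show "(\<integral>x. D x * D x \<partial>lborel) + \<kappa>\<^sup>2 * (\<integral>x. \<Psi> x * \<Psi> x \<partial>lborel) = - (\<integral>x. h x * \<Psi> x \<partial>lborel)" by simp
qed

section \<open>The singular energy estimate at the critical point of \<open>b - c\<close>\<close>

context monotone_shear
begin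

lemma b_increment:
  assumes "x \<le> y"
  shows "c\<^sub>m * (y - x) \<le> b y - b x"
proof (cases "x = y")
  case False
  then have "x < y" using assms by simp
  from MVT2[OF this b_has_derivative] obtain z where "b y - b x = (y - x) * deriv b z" by blast
  moreover have "(y - x) * c\<^sub>m \<le> (y - x) * deriv b z" using b'_bounds[of z] assms by (intro mult_left_mono) auto
  ultimately show ?thesis by (simp add: mult.commute)
qed simp

lemma b_surjective:
  obtains y\<^sub>0 where "b y\<^sub>0 = c"
proof -
  define R where "R = \<bar>c - b 0\<bar> / c\<^sub>m"
  have R: "0 \<le> R" "c\<^sub>m * R = \<bar>c - b 0\<bar>" using cm by (simp_all add: R_def)
  have "b (- R) \<le> c" "c \<le> b R" using b_increment[of 0 R] b_increment[of "- R" 0] R by simp_all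
  with IVT'[of b "- R" c R] R b_continuous that show thesis by auto
qed

lemma b''_borel [measurable]: "b'' \<in> borel_measurable borel"
proof -
  have "(\<lambda>y. Re (of_real (b'' y))) \<in> borel_measurable borel"
    using b''_sq unfolding square_integrable_def by (intro measurable_compose[OF _ borel_measurable_Re]) simp_all
  then show ?thesis by simp
qed

lemma b''_mult_integrable:
  assumes "\<eta> \<in> borel_measurable borel" "integrable lborel (\<lambda>x. (\<eta> x)\<^sup>2)"
  shows "integrable lborel (\<lambda>y. b'' y * \<eta> y :: real)"
proof (rule Bochner_Integration.integrable_bound)
  show "integrable lborel (\<lambda>y. (b'' y)\<^sup>2 + (\<eta> y)\<^sup>2)"
    using b''_sq assms(2) by (intro Bochner_Integration.integrable_add) (simp_all add: square_integrable_def)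
  show "(\<lambda>y. b'' y * \<eta> y) \<in> borel_measurable lborel" using assms(1) by measurable
  have "\<bar>p * q\<bar> \<le> p\<^sup>2 + q\<^sup>2" for p q :: real
    using sum_squares_bound[of "\<bar>p\<bar>" "\<bar>q\<bar>"] zero_le_mult_iff[of "\<bar>p\<bar>" "\<bar>q\<bar>"] unfolding abs_mult power2_abs by linarith
  then show "AE y in lborel. norm (b'' y * \<eta> y) \<le> norm ((b'' y)\<^sup>2 + (\<eta> y)\<^sup>2)"
    by (intro AE_I2) simp
qed

lemma adjoint_eigenfunction_real:
  fixes \<eta> :: "real \<Rightarrow> real"
  assumes \<eta>: "\<eta> \<in> borel_measurable borel" "integrable lborel (\<lambda>x. (\<eta> x)\<^sup>2)"
    and eq: "AE x in lborel. (b x - c) * \<eta> x = rconv (green \<kappa>) (\<lambda>y. b'' y * \<eta> y) x"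
  shows "AE x in lborel. \<eta> x = 0"
proof -
  define h where "h y = b'' y * \<eta> y" for y
  define \<Psi> where "\<Psi> = rconv (green \<kappa>) h"
  define D where "D = rconv (green' \<kappa>) h"
  have h: "integrable lborel h" unfolding h_def by (rule b''_mult_integrable[OF \<eta>])
  note K = bounded_kernel_green[OF \<kappa>] and K' = bounded_kernel_green'[OF \<kappa>]
  note [measurable] = bounded_kernel_borel[OF K] bounded_kernel_borel[OF K'] borel_measurable_integrable[OF h, simplified] \<eta>(1)
  have m[measurable]: "\<Psi> \<in> borel_measurable borel" "D \<in> borel_measurable borel" unfolding \<Psi>_def D_def by measurable
  note energy = rconv_energy[OF \<kappa> h, folded \<Psi>_def D_def]
  have d\<Psi>: "(\<Psi> has_real_derivative D x) (at x)" for x unfolding \<Psi>_def D_def by (rule rconv_green_has_derivative[OF \<kappa> h])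
  obtain B' where B': "\<And>z. \<bar>green' \<kappa> z\<bar> \<le> B'" using K' by (auto simp: bounded_kernel_def)
  define B where "B = B' * (\<integral>y. \<bar>h y\<bar> \<partial>lborel)"
  have DB: "\<bar>D x\<bar> \<le> B" for x unfolding D_def B_def by (rule rconv_bound[OF K' B' h])
  have lip: "\<bar>\<Psi> x - \<Psi> y\<bar> \<le> B * \<bar>x - y\<bar>" for x y
    using field_differentiable_bound[of UNIV \<Psi> D B x y] d\<Psi> DB by simp
  obtain y0 where y0: "b y0 = c" by (rule b_surjective)
  define \<beta> where "\<beta> x = b x - c" for x
  have \<beta>pos: "c\<^sub>m * (x - y0) \<le> \<beta> x" if "y0 \<le> x" for x using b_increment[OF that] y0 by (simp add: \<beta>_def)
  have \<beta>neg: "c\<^sub>m * (y0 - x) \<le> - \<beta> x" if "x \<le> y0" for x using b_increment[OF that] y0 by (simp add: \<beta>_def)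
  have \<beta>low: "c\<^sub>m * \<bar>x - y0\<bar> \<le> \<bar>\<beta> x\<bar>" for x
    using \<beta>pos[of x] \<beta>neg[of x] by (cases "y0 \<le> x") (auto simp: abs_if)
  have \<beta>0: "\<beta> x \<noteq> 0" if "x \<noteq> y0" for x
  proof -
    have "0 < c\<^sub>m * \<bar>x - y0\<bar>" using cm that by simp
    then show ?thesis using \<beta>low[of x] by auto
  qed
  \<comment> \<open>A version of \<open>\<eta>\<close> that is defined pointwise and differentiable
    away from \<open>y0\<close>.\<close>
  define e where "e x = \<Psi> x / \<beta> x" for x
  have e\<beta>: "e x * \<beta> x = \<Psi> x" if "x \<noteq> y0" for x using \<beta>0[OF that] by (simp add: e_def)
  have \<eta>e: "AE x in lborel. \<eta> x = e x"
    using eq AE_lborel_singleton[of y0]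
  proof eventually_elim
    case (elim x)
    then have "\<beta> x * \<eta> x = \<Psi> x" by (simp add: \<beta>_def \<Psi>_def h_def[abs_def])
    then show ?case using \<beta>0[OF elim(2)] by (simp add: e_def field_simps)
  qed
  have em: "e \<in> borel_measurable borel" unfolding e_def[abs_def] \<beta>_def by measurable
  have esq: "integrable lborel (\<lambda>x. (e x)\<^sup>2)"
  proof (subst integrable_cong_AE[where g="\<lambda>x. (\<eta> x)\<^sup>2"])
    show "AE x in lborel. (e x)\<^sup>2 = (\<eta> x)\<^sup>2" using \<eta>e by eventually_elim simp
  qed (use em \<eta> in auto)
  have \<beta>up: "\<bar>\<beta> x\<bar> \<le> inverse c\<^sub>m * \<bar>x - y0\<bar>" for x using b_lipschitz[of x y0] y0 by (simp add: \<beta>_def)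
  \<comment> \<open>Otherwise \<open>e\<close> would behave like \<open>1 / (x - y0)\<close> near \<open>y0\<close>.\<close>
  have \<Psi>0: "\<Psi> y0 = 0"
  proof (rule ccontr)
    assume "\<Psi> y0 \<noteq> 0"
    then have p: "0 < \<bar>\<Psi> y0\<bar> / 2" by simp
    \<comment> \<open>At distance between \<open>\<delta>\<close> and \<open>2 \<delta>\<close> from
      \<open>y0\<close>, the bounds \<open>|\<Psi>| \<ge> |\<Psi> y0| / 2\<close> and
      \<open>|\<beta>| \<le> 2 \<delta> / c_m\<close> give
      \<open>|e| \<ge> q / \<delta>\<close>.\<close>
    define q where "q = c\<^sub>m * (\<bar>\<Psi> y0\<bar> / 2) / 2"
    have q: "0 < q" using p cm by (simp add: q_def)
    have "isCont \<Psi> y0" using d\<Psi> by (rule DERIV_isCont)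
    then obtain r where r: "0 < r" "\<And>x. dist x y0 < r \<Longrightarrow> dist (\<Psi> x) (\<Psi> y0) < \<bar>\<Psi> y0\<bar> / 2"
      using p unfolding continuous_at_eps_delta by blast
    have big: "q\<^sup>2 / \<delta> \<le> (\<integral>x. (e x)\<^sup>2 \<partial>lborel)" if \<delta>: "0 < \<delta>" "2 * \<delta> < r" for \<delta>
    proof -
      have "indicator {y0 + \<delta>..y0 + 2 * \<delta>} x * (q / \<delta>)\<^sup>2 \<le> (e x)\<^sup>2" for x
      proof (cases "x \<in> {y0 + \<delta>..y0 + 2 * \<delta>}")
        case True
        then have x: "x - y0 \<le> 2 * \<delta>" "\<delta> \<le> x - y0" "dist x y0 < r" using \<delta> by (auto simp: dist_real_def)
        have P: "\<bar>\<Psi> y0\<bar> / 2 \<le> \<bar>\<Psi> x\<bar>" using r(2)[OF x(3)] unfolding dist_real_def by linarith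
        have "\<bar>\<beta> x\<bar> \<le> inverse c\<^sub>m * (2 * \<delta>)"
          by (rule order_trans[OF \<beta>up mult_left_mono]) (use x \<delta> cm in auto)
        moreover have "\<beta> x \<noteq> 0" using \<beta>0[of x] x \<delta> by auto
        ultimately have "(\<bar>\<Psi> y0\<bar> / 2) / (inverse c\<^sub>m * (2 * \<delta>)) \<le> \<bar>\<Psi> x\<bar> / \<bar>\<beta> x\<bar>"
          using P by (intro frac_le) auto
        moreover have "(\<bar>\<Psi> y0\<bar> / 2) / (inverse c\<^sub>m * (2 * \<delta>)) = q / \<delta>" using cm by (simp add: q_def field_simps)
        ultimately have "q / \<delta> \<le> \<bar>e x\<bar>" by (simp add: e_def)
        then have "(q / \<delta>)\<^sup>2 \<le> \<bar>e x\<bar>\<^sup>2" by (rule power_mono) (use q \<delta> in auto)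
        then show ?thesis using True by simp
      qed simp
      moreover have "integrable lborel (\<lambda>x. indicator {y0 + \<delta>..y0 + 2 * \<delta>} x * (q / \<delta>)\<^sup>2)"
        by (intro integrable_mult_left integrable_real_indicator) (simp_all add: emeasure_lborel_Icc_eq)
      ultimately have "(\<integral>x. indicator {y0 + \<delta>..y0 + 2 * \<delta>} x * (q / \<delta>)\<^sup>2 \<partial>lborel) \<le> (\<integral>x. (e x)\<^sup>2 \<partial>lborel)"
        by (intro integral_mono esq)
      moreover have "(\<integral>x. indicator {y0 + \<delta>..y0 + 2 * \<delta>} x * (q / \<delta>)\<^sup>2 \<partial>lborel) = q\<^sup>2 / \<delta>"
        using \<delta> by (simp add: power_divide power2_eq_square)
      ultimately show ?thesis by simp
    qed
    define I where "I = (\<integral>x. (e x)\<^sup>2 \<partial>lborel)"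
    have I: "0 \<le> I" unfolding I_def by (intro integral_nonneg_AE AE_I2) simp
    \<comment> \<open>Small enough for continuity of \<open>\<Psi>\<close> to apply, and small
      enough that \<open>q^2 / \<delta>\<close> exceeds the integral \<open>I\<close> of the square
      of \<open>e\<close>.\<close>
    define \<delta> where "\<delta> = min (r / 4) (q\<^sup>2 / (I + 1))"
    have "0 < q\<^sup>2 / (I + 1)" using q I by simp
    then have \<delta>: "0 < \<delta>" "2 * \<delta> < r" using r(1) unfolding \<delta>_def by linarith+
    have "\<delta> * (I + 1) \<le> q\<^sup>2 / (I + 1) * (I + 1)" by (rule mult_right_mono) (use I in \<open>auto simp: \<delta>_def\<close>)
    then have "\<delta> * (I + 1) \<le> q\<^sup>2" using I by simp
    then have "I + 1 \<le> q\<^sup>2 / \<delta>" using \<delta>(1) by (simp add: field_simps)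
    then show False using big[OF \<delta>] unfolding I_def by simp
  qed
  define G where "G x = deriv b x * (\<Psi> x)\<^sup>2 / \<beta> x" for x
  define F where "F x = D x * D x + b'' x * e x * \<Psi> x" for x
  define C where "C = inverse c\<^sub>m * B\<^sup>2 / c\<^sub>m"
  have B0: "0 \<le> B" using DB[of 0] by linarith
  have b'0: "0 \<le> deriv b x" "deriv b x \<le> inverse c\<^sub>m" for x using b'_bounds[of x] cm by auto
  \<comment> \<open>\<open>\<Psi>\<close> is Lipschitz and vanishes at \<open>y0\<close>, so its
    square beats the simple zero of \<open>\<beta>\<close>, and the boundary terms at the critical
    point disappear in the limit.\<close>
  have Gabs: "\<bar>G x\<bar> \<le> C * \<bar>x - y0\<bar>" for x
  proof (cases "x = y0")
    case False
    have "\<bar>\<Psi> x\<bar> \<le> B * \<bar>x - y0\<bar>" using lip[of x y0] \<Psi>0 by simp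
    then have "\<bar>\<Psi> x\<bar>\<^sup>2 \<le> (B * \<bar>x - y0\<bar>)\<^sup>2" by (rule power_mono) simp
    then have "deriv b x * (\<Psi> x)\<^sup>2 \<le> inverse c\<^sub>m * (B * \<bar>x - y0\<bar>)\<^sup>2"
      using b'0[of x] cm by (intro mult_mono) auto
    then have "\<bar>G x\<bar> \<le> inverse c\<^sub>m * (B * \<bar>x - y0\<bar>)\<^sup>2 / (c\<^sub>m * \<bar>x - y0\<bar>)"
      unfolding G_def abs_divide using \<beta>low[of x] False cm b'0[of x] by (intro frac_le) (auto simp: abs_mult)
    also have "\<dots> = C * \<bar>x - y0\<bar>" using False cm by (simp add: C_def power2_eq_square)
    finally show ?thesis .
  qed (simp add: G_def \<Psi>0)
  have Fi: "integrable lborel F" and FI: "(\<integral>x. F x \<partial>lborel) = (\<integral>x. D x * D x \<partial>lborel) + (\<integral>x. h x * \<Psi> x \<partial>lborel)"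
  proof -
    have Fm: "F \<in> borel_measurable lborel" using em unfolding F_def by measurable
    have m2: "(\<lambda>x. D x * D x + h x * \<Psi> x) \<in> borel_measurable lborel" by measurable
    have ae: "AE x in lborel. F x = D x * D x + h x * \<Psi> x" using \<eta>e by eventually_elim (simp add: F_def h_def)
    show "integrable lborel F"
      using integrable_cong_AE[OF Fm m2 ae] Bochner_Integration.integrable_add[OF energy(1) energy(3)] by (rule iffD2)
    show "(\<integral>x. F x \<partial>lborel) = (\<integral>x. D x * D x \<partial>lborel) + (\<integral>x. h x * \<Psi> x \<partial>lborel)"
      unfolding integral_cong_AE[OF Fm m2 ae] by (rule Bochner_Integration.integral_add[OF energy(1) energy(3)])
  qed
  \<comment> \<open>Completing the square: \<open>G' = F - (D - b' e)\<^sup>2 \<le> F\<close> away from \<open>y0\<close>.\<close>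
  have ineq: "G N - G a \<le> (\<integral>x. indicator {a..N} x * F x \<partial>lborel)" if aN: "a \<le> N" "y0 \<notin> {a..N}" for a N
  proof -
    have dG: "(G has_real_derivative F x - (D x - deriv b x * e x)\<^sup>2) (at x)" if "x \<noteq> y0" for x
    proof -
      have db': "(deriv b has_real_derivative b'' x) (at x)" using b'_diff by (rule differentiable_on_UNIV_deriv)
      have d\<beta>: "(\<beta> has_real_derivative deriv b x) (at x)"
        unfolding \<beta>_def[abs_def] by (rule DERIV_cong[OF DERIV_diff[OF b_has_derivative DERIV_const]]) simp
      have "(G has_real_derivative ((b'' x * (\<Psi> x)\<^sup>2 + (real 2 * (\<Psi> x) ^ (2 - 1) * D x) * deriv b x) * \<beta> x - deriv b x * (\<Psi> x)\<^sup>2 * deriv b x) / (\<beta> x * \<beta> x)) (at x)"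
        unfolding G_def[abs_def] using \<beta>0[OF that]
        by (intro DERIV_divide DERIV_mult db' d\<beta> DERIV_cong[OF DERIV_power[OF d\<Psi>]]) simp_all
      moreover have "((b'' x * (\<Psi> x)\<^sup>2 + (real 2 * (\<Psi> x) ^ (2 - 1) * D x) * deriv b x) * \<beta> x - deriv b x * (\<Psi> x)\<^sup>2 * deriv b x) / (\<beta> x * \<beta> x)
          = F x - (D x - deriv b x * e x)\<^sup>2"
        using \<beta>0[OF that] unfolding F_def e\<beta>[OF that, symmetric]
        by (simp add: power2_eq_square field_simps)
      ultimately show ?thesis by simp
    qed
    have fi: "((\<lambda>x. F x - (D x - deriv b x * e x)\<^sup>2) has_integral G N - G a) {a..N}"
    proof (rule fundamental_theorem_of_calculus[OF aN(1)])
      fix x assume "x \<in> {a..N}"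
      then have "x \<noteq> y0" using aN(2) by auto
      then show "(G has_vector_derivative F x - (D x - deriv b x * e x)\<^sup>2) (at x within {a..N})"
        by (rule has_vector_derivative_at_within[OF dG[unfolded has_real_derivative_iff_has_vector_derivative]])
    qed
    have s: "set_integrable lborel {a..N} F"
      unfolding set_integrable_def by (rule integrable_mult_indicator[OF _ Fi]) simp
    have "(F has_integral integral {a..N} F) {a..N}"
      using set_borel_integral_eq_integral(1)[OF s] by (rule integrable_integral)
    from has_integral_le[OF fi this] have "G N - G a \<le> integral {a..N} F" by simp
    also have "\<dots> = (\<integral>x. indicator {a..N} x * F x \<partial>lborel)"
      using set_borel_integral_eq_integral(2)[OF s] by (simp add: set_lebesgue_integral_def)
    finally show ?thesis .
  qed
  define \<epsilon> where "\<epsilon> n = inverse (real (Suc n))" for n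
  have \<epsilon>: "0 < \<epsilon> n" "\<epsilon> n \<le> real (Suc n)" "\<epsilon> n \<le> 1" for n
    by (simp_all add: \<epsilon>_def field_simps)
  \<comment> \<open>The indicator of a large interval around \<open>y0\<close> with an
    \<open>\<epsilon> n\<close> neighbourhood of \<open>y0\<close> removed. The bound
    \<open>\<epsilon> n \<le> real (Suc n)\<close> orders the endpoints of both pieces.\<close>
  define A where "A n x = (indicator {y0 + \<epsilon> n..y0 + real (Suc n)} x + indicator {y0 - real (Suc n)..y0 - \<epsilon> n} x :: real)" for n x
  have A1: "\<bar>A n x\<bar> \<le> 1" for n x using \<epsilon>(1)[of n] by (auto simp: A_def indicator_def)
  have low: "- (2 * C * \<epsilon> n) \<le> (\<integral>x. A n x * F x \<partial>lborel)" for n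
  proof -
    have i: "integrable lborel (\<lambda>x. indicator S x * F x)" if "S \<in> sets borel" for S :: "real set"
      using integrable_mult_indicator[OF _ Fi, of S] that by simp
    have "(\<integral>x. A n x * F x \<partial>lborel) = (\<integral>x. indicator {y0 + \<epsilon> n..y0 + real (Suc n)} x * F x \<partial>lborel)
        + (\<integral>x. indicator {y0 - real (Suc n)..y0 - \<epsilon> n} x * F x \<partial>lborel)"
      unfolding A_def distrib_right by (rule Bochner_Integration.integral_add) (rule i, simp)+
    moreover have "- (C * \<epsilon> n) \<le> (\<integral>x. indicator {y0 + \<epsilon> n..y0 + real (Suc n)} x * F x \<partial>lborel)"
    proof -
      have "0 \<le> \<beta> (y0 + real (Suc n))" by (rule order_trans[OF _ \<beta>pos]) (use cm in simp_all)
      then have "0 \<le> G (y0 + real (Suc n))" unfolding G_def using b'0 by (intro divide_nonneg_nonneg mult_nonneg_nonneg) auto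
      then show ?thesis using ineq[of "y0 + \<epsilon> n" "y0 + real (Suc n)"] Gabs[of "y0 + \<epsilon> n"] \<epsilon>[of n] by auto
    qed
    moreover have "- (C * \<epsilon> n) \<le> (\<integral>x. indicator {y0 - real (Suc n)..y0 - \<epsilon> n} x * F x \<partial>lborel)"
    proof -
      have "0 \<le> - \<beta> (y0 - real (Suc n))" by (rule order_trans[OF _ \<beta>neg]) (use cm in simp_all)
      then have "G (y0 - real (Suc n)) \<le> 0" unfolding G_def using b'0 by (intro divide_nonneg_nonpos mult_nonneg_nonneg) auto
      then show ?thesis using ineq[of "y0 - real (Suc n)" "y0 - \<epsilon> n"] Gabs[of "y0 - \<epsilon> n"] \<epsilon>[of n] by auto
    qed
    ultimately show ?thesis by simp
  qed
  have lim: "(\<lambda>n. \<integral>x. A n x * F x \<partial>lborel) \<longlonglongrightarrow> (\<integral>x. F x \<partial>lborel)"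
  proof (rule integral_dominated_convergence)
    show "integrable lborel (\<lambda>x. norm (F x))" using Fi by (rule integrable_norm)
    show "F \<in> borel_measurable lborel" using Fi by (rule borel_measurable_integrable)
    then show "(\<lambda>x. A n x * F x) \<in> borel_measurable lborel" for n unfolding A_def by measurable
    show "AE x in lborel. norm (A n x * F x) \<le> norm (F x)" for n
      using mult_right_mono[OF A1 abs_ge_zero, of n _ "F _"] by (intro AE_I2) (simp add: abs_mult)
    have \<epsilon>0: "\<epsilon> \<longlonglongrightarrow> 0" unfolding \<epsilon>_def by (rule LIMSEQ_inverse_real_of_nat)
    show "AE x in lborel. (\<lambda>n. A n x * F x) \<longlonglongrightarrow> F x"
      using AE_lborel_singleton[of y0]
    proof eventually_elim
      case (elim x)
      obtain n0 :: nat where n0: "\<bar>x - y0\<bar> < real n0" using reals_Archimedean2 by blast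
      have "eventually (\<lambda>n. \<epsilon> n < \<bar>x - y0\<bar>) sequentially" using order_tendstoD(2)[OF \<epsilon>0, of "\<bar>x - y0\<bar>"] elim by simp
      moreover have "eventually (\<lambda>n. n0 \<le> n) sequentially" by (rule eventually_ge_at_top)
      ultimately have "eventually (\<lambda>n. A n x * F x = F x) sequentially"
      proof eventually_elim
        case (elim n)
        have "\<bar>x - y0\<bar> \<le> real (Suc n)" using n0 elim(2) by simp
        then have "A n x = 1" using elim(1) \<epsilon>(1)[of n] by (auto simp: A_def indicator_def abs_if split: if_splits)
        then show ?case by simp
      qed
      then show ?case by (rule tendsto_eventually)
    qed
  qed
  have "0 \<le> (\<integral>x. F x \<partial>lborel)"
  proof (rule LIMSEQ_le[OF _ lim])
    have "(\<lambda>n. - (2 * C * \<epsilon> n)) \<longlonglongrightarrow> - (2 * C * 0)"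
      unfolding \<epsilon>_def by (intro tendsto_intros LIMSEQ_inverse_real_of_nat)
    then show "(\<lambda>n. - (2 * C * \<epsilon> n)) \<longlonglongrightarrow> 0" by simp
  qed (use low in blast)
  then have "\<kappa>\<^sup>2 * (\<integral>x. \<Psi> x * \<Psi> x \<partial>lborel) \<le> 0" using energy(4) FI by linarith
  then have "(\<integral>x. \<Psi> x * \<Psi> x \<partial>lborel) \<le> 0" using \<kappa> by (simp add: mult_le_0_iff)
  moreover have "0 \<le> (\<integral>x. \<Psi> x * \<Psi> x \<partial>lborel)" by (intro integral_nonneg_AE AE_I2) simp
  ultimately have "(\<integral>x. \<Psi> x * \<Psi> x \<partial>lborel) = 0" by simp
  then have "AE x in lborel. \<Psi> x * \<Psi> x = 0"
    using integral_nonneg_eq_0_iff_AE[OF energy(2)] by simp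
  then show ?thesis using \<eta>e by eventually_elim (simp add: e_def)
qed


section \<open>Density of the range; \<open>shifted_test c \<phi>\<close> is
  \<open>(R - c) \<phi>\<close> with \<open>R\<close> the Rayleigh operator\<close>

definition shifted_test :: "real \<Rightarrow> (real \<Rightarrow> real) \<Rightarrow> real \<Rightarrow> real" where
  "shifted_test c \<phi> y = (b y - c) * \<phi> y - b'' y * rconv (green \<kappa>) \<phi> y"

lemma b_diff_bound:
  assumes "\<bar>x\<bar> \<le> R"
  shows "\<bar>b x - c\<bar> \<le> \<bar>b 0 - c\<bar> + inverse c\<^sub>m * R"
proof -
  have "inverse c\<^sub>m * \<bar>x\<bar> \<le> inverse c\<^sub>m * R" using assms cm by (intro mult_left_mono) auto
  then show ?thesis using b_lipschitz[of x 0] by simp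
qed

lemma square_integrable_b_local:
  assumes "square_integrable f"
  shows "square_integrable (\<lambda>y. of_real (indicator {-R..R} y) * (of_real (b y - c) * f y))"
proof -
  have "square_integrable (\<lambda>y. of_real (indicator {-R..R} y * (b y - c)) * f y)"
  proof (rule square_integrable_mult_bounded[OF assms])
    show "(\<lambda>y. complex_of_real (indicator {-R..R} y * (b y - c))) \<in> borel_measurable borel" by measurable
    show "cmod (of_real (indicator {-R..R} y * (b y - c))) \<le> \<bar>b 0 - c\<bar> + inverse c\<^sub>m * \<bar>R\<bar>" for y
      unfolding norm_of_real using b_diff_bound[of y "\<bar>R\<bar>" c] cm by (cases "y \<in> {-R..R}") auto
  qed
  then show ?thesis by (simp add: mult.assoc)
qed

text \<open>By Fubini and the symmetry of the Green function, the convolution moves from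
  \<open>\<phi>\<close> to \<open>b'' p\<close>. The resulting identity holds pointwise by
  \<open>du_bois_reymond\<close>, for which local square integrability of \<open>(b - c) p\<close>
  suffices.\<close>

lemma adjoint_eigenfunction_weak:
  fixes p :: "real \<Rightarrow> real"
  assumes p: "p \<in> borel_measurable borel" "integrable lborel (\<lambda>x. (p x)\<^sup>2)"
    and zero: "\<And>\<phi>. test_function \<phi> \<Longrightarrow> (\<integral>x. p x * shifted_test c \<phi> x \<partial>lborel) = 0"
  shows "AE x in lborel. p x = 0"
proof (rule adjoint_eigenfunction_real[OF p])
  define h where "h y = b'' y * p y" for y
  define \<Psi> where "\<Psi> = rconv (green \<kappa>) h"
  note K = bounded_kernel_green[OF \<kappa>]
  have h: "integrable lborel h" unfolding h_def by (rule b''_mult_integrable[OF p])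
  note [measurable] = bounded_kernel_borel[OF K] borel_measurable_integrable[OF h, simplified] p(1)
  obtain B where B: "\<And>z. \<bar>green \<kappa> z\<bar> \<le> B" using K by (auto simp: bounded_kernel_def)
  have \<Psi>m[measurable]: "\<Psi> \<in> borel_measurable borel" unfolding \<Psi>_def by measurable
  have ps: "square_integrable (\<lambda>x. of_real (p x))" using p by (simp add: square_integrable_def)
  have "AE x in lborel. complex_of_real ((b x - c) * p x - \<Psi> x) = 0"
  proof (rule du_bois_reymond)
    fix R
    have "square_integrable (\<lambda>y. of_real (indicator {-R..R} y) * of_real (\<Psi> y))"
    proof (rule square_integrable_compact_support)
      show "(\<lambda>y. complex_of_real (indicator {-R..R} y) * of_real (\<Psi> y)) \<in> borel_measurable borel" by measurable
      show "cmod (complex_of_real (indicator {-R..R} y) * of_real (\<Psi> y)) \<le> B * (\<integral>y. \<bar>h y\<bar> \<partial>lborel)" for y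
        using rconv_bound[OF K B h, of y] abs_ge_zero[of "\<Psi> y"] by (cases "y \<in> {-R..R}") (simp_all add: \<Psi>_def)
      show "complex_of_real (indicator {-R..R} y) * of_real (\<Psi> y) = 0" if "\<bar>R\<bar> < \<bar>y\<bar>" for y using that by (auto simp: indicator_def)
    qed
    from square_integrable_diff[OF square_integrable_b_local[OF ps] this]
    show "square_integrable (\<lambda>y. of_real (indicator {-R..R} y) * of_real ((b y - c) * p y - \<Psi> y))"
      by (simp add: right_diff_distrib)
  next
    fix \<phi> :: "real \<Rightarrow> real" assume \<phi>: "test_function \<phi>"
    obtain C where C: "\<And>y. \<bar>\<phi> y\<bar> \<le> C" using test_function_bounded[OF \<phi>] by blast
    note \<phi>m[measurable] = test_function_borel[OF \<phi>]
    have \<phi>i: "integrable lborel \<phi>" using test_function_bounded_kernel[OF \<phi>] by (simp add: bounded_kernel_def)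
    note fub = rconv_fubini[OF K h \<phi>m C, folded \<Psi>_def]
    have sym: "(\<integral>x. green \<kappa> (x - y) * \<phi> x \<partial>lborel) = rconv (green \<kappa>) \<phi> y" for y
    proof -
      have "green \<kappa> (x - y) = green \<kappa> (y - x)" for x using green_minus[of \<kappa> "y - x"] by simp
      then show ?thesis by (simp add: rconv_def)
    qed
    have i1: "integrable lborel (\<lambda>x. (b x - c) * \<phi> x * p x)"
    proof -
      have "square_integrable (\<lambda>y. of_real (b y * \<phi> y) - of_real c * of_real (\<phi> y))"
        by (intro square_integrable_diff square_integrable_b_test[OF \<phi>] square_integrable_cmult test_function_square_integrable[OF \<phi>])
      then have "integrable lborel (\<lambda>y. of_real (p y) * (of_real (b y * \<phi> y) - of_real c * of_real (\<phi> y) :: complex))"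
        by (rule square_integrable_mult_integrable[OF ps])
      then have "integrable lborel (\<lambda>y. complex_of_real ((b y - c) * \<phi> y * p y))"
        by (simp add: algebra_simps)
      then show ?thesis by (simp only: complex_of_real_integrable_eq)
    qed
    have i2: "integrable lborel (\<lambda>x. h x * rconv (green \<kappa>) \<phi> x)"
    proof (rule Bochner_Integration.integrable_bound[OF integrable_mult_right[OF h, of "B * (\<integral>y. \<bar>\<phi> y\<bar> \<partial>lborel)"]])
      have "\<bar>rconv (green \<kappa>) \<phi> x\<bar> * \<bar>h x\<bar> \<le> \<bar>B * (\<integral>y. \<bar>\<phi> y\<bar> \<partial>lborel)\<bar> * \<bar>h x\<bar>" for x
        by (intro mult_right_mono order_trans[OF rconv_bound[OF K B \<phi>i] abs_ge_self]) simp
      then show "AE x in lborel. norm (h x * rconv (green \<kappa>) \<phi> x) \<le> norm ((B * (\<integral>y. \<bar>\<phi> y\<bar> \<partial>lborel)) * h x)"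
        unfolding real_norm_def abs_mult[of "h _"] abs_mult[of _ "h _"] mult.commute[of "\<bar>h _\<bar>"] by (intro AE_I2)
    qed measurable
    have "(\<integral>x. (b x - c) * \<phi> x * p x \<partial>lborel) - (\<integral>x. h x * rconv (green \<kappa>) \<phi> x \<partial>lborel) = (\<integral>x. p x * shifted_test c \<phi> x \<partial>lborel)"
      unfolding Bochner_Integration.integral_diff[OF i1 i2, symmetric]
      by (rule arg_cong[where f="integral\<^sup>L lborel"]) (simp add: fun_eq_iff shifted_test_def h_def algebra_simps)
    also have "\<dots> = 0" by (rule zero[OF \<phi>])
    finally have "(\<integral>x. (b x - c) * \<phi> x * p x - \<Psi> x * \<phi> x \<partial>lborel) = 0"
      unfolding Bochner_Integration.integral_diff[OF i1 fub(1)] fub(2) sym .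
    then have "complex_of_real (\<integral>x. (b x - c) * \<phi> x * p x - \<Psi> x * \<phi> x \<partial>lborel) = 0" by simp
    then have "(\<integral>x. complex_of_real ((b x - c) * \<phi> x * p x - \<Psi> x * \<phi> x) \<partial>lborel) = 0"
      by (simp only: integral_complex_of_real)
    moreover have "(\<lambda>x. complex_of_real ((b x - c) * \<phi> x * p x - \<Psi> x * \<phi> x)) = (\<lambda>y. of_real ((b y - c) * p y - \<Psi> y) * of_real (\<phi> y))"
      by (simp add: fun_eq_iff algebra_simps)
    ultimately show "(\<integral>y. of_real ((b y - c) * p y - \<Psi> y) * of_real (\<phi> y) \<partial>lborel) = (0 :: complex)" by simp
  qed
  then show "AE x in lborel. (b x - c) * p x = rconv (green \<kappa>) (\<lambda>y. b'' y * p y) x"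
  proof eventually_elim
    case (elim x)
    then have "(b x - c) * p x - \<Psi> x = 0" by (simp only: of_real_eq_0_iff)
    then show ?case by (simp add: \<Psi>_def h_def[abs_def])
  qed
qed

lemma square_integrable_shifted_test:
  assumes \<phi>: "test_function \<phi>"
  shows "square_integrable (\<lambda>y. of_real (shifted_test c \<phi> y))"
    and "T (abs_l2 (\<lambda>y. z * of_real (\<phi> y))) = abs_l2 (\<lambda>y. z * of_real (b'' y * rconv (green \<kappa>) \<phi> y))"
    and "square_integrable (\<lambda>y. of_real (b'' y * rconv (green \<kappa>) \<phi> y))"
proof -
  note \<phi>s = test_function_square_integrable[OF \<phi>]
  have cv: "convol (green \<kappa>) (\<lambda>y. z * of_real (\<phi> y)) = (\<lambda>x. z * of_real (rconv (green \<kappa>) \<phi> x))" for z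
  proof
    fix x
    have "convol (green \<kappa>) (\<lambda>y. z * of_real (\<phi> y)) x = (\<integral>y. z * complex_of_real (green \<kappa> (x - y) * \<phi> y) \<partial>lborel)"
      unfolding convol_def by (rule arg_cong[where f="integral\<^sup>L lborel"]) (simp add: fun_eq_iff mult_ac)
    also have "\<dots> = z * of_real (rconv (green \<kappa>) \<phi> x)"
      by (simp only: integral_mult_right_zero integral_complex_of_real rconv_def)
    finally show "convol (green \<kappa>) (\<lambda>y. z * of_real (\<phi> y)) x = z * of_real (rconv (green \<kappa>) \<phi> x)" .
  qed
  show 1: "square_integrable (\<lambda>y. of_real (b'' y * rconv (green \<kappa>) \<phi> y))"
    using square_integrable_mconv(1)[OF b''_sq bounded_kernel_green[OF \<kappa>] \<phi>s] cv[of 1] by simp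
  have "square_integrable (\<lambda>y. of_real (b y * \<phi> y) - of_real c * of_real (\<phi> y) - of_real (b'' y * rconv (green \<kappa>) \<phi> y))"
    by (intro square_integrable_diff square_integrable_b_test[OF \<phi>] square_integrable_cmult \<phi>s 1)
  then show "square_integrable (\<lambda>y. of_real (shifted_test c \<phi> y))"
    by (simp add: shifted_test_def left_diff_distrib)
  show "T (abs_l2 (\<lambda>y. z * of_real (\<phi> y))) = abs_l2 (\<lambda>y. z * of_real (b'' y * rconv (green \<kappa>) \<phi> y))"
    unfolding T_abs[OF square_integrable_cmult[OF \<phi>s]] cv by (simp add: mult_ac)
qed

text \<open>Orthogonality for both values of \<open>z\<close> makes the complex pairing vanish. As
  \<open>shifted_test c \<phi>\<close> is real, the real and imaginary parts of \<open>u\<close>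
  each solve the real adjoint equation.\<close>

lemma shifted_test_dense:
  "closure (span {abs_l2 (\<lambda>y. z * of_real (shifted_test c \<phi> y)) |z \<phi>. z \<in> {1, \<i>} \<and> test_function \<phi>}) = UNIV"
    (is "closure (span ?X) = UNIV")
proof (rule dense_subspace_if_orthogonal_trivial[OF subspace_span])
  fix u assume orth: "\<And>d. d \<in> span ?X \<Longrightarrow> u \<bullet> d = 0"
  note us = square_integrable_rep[of u]
  have pair: "l2_pair u (\<lambda>y. of_real (shifted_test c \<phi> y)) = 0" if \<phi>: "test_function \<phi>" for \<phi>
  proof -
    have "Re (cnj z * l2_pair u (\<lambda>y. of_real (shifted_test c \<phi> y))) = 0" if z: "z \<in> {1, \<i>}" for z
    proof -
      have "abs_l2 (\<lambda>y. z * of_real (shifted_test c \<phi> y)) \<in> ?X" using z \<phi> by auto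
      then show ?thesis
        using orth[OF span_base] inner_real_test[OF square_integrable_shifted_test(1)[OF \<phi>], of u z c] by simp
    qed
    from this[of 1] this[of \<i>] show ?thesis by (simp add: complex_eq_iff)
  qed
  have int: "integrable lborel (\<lambda>y. rep_l2 u y * of_real (shifted_test c \<phi> y))" if "test_function \<phi>" for \<phi>
    by (rule l2_pair_integrable[OF square_integrable_shifted_test(1)[OF that]])
  have "AE y in lborel. Re (rep_l2 u y) = 0"
  proof (rule adjoint_eigenfunction_weak)
    show "(\<lambda>y. Re (rep_l2 u y)) \<in> borel_measurable borel" by measurable
    show "integrable lborel (\<lambda>x. (Re (rep_l2 u x))\<^sup>2)"
    proof (rule Bochner_Integration.integrable_bound)
      show "integrable lborel (\<lambda>x. (cmod (rep_l2 u x))\<^sup>2)" using us by (simp add: square_integrable_def)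
    qed (auto simp: cmod_power2)
    show "(\<integral>x. Re (rep_l2 u x) * shifted_test c \<phi> x \<partial>lborel) = 0" if "test_function \<phi>" for \<phi>
      using arg_cong[OF pair[OF that], of Re] integral_Re[OF int[OF that]] by (simp add: l2_pair_def)
  qed
  moreover have "AE y in lborel. Im (rep_l2 u y) = 0"
  proof (rule adjoint_eigenfunction_weak)
    show "(\<lambda>y. Im (rep_l2 u y)) \<in> borel_measurable borel" by measurable
    show "integrable lborel (\<lambda>x. (Im (rep_l2 u x))\<^sup>2)"
    proof (rule Bochner_Integration.integrable_bound)
      show "integrable lborel (\<lambda>x. (cmod (rep_l2 u x))\<^sup>2)" using us by (simp add: square_integrable_def)
    qed (auto simp: cmod_power2)
    show "(\<integral>x. Im (rep_l2 u x) * shifted_test c \<phi> x \<partial>lborel) = 0" if "test_function \<phi>" for \<phi>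
      using arg_cong[OF pair[OF that], of Im] integral_Im[OF int[OF that]] by (simp add: l2_pair_def)
  qed
  ultimately have "AE y in lborel. rep_l2 u y = 0" by eventually_elim (simp add: complex_eq_iff)
  then have "abs_l2 (rep_l2 u) = abs_l2 (\<lambda>_. 0)" by (rule abs_l2_eq_iff[OF us square_integrable_0, THEN iffD2])
  then show "u = 0" by (simp add: abs_l2_0)
qed

section \<open>The resolvent of the Rayleigh operator\<close>

text \<open>\<open>weak_op c u v\<close> means \<open>v = i k (R - c) u\<close> in the sense of distributions, where \<open>R\<close> is the Rayleigh
  operator; \<open>u\<close> need not lie in the domain of multiplication by \<open>b\<close>.\<close>

definition weak_op :: "real \<Rightarrow> l2 \<Rightarrow> l2 \<Rightarrow> bool" where
  "weak_op c u v \<longleftrightarrow> (\<forall>\<phi>. test_function \<phi> \<longrightarrow>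
     - gen 0 u \<phi> - \<i> * of_int k * of_real c * l2_pair u (\<lambda>y. of_real (\<phi> y)) = l2_pair v (\<lambda>y. of_real (\<phi> y)))"

definition weak_op_adj :: "real \<Rightarrow> complex \<Rightarrow> (real \<Rightarrow> real) \<Rightarrow> l2" where
  "weak_op_adj c z \<phi> = - gen_adj 0 z \<phi> - abs_l2 (\<lambda>y. (z * cnj (\<i> * of_int k * of_real c)) * of_real (\<phi> y))"

lemma weak_op_adj:
  assumes "test_function \<phi>"
  shows "u \<bullet> weak_op_adj c z \<phi> = Re (cnj z * (- gen 0 u \<phi> - \<i> * of_int k * of_real c * l2_pair u (\<lambda>y. of_real (\<phi> y))))"
  unfolding weak_op_adj_def inner_diff_right inner_minus_right inner_real_test[OF test_function_square_integrable[OF assms]]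
    gen_adj[OF assms, symmetric]
  by (simp add: algebra_simps)

lemma weak_op_inner:
  "weak_op c u v \<longleftrightarrow> (\<forall>\<phi> z. test_function \<phi> \<and> z \<in> {1, \<i>} \<longrightarrow> u \<bullet> weak_op_adj c z \<phi> = v \<bullet> abs_l2 (\<lambda>y. z * of_real (\<phi> y)))"
    (is "_ \<longleftrightarrow> ?R")
proof
  assume "weak_op c u v"
  then show ?R
    unfolding weak_op_def by (simp add: weak_op_adj inner_real_test[OF test_function_square_integrable])
next
  assume R: ?R
  show "weak_op c u v" unfolding weak_op_def
  proof (intro allI impI)
    fix \<phi> :: "real \<Rightarrow> real" assume \<phi>: "test_function \<phi>"
    have "Re (cnj z * (- gen 0 u \<phi> - \<i> * of_int k * of_real c * l2_pair u (\<lambda>y. of_real (\<phi> y)))) = Re (cnj z * l2_pair v (\<lambda>y. of_real (\<phi> y)))"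
      if "z \<in> {1, \<i>}" for z
      unfolding weak_op_adj[OF \<phi>, symmetric] inner_real_test[OF test_function_square_integrable[OF \<phi>], symmetric]
      using R \<phi> that by blast
    from this[of 1] this[of \<i>]
    show "- gen 0 u \<phi> - \<i> * of_int k * of_real c * l2_pair u (\<lambda>y. of_real (\<phi> y)) = l2_pair v (\<lambda>y. of_real (\<phi> y))"
      unfolding complex_eq_iff by simp
  qed
qed

lemma weak_op_add: "weak_op c u v \<Longrightarrow> weak_op c u' v' \<Longrightarrow> weak_op c (u + u') (v + v')"
  by (simp add: weak_op_inner inner_add_left)

lemma weak_op_diff: "weak_op c u v \<Longrightarrow> weak_op c u' v' \<Longrightarrow> weak_op c (u - u') (v - v')"
  by (simp add: weak_op_inner inner_diff_left)

lemma weak_op_scaleR: "weak_op c u v \<Longrightarrow> weak_op c (a *\<^sub>R u) (a *\<^sub>R v)"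
  by (simp add: weak_op_inner)

lemma weak_op_0: "weak_op c 0 0"
  by (simp add: weak_op_inner)

lemma gen_cmult:
  assumes "test_function \<phi>"
  shows "gen 0 (l2_cmult w u) \<phi> = w * gen 0 u \<phi>"
  unfolding gen_def T_cmult l2_pair_cmult[OF square_integrable_b_test[OF assms]]
    l2_pair_cmult[OF test_function_square_integrable[OF assms]]
  by (simp add: algebra_simps)

lemma weak_op_cmult: "weak_op c u v \<Longrightarrow> weak_op c (l2_cmult w u) (l2_cmult w v)"
  unfolding weak_op_def
proof (intro allI impI)
  fix \<phi> :: "real \<Rightarrow> real" assume "\<forall>\<phi>. test_function \<phi> \<longrightarrow>
     - gen 0 u \<phi> - \<i> * of_int k * of_real c * l2_pair u (\<lambda>y. of_real (\<phi> y)) = l2_pair v (\<lambda>y. of_real (\<phi> y))"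
    and \<phi>: "test_function \<phi>"
  then have "w * (- gen 0 u \<phi> - \<i> * of_int k * of_real c * l2_pair u (\<lambda>y. of_real (\<phi> y))) = w * l2_pair v (\<lambda>y. of_real (\<phi> y))"
    by simp
  then show "- gen 0 (l2_cmult w u) \<phi> - \<i> * of_int k * of_real c * l2_pair (l2_cmult w u) (\<lambda>y. of_real (\<phi> y))
      = l2_pair (l2_cmult w v) (\<lambda>y. of_real (\<phi> y))"
    unfolding gen_cmult[OF \<phi>] l2_pair_cmult[OF test_function_square_integrable[OF \<phi>]] by (simp only: algebra_simps mult_minus_right)
qed

lemma weak_op_closed:
  assumes "\<And>n. weak_op c (u n) (v n)" "u \<longlonglongrightarrow> u'" "v \<longlonglongrightarrow> v'"
  shows "weak_op c u' v'"
  unfolding weak_op_inner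
proof (intro allI impI)
  fix \<phi> z assume a: "test_function \<phi> \<and> z \<in> {1, \<i>}"
  have "(\<lambda>n. u n \<bullet> weak_op_adj c z \<phi>) \<longlonglongrightarrow> u' \<bullet> weak_op_adj c z \<phi>" by (intro tendsto_inner tendsto_const assms)
  moreover have "(\<lambda>n. v n \<bullet> abs_l2 (\<lambda>y. z * of_real (\<phi> y))) \<longlonglongrightarrow> v' \<bullet> abs_l2 (\<lambda>y. z * of_real (\<phi> y))"
    by (intro tendsto_inner tendsto_const assms)
  moreover have "u n \<bullet> weak_op_adj c z \<phi> = v n \<bullet> abs_l2 (\<lambda>y. z * of_real (\<phi> y))" for n
    using assms(1)[of n] a unfolding weak_op_inner by blast
  ultimately show "u' \<bullet> weak_op_adj c z \<phi> = v' \<bullet> abs_l2 (\<lambda>y. z * of_real (\<phi> y))"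
    using LIMSEQ_unique by simp
qed

text \<open>All terms are locally square integrable, so the distributional identity is a pointwise
  one. This links \<open>weak_op\<close> with eigenvalues, which are defined by equality almost
  everywhere.\<close>

lemma weak_op_AE:
  "weak_op c u v \<longleftrightarrow> (AE y in lborel. \<i> * of_int k * (of_real (b y - c) * rep_l2 u y - rep_l2 (T u) y) = rep_l2 v y)"
    (is "_ \<longleftrightarrow> (AE y in lborel. ?L y = _)")
proof -
  have int: "(\<integral>y. (?L y - rep_l2 v y) * of_real (\<phi> y) \<partial>lborel)
      = - gen 0 u \<phi> - \<i> * of_int k * of_real c * l2_pair u (\<lambda>y. of_real (\<phi> y)) - l2_pair v (\<lambda>y. of_real (\<phi> y))"
    if \<phi>: "test_function \<phi>" for \<phi>
  proof -
    note s = test_function_square_integrable[OF \<phi>]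
    note i = l2_pair_integrable[OF square_integrable_b_test[OF \<phi>], of u] l2_pair_integrable[OF s, of u]
      l2_pair_integrable[OF s, of "T u"] l2_pair_integrable[OF s, of v]
    have "(\<lambda>y. (?L y - rep_l2 v y) * of_real (\<phi> y)) = (\<lambda>y. \<i> * of_int k * (rep_l2 u y * of_real (b y * \<phi> y))
        - (\<i> * of_int k * of_real c) * (rep_l2 u y * of_real (\<phi> y)) - \<i> * of_int k * (rep_l2 (T u) y * of_real (\<phi> y))
        - rep_l2 v y * of_real (\<phi> y))"
      by (simp add: fun_eq_iff algebra_simps)
    then have "(\<integral>y. (?L y - rep_l2 v y) * of_real (\<phi> y) \<partial>lborel) = \<i> * of_int k * l2_pair u (\<lambda>y. of_real (b y * \<phi> y))
        - (\<i> * of_int k * of_real c) * l2_pair u (\<lambda>y. of_real (\<phi> y)) - \<i> * of_int k * l2_pair (T u) (\<lambda>y. of_real (\<phi> y))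
        - l2_pair v (\<lambda>y. of_real (\<phi> y))"
      using i by (simp only: Bochner_Integration.integral_diff Bochner_Integration.integrable_diff integrable_mult_right
          integral_mult_right_zero l2_pair_def)
    then show ?thesis by (simp add: gen_def algebra_simps)
  qed
  show ?thesis
  proof
    assume w: "weak_op c u v"
    have "AE y in lborel. ?L y - rep_l2 v y = 0"
    proof (rule du_bois_reymond)
      fix R
      have ind: "square_integrable (\<lambda>y. of_real (indicator {-R..R} y) * g y)" if "square_integrable g" for g
        by (rule square_integrable_mult_bounded[OF that, of _ 1]) (auto simp: indicator_def)
      have "square_integrable (\<lambda>y. \<i> * of_int k * (of_real (indicator {-R..R} y) * (of_real (b y - c) * rep_l2 u y)
          - of_real (indicator {-R..R} y) * rep_l2 (T u) y) - of_real (indicator {-R..R} y) * rep_l2 v y)"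
        by (intro square_integrable_diff square_integrable_cmult square_integrable_b_local ind square_integrable_rep)
      moreover have "(\<lambda>y. \<i> * of_int k * (of_real (indicator {-R..R} y) * (of_real (b y - c) * rep_l2 u y)
          - of_real (indicator {-R..R} y) * rep_l2 (T u) y) - of_real (indicator {-R..R} y) * rep_l2 v y)
          = (\<lambda>y. of_real (indicator {-R..R} y) * (?L y - rep_l2 v y))"
        by (simp add: fun_eq_iff algebra_simps)
      ultimately show "square_integrable (\<lambda>y. of_real (indicator {-R..R} y) * (?L y - rep_l2 v y))" by simp
    next
      fix \<phi> :: "real \<Rightarrow> real" assume \<phi>: "test_function \<phi>"
      then show "(\<integral>y. (?L y - rep_l2 v y) * of_real (\<phi> y) \<partial>lborel) = 0"
        using w unfolding int[OF \<phi>] weak_op_def by simp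
    qed
    then show "AE y in lborel. ?L y = rep_l2 v y" by simp
  next
    assume ae: "AE y in lborel. ?L y = rep_l2 v y"
    show "weak_op c u v" unfolding weak_op_def
    proof (intro allI impI)
      fix \<phi> :: "real \<Rightarrow> real" assume \<phi>: "test_function \<phi>"
      have "(\<integral>y. (?L y - rep_l2 v y) * of_real (\<phi> y) \<partial>lborel) = 0"
      proof (rule integral_eq_zero_AE)
        show "AE y in lborel. (?L y - rep_l2 v y) * of_real (\<phi> y) = 0" using ae by eventually_elim simp
      qed
      then show "- gen 0 u \<phi> - \<i> * of_int k * of_real c * l2_pair u (\<lambda>y. of_real (\<phi> y)) = l2_pair v (\<lambda>y. of_real (\<phi> y))"
        unfolding int[OF \<phi>] by simp
    qed
  qed
qed

lemma bounded_bilinear_l2_cmult: "bounded_bilinear l2_cmult"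
proof
  note lin = bounded_linear_l2_mult(1)[of "\<lambda>_. z" "cmod z" for z]
  fix z w :: complex and u v :: l2 and r :: real
  show "l2_cmult (z + w) u = l2_cmult z u + l2_cmult w u"
    unfolding l2_mult_def by (subst abs_l2_add) (auto intro: square_integrable_cmult simp: distrib_right)
  show "l2_cmult z (u + v) = l2_cmult z u + l2_cmult z v" by (rule linear_add[OF bounded_linear.linear[OF lin]]) simp_all
  show "l2_cmult (r *\<^sub>R z) u = r *\<^sub>R l2_cmult z u"
    unfolding l2_mult_def by (subst abs_l2_scaleR) (auto intro: square_integrable_cmult)
  show "l2_cmult z (r *\<^sub>R u) = r *\<^sub>R l2_cmult z u" by (rule linear_cmul[OF bounded_linear.linear[OF lin]]) simp_all
  show "\<exists>K. \<forall>z u. norm (l2_cmult z u) \<le> norm z * norm u * K"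
    by (intro exI[of _ 1]) (simp add: norm_l2_cmult)
qed


lemma weak_op_shifted_test:
  assumes \<phi>: "test_function \<phi>"
  shows "weak_op c (abs_l2 (\<lambda>y. z * of_real (\<phi> y))) (l2_cmult (\<i> * of_int k) (abs_l2 (\<lambda>y. z * of_real (shifted_test c \<phi> y))))"
proof -
  note s = square_integrable_shifted_test[OF \<phi>]
  note sq = square_integrable_cmult[OF test_function_square_integrable[OF \<phi>]]
    square_integrable_cmult[OF s(3)] square_integrable_cmult[OF square_integrable_cmult[OF s(1)]]
  show ?thesis
    unfolding weak_op_AE s(2) l2_cmult_abs[OF square_integrable_cmult[OF s(1)]]
    using rep_abs_l2[OF sq(1), of z] rep_abs_l2[OF sq(2), of z] rep_abs_l2[OF sq(3), of "\<i> * of_int k" z c]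
  proof eventually_elim
    case (elim y)
    show ?case unfolding elim by (simp add: shifted_test_def algebra_simps)
  qed
qed

text \<open>The preimage \<open>g\<close> is a test vector, so the resolvent bound obtained from the
  evolution can be applied to \<open>g\<close> itself.\<close>

lemma shifted_test_span:
  assumes "d \<in> span {abs_l2 (\<lambda>y. z * of_real (shifted_test c \<phi> y)) |z \<phi>. z \<in> {1, \<i>} \<and> test_function \<phi>}"
  shows "\<exists>g\<in>test_vectors. weak_op c g (l2_cmult (\<i> * of_int k) d)"
  using assms
proof (induction rule: span_induct)
  case base
  note lin = bounded_linear.linear[OF bounded_bilinear.bounded_linear_right[OF bounded_bilinear_l2_cmult, of "\<i> * of_int k"]]
  let ?P = "\<lambda>d. \<exists>g\<in>test_vectors. weak_op c g (l2_cmult (\<i> * of_int k) d)"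
  have 0: "?P 0"
    by (intro bexI[of _ 0]) (simp_all only: linear_0[OF lin] weak_op_0 subspace_0[OF subspace_test_vectors])
  have 1: "?P (r *\<^sub>R d)" if P: "?P d" for r d
  proof -
    obtain g where g: "g \<in> test_vectors" "weak_op c g (l2_cmult (\<i> * of_int k) d)" using P by blast
    then show ?thesis
      unfolding linear_cmul[OF lin] using weak_op_scaleR[OF g(2)] subspace_scale[OF subspace_test_vectors g(1)] by blast
  qed
  have 2: "?P (d + e)" if P: "?P d" "?P e" for d e
  proof -
    obtain g h where "g \<in> test_vectors" "weak_op c g (l2_cmult (\<i> * of_int k) d)"
      "h \<in> test_vectors" "weak_op c h (l2_cmult (\<i> * of_int k) e)" using P by blast
    then show ?thesis
      unfolding linear_add[OF lin] using weak_op_add subspace_add[OF subspace_test_vectors] by blast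
  qed
  show ?case
    by (rule subspaceI; unfold mem_Collect_eq) (rule 0 1 2; assumption)+
next
  case (step d)
  then obtain z \<phi> where z: "z \<in> {1, \<i>}" and \<phi>: "test_function \<phi>" and d: "d = abs_l2 (\<lambda>y. z * of_real (shifted_test c \<phi> y))"
    by blast
  have t0: "test_function (\<lambda>_. 0)" using test_function_cmult[OF \<phi>, of 0] by simp
  have "abs_l2 (\<lambda>y. z * of_real (\<phi> y)) \<in> test_vectors"
  proof (cases "z = 1")
    case True
    then show ?thesis using test_vectorsI[OF \<phi> t0] by (simp add: complex_of_real_def)
  next
    case False
    then have "z = \<i>" using z by simp
    then have "(\<lambda>y. z * of_real (\<phi> y)) = (\<lambda>y. Complex 0 (\<phi> y))" by (simp add: fun_eq_iff complex_eq_iff)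
    then show ?thesis using test_vectorsI[OF t0 \<phi>] by simp
  qed
  then show ?case unfolding d using weak_op_shifted_test[OF \<phi>] by blast
qed

lemma eigenvector_weak_op:
  assumes w: "square_integrable w" and ae: "AE y in lborel. rayleigh b k w y = of_real c * w y"
  shows "weak_op c (abs_l2 w) 0"
proof -
  have "AE y in lborel. rep_l2 (0 :: l2) y = 0"
    using rep_abs_l2[OF square_integrable_0] by (simp add: abs_l2_0)
  moreover note rayleigh_AE[OF w] rep_abs_l2[OF w]
    rep_abs_l2[OF square_integrable_mconv(1)[OF b''_sq bounded_kernel_green[OF \<kappa>] w]]
  ultimately show ?thesis unfolding weak_op_AE T_abs[OF w] using ae
  proof eventually_elim
    case (elim y)
    have "\<i> * of_int k * (of_real (b y - c) * w y - of_real (b'' y) * convol (green \<kappa>) w y) = 0"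
      using elim(2,5) by (simp add: algebra_simps)
    then show ?case unfolding elim .
  qed
qed

text \<open>A kernel element of \<open>l + A\<close> would be an eigenvector of the Rayleigh
  operator for a nonreal eigenvalue.\<close>

lemma weak_op_injective:
  assumes spec: "\<And>\<mu>. rayleigh_eigenvalue b k \<mu> \<Longrightarrow> \<mu> \<in> \<real>" and l: "0 < l" and r: "weak_op c r (- (l *\<^sub>R r))"
  shows "r = 0"
proof (rule ccontr)
  assume "r \<noteq> 0"
  \<comment> \<open>Solving \<open>\<i> k (\<mu> - c) = - l\<close> for \<open>\<mu>\<close>; its
    imaginary part \<open>l / k\<close> is nonzero.\<close>
  define \<mu> where "\<mu> = of_real c + \<i> * of_real (l / of_int k)"
  have k0: "(of_int k :: complex) \<noteq> 0" using k by simp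
  have "- (l *\<^sub>R r) = abs_l2 (\<lambda>y. - (l *\<^sub>R rep_l2 r y))"
    using abs_l2_scaleR[OF square_integrable_rep[of r], of "- l"] by simp
  then have sc: "AE y in lborel. rep_l2 (- (l *\<^sub>R r)) y = - (l *\<^sub>R rep_l2 r y)"
    using rep_abs_l2[OF square_integrable_uminus[OF square_integrable_scaleR[OF square_integrable_rep]]] by simp
  have "AE y in lborel. rayleigh b k (rep_l2 r) y = \<mu> * rep_l2 r y"
    using r[unfolded weak_op_AE] sc rayleigh_AE_T[of r]
  proof eventually_elim
    case (elim y)
    let ?r = "rep_l2 r y" and ?t = "rep_l2 (T r) y"
    have e: "\<i> * of_int k * (of_real (b y - c) * ?r - ?t) = - (of_real l * ?r)"
      using elim(1) unfolding elim(2) scaleR_conv_of_real .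
    have "of_int k * (of_real (b y - c) * ?r - ?t) = - \<i> * (\<i> * of_int k * (of_real (b y - c) * ?r - ?t))"
      by (simp only: mult.assoc complex_i_mult_minus mult_minus_left minus_minus)
    also have "\<dots> = \<i> * of_real l * ?r" unfolding e by simp
    finally have "of_int k * (of_real (b y - c) * ?r - ?t) = \<i> * of_real l * ?r" .
    then have "of_real (b y - c) * ?r - ?t = \<i> * of_real l * ?r / of_int k" using k0 by (simp add: field_simps)
    then show ?case unfolding elim(3) \<mu>_def by (simp add: algebra_simps)
  qed
  moreover have "\<not> (AE y in lborel. rep_l2 r y = 0)"
  proof
    assume "AE y in lborel. rep_l2 r y = 0"
    then have "abs_l2 (rep_l2 r) = abs_l2 (\<lambda>_. 0)" by (rule abs_l2_eq_iff[OF square_integrable_rep square_integrable_0, THEN iffD2])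
    then show False using \<open>r \<noteq> 0\<close> by (simp add: abs_l2_0)
  qed
  ultimately have "rayleigh_eigenvalue b k \<mu>" unfolding rayleigh_eigenvalue_def using square_integrable_rep[of r] by blast
  then have "\<mu> \<in> \<real>" by (rule spec)
  then have "Im \<mu> = 0" by (simp add: complex_is_Real_iff)
  then show False using l k by (simp add: \<mu>_def)
qed

text \<open>The hypothesis on \<open>r\<close> says \<open>(l + A) r = l f\<close>. For
  approximating test vectors the bounded solutions form a Cauchy sequence, by linearity and
  uniqueness; since \<open>weak_op\<close> is closed, the limit solves the equation for
  \<open>f\<close>, and uniqueness identifies it with \<open>r\<close>.\<close>

lemma weak_op_solution_bound:
  assumes spec: "\<And>\<mu>. rayleigh_eigenvalue b k \<mu> \<Longrightarrow> \<mu> \<in> \<real>" and l: "0 < l" and M: "0 \<le> M"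
    and solve: "\<And>f. f \<in> test_vectors \<Longrightarrow> \<exists>r. weak_op c r (l *\<^sub>R (f - r)) \<and> norm r \<le> M * norm f"
    and r: "weak_op c r (l *\<^sub>R (f - r))"
  shows "norm r \<le> M * norm f"
proof -
  have unique: "r1 = r2" if "weak_op c r1 (l *\<^sub>R (f - r1))" "weak_op c r2 (l *\<^sub>R (f - r2))" for r1 r2 f
  proof -
    have "weak_op c (r1 - r2) (- (l *\<^sub>R (r1 - r2)))"
      using weak_op_diff[OF that] by (simp add: algebra_simps)
    from weak_op_injective[OF spec l this] show ?thesis by simp
  qed
  have "f \<in> closure test_vectors" using test_vectors_dense by simp
  then obtain F where F: "\<And>n. F n \<in> test_vectors" "F \<longlonglongrightarrow> f" unfolding closure_sequential by blast
  from solve[OF F(1)] have "\<forall>n. \<exists>r. weak_op c r (l *\<^sub>R (F n - r)) \<and> norm r \<le> M * norm (F n)" by blast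
  then obtain X where X: "\<And>n. weak_op c (X n) (l *\<^sub>R (F n - X n))" "\<And>n. norm (X n) \<le> M * norm (F n)" by metis
  have diff: "norm (X m - X n) \<le> M * norm (F m - F n)" for m n
  proof -
    have "F m - F n \<in> test_vectors" by (rule subspace_diff[OF subspace_test_vectors F(1) F(1)])
    from solve[OF this] obtain s where s: "weak_op c s (l *\<^sub>R (F m - F n - s))" "norm s \<le> M * norm (F m - F n)" by blast
    have "weak_op c (X m - X n) (l *\<^sub>R (F m - F n - (X m - X n)))"
      using weak_op_diff[OF X(1) X(1), of m n] by (simp add: algebra_simps)
    from unique[OF this s(1)] s(2) show ?thesis by simp
  qed
  have "Cauchy X"
  proof (rule CauchyI)
    fix e :: real assume "0 < e"
    then have "0 < e / (M + 1)" using M by simp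
    then obtain N where N: "\<And>m n. N \<le> m \<Longrightarrow> N \<le> n \<Longrightarrow> norm (F m - F n) < e / (M + 1)"
      using CauchyD[OF LIMSEQ_imp_Cauchy[OF F(2)]] by blast
    have "norm (X m - X n) < e" if "N \<le> m" "N \<le> n" for m n
    proof -
      have "norm (X m - X n) \<le> (M + 1) * norm (F m - F n)"
        using diff[of m n] mult_right_mono[of M "M + 1" "norm (F m - F n)"] by simp
      also have "\<dots> < e" using N[OF that] M by (simp add: field_simps)
      finally show ?thesis .
    qed
    then show "\<exists>N. \<forall>m\<ge>N. \<forall>n\<ge>N. norm (X m - X n) < e" by blast
  qed
  then obtain r' where r': "X \<longlonglongrightarrow> r'" using Cauchy_convergent convergent_def by blast
  have "weak_op c r' (l *\<^sub>R (f - r'))" by (rule weak_op_closed[OF X(1) r']) (intro tendsto_intros F(2) r')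
  then have "r = r'" using unique r by blast
  moreover have "norm r' \<le> M * norm f"
    by (rule LIMSEQ_le[OF tendsto_norm[OF r'] tendsto_mult[OF tendsto_const tendsto_norm[OF F(2)]]]) (use X(2) in blast)
  ultimately show ?thesis by simp
qed

lemma no_eigenvector_if_power_bounded:
  assumes spec: "\<And>\<mu>. rayleigh_eigenvalue b k \<mu> \<Longrightarrow> \<mu> \<in> \<real>" and M: "0 \<le> M"
    and solve: "\<And>f l. f \<in> test_vectors \<Longrightarrow> 0 < l \<Longrightarrow> \<exists>r. weak_op c r (l *\<^sub>R (f - r)) \<and> norm r \<le> M * norm f"
    and w: "weak_op c w 0"
  shows "w = 0"
proof -
  let ?ik = "\<i> * of_int k :: complex"
  have k0: "?ik \<noteq> 0" using k by simp
  have lin: "linear (l2_cmult z)" for z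
    by (rule bounded_linear.linear[OF bounded_bilinear.bounded_linear_right[OF bounded_bilinear_l2_cmult]])
  have comp: "l2_cmult z (l2_cmult z' u) = l2_cmult (z * z') u" for z z' u
    using l2_cmult_abs[OF square_integrable_cmult[OF square_integrable_rep[of u]], of z z'] by (simp add: l2_mult_def mult.assoc)
  have real: "l2_cmult (of_real a) u = a *\<^sub>R u" for a u
    using abs_l2_scaleR[OF square_integrable_rep[of u], of a] by (simp add: l2_mult_def scaleR_conv_of_real)
  have le: "norm w \<le> (M + 1) * \<delta>" if \<delta>: "0 < \<delta>" for \<delta>
  proof -
    have "w \<in> closure (span {abs_l2 (\<lambda>y. z * of_real (shifted_test c \<phi> y)) |z \<phi>. z \<in> {1, \<i>} \<and> test_function \<phi>})"
      using shifted_test_dense by simp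
    from closure_approachable[THEN iffD1, OF this, rule_format, OF \<delta>]
    obtain d where d: "d \<in> span {abs_l2 (\<lambda>y. z * of_real (shifted_test c \<phi> y)) |z \<phi>. z \<in> {1, \<i>} \<and> test_function \<phi>}" "dist d w < \<delta>"
      by blast
    from shifted_test_span[OF d(1)] obtain g where g: "g \<in> test_vectors" "weak_op c g (l2_cmult ?ik d)" by blast
    \<comment> \<open>Chosen so that \<open>l / \<kappa>\<close> times the bound
      \<open>(M + 1) norm g\<close> of \<open>g - r\<close> is at most \<open>\<delta>\<close>; the
      \<open>+ 1\<close> avoids a zero denominator.\<close>
    define l where "l = \<delta> * \<kappa> / ((M + 1) * norm g + 1)"
    have den: "0 < (M + 1) * norm g + 1" using M by (intro add_nonneg_pos mult_nonneg_nonneg) auto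
    have l: "0 < l" using \<delta> \<kappa> den by (simp add: l_def)
    from solve[OF g(1) l] obtain r where r: "weak_op c r (l *\<^sub>R (g - r))" "norm r \<le> M * norm g" by blast
    \<comment> \<open>As \<open>A g\<close> is \<open>\<i> k d\<close>, this \<open>s\<close> solves
      \<open>(l + A) s = l d\<close>. It is small because it carries the factor \<open>l\<close>.
      The eigenvector satisfies \<open>(l + A) w = l w\<close>, so \<open>w - s\<close> solves the
      equation with datum \<open>w - d\<close>.\<close>
    define s where "s = l2_cmult (of_real l / ?ik) (g - r)"
    have "weak_op c s (l2_cmult (of_real l / ?ik) (l2_cmult ?ik d - l *\<^sub>R (g - r)))"
      unfolding s_def by (rule weak_op_cmult[OF weak_op_diff[OF g(2) r(1)]])
    also have "l2_cmult (of_real l / ?ik) (l2_cmult ?ik d - l *\<^sub>R (g - r)) = l *\<^sub>R d - l *\<^sub>R s"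
      unfolding linear_diff[OF lin, of _ "l2_cmult ?ik d"] linear_cmul[OF lin] comp s_def[symmetric] using k0 by (simp add: real)
    finally have "weak_op c (w - s) (0 - (l *\<^sub>R d - l *\<^sub>R s))" by (rule weak_op_diff[OF w])
    then have "weak_op c (w - s) (l *\<^sub>R ((w - d) - (w - s)))" by (simp add: algebra_simps)
    then have 1: "norm (w - s) \<le> M * norm (w - d)"
      by (rule weak_op_solution_bound[OF spec l M solve[OF _ l], rotated -1])
    have "norm (g - r) \<le> (M + 1) * norm g" using norm_triangle_ineq4[of g r] r(2) by (simp add: algebra_simps)
    then have "norm s \<le> l / \<kappa> * ((M + 1) * norm g)"
      using l \<kappa> unfolding s_def norm_l2_cmult by (simp add: norm_divide norm_mult \<kappa>_def divide_right_mono)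
    also have "\<dots> \<le> l / \<kappa> * ((M + 1) * norm g + 1)" using l \<kappa> by (intro mult_left_mono) auto
    also have "\<dots> = \<delta>" using \<kappa> den by (simp add: l_def)
    finally have 2: "norm s \<le> \<delta>" .
    have "norm w \<le> norm (w - s) + norm s" using norm_triangle_ineq[of "w - s" s] by simp
    also have "M * norm (w - d) \<le> M * \<delta>" using d(2) M by (intro mult_left_mono) (simp_all add: dist_norm norm_minus_commute)
    with 1 2 have "norm (w - s) + norm s \<le> (M + 1) * \<delta>" by (simp add: algebra_simps)
    finally show ?thesis .
  qed
  have "norm w \<le> 0"
  proof (rule field_le_epsilon)
    fix e :: real assume "0 < e"
    then have "norm w \<le> (M + 1) * (e / (M + 1))" using M by (intro le) simp
    then show "norm w \<le> 0 + e" using M by simp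
  qed
  then show ?thesis by simp
qed


section \<open>Growth\<close>

lemma weak_solution_exists:
  assumes f: "f \<in> test_vectors" and "0 \<le> \<nu>" "\<nu> \<le> 1"
  obtains u where "continuous_on {0..} u" "weak_solution \<nu> u" "u 0 = f"
proof -
  obtain L where L: "\<And>t. 0 \<le> t \<Longrightarrow> 0 \<le> L t" "\<And>s t. 0 \<le> s \<Longrightarrow> s \<le> t \<Longrightarrow> L s \<le> L t"
    and ex: "\<And>\<nu>. 0 \<le> \<nu> \<Longrightarrow> \<nu> \<le> 1 \<Longrightarrow> \<exists>u. u 0 = f \<and> weak_solution \<nu> u \<and>
       (\<forall>t\<ge>0. norm (u t) \<le> exp (\<kappa> * T_bound * t) * norm f) \<and>
       (\<forall>s t. 0 \<le> s \<longrightarrow> s \<le> t \<longrightarrow> norm (u t - u s) \<le> L t * (t - s))"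
    using evolution_exists[OF f] by blast
  from ex[OF assms(2,3)] obtain u where u: "u 0 = f" "weak_solution \<nu> u"
    and lip: "\<forall>s t. 0 \<le> s \<longrightarrow> s \<le> t \<longrightarrow> norm (u t - u s) \<le> L t * (t - s)" by blast
  have "continuous_on {0..} u"
  proof (rule continuous_on_if_locally_lipschitz[where L=L and u=u])
    show "L s \<le> L t" if "0 \<le> s" "s \<le> t" for s t using that by (rule L(2))
    show "norm (u t - u s) \<le> L t * (t - s)" if "0 \<le> s" "s \<le> t" for s t using lip that by simp
  qed
  with that u show thesis by blast
qed

text \<open>The viscosity in \<open>small\<close> depends on the time, so the limit is taken for
  each \<open>t\<close> separately. Viscous uniqueness transfers the bound to the constructed,
  equi-Lipschitz solutions before the limit.\<close>

lemma inviscid_bound: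
  assumes f: "f \<in> test_vectors"
    and small: "\<And>t \<nu>\<^sub>0. 0 \<le> t \<Longrightarrow> 0 < \<nu>\<^sub>0 \<Longrightarrow> \<nu>\<^sub>0 \<le> 1 \<Longrightarrow> \<exists>\<nu> u. 0 \<le> \<nu> \<and> \<nu> \<le> \<nu>\<^sub>0 \<and>
      continuous_on {0..} u \<and> weak_solution \<nu> u \<and> u 0 = f \<and> norm (u t) \<le> M"
  obtains u where "continuous_on {0..} u" "weak_solution 0 u" "u 0 = f" "\<And>t. 0 \<le> t \<Longrightarrow> norm (u t) \<le> M"
proof -
  obtain L where L: "\<And>t. 0 \<le> t \<Longrightarrow> 0 \<le> L t" "\<And>s t. 0 \<le> s \<Longrightarrow> s \<le> t \<Longrightarrow> L s \<le> L t"
    and ex: "\<And>\<nu>. 0 \<le> \<nu> \<Longrightarrow> \<nu> \<le> 1 \<Longrightarrow> \<exists>u. u 0 = f \<and> weak_solution \<nu> u \<and>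
       (\<forall>t\<ge>0. norm (u t) \<le> exp (\<kappa> * T_bound * t) * norm f) \<and>
       (\<forall>s t. 0 \<le> s \<longrightarrow> s \<le> t \<longrightarrow> norm (u t - u s) \<le> L t * (t - s))"
    using evolution_exists[OF f] by blast
  define \<Phi> where "\<Phi> i = abs_l2 (\<lambda>y. snd i * of_real (fst i y))" for i :: "(real \<Rightarrow> real) \<times> complex"
  define I where "I = {i :: (real \<Rightarrow> real) \<times> complex. test_function (fst i) \<and> snd i \<in> {1, \<i>}}"
  have weak: "weak_solution \<nu> u \<longleftrightarrow> (\<forall>i t. i \<in> I \<longrightarrow> 0 \<le> t \<longrightarrow>
      ((\<lambda>s. u s \<bullet> \<Phi> i) has_real_derivative u t \<bullet> gen_adj \<nu> (snd i) (fst i)) (at t within {0..}))" for \<nu> u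
    unfolding weak_solution_inner \<Phi>_def I_def by (simp add: split_paired_all) blast
  have lip: "continuous_on {0..} g" if g: "\<And>s t. 0 \<le> s \<Longrightarrow> s \<le> t \<Longrightarrow> norm (g t - g s) \<le> L t * (t - s)" for g :: "real \<Rightarrow> l2"
  proof (rule continuous_on_if_locally_lipschitz[where L=L and u=g])
    show "L s \<le> L t" if "0 \<le> s" "s \<le> t" for s t using that by (rule L(2))
    show "norm (g t - g s) \<le> L t * (t - s)" if "0 \<le> s" "s \<le> t" for s t using that by (rule g)
  qed
  from ex[of 0] obtain u0 where u0: "u0 0 = f" "weak_solution 0 u0"
      "\<And>s t. 0 \<le> s \<Longrightarrow> s \<le> t \<Longrightarrow> norm (u0 t - u0 s) \<le> L t * (t - s)" by auto
  have c0: "continuous_on {0..} u0" by (rule lip[OF u0(3)])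
  have "norm (u0 t) \<le> M" if t: "0 \<le> t" for t
  proof -
    define \<epsilon> where "\<epsilon> n = inverse (real (Suc n))" for n
    have \<epsilon>: "0 < \<epsilon> n" "\<epsilon> n \<le> 1" for n by (simp_all add: \<epsilon>_def field_simps)
    define good where "good n \<nu> v \<longleftrightarrow> 0 \<le> \<nu> \<and> \<nu> \<le> \<epsilon> n \<and> v 0 = f \<and> weak_solution \<nu> v \<and> norm (v t) \<le> M \<and>
       (\<forall>t\<ge>0. norm (v t) \<le> exp (\<kappa> * T_bound * t) * norm f) \<and>
       (\<forall>s t. 0 \<le> s \<longrightarrow> s \<le> t \<longrightarrow> norm (v t - v s) \<le> L t * (t - s))" for n \<nu> v
    have "\<exists>p. good n (fst p) (snd p)" for n
    proof -
      from small[OF t \<epsilon>] obtain \<nu> u where \<nu>: "0 \<le> \<nu>" "\<nu> \<le> \<epsilon> n"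
        and u: "continuous_on {0..} u" "weak_solution \<nu> u" "u 0 = f" "norm (u t) \<le> M" by blast
      have "\<nu> \<le> 1" using \<nu>(2) \<epsilon>(2) by (rule order_trans)
      from ex[OF \<nu>(1) this] obtain v where v: "v 0 = f" "weak_solution \<nu> v"
        "\<forall>t\<ge>0. norm (v t) \<le> exp (\<kappa> * T_bound * t) * norm f"
        "\<forall>s t. 0 \<le> s \<longrightarrow> s \<le> t \<longrightarrow> norm (v t - v s) \<le> L t * (t - s)" by blast
      have "norm (v t - v s) \<le> L t * (t - s)" if "0 \<le> s" "s \<le> t" for s t using v(4) that by simp
      then have "continuous_on {0..} v" by (rule lip)
      from weak_solution_unique[OF u(1,2) this v(2) \<nu>(1) _ t] u(3) v(1) have "u t = v t" by simp
      with u(4) have "good n \<nu> v" unfolding good_def using \<nu> v by simp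
      then show ?thesis by (intro exI[of _ "(\<nu>, v)"]) simp
    qed
    then have "\<forall>n. \<exists>p. good n (fst p) (snd p)" ..
    from choice[OF this] obtain p where p: "\<And>n. good n (fst (p n)) (snd (p n))" by blast
    define \<nu> where "\<nu> n = fst (p n)" for n
    define v where "v n = snd (p n)" for n
    note g = p[folded \<nu>_def v_def, unfolded good_def]
    have \<nu>: "0 \<le> \<nu> n" "\<nu> n \<le> \<epsilon> n" for n using g[of n] by blast+
    have v: "v n 0 = f" "weak_solution (\<nu> n) (v n)" "norm (v n t) \<le> M" for n using g[of n] by blast+
    have v': "0 \<le> t \<Longrightarrow> norm (v n t) \<le> exp (\<kappa> * T_bound * t) * norm f"
      "0 \<le> s \<Longrightarrow> s \<le> t \<Longrightarrow> norm (v n t - v n s) \<le> L t * (t - s)" for n s t using g[of n] by blast+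
    have \<nu>0: "\<nu> \<longlonglongrightarrow> 0"
      by (rule tendsto_sandwich[OF _ _ tendsto_const LIMSEQ_inverse_real_of_nat]) (use \<nu> in \<open>auto simp: \<epsilon>_def\<close>)
    \<comment> \<open>The weak limit keeps bounds time by time, so the sharp bound \<open>M\<close>
      is imposed at the single time \<open>t\<close> and the exponential one elsewhere.\<close>
    define C where "C s = (if s = t then M else exp (\<kappa> * T_bound * s) * norm f)" for s
    obtain w where w: "w 0 = f" "\<And>s. 0 \<le> s \<Longrightarrow> norm (w s) \<le> C s"
      "\<And>s t. 0 \<le> s \<Longrightarrow> s \<le> t \<Longrightarrow> norm (w t - w s) \<le> L t * (t - s)"
      "\<And>i t. i \<in> I \<Longrightarrow> 0 \<le> t \<Longrightarrow>
        ((\<lambda>s. w s \<bullet> \<Phi> i) has_real_derivative w t \<bullet> gen_adj 0 (snd i) (fst i)) (at t within {0..})"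
    proof (rule weak_evolution_compactness[of v f L C I \<Phi> "\<lambda>n i. gen_adj (\<nu> n) (snd i) (fst i)" "\<lambda>i. gen_adj 0 (snd i) (fst i)"])
      show "norm (v n s) \<le> C s" if "0 \<le> s" for n s using v(3) v'(1) that by (simp add: C_def)
      show "((\<lambda>s. v n s \<bullet> \<Phi> i) has_real_derivative v n s \<bullet> gen_adj (\<nu> n) (snd i) (fst i)) (at s within {0..})"
        if "i \<in> I" "0 \<le> s" for n i s using v(2)[of n] that unfolding weak by blast
      show "(\<lambda>n. gen_adj (\<nu> n) (snd i) (fst i)) \<longlonglongrightarrow> gen_adj 0 (snd i) (fst i)" if "i \<in> I" for i
        using that by (intro gen_adj_tendsto[OF \<nu>0]) (simp add: I_def)
    qed (rule v v' L that; assumption)+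
    have ww: "weak_solution 0 w" unfolding weak using w(4) by blast
    have cw: "continuous_on {0..} w" by (rule lip[OF w(3)])
    \<comment> \<open>The limit \<open>w\<close> depends on \<open>t\<close>; inviscid uniqueness
      identifies it with the fixed solution \<open>u0\<close>, which thereby satisfies the bound at
      every time.\<close>
    have "u0 t = w t" by (rule weak_solution_unique[OF c0 u0(2) cw ww order_refl _ t]) (simp only: u0(1) w(1))
    then show ?thesis using w(2)[OF t] by (simp add: C_def)
  qed
  with that c0 u0(1,2) show thesis by blast
qed

lemma bounded_solution_resolvent:
  assumes c: "continuous_on {0..} u" and w: "weak_solution 0 u" and B: "\<And>t. 0 \<le> t \<Longrightarrow> norm (u t) \<le> M" and l: "0 < l"
  obtains r where "weak_op c r (l *\<^sub>R (u 0 - r))" "norm r \<le> M"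
proof -
  \<comment> \<open>The unimodular factor \<open>exp (\<omega> t)\<close> changes the generator
    \<open>- \<i> k R\<close> into \<open>- \<i> k (R - c)\<close> and leaves all norms
    unchanged.\<close>
  define \<omega> where "\<omega> = \<i> * of_int k * of_real c"
  define v where "v t = l2_cmult (exp (\<omega> * of_real t)) (u t)" for t
  have "continuous_on {0..} v" unfolding v_def
    by (intro bounded_bilinear.continuous_on[OF bounded_bilinear_l2_cmult] c continuous_intros)
  moreover have "norm (v t) \<le> M" if "0 \<le> t" for t
    using B[OF that] unfolding v_def norm_l2_cmult by (simp add: \<omega>_def)
  ultimately obtain r where r: "norm r \<le> M"
    "\<And>\<phi> \<psi>. (\<And>t. 0 \<le> t \<Longrightarrow> ((\<lambda>s. v s \<bullet> \<phi>) has_real_derivative v t \<bullet> \<psi>) (at t within {0..})) \<Longrightarrow>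
       r \<bullet> (l *\<^sub>R \<phi> - \<psi>) = l * (v 0 \<bullet> \<phi>)"
    using laplace_resolvent[OF _ _ l] by blast
  have v0: "v 0 = u 0" by (simp add: v_def l2_mult_def)
  have "weak_op c r (l *\<^sub>R (u 0 - r))" unfolding weak_op_inner
  proof (intro allI impI)
    fix \<phi> :: "real \<Rightarrow> real" and z :: complex assume "test_function \<phi> \<and> z \<in> {1, \<i>}"
    then have \<phi>: "test_function \<phi>" by blast
    note s = test_function_square_integrable[OF \<phi>]
    let ?\<phi> = "\<lambda>y. complex_of_real (\<phi> y)"
    have "((\<lambda>s. v s \<bullet> abs_l2 (\<lambda>y. z * ?\<phi> y)) has_real_derivative v t \<bullet> (- weak_op_adj c z \<phi>)) (at t within {0..})"
      if t: "0 \<le> t" for t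
    proof -
      have e: "((\<lambda>s. exp (\<omega> * of_real s)) has_vector_derivative \<omega> * exp (\<omega> * of_real t)) (at t within {0..})"
        by (rule has_vector_derivative_real_field) (auto intro!: derivative_eq_intros)
      have p: "((\<lambda>s. l2_pair (u s) ?\<phi>) has_vector_derivative gen 0 (u t) \<phi>) (at t within {0..})"
        using w \<phi> t unfolding weak_solution_def by blast
      have "((\<lambda>s. Re (cnj z * (exp (\<omega> * of_real s) * l2_pair (u s) ?\<phi>))) has_vector_derivative
          Re (cnj z * (exp (\<omega> * of_real t) * gen 0 (u t) \<phi> + \<omega> * exp (\<omega> * of_real t) * l2_pair (u t) ?\<phi>))) (at t within {0..})"
        by (rule bounded_linear.has_vector_derivative[OF bounded_linear_Re
            bounded_linear.has_vector_derivative[OF bounded_linear_mult_right has_vector_derivative_mult[OF e p]]])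
      moreover have "Re (cnj z * (exp (\<omega> * of_real s) * l2_pair (u s) ?\<phi>)) = v s \<bullet> abs_l2 (\<lambda>y. z * ?\<phi> y)" for s
        unfolding v_def inner_real_test[OF s] l2_pair_cmult[OF s] ..
      moreover have "Re (cnj z * (exp (\<omega> * of_real t) * gen 0 (u t) \<phi> + \<omega> * exp (\<omega> * of_real t) * l2_pair (u t) ?\<phi>)) = v t \<bullet> (- weak_op_adj c z \<phi>)"
        unfolding v_def inner_minus_right weak_op_adj[OF \<phi>] gen_cmult[OF \<phi>] l2_pair_cmult[OF s] \<omega>_def[symmetric]
        by (simp add: algebra_simps)
      ultimately show ?thesis by (simp only: has_real_derivative_iff_has_vector_derivative)
    qed
    from r(2)[OF this] show "r \<bullet> weak_op_adj c z \<phi> = (l *\<^sub>R (u 0 - r)) \<bullet> abs_l2 (\<lambda>y. z * ?\<phi> y)"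
      by (simp add: v0 inner_diff_right inner_diff_left inner_add_right algebra_simps)
  qed
  with that r(1) show thesis by blast
qed

text \<open>The failure of the claim concerns unit test vectors only. Scaling gives the resolvent
  estimate \<open>solve\<close> for all test vectors with the same constant
  \<open>M\<close>.\<close>

lemma growth:
  assumes spec: "\<And>\<mu>. rayleigh_eigenvalue b k \<mu> \<Longrightarrow> \<mu> \<in> \<real>" and ev: "rayleigh_eigenvalue b k \<mu>\<^sub>0" and M: "0 < M"
  obtains f T \<nu>\<^sub>0 where "f \<in> test_vectors" "norm f = 1" "0 \<le> T" "0 < \<nu>\<^sub>0" "\<nu>\<^sub>0 \<le> 1"
    "\<And>\<nu> u. 0 \<le> \<nu> \<Longrightarrow> \<nu> \<le> \<nu>\<^sub>0 \<Longrightarrow> continuous_on {0..} u \<Longrightarrow> weak_solution \<nu> u \<Longrightarrow> u 0 = f \<Longrightarrow> M \<le> norm (u T)"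
proof (rule ccontr)
  assume no: "\<not> thesis"
  note result = that
  have small: "\<exists>\<nu> u. 0 \<le> \<nu> \<and> \<nu> \<le> \<nu>\<^sub>0 \<and> continuous_on {0..} u \<and> weak_solution \<nu> u \<and> u 0 = f \<and> norm (u t) \<le> M"
    if "f \<in> test_vectors" "norm f = 1" "0 \<le> t" "0 < \<nu>\<^sub>0" "\<nu>\<^sub>0 \<le> 1" for f t \<nu>\<^sub>0
  proof (rule ccontr)
    assume *: "\<not> ?thesis"
    have "M \<le> norm (u t)" if "0 \<le> \<nu>" "\<nu> \<le> \<nu>\<^sub>0" "continuous_on {0..} u" "weak_solution \<nu> u" "u 0 = f" for \<nu> u
    proof (rule ccontr)
      assume "\<not> M \<le> norm (u t)"
      then have "norm (u t) \<le> M" by simp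
      with * that show False by blast
    qed
    with result[OF that(1,2,3,4,5)] no show False by blast
  qed
  obtain c where c: "\<mu>\<^sub>0 = of_real c" using spec[OF ev] by (elim Reals_cases)
  obtain w where w: "square_integrable w" "\<not> (AE y in lborel. w y = 0)" "AE y in lborel. rayleigh b k w y = of_real c * w y"
    using ev unfolding rayleigh_eigenvalue_def c by blast
  have solve: "\<exists>r. weak_op c r (l *\<^sub>R (f - r)) \<and> norm r \<le> M * norm f" if f: "f \<in> test_vectors" and l: "0 < l" for f l
  proof (cases "f = 0")
    case True
    then show ?thesis using weak_op_0 by (intro exI[of _ 0]) simp
  next
    case False
    define g where "g = (1 / norm f) *\<^sub>R f"
    have g: "g \<in> test_vectors" "norm g = 1" "norm f *\<^sub>R g = f"
      using subspace_scale[OF subspace_test_vectors f] False by (simp_all add: g_def)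
    from inviscid_bound[OF g(1) small[OF g(1,2)]] obtain u
      where u: "continuous_on {0..} u" "weak_solution 0 u" "u 0 = g" "\<And>t. 0 \<le> t \<Longrightarrow> norm (u t) \<le> M" by blast
    from bounded_solution_resolvent[OF u(1,2,4) l] obtain r where r: "weak_op c r (l *\<^sub>R (u 0 - r))" "norm r \<le> M" by blast
    have "weak_op c (norm f *\<^sub>R r) (norm f *\<^sub>R (l *\<^sub>R (g - r)))" using weak_op_scaleR[OF r(1)] u(3) by simp
    also have "norm f *\<^sub>R (l *\<^sub>R (g - r)) = l *\<^sub>R (f - norm f *\<^sub>R r)"
      using g(3) by (metis scaleR_left_commute scaleR_right_diff_distrib)
    finally show ?thesis using mult_left_mono[OF r(2), of "norm f"]
      by (intro exI[of _ "norm f *\<^sub>R r"]) (simp add: mult.commute)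
  qed
  have "abs_l2 w = 0"
    by (rule no_eigenvector_if_power_bounded[OF spec less_imp_le[OF M] solve eigenvector_weak_op[OF w(1,3)]])
  then have "abs_l2 w = abs_l2 (\<lambda>_. 0)" by (simp add: abs_l2_0)
  then show False using w(2) by (simp add: abs_l2_eq_iff[OF w(1) square_integrable_0])
qed

end

theorem corollary1p6:
  fixes b :: "real \<Rightarrow> real" and k :: int and c\<^sub>m M :: real
  assumes "k \<noteq> 0"
    and "b differentiable_on UNIV"
    and "0 < c\<^sub>m" and "c\<^sub>m < 1"
    and "\<And>y. c\<^sub>m \<le> deriv b y \<and> deriv b y \<le> inverse c\<^sub>m"
    and "deriv b differentiable_on UNIV"
    and "sobolev 4 (\<lambda>y. of_real (deriv (deriv b) y))"
    and "\<exists>!c. embedded_eigenvalue b k c"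
    and "\<And>c. rayleigh_eigenvalue b k c \<Longrightarrow> embedded_eigenvalue b k c"
    and "M > 0"
  shows "\<exists>\<omega>\<^sub>i\<^sub>n T \<nu>\<^sub>0.
           square_integrable \<omega>\<^sub>i\<^sub>n \<and> L2_norm \<omega>\<^sub>i\<^sub>n = 1 \<and> 0 \<le> T \<and> 0 < \<nu>\<^sub>0 \<and>
           (\<forall>\<nu>. 0 \<le> \<nu> \<and> \<nu> \<le> \<nu>\<^sub>0 \<longrightarrow>
              (\<exists>\<omega>. orr_sommerfeld_solution b k \<nu> \<omega>\<^sub>i\<^sub>n \<omega>) \<and>
              (\<forall>\<omega>. orr_sommerfeld_solution b k \<nu> \<omega>\<^sub>i\<^sub>n \<omega> \<longrightarrow> M \<le> L2_norm (\<omega> T)))"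
proof -
  interpret monotone_shear b k c\<^sub>m
    by unfold_locales (use assms(1-7) in \<open>auto simp: sobolev_def\<close>)
  have spec: "\<mu> \<in> \<real>" if "rayleigh_eigenvalue b k \<mu>" for \<mu>
    using assms(9)[OF that] by (simp add: embedded_eigenvalue_def)
  obtain \<mu>\<^sub>0 where "rayleigh_eigenvalue b k \<mu>\<^sub>0" using assms(8) by (auto simp: embedded_eigenvalue_def)
  from growth[OF spec this assms(10)] obtain f T \<nu>\<^sub>0 where f: "f \<in> test_vectors" "norm f = 1" "0 \<le> T" "0 < \<nu>\<^sub>0" "\<nu>\<^sub>0 \<le> 1"
    and low: "\<And>\<nu> u. 0 \<le> \<nu> \<Longrightarrow> \<nu> \<le> \<nu>\<^sub>0 \<Longrightarrow> continuous_on {0..} u \<Longrightarrow> weak_solution \<nu> u \<Longrightarrow> u 0 = f \<Longrightarrow> M \<le> norm (u T)"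
    by blast
  show ?thesis
  proof (rule exI[of _ "rep_l2 f"], rule exI[of _ T], rule exI[of _ \<nu>\<^sub>0], intro conjI allI impI)
    show "L2_norm (rep_l2 f) = 1" using f(2) by (simp add: norm_l2_rep)
  next
    fix \<nu> assume "0 \<le> \<nu> \<and> \<nu> \<le> \<nu>\<^sub>0"
    then have \<nu>: "0 \<le> \<nu>" "\<nu> \<le> \<nu>\<^sub>0" "\<nu> \<le> 1" using f(5) by auto
    from weak_solution_exists[OF f(1) \<nu>(1,3)] obtain u where u: "continuous_on {0..} u" "weak_solution \<nu> u" "u 0 = f" .
    from l2_orr_sommerfeld_solution[OF u(1,2), of "rep_l2 f"] u(3)
    show "\<exists>\<omega>. orr_sommerfeld_solution b k \<nu> (rep_l2 f) \<omega>" by auto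
    fix \<omega> assume \<omega>: "orr_sommerfeld_solution b k \<nu> (rep_l2 f) \<omega>"
    note s = orr_sommerfeld_solution_l2[OF \<omega> square_integrable_rep]
    \<comment> \<open>The nonnegativity of \<open>T\<close> matters here, since a solution is
      constrained only at nonnegative times.\<close>
    have "square_integrable (\<omega> T)" using \<omega> f(3) by (simp add: orr_sommerfeld_solution_def)
    then show "M \<le> L2_norm (\<omega> T)"
      using low[OF \<nu>(1,2) s(1,3)] s(2) by (simp add: norm_abs_l2)
  qed (use f in simp_all)
qed

end
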